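(* In the setting described in the context, let scalars $\alpha_1,\dots,\alpha_\beta\in\mathbb{R}$ be given. Suppose there exist $P_1,W\in\mathbb{S}^n$, $P_2\in\mathbb{R}^{n\times dn}$, $P_3\in\mathbb{S}^{dn}$, and $Q_i,R_i\in\mathbb{S}^n$, $U_0,U_i\in\mathbb{R}^{n\times l}$, $\widehat{U}_i\in\mathbb{R}^{n\times\kappa_il}$, $\mathcal{L}_0,\mathcal{L}_i\in\mathbb{R}^{m\times l}$, $\widehat{\mathcal{L}}_i\in\mathbb{R}^{m\times\kappa_il}$ ($i\in\mathbb{N}_\nu$) such that $$\begin{bmatrix}P_1&P_2\\ P_2^\top& P_3+\mathrm{diag}_{i=1}^\nu(I_{d_i}\otimes Q_i)\end{bmatrix}\succ0,\qquad \mathbf{Q}=\mathrm{diag}_{i=1}^\nu Q_i\succ0,\qquad \mathbf{R}=\mathrm{diag}_{i=1}^\nu R_i\succ0,$$ $$\mathsf{Sy}\left(\begin{bmatrix}I_n\\ [\alpha_iI_n]_{i=1}^\beta\\ \mathsf{O}_{(q+m),n}\end{bmatrix}\big[-W\ \ \widehat{\boldsymbol{\Pi}}\big]\right)+\begin{bmatrix}\mathsf{O}_n&\mathbf{P}\\ \mathbf{P}^\top&\boldsymbol{\Phi}\end{bmatrix}\prec0,$$ where $$\widehat{\boldsymbol{\Pi}}=\big[\,W\mathbf{A}+\mathbf{U}[(I_\beta\otimes\mathfrak{C})\oplus\mathsf{O}_q]\ \ \ \mathsf{O}_{n,m}\big],$$ $$\mathbf{U}=\Big[U_0\ \ [\![U_i]\!]_{i=1}^\nu\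 \ [\![\widehat{U}_i(T_i\otimes I_l)]\!]_{i=1}^\nu\ \ [\![\widehat{U}_i(\widetilde{T}_i\otimes I_l)]\!]_{i=1}^\nu\ \ \mathsf{O}_{n,q}\Big],$$ and $\mathbf{P},\boldsymbol{\Phi}$ are the matrices $$\mathbf{P}=\big[P_1\ \ \mathsf{O}_{n,\nu n}\ \ P_2\widehat{I}\ \ \mathsf{O}_{n,(\mu n+q+m)}\big],$$ $$\boldsymbol{\Phi}=\mathsf{Sy}\left(\begin{bmatrix}P_2\\ \mathsf{O}_{\nu n,dn}\\ \widehat{I}^\top P_3\\ \mathsf{O}_{(\mu n+q+m),dn}\end{bmatrix}[\,\mathbf{M}\otimes I_n\ \ \mathsf{O}_{dn,(\mu n+q+m)}]+\begin{bmatrix}\mathsf{O}_{\beta n,m}\\ -J_2^\top\\ \widetilde{J}\end{bmatrix}[\boldsymbol{\Sigma}\ \ \mathsf{O}_m]\right)+\Xi\oplus J_1,$$ with $\boldsymbol{\Sigma}=\mathbf{C}+\mathbf{L}_2[(I_\beta\otimes\mathfrak{C})\oplus \mathsf{O}_q]$, $$\Xi=\big[(\mathbf{Q}+\mathbf{R}\Lambda)\oplus\mathsf{O}_n\oplus\mathsf{O}_{\kappa n}\oplus\mathsf{O}_q\big]-\big[\mathsf{O}_n\oplus\mathbf{Q}\oplus\mathrm{diag}_{i=1}^\nu(I_{\varkappa_i}\otimes R_i)\oplus\mathrm{diag}_{i=1}^\nu(I_{\mu_i}\otimes R_i)\oplus J_3\big],$$ $$\widehat{I}=\Big(\mathrm{diag}_{i=1}^\nu\sqrt{\mathfrak{F}_i^{-1}}\,[\mathsf{O}_{d_i,\delta_i}\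 \ I_{d_i}]\,\sqrt{\mathfrak{H}_i}\Big)\otimes I_n,\qquad \Lambda=\mathrm{diag}_{i=1}^\nu(r_i-r_{i-1})I_n,$$ $$\mathbf{M}=\Big[\mathrm{diag}_{i=1}^\nu\sqrt{\mathfrak{F}_i^{-1}}\boldsymbol{f}_i(-r_{i-1})\ \ \mathbf{0}_d\ \ \mathsf{O}_{d,\varkappa}\Big]-\Big[\mathbf{0}_d\ \ \mathrm{diag}_{i=1}^\nu\sqrt{\mathfrak{F}_i^{-1}}\boldsymbol{f}_i(-r_i)\ \ \mathrm{diag}_{i=1}^\nu\sqrt{\mathfrak{F}_i^{-1}}M_i\sqrt{\mathfrak{H}_i}\Big].$$ Then, with the state estimator gains $L_0=W^{-1}U_0$, $L_i=W^{-1}U_i$, $\widehat{L}_i=W^{-1}\widehat{U}_i$ ($i\in\mathbb{N}_\nu$) and the gains $\mathcal{L}_0,\mathcal{L}_i,\widehat{\mathcal{L}}_i$, the error dynamics (E) of the context with supply rate function $\mathsf{s}$ is dissipative, and the trivial solution of (E) with $\boldsymbol{w}(t)\equiv\mathbf{0}_q$ is exponentially stable for any initial function $\boldsymbol{\psi}\in C(\mathcal{J};\mathbb{R}^n)$. Finally, the number of unknowns is $(0.5d^2+0.5d+\nu+1)n^2+(0.5d+1+\nu+\beta l)n+\beta ml\in\mathcal{O}(d^2n^2)$.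
   Context: **Notation.** $\mathbb{N}_\nu=\{1,\dots,\nu\}$; $\mathbb{S}^n$: real symmetric $n\times n$ matrices; $\succ0,\prec0,\preceq 0$: definiteness; $\mathsf{Sy}(X)=X+X^\top$; $\mathsf{O}_{n,m}$: $n\times m$ zero matrix, $\mathsf{O}_n=\mathsf{O}_{n,n}$, $\mathbf{0}_n=\mathsf{O}_{n,1}$; $X\oplus Y$: block diagonal matrix with (possibly rectangular) diagonal blocks $X,Y$; $\mathrm{diag}_{i=1}^\nu X_i=X_1\oplus\cdots\oplus X_\nu$; $[X_i]_{i=1}^\nu$: vertical stacking of $X_1,\dots,X_\nu$; $[\![X_i]\!]_{i=1}^\nu=[X_1\ \cdots\ X_\nu]$: horizontal concatenation; $\otimes$: Kronecker product; $\sqrt{X}$: the positive definite square root of $X\succ0$. Blocks with a zero dimension are empty and absent. **Data.** $n,m,q,l,\nu\in\mathbb{N}$; known delays $0=r_0<r_1<\dots<r_\nu=r$; $\mathcal{J}=[-r,0]$; $\mathcal{I}_i=[-r_i,-r_{i-1}]$. Matrices $A_i\in\mathbb{R}^{n\times n}$, $C_i\in\mathbb{R}^{m\times n}$ ($0\le i\le\nu$), $D_1,D_3\in\mathbb{R}^{n\times q}$, $D_2,D_4\in\mathbb{R}^{m\times q}$, $\mathfrak{C}\in\mathbb{R}^{l\times n}$. For $i\in\mathbb{N}_\nu$: $d_i\in\mathbb{N}$, $\delta_i,\mu_i\in\mathbb{N}\cup\{0\}$, $\varkappa_i=d_i+\delta_i$, $\kappa_i=d_i+\delta_i+\mu_i$,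 $d=\sum d_i$, $\varkappa=\sum\varkappa_i$, $\mu=\sum\mu_i$, $\kappa=\sum\kappa_i=\varkappa+\mu$, $\beta=1+\nu+\kappa$. Functions $\boldsymbol{f}_i\in H^1(\mathcal{I}_i;\mathbb{R}^{d_i})$ (identified with their continuous representatives), $\boldsymbol{\varphi}_i\in L^2(\mathcal{I}_i;\mathbb{R}^{\delta_i})$, $\boldsymbol{\phi}_i\in L^2(\mathcal{I}_i;\mathbb{R}^{\mu_i})$, and $M_i\in\mathbb{R}^{d_i\times\varkappa_i}$ satisfy, with $\boldsymbol{h}_i=\begin{bmatrix}\boldsymbol{\varphi}_i\\ \boldsymbol{f}_i\end{bmatrix}$ and $\boldsymbol{g}_i=\begin{bmatrix}\boldsymbol{\phi}_i\\ \boldsymbol{h}_i\end{bmatrix}$, $$\boldsymbol{f}_i'(\tau)=M_i\boldsymbol{h}_i(\tau)\ \text{(weak derivative)},\qquad \int_{\mathcal{I}_i}\boldsymbol{g}_i(\tau)\boldsymbol{g}_i^\top(\tau)\,\mathrm{d}\tau\succ0 .$$ Matrices $\widehat{A}_i\in\mathbb{R}^{n\times\kappa_in}$, $\widehat{C}_i\in\mathbb{R}^{m\times\kappa_in}$ are given (the distributed-delay kernels of the plant being $\widehat{A}_i(\boldsymbol{g}_i(\tau)\otimes I_n)$ and $\widehat{C}_i(\boldsymbol{g}_i(\tau)\otimes I_n)$ on $\mathcal{I}_i$). Define $$\mathfrak{F}_i=\int_{\mathcal{I}_i}\boldsymbol{f}_i\boldsymbol{f}_i^\top\mathrm{d}\tau,\quad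 \mathfrak{H}_i=\int_{\mathcal{I}_i}\boldsymbol{h}_i\boldsymbol{h}_i^\top\mathrm{d}\tau,\quad \Gamma_i=\int_{\mathcal{I}_i}\boldsymbol{\phi}_i\boldsymbol{h}_i^\top\mathrm{d}\tau,$$ $$\boldsymbol{\varepsilon}_i=\boldsymbol{\phi}_i-\Gamma_i\mathfrak{H}_i^{-1}\boldsymbol{h}_i,\quad \mathfrak{E}_i=\int_{\mathcal{I}_i}\boldsymbol{\varepsilon}_i\boldsymbol{\varepsilon}_i^\top\mathrm{d}\tau,$$ (all of $\mathfrak{F}_i,\mathfrak{H}_i,\mathfrak{E}_i$ are positive definite), and $$T_i=\begin{bmatrix}\Gamma_i\sqrt{\mathfrak{H}_i^{-1}}\\ \sqrt{\mathfrak{H}_i}\end{bmatrix}\in\mathbb{R}^{\kappa_i\times\varkappa_i},\qquad \widetilde{T}_i=\begin{bmatrix}\sqrt{\mathfrak{E}_i}\\ \mathsf{O}_{\varkappa_i,\mu_i}\end{bmatrix}\in\mathbb{R}^{\kappa_i\times\mu_i}.$$ **Coefficient matrices.** For estimator gains $L_0,L_i\in\mathbb{R}^{n\times l}$, $\widehat{L}_i\in\mathbb{R}^{n\times\kappa_i l}$, $\mathcal{L}_0,\mathcal{L}_i\in\mathbb{R}^{m\times l}$, $\widehat{\mathcal{L}}_i\in\mathbb{R}^{m\times\kappa_i l}$: $$\mathbf{A}=\Big[A_0\ \ [\![A_i]\!]_{i=1}^\nu\ \ [\![\widehat{A}_i(T_i\otimes I_n)]\!]_{i=1}^\nu\ \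 [\![\widehat{A}_i(\widetilde{T}_i\otimes I_n)]\!]_{i=1}^\nu\ \ D_1-D_3\Big],$$ $$\mathbf{C}=\Big[C_0\ \ [\![C_i]\!]_{i=1}^\nu\ \ [\![\widehat{C}_i(T_i\otimes I_n)]\!]_{i=1}^\nu\ \ [\![\widehat{C}_i(\widetilde{T}_i\otimes I_n)]\!]_{i=1}^\nu\ \ D_2-D_4\Big],$$ $$\mathbf{L}_1=\Big[L_0\ \ [\![L_i]\!]_{i=1}^\nu\ \ [\![\widehat{L}_i(T_i\otimes I_l)]\!]_{i=1}^\nu\ \ [\![\widehat{L}_i(\widetilde{T}_i\otimes I_l)]\!]_{i=1}^\nu\ \ \mathsf{O}_{n,q}\Big],$$ $$\mathbf{L}_2=\Big[\mathcal{L}_0\ \ [\![\mathcal{L}_i]\!]_{i=1}^\nu\ \ [\![\widehat{\mathcal{L}}_i(T_i\otimes I_l)]\!]_{i=1}^\nu\ \ [\![\widehat{\mathcal{L}}_i(\widetilde{T}_i\otimes I_l)]\!]_{i=1}^\nu\ \ \mathsf{O}_{m,q}\Big].$$ **Error dynamics (E).** For $t_0\in\mathbb{R}$ and disturbance $\boldsymbol{w}\in L^2([t_0,\infty);\mathbb{R}^q)$, $$\dot{\boldsymbol{e}}(t)=\big(\mathbf{A}+\mathbf{L}_1[(I_\beta\otimes\mathfrak{C})\oplus\mathsf{O}_q]\big)\boldsymbol{\vartheta}(t)\ \text{ for almost all }t\ge t_0,$$ $$\boldsymbol{\zeta}(t)=\big(\mathbf{C}+\mathbf{L}_2[(I_\beta\otimes\mathfrak{C})\oplus\mathsf{O}_q]\big)\boldsymbol{\vartheta}(t),\qquad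 \boldsymbol{e}(t_0+\theta)=\boldsymbol{\psi}(\theta)\ (\theta\in\mathcal{J}),\ \boldsymbol{\psi}\in C(\mathcal{J};\mathbb{R}^n),$$ with solutions in the Carathéodory sense, where $\boldsymbol{\vartheta}(t)$ is the vertical stacking of $\boldsymbol{e}(t)$, $[\boldsymbol{e}(t-r_i)]_{i=1}^\nu$, $\boldsymbol{\xi}(t)$, $\mathfrak{a}(t)$, $\boldsymbol{w}(t)$, with $$\boldsymbol{\xi}(t)=\Big[\int_{\mathcal{I}_i}\big(\sqrt{\mathfrak{H}_i^{-1}}\boldsymbol{h}_i(\tau)\otimes I_n\big)\boldsymbol{e}(t+\tau)\mathrm{d}\tau\Big]_{i=1}^\nu,\quad \mathfrak{a}(t)=\Big[\int_{\mathcal{I}_i}\big(\sqrt{\mathfrak{E}_i^{-1}}\boldsymbol{\varepsilon}_i(\tau)\otimes I_n\big)\boldsymbol{e}(t+\tau)\mathrm{d}\tau\Big]_{i=1}^\nu .$$ **Supply rate function.** $$\mathsf{s}(\boldsymbol{\zeta},\boldsymbol{w})=\begin{bmatrix}\boldsymbol{\zeta}\\ \boldsymbol{w}\end{bmatrix}^\top\begin{bmatrix}\widetilde{J}^\top J_1^{-1}\widetilde{J}&J_2\\ J_2^\top&J_3\end{bmatrix}\begin{bmatrix}\boldsymbol{\zeta}\\ \boldsymbol{w}\end{bmatrix},$$ where $J_1\in\mathbb{S}^m$, $J_1^{-1}\prec0$, $\widetilde{J}\in\mathbb{R}^{m\times m}$, $\widetilde{J}^\top J_1^{-1}\widetilde{J}\preceq0$,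 $J_2\in\mathbb{R}^{m\times q}$, $J_3\in\mathbb{S}^q$, with $\widetilde{J},J_2$ known. **Dissipativity.** (E) with supply rate $\mathsf{s}$ is dissipative if there is a differentiable functional $\mathsf{v}:C(\mathcal{J};\mathbb{R}^n)\to\mathbb{R}$ such that for almost all $t\ge t_0$, $\frac{\mathrm{d}}{\mathrm{d}t}\mathsf{v}(\boldsymbol{e}_t(\cdot))-\mathsf{s}(\boldsymbol{\zeta}(t),\boldsymbol{w}(t))\le0$ along (E), where $\boldsymbol{e}_t(\theta)=\boldsymbol{e}(t+\theta)$ for $\theta\in\mathcal{J}$.
   Formalization: In the number of unknowns, the coefficient of n² is corrected from 0.5d²+0.5d+ν+1 to 0.5d²+d+ν+1: P₂ alone contributes dn² entries, so the printed count is too small by 0.5dn² for all d,n≥1. The O(d²n²) claim is unchanged. *)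

theory Defs
  imports
    "HOL-Analysis.Analysis"
    "HOL-Library.Landau_Symbols"
    "Jordan_Normal_Form.Gauss_Jordan_Elimination"
begin

unbundle no vec_syntax and no inner_syntax
hide_type (open) Finite_Cartesian_Product.vec
hide_const (open) Finite_Cartesian_Product.vec Finite_Cartesian_Product.mat


section \<open>Matrices and vectors\<close>

definition sym_mat :: "nat \<Rightarrow> real mat \<Rightarrow> bool" where
  "sym_mat k X \<longleftrightarrow> X \<in> carrier_mat k k \<and> X\<^sup>T = X"

definition pos_def :: "real mat \<Rightarrow> bool" where
  "pos_def X \<longleftrightarrow> sym_mat (dim_row X) X \<and>
     (\<forall>x \<in> carrier_vec (dim_row X). x \<noteq> 0\<^sub>v (dim_row X) \<longrightarrow> x \<bullet> (X *\<^sub>v x) > 0)"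

definition neg_def :: "real mat \<Rightarrow> bool" where
  "neg_def X \<longleftrightarrow> sym_mat (dim_row X) X \<and>
     (\<forall>x \<in> carrier_vec (dim_row X). x \<noteq> 0\<^sub>v (dim_row X) \<longrightarrow> x \<bullet> (X *\<^sub>v x) < 0)"

definition neg_semidef :: "real mat \<Rightarrow> bool" where
  "neg_semidef X \<longleftrightarrow> sym_mat (dim_row X) X \<and>
     (\<forall>x \<in> carrier_vec (dim_row X). x \<bullet> (X *\<^sub>v x) \<le> 0)"

text \<open>Only meaningful for invertible matrices; otherwise the value is unspecified.\<close>
definition minv :: "real mat \<Rightarrow> real mat" where
  "minv X = the (mat_inverse X)"

text \<open>The positive definite square root; only meaningful for positive definite matrices.\<close>
definition msqrt :: "real mat \<Rightarrow> real mat" where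
  "msqrt X = (THE Y. pos_def Y \<and> Y * Y = X)"

definition Sy :: "real mat \<Rightarrow> real mat" where
  "Sy X = X + X\<^sup>T"

definition kron :: "real mat \<Rightarrow> real mat \<Rightarrow> real mat" (infixl "\<otimes>\<^sub>k" 75) where
  "A \<otimes>\<^sub>k B = mat (dim_row A * dim_row B) (dim_col A * dim_col B)
     (\<lambda>(i, j). A $$ (i div dim_row B, j div dim_col B) * B $$ (i mod dim_row B, j mod dim_col B))"

definition col_mat :: "real vec \<Rightarrow> real mat" where
  "col_mat v = mat_of_cols (dim_vec v) [v]"

text \<open>The first argument is the common number of rows (resp. columns), needed for the empty list.
  The direct sum of (possibly rectangular) matrices is \<^const>\<open>diag_block_mat\<close>.\<close>
definition hcat :: "nat \<Rightarrow> real mat list \<Rightarrow> real mat" where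
  "hcat nr Xs = foldr (\<lambda>A B. four_block_mat A B (0\<^sub>m 0 (dim_col A)) (0\<^sub>m 0 (dim_col B))) Xs (0\<^sub>m nr 0)"

definition vcat :: "nat \<Rightarrow> real mat list \<Rightarrow> real mat" where
  "vcat nc Xs = foldr (@\<^sub>r) Xs (0\<^sub>m 0 nc)"

definition stack_vec :: "real vec list \<Rightarrow> real vec" where
  "stack_vec vs = foldr (@\<^sub>v) vs vNil"

definition vnorm :: "real vec \<Rightarrow> real" where
  "vnorm x = sqrt (x \<bullet> x)"


section \<open>Function spaces\<close>

definition square_integrable_on :: "real set \<Rightarrow> (real \<Rightarrow> real) \<Rightarrow> bool" where
  "square_integrable_on S f \<longleftrightarrow>
     set_borel_measurable lebesgue S f \<and> set_integrable lebesgue S (\<lambda>x. (f x)\<^sup>2)"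

definition L2_on :: "real set \<Rightarrow> nat \<Rightarrow> (real \<Rightarrow> real vec) \<Rightarrow> bool" where
  "L2_on S k f \<longleftrightarrow> (\<forall>x\<in>S. f x \<in> carrier_vec k) \<and> (\<forall>j<k. square_integrable_on S (\<lambda>x. f x $ j))"

definition test_function :: "real \<Rightarrow> real \<Rightarrow> (real \<Rightarrow> real) \<Rightarrow> bool" where
  "test_function a b \<chi> \<longleftrightarrow>
     (\<forall>k. ((deriv ^^ k) \<chi>) differentiable_on UNIV) \<and> closure {x. \<chi> x \<noteq> 0} \<subseteq> {a<..<b}"

definition weak_derivative_on :: "real \<Rightarrow> real \<Rightarrow> (real \<Rightarrow> real) \<Rightarrow> (real \<Rightarrow> real) \<Rightarrow> bool" where
  "weak_derivative_on a b f g \<longleftrightarrow>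
     (\<forall>\<chi>. test_function a b \<chi> \<longrightarrow>
        (LINT x:{a..b}|lebesgue. f x * deriv \<chi> x) = - (LINT x:{a..b}|lebesgue. g x * \<chi> x))"

text \<open>\<open>H\<^sup>1\<close> functions on \<open>[a,b]\<close> with values in \<open>\<real>\<^sup>k\<close>, given by their continuous representatives,
  whose weak derivative is \<open>g\<close>.\<close>
definition H1_with_weak_derivative ::
    "real \<Rightarrow> real \<Rightarrow> nat \<Rightarrow> (real \<Rightarrow> real vec) \<Rightarrow> (real \<Rightarrow> real vec) \<Rightarrow> bool" where
  "H1_with_weak_derivative a b k f g \<longleftrightarrow>
     L2_on {a..b} k f \<and> L2_on {a..b} k g \<and>
     (\<forall>j<k. continuous_on {a..b} (\<lambda>x. f x $ j) \<and>
            weak_derivative_on a b (\<lambda>x. f x $ j) (\<lambda>x. g x $ j))"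

definition absolutely_continuous_between :: "real \<Rightarrow> real \<Rightarrow> (real \<Rightarrow> real) \<Rightarrow> bool" where
  "absolutely_continuous_between a b f \<longleftrightarrow>
     (\<forall>\<epsilon>>0. \<exists>\<delta>>0. \<forall>(N::nat) x y.
        (\<forall>k<N. a \<le> x k \<and> x k \<le> y k \<and> y k \<le> b) \<and>
        disjoint_family_on (\<lambda>k. {x k<..<y k}) {..<N} \<and>
        (\<Sum>k<N. y k - x k) < \<delta>
        \<longrightarrow> (\<Sum>k<N. \<bar>f (y k) - f (x k)\<bar>) < \<epsilon>)"

text \<open>\<open>C([-r,0]; \<real>\<^sup>k)\<close> as a set of extensional functions, so that a functional on it
  depends only on the values on \<open>[-r,0]\<close>.\<close>
definition C_space :: "real \<Rightarrow> nat \<Rightarrow> (real \<Rightarrow> real vec) set" where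
  "C_space r k = {\<psi> \<in> {-r..0} \<rightarrow>\<^sub>E carrier_vec k. \<forall>j<k. continuous_on {-r..0} (\<lambda>\<theta>. \<psi> \<theta> $ j)}"

definition C_add :: "real \<Rightarrow> (real \<Rightarrow> real vec) \<Rightarrow> (real \<Rightarrow> real vec) \<Rightarrow> real \<Rightarrow> real vec" where
  "C_add r \<psi> \<eta> = (\<lambda>\<theta>\<in>{-r..0}. \<psi> \<theta> + \<eta> \<theta>)"

definition C_scale :: "real \<Rightarrow> real \<Rightarrow> (real \<Rightarrow> real vec) \<Rightarrow> real \<Rightarrow> real vec" where
  "C_scale r c \<psi> = (\<lambda>\<theta>\<in>{-r..0}. c \<cdot>\<^sub>v \<psi> \<theta>)"

definition C_norm :: "real \<Rightarrow> (real \<Rightarrow> real vec) \<Rightarrow> real" where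
  "C_norm r \<psi> = (SUP \<theta>\<in>{-r..0}. vnorm (\<psi> \<theta>))"

text \<open>Frechet differentiability on the Banach space \<^term>\<open>C_space r k\<close> with the supremum norm.\<close>
definition differentiable_functional :: "real \<Rightarrow> nat \<Rightarrow> ((real \<Rightarrow> real vec) \<Rightarrow> real) \<Rightarrow> bool" where
  "differentiable_functional r k v \<longleftrightarrow>
     (\<forall>\<psi>\<in>C_space r k. \<exists>D.
        (\<forall>\<eta>\<in>C_space r k. \<forall>\<eta>'\<in>C_space r k. D (C_add r \<eta> \<eta>') = D \<eta> + D \<eta>') \<and>
        (\<forall>c. \<forall>\<eta>\<in>C_space r k. D (C_scale r c \<eta>) = c * D \<eta>) \<and>
        (\<exists>B. \<forall>\<eta>\<in>C_space r k. \<bar>D \<eta>\<bar> \<le> B * C_norm r \<eta>) \<and>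
        (\<forall>\<epsilon>>0. \<exists>\<delta>>0. \<forall>\<eta>\<in>C_space r k. C_norm r \<eta> < \<delta> \<longrightarrow>
           \<bar>v (C_add r \<psi> \<eta>) - v \<psi> - D \<eta>\<bar> \<le> \<epsilon> * C_norm r \<eta>))"

definition segment :: "real \<Rightarrow> (real \<Rightarrow> real vec) \<Rightarrow> real \<Rightarrow> real \<Rightarrow> real vec" where
  "segment r e t = (\<lambda>\<theta>\<in>{-r..0}. e (t + \<theta>))"

definition gram :: "real set \<Rightarrow> nat \<Rightarrow> nat \<Rightarrow> (real \<Rightarrow> real vec) \<Rightarrow> (real \<Rightarrow> real vec) \<Rightarrow> real mat" where
  "gram S k k' u v = mat k k' (\<lambda>(a, b). LINT \<tau>:S|lebesgue. u \<tau> $ a * v \<tau> $ b)"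


section \<open>Plant data\<close>

text \<open>
  Correspondence with the mathematical notation:
  \<open>dim_x\<close>, \<open>dim_z\<close>, \<open>dim_w\<close>, \<open>dim_y\<close> are \<open>n\<close>, \<open>m\<close>, \<open>q\<close>, \<open>l\<close>; \<open>ndelays\<close> is \<open>\<nu>\<close>; \<open>delay i\<close> is \<open>r\<^sub>i\<close>;
  \<open>Cout\<close> is the output matrix (fraktur \<open>C\<close>);
  \<open>dim_f\<close>, \<open>dim_vphi\<close>, \<open>dim_phi\<close> are \<open>d\<^sub>i\<close>, \<open>\<delta>\<^sub>i\<close>, \<open>\<mu>\<^sub>i\<close>, the dimensions of the values of
  \<open>fn_f\<close>, \<open>fn_vphi\<close>, \<open>fn_phi\<close>, the kernel functions
  written \<open>f\<^sub>i\<close>, \<open>varphi\<^sub>i\<close>, \<open>phi\<^sub>i\<close> in LaTeX.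
  Families over \<open>i = 0,\<dots>,\<nu>\<close> or \<open>i = 1,\<dots>,\<nu>\<close> are functions on \<^typ>\<open>nat\<close> of which only those
  values matter.
\<close>
record plant =
  dim_x :: nat
  dim_z :: nat
  dim_w :: nat
  dim_y :: nat
  ndelays :: nat
  delay :: "nat \<Rightarrow> real"
  Amat :: "nat \<Rightarrow> real mat"
  Cmat :: "nat \<Rightarrow> real mat"
  D1 :: "real mat"
  D2 :: "real mat"
  D3 :: "real mat"
  D4 :: "real mat"
  Cout :: "real mat"
  dim_f :: "nat \<Rightarrow> nat"
  dim_vphi :: "nat \<Rightarrow> nat"
  dim_phi :: "nat \<Rightarrow> nat"
  fn_f :: "nat \<Rightarrow> real \<Rightarrow> real vec"
  fn_vphi :: "nat \<Rightarrow> real \<Rightarrow> real vec"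
  fn_phi :: "nat \<Rightarrow> real \<Rightarrow> real vec"
  Mmat :: "nat \<Rightarrow> real mat"
  Ahat :: "nat \<Rightarrow> real mat"
  Chat :: "nat \<Rightarrow> real mat"

definition idx :: "plant \<Rightarrow> nat list" where
  "idx p = [1..<Suc (ndelays p)]"

definition rmax :: "plant \<Rightarrow> real" where
  "rmax p = delay p (ndelays p)"

definition ival :: "plant \<Rightarrow> nat \<Rightarrow> real set" where
  "ival p i = {- delay p i .. - delay p (i - 1)}"

text \<open>\<open>vk\<close> is varkappa (\<open>d\<^sub>i + \<delta>\<^sub>i\<close>) and \<open>kp\<close> is kappa (\<open>d\<^sub>i + \<delta>\<^sub>i + \<mu>\<^sub>i\<close>);
  the suffix \<open>_sum\<close> marks the total over \<open>i = 1,\<dots>,\<nu>\<close>.\<close>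
definition vk :: "plant \<Rightarrow> nat \<Rightarrow> nat" where "vk p i = dim_f p i + dim_vphi p i"
definition kp :: "plant \<Rightarrow> nat \<Rightarrow> nat" where "kp p i = dim_f p i + dim_vphi p i + dim_phi p i"
definition d_sum :: "plant \<Rightarrow> nat" where "d_sum p = (\<Sum>i = 1..ndelays p. dim_f p i)"
definition vk_sum :: "plant \<Rightarrow> nat" where "vk_sum p = (\<Sum>i = 1..ndelays p. vk p i)"
definition mu_sum :: "plant \<Rightarrow> nat" where "mu_sum p = (\<Sum>i = 1..ndelays p. dim_phi p i)"
definition kp_sum :: "plant \<Rightarrow> nat" where "kp_sum p = (\<Sum>i = 1..ndelays p. kp p i)"
definition beta :: "plant \<Rightarrow> nat" where "beta p = 1 + ndelays p + kp_sum p"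

definition fn_h :: "plant \<Rightarrow> nat \<Rightarrow> real \<Rightarrow> real vec" where
  "fn_h p i \<tau> = fn_vphi p i \<tau> @\<^sub>v fn_f p i \<tau>"

definition fn_g :: "plant \<Rightarrow> nat \<Rightarrow> real \<Rightarrow> real vec" where
  "fn_g p i \<tau> = fn_phi p i \<tau> @\<^sub>v fn_h p i \<tau>"

definition admissible_plant :: "plant \<Rightarrow> bool" where
  "admissible_plant p \<longleftrightarrow>
     dim_x p \<ge> 1 \<and> dim_z p \<ge> 1 \<and> dim_w p \<ge> 1 \<and> dim_y p \<ge> 1 \<and> ndelays p \<ge> 1 \<and>
     delay p 0 = 0 \<and> (\<forall>i<ndelays p. delay p i < delay p (Suc i)) \<and>
     (\<forall>i\<le>ndelays p. Amat p i \<in> carrier_mat (dim_x p) (dim_x p) \<and>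
                    Cmat p i \<in> carrier_mat (dim_z p) (dim_x p)) \<and>
     D1 p \<in> carrier_mat (dim_x p) (dim_w p) \<and> D3 p \<in> carrier_mat (dim_x p) (dim_w p) \<and>
     D2 p \<in> carrier_mat (dim_z p) (dim_w p) \<and> D4 p \<in> carrier_mat (dim_z p) (dim_w p) \<and>
     Cout p \<in> carrier_mat (dim_y p) (dim_x p) \<and>
     (\<forall>i\<in>{1..ndelays p}.
        dim_f p i \<ge> 1 \<and>
        L2_on (ival p i) (dim_vphi p i) (fn_vphi p i) \<and>
        L2_on (ival p i) (dim_phi p i) (fn_phi p i) \<and>
        Mmat p i \<in> carrier_mat (dim_f p i) (vk p i) \<and>
        H1_with_weak_derivative (- delay p i) (- delay p (i - 1)) (dim_f p i)
          (fn_f p i) (\<lambda>\<tau>. Mmat p i *\<^sub>v fn_h p i \<tau>) \<and>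
        pos_def (gram (ival p i) (kp p i) (kp p i) (fn_g p i) (fn_g p i)) \<and>
        Ahat p i \<in> carrier_mat (dim_x p) (kp p i * dim_x p) \<and>
        Chat p i \<in> carrier_mat (dim_z p) (kp p i * dim_x p))"

definition Fmat :: "plant \<Rightarrow> nat \<Rightarrow> real mat" where
  "Fmat p i = gram (ival p i) (dim_f p i) (dim_f p i) (fn_f p i) (fn_f p i)"

definition Hmat :: "plant \<Rightarrow> nat \<Rightarrow> real mat" where
  "Hmat p i = gram (ival p i) (vk p i) (vk p i) (fn_h p i) (fn_h p i)"

definition Gam :: "plant \<Rightarrow> nat \<Rightarrow> real mat" where
  "Gam p i = gram (ival p i) (dim_phi p i) (vk p i) (fn_phi p i) (fn_h p i)"

definition fn_eps :: "plant \<Rightarrow> nat \<Rightarrow> real \<Rightarrow> real vec" where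
  "fn_eps p i \<tau> = fn_phi p i \<tau> - (Gam p i * minv (Hmat p i)) *\<^sub>v fn_h p i \<tau>"

definition Emat :: "plant \<Rightarrow> nat \<Rightarrow> real mat" where
  "Emat p i = gram (ival p i) (dim_phi p i) (dim_phi p i) (fn_eps p i) (fn_eps p i)"

definition Tmat :: "plant \<Rightarrow> nat \<Rightarrow> real mat" where
  "Tmat p i = (Gam p i * msqrt (minv (Hmat p i))) @\<^sub>r msqrt (Hmat p i)"

definition Ttil :: "plant \<Rightarrow> nat \<Rightarrow> real mat" where
  "Ttil p i = msqrt (Emat p i) @\<^sub>r 0\<^sub>m (vk p i) (dim_phi p i)"

text \<open>The common shape
  \<open>[X\<^sub>0  [X\<^sub>i]\<^sub>i  [Xh\<^sub>i (T\<^sub>i \<otimes> I\<^sub>k)]\<^sub>i  [Xh\<^sub>i (Ttil\<^sub>i \<otimes> I\<^sub>k)]\<^sub>i  Y]\<close> of the coefficient matrices.\<close>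
definition coeff_row :: "plant \<Rightarrow> nat \<Rightarrow> (nat \<Rightarrow> real mat) \<Rightarrow> (nat \<Rightarrow> real mat) \<Rightarrow> real mat \<Rightarrow> real mat" where
  "coeff_row p k X Xh Y = hcat (dim_row Y)
     ([X 0] @ map X (idx p) @
      map (\<lambda>i. Xh i * (Tmat p i \<otimes>\<^sub>k 1\<^sub>m k)) (idx p) @
      map (\<lambda>i. Xh i * (Ttil p i \<otimes>\<^sub>k 1\<^sub>m k)) (idx p) @ [Y])"

definition bA :: "plant \<Rightarrow> real mat" where
  "bA p = coeff_row p (dim_x p) (Amat p) (Ahat p) (D1 p - D3 p)"

definition bC :: "plant \<Rightarrow> real mat" where
  "bC p = coeff_row p (dim_x p) (Cmat p) (Chat p) (D2 p - D4 p)"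

text \<open>Used for \<open>\<^bold>L\<^sub>1\<close> and \<open>\<^bold>U\<close> (\<open>nr = n\<close>) and for \<open>\<^bold>L\<^sub>2\<close> (\<open>nr = m\<close>).\<close>
definition gain_row :: "plant \<Rightarrow> nat \<Rightarrow> (nat \<Rightarrow> real mat) \<Rightarrow> (nat \<Rightarrow> real mat) \<Rightarrow> real mat" where
  "gain_row p nr X Xh = coeff_row p (dim_y p) X Xh (0\<^sub>m nr (dim_w p))"

definition out_block :: "plant \<Rightarrow> real mat" where
  "out_block p = diag_block_mat [1\<^sub>m (beta p) \<otimes>\<^sub>k Cout p, 0\<^sub>m (dim_w p) (dim_w p)]"


section \<open>Error dynamics\<close>

definition xi_vec :: "plant \<Rightarrow> (real \<Rightarrow> real vec) \<Rightarrow> real \<Rightarrow> real vec" where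
  "xi_vec p e t = stack_vec (map (\<lambda>i. vec (vk p i * dim_x p) (\<lambda>a.
     LINT \<tau>:ival p i|lebesgue.
       ((col_mat (msqrt (minv (Hmat p i)) *\<^sub>v fn_h p i \<tau>) \<otimes>\<^sub>k 1\<^sub>m (dim_x p)) *\<^sub>v e (t + \<tau>)) $ a)) (idx p))"

definition a_vec :: "plant \<Rightarrow> (real \<Rightarrow> real vec) \<Rightarrow> real \<Rightarrow> real vec" where
  "a_vec p e t = stack_vec (map (\<lambda>i. vec (dim_phi p i * dim_x p) (\<lambda>a.
     LINT \<tau>:ival p i|lebesgue.
       ((col_mat (msqrt (minv (Emat p i)) *\<^sub>v fn_eps p i \<tau>) \<otimes>\<^sub>k 1\<^sub>m (dim_x p)) *\<^sub>v e (t + \<tau>)) $ a)) (idx p))"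

definition theta_vec :: "plant \<Rightarrow> (real \<Rightarrow> real vec) \<Rightarrow> (real \<Rightarrow> real vec) \<Rightarrow> real \<Rightarrow> real vec" where
  "theta_vec p e w t = stack_vec
     ([e t] @ map (\<lambda>i. e (t - delay p i)) (idx p) @ [xi_vec p e t, a_vec p e t, w t])"

definition error_rhs ::
    "plant \<Rightarrow> (nat \<Rightarrow> real mat) \<Rightarrow> (nat \<Rightarrow> real mat) \<Rightarrow>
     (real \<Rightarrow> real vec) \<Rightarrow> (real \<Rightarrow> real vec) \<Rightarrow> real \<Rightarrow> real vec" where
  "error_rhs p L Lh e w t = (bA p + gain_row p (dim_x p) L Lh * out_block p) *\<^sub>v theta_vec p e w t"

definition zeta ::
    "plant \<Rightarrow> (nat \<Rightarrow> real mat) \<Rightarrow> (nat \<Rightarrow> real mat) \<Rightarrow>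
     (real \<Rightarrow> real vec) \<Rightarrow> (real \<Rightarrow> real vec) \<Rightarrow> real \<Rightarrow> real vec" where
  "zeta p K Kh e w t = (bC p + gain_row p (dim_z p) K Kh * out_block p) *\<^sub>v theta_vec p e w t"

definition error_solution ::
    "plant \<Rightarrow> (nat \<Rightarrow> real mat) \<Rightarrow> (nat \<Rightarrow> real mat) \<Rightarrow> real \<Rightarrow>
     (real \<Rightarrow> real vec) \<Rightarrow> (real \<Rightarrow> real vec) \<Rightarrow> (real \<Rightarrow> real vec) \<Rightarrow> bool" where
  "error_solution p L Lh t0 \<psi> w e \<longleftrightarrow>
     (\<forall>t \<ge> t0 - rmax p. e t \<in> carrier_vec (dim_x p)) \<and>
     (\<forall>\<theta>\<in>{- rmax p..0}. e (t0 + \<theta>) = \<psi> \<theta>) \<and>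
     (\<forall>T>t0. \<forall>j<dim_x p. absolutely_continuous_between t0 T (\<lambda>t. e t $ j)) \<and>
     (AE t in lebesgue. t0 \<le> t \<longrightarrow>
        (\<forall>j<dim_x p. ((\<lambda>s. e s $ j) has_real_derivative error_rhs p L Lh e w t $ j) (at t)))"


section \<open>Dissipativity and stability\<close>

text \<open>\<open>Jt\<close> is \<open>J\<close> with tilde.\<close>
record supply_data =
  J1 :: "real mat"
  Jt :: "real mat"
  J2 :: "real mat"
  J3 :: "real mat"

definition admissible_supply :: "plant \<Rightarrow> supply_data \<Rightarrow> bool" where
  "admissible_supply p s \<longleftrightarrow>
     sym_mat (dim_z p) (J1 s) \<and> invertible_mat (J1 s) \<and> neg_def (minv (J1 s)) \<and>
     Jt s \<in> carrier_mat (dim_z p) (dim_z p) \<and>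
     neg_semidef ((Jt s)\<^sup>T * minv (J1 s) * Jt s) \<and>
     J2 s \<in> carrier_mat (dim_z p) (dim_w p) \<and> sym_mat (dim_w p) (J3 s)"

definition supply_rate :: "supply_data \<Rightarrow> real vec \<Rightarrow> real vec \<Rightarrow> real" where
  "supply_rate s z w =
     (z @\<^sub>v w) \<bullet> (four_block_mat ((Jt s)\<^sup>T * minv (J1 s) * Jt s) (J2 s) ((J2 s)\<^sup>T) (J3 s) *\<^sub>v (z @\<^sub>v w))"

definition dissipative ::
    "plant \<Rightarrow> supply_data \<Rightarrow> (nat \<Rightarrow> real mat) \<Rightarrow> (nat \<Rightarrow> real mat) \<Rightarrow>
     (nat \<Rightarrow> real mat) \<Rightarrow> (nat \<Rightarrow> real mat) \<Rightarrow> bool" where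
  "dissipative p s L Lh K Kh \<longleftrightarrow>
     (\<exists>v. differentiable_functional (rmax p) (dim_x p) v \<and>
        (\<forall>t0 w \<psi> e. L2_on {t0..} (dim_w p) w \<and> \<psi> \<in> C_space (rmax p) (dim_x p) \<and>
           error_solution p L Lh t0 \<psi> w e \<longrightarrow>
           (AE t in lebesgue. t0 \<le> t \<longrightarrow>
              (\<exists>D. ((\<lambda>u. v (segment (rmax p) e u)) has_real_derivative D) (at t) \<and>
                   D - supply_rate s (zeta p K Kh e w t) (w t) \<le> 0))))"

text \<open>Exponential stability of the trivial solution of the undisturbed dynamics, with constants
  independent of the initial time and of the initial function.\<close>
definition exponentially_stable :: "plant \<Rightarrow> (nat \<Rightarrow> real mat) \<Rightarrow> (nat \<Rightarrow> real mat) \<Rightarrow> bool" where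
  "exponentially_stable p L Lh \<longleftrightarrow>
     (\<exists>c>0. \<exists>\<gamma>>0. \<forall>t0 \<psi> e. \<psi> \<in> C_space (rmax p) (dim_x p) \<and>
        error_solution p L Lh t0 \<psi> (\<lambda>t. 0\<^sub>v (dim_w p)) e \<longrightarrow>
        (\<forall>t\<ge>t0. vnorm (e t) \<le> c * exp (- \<gamma> * (t - t0)) * C_norm (rmax p) \<psi>))"


section \<open>Matrix inequalities\<close>

definition diag_idx :: "plant \<Rightarrow> (nat \<Rightarrow> real mat) \<Rightarrow> real mat" where
  "diag_idx p X = diag_block_mat (map X (idx p))"

definition Ihat :: "plant \<Rightarrow> real mat" where
  "Ihat p = diag_idx p (\<lambda>i. msqrt (minv (Fmat p i)) *
       hcat (dim_f p i) [0\<^sub>m (dim_f p i) (dim_vphi p i), 1\<^sub>m (dim_f p i)] * msqrt (Hmat p i))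
     \<otimes>\<^sub>k 1\<^sub>m (dim_x p)"

definition Lam :: "plant \<Rightarrow> real mat" where
  "Lam p = diag_idx p (\<lambda>i. (delay p i - delay p (i - 1)) \<cdot>\<^sub>m 1\<^sub>m (dim_x p))"

definition bM :: "plant \<Rightarrow> real mat" where
  "bM p = hcat (d_sum p)
       [diag_idx p (\<lambda>i. col_mat (msqrt (minv (Fmat p i)) *\<^sub>v fn_f p i (- delay p (i - 1)))),
        0\<^sub>m (d_sum p) 1, 0\<^sub>m (d_sum p) (vk_sum p)]
     - hcat (d_sum p)
       [0\<^sub>m (d_sum p) 1,
        diag_idx p (\<lambda>i. col_mat (msqrt (minv (Fmat p i)) *\<^sub>v fn_f p i (- delay p i))),
        diag_idx p (\<lambda>i. msqrt (minv (Fmat p i)) * Mmat p i * msqrt (Hmat p i))]"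

definition Xi :: "plant \<Rightarrow> supply_data \<Rightarrow> (nat \<Rightarrow> real mat) \<Rightarrow> (nat \<Rightarrow> real mat) \<Rightarrow> real mat" where
  "Xi p s Q R = (let n = dim_x p in
     diag_block_mat
       [diag_idx p Q + diag_idx p R * Lam p, 0\<^sub>m n n,
        0\<^sub>m (kp_sum p * n) (kp_sum p * n), 0\<^sub>m (dim_w p) (dim_w p)]
     - diag_block_mat
       [0\<^sub>m n n, diag_idx p Q,
        diag_idx p (\<lambda>i. 1\<^sub>m (vk p i) \<otimes>\<^sub>k R i), diag_idx p (\<lambda>i. 1\<^sub>m (dim_phi p i) \<otimes>\<^sub>k R i), J3 s])"

definition Sig :: "plant \<Rightarrow> (nat \<Rightarrow> real mat) \<Rightarrow> (nat \<Rightarrow> real mat) \<Rightarrow> real mat" where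
  "Sig p K Kh = bC p + gain_row p (dim_z p) K Kh * out_block p"

definition bP :: "plant \<Rightarrow> real mat \<Rightarrow> real mat \<Rightarrow> real mat" where
  "bP p P1 P2 = (let n = dim_x p in
     hcat n [P1, 0\<^sub>m n (ndelays p * n), P2 * Ihat p,
             0\<^sub>m n (mu_sum p * n + dim_w p + dim_z p)])"

definition Phi ::
    "plant \<Rightarrow> supply_data \<Rightarrow> real mat \<Rightarrow> real mat \<Rightarrow> (nat \<Rightarrow> real mat) \<Rightarrow> (nat \<Rightarrow> real mat) \<Rightarrow>
     (nat \<Rightarrow> real mat) \<Rightarrow> (nat \<Rightarrow> real mat) \<Rightarrow> real mat" where
  "Phi p s P2 P3 Q R K Kh =
     (let n = dim_x p; m = dim_z p; q = dim_w p; dn = d_sum p * n; z = mu_sum p * n + q + m in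
      Sy (vcat dn [P2, 0\<^sub>m (ndelays p * n) dn, (Ihat p)\<^sup>T * P3, 0\<^sub>m z dn]
            * hcat dn [bM p \<otimes>\<^sub>k 1\<^sub>m n, 0\<^sub>m dn z]
          + vcat m [0\<^sub>m (beta p * n) m, - ((J2 s)\<^sup>T), Jt s]
            * hcat m [Sig p K Kh, 0\<^sub>m m m])
      + diag_block_mat [Xi p s Q R, J1 s])"

definition Pihat :: "plant \<Rightarrow> real mat \<Rightarrow> (nat \<Rightarrow> real mat) \<Rightarrow> (nat \<Rightarrow> real mat) \<Rightarrow> real mat" where
  "Pihat p W U Uh = hcat (dim_x p)
     [W * bA p + gain_row p (dim_x p) U Uh * out_block p, 0\<^sub>m (dim_x p) (dim_z p)]"

definition alpha_stack :: "plant \<Rightarrow> (nat \<Rightarrow> real) \<Rightarrow> real mat" where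
  "alpha_stack p \<alpha> = vcat (dim_x p)
     ([1\<^sub>m (dim_x p)] @ map (\<lambda>i. \<alpha> i \<cdot>\<^sub>m 1\<^sub>m (dim_x p)) [1..<Suc (beta p)] @
      [0\<^sub>m (dim_w p + dim_z p) (dim_x p)])"


section \<open>Number of scalar unknowns\<close>

text \<open>One label for each matrix unknown. The gains \<open>K\<close>, \<open>Kh\<close> are the calligraphic \<open>L\<close> and its hatted
  version. A symmetric matrix contributes the entries on and above its diagonal.\<close>
datatype unknown_matrix =
  Unk_P1 | Unk_W | Unk_P2 | Unk_P3 | Unk_Q nat | Unk_R nat |
  Unk_U nat | Unk_Uh nat | Unk_K nat | Unk_Kh nat

definition sym_entries :: "nat \<Rightarrow> (nat \<times> nat) set" where
  "sym_entries k = {(a, b). a \<le> b \<and> b < k}"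

definition rect_entries :: "nat \<Rightarrow> nat \<Rightarrow> (nat \<times> nat) set" where
  "rect_entries r c = {..<r} \<times> {..<c}"

fun unknown_entries :: "plant \<Rightarrow> unknown_matrix \<Rightarrow> (nat \<times> nat) set" where
  "unknown_entries p Unk_P1 = sym_entries (dim_x p)"
| "unknown_entries p Unk_W = sym_entries (dim_x p)"
| "unknown_entries p Unk_P2 = rect_entries (dim_x p) (d_sum p * dim_x p)"
| "unknown_entries p Unk_P3 = sym_entries (d_sum p * dim_x p)"
| "unknown_entries p (Unk_Q i) = (if i \<in> {1..ndelays p} then sym_entries (dim_x p) else {})"
| "unknown_entries p (Unk_R i) = (if i \<in> {1..ndelays p} then sym_entries (dim_x p) else {})"
| "unknown_entries p (Unk_U i) = (if i \<in> {0..ndelays p} then rect_entries (dim_x p) (dim_y p) else {})"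
| "unknown_entries p (Unk_Uh i) =
     (if i \<in> {1..ndelays p} then rect_entries (dim_x p) (kp p i * dim_y p) else {})"
| "unknown_entries p (Unk_K i) = (if i \<in> {0..ndelays p} then rect_entries (dim_z p) (dim_y p) else {})"
| "unknown_entries p (Unk_Kh i) =
     (if i \<in> {1..ndelays p} then rect_entries (dim_z p) (kp p i * dim_y p) else {})"

definition num_unknowns :: "plant \<Rightarrow> nat" where
  "num_unknowns p = card (SIGMA X:UNIV. unknown_entries p X)"

end

theory Submission
  imports Defs "Jordan_Normal_Form.Spectral_Radius"
begin

text \<open>
  The functional is
  \<open>v = e(t)\<^sup>T P\<^sub>1 e(t) + 2 e(t)\<^sup>T P\<^sub>2 \<eta> + \<eta>\<^sup>T P\<^sub>3 \<eta> + \<Sum>\<^sub>i \<integral> e(t+\<tau>)\<^sup>T (Q\<^sub>i + (\<tau> + r\<^sub>i) R\<^sub>i) e(t+\<tau>) d\<tau>\<close>, the integrals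
  running over the intervals \<open>I\<^sub>i\<close>, where \<open>\<eta>\<close> collects the integrals of \<open>F\<^sub>i\<^sup>-\<^sup>1\<^sup>/\<^sup>2 f\<^sub>i(\<tau>) \<otimes> e(t+\<tau>)\<close>.
  Since \<open>f\<^sub>i' = M\<^sub>i h\<^sub>i\<close>, the derivative of \<open>\<eta>\<close> is a linear function of the stacked vector \<open>\<theta>\<close>, and
  Bessel's inequality for the orthonormal systems made from \<open>h\<^sub>i\<close> and \<open>\<epsilon>\<^sub>i\<close> bounds the integrals of
  \<open>e\<^sup>T R\<^sub>i e\<close> from below by a quadratic form in \<open>\<theta>\<close>. Testing the main inequality on \<open>(x, \<theta>, y)\<close> with \<open>x\<close> the
  derivative of \<open>e\<close> annihilates the \<open>\<alpha>\<close>-term, because \<open>W x\<close> is the product of the matrix next to \<open>- W\<close>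
  with \<open>(\<theta>, y)\<close>, and with \<open>y = - J\<^sub>1\<^sup>-\<^sup>1 Jt \<zeta>\<close> the \<open>\<zeta>\<close>-part becomes the supply rate, so \<open>v' - s \<le> 0\<close>.
  For \<open>w = 0\<close> the strictness absorbs a further small term \<open>\<integral> (\<tau> + r + 1) \<bar>e(t+\<tau>)\<bar>\<^sup>2 d\<tau>\<close>, which makes
  the derivative at most a negative multiple of the functional.
\<close>

section \<open>Positive definite matrices\<close>

text \<open>The gains would enter as products with W. The multiplier (I, \<alpha>_i I, 0) leaves the
  dynamics as the factor \<open>[- W, Pihat]\<close>, linear in W and \<open>U\<close>, and U = W L
  can be solved for L because the first diagonal block of the inequality is -2 W, which forces W >
  0. The initial history is only continuous and the f_i only weakly differentiable, so the window
  integrals cannot simply be differentiated under the integral sign: weak derivatives are turned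
  into primitives, and integration by parts moves the difference quotient to an antiderivative of e.
  As e' exists only almost everywhere, the decay of exp(\<gamma> t) v is a monotonicity statement
  about absolutely continuous functions, proved with a tagged division. Bessel's inequality is used
  a second time, for f_i alone and with Q_i: it lets \<open>P3\<close> plus the Q-blocks bound v
  from below by a multiple of |e(t)|^2. The weight \<tau> + r + 1 has slope one and is at least one
  on [-r, 0], so its boundary terms telescope over the delays into at most (r + 1) |e(t)|^2, which
  the margin absorbs.\<close>

lemma scalar_prod_self_nonneg [simp]: "0 \<le> x \<bullet> (x :: real vec)"
  by (simp add: scalar_prod_def sum_nonneg)

lemma scalar_prod_self_eq_0_iff:
  assumes "x \<in> carrier_vec n"
  shows "x \<bullet> x = 0 \<longleftrightarrow> (x :: real vec) = 0\<^sub>v n"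
proof -
  have "x \<bullet> x = (\<Sum>i\<in>{0..<n}. (x $ i)\<^sup>2)"
    using assms by (simp add: scalar_prod_def power2_eq_square)
  then show ?thesis
    using assms by (auto simp: sum_nonneg_eq_0_iff intro!: eq_vecI)
qed

lemma scalar_prod_self_pos:
  assumes "x \<in> carrier_vec n" "x \<noteq> 0\<^sub>v n"
  shows "0 < x \<bullet> (x :: real vec)"
  using scalar_prod_self_eq_0_iff[OF assms(1)] assms(2) scalar_prod_self_nonneg[of x] by linarith

lemma eq_mat_by_mult_vec:
  fixes A :: "real mat"
  assumes A: "A \<in> carrier_mat nr nc" and B: "B \<in> carrier_mat nr nc"
    and eq: "\<And>x. x \<in> carrier_vec nc \<Longrightarrow> A *\<^sub>v x = B *\<^sub>v x"
  shows "A = B"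
proof (rule eq_matI)
  fix i j assume ij: "i < dim_row B" "j < dim_col B"
  have "(A *\<^sub>v unit_vec nc j) $ i = (B *\<^sub>v unit_vec nc j) $ i"
    using eq by simp
  then show "A $$ (i, j) = B $$ (i, j)"
    using A B ij by simp
qed (use A B in auto)

lemma sym_mat_carrier: "sym_mat n X \<Longrightarrow> X \<in> carrier_mat n n"
  by (simp add: sym_mat_def)

lemma sym_mat_scalar_prod:
  assumes "sym_mat n X" "x \<in> carrier_vec n" "y \<in> carrier_vec n"
  shows "(X *\<^sub>v x) \<bullet> y = x \<bullet> (X *\<^sub>v y)"
  using transpose_vec_mult_scalar[of X n n y x] assms by (simp add: sym_mat_def)

lemma sym_matI:
  assumes "X \<in> carrier_mat n n"
    and "\<And>i j. i < n \<Longrightarrow> j < n \<Longrightarrow> X $$ (i, j) = X $$ (j, i)"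
  shows "sym_mat n X"
  using assms unfolding sym_mat_def by (auto intro!: eq_matI)

lemma sym_mat_index:
  assumes "sym_mat n X" "i < n" "j < n"
  shows "X $$ (i, j) = X $$ (j, i)"
proof -
  have "X $$ (i, j) = X\<^sup>T $$ (i, j)" using assms(1) by (simp add: sym_mat_def)
  also have "\<dots> = X $$ (j, i)" using sym_mat_carrier[OF assms(1)] assms(2,3) by simp
  finally show ?thesis .
qed

lemma mult_mat_zero_vec: "A \<in> carrier_mat nr nc \<Longrightarrow> A *\<^sub>v 0\<^sub>v nc = (0\<^sub>v nr :: real vec)"
  by (intro eq_vecI) auto

lemma zero_vec_append: "0\<^sub>v n @\<^sub>v 0\<^sub>v m = (0\<^sub>v (n + m) :: real vec)"
  by (intro eq_vecI) auto

lemma sym_mat_by_scalar_prod: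
  assumes X: "X \<in> carrier_mat n n"
    and eq: "\<And>x y. x \<in> carrier_vec n \<Longrightarrow> y \<in> carrier_vec n \<Longrightarrow> (X *\<^sub>v x) \<bullet> y = x \<bullet> (X *\<^sub>v y)"
  shows "sym_mat n X"
proof (rule sym_matI[OF X])
  fix i j assume ij: "i < n" "j < n"
  have "(X *\<^sub>v unit_vec n j) \<bullet> unit_vec n i = unit_vec n j \<bullet> (X *\<^sub>v unit_vec n i)"
    using eq by simp
  then show "X $$ (i, j) = X $$ (j, i)"
    using X ij by simp
qed

lemma pos_def_sym: "pos_def X \<Longrightarrow> X \<in> carrier_mat n n \<Longrightarrow> sym_mat n X"
  by (auto simp: pos_def_def)

lemma pos_def_pos:
  "pos_def X \<Longrightarrow> X \<in> carrier_mat n n \<Longrightarrow> x \<in> carrier_vec n \<Longrightarrow> x \<noteq> 0\<^sub>v n \<Longrightarrow> 0 < x \<bullet> (X *\<^sub>v x)"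
  by (auto simp: pos_def_def)

lemma pos_def_nonneg:
  assumes "pos_def X" "X \<in> carrier_mat n n" "x \<in> carrier_vec n"
  shows "0 \<le> x \<bullet> (X *\<^sub>v x)"
proof (cases "x = 0\<^sub>v n")
  case True
  then show ?thesis using assms by simp
qed (use pos_def_pos[OF assms] in simp)

lemma pos_defI:
  assumes "sym_mat n X"
    and "\<And>x. x \<in> carrier_vec n \<Longrightarrow> x \<noteq> 0\<^sub>v n \<Longrightarrow> 0 < x \<bullet> (X *\<^sub>v x)"
  shows "pos_def X"
  using assms unfolding pos_def_def sym_mat_def by auto

lemma pos_def_square: "pos_def X \<Longrightarrow> X \<in> carrier_mat (dim_row X) (dim_row X)"
  by (simp add: pos_def_def sym_mat_def)

lemma pos_def_det:
  assumes "pos_def X" "X \<in> carrier_mat n n"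
  shows "det X \<noteq> 0"
proof
  assume "det X = 0"
  then obtain v where "v \<in> carrier_vec n" "v \<noteq> 0\<^sub>v n" "X *\<^sub>v v = 0\<^sub>v n"
    using det_0_iff_vec_prod_zero_field[OF assms(2)] by auto
  then show False using pos_def_pos[OF assms, of v] by simp
qed

lemma minv_inverse:
  assumes "X \<in> carrier_mat n n" "det X \<noteq> 0"
  shows "minv X \<in> carrier_mat n n" "X * minv X = 1\<^sub>m n" "minv X * X = 1\<^sub>m n"
proof -
  obtain B where B: "mat_inverse X = Some B"
    using mat_inverse(1)[OF assms(1)] det_non_zero_imp_unit[OF assms] by fastforce
  then show "minv X \<in> carrier_mat n n" "X * minv X = 1\<^sub>m n" "minv X * X = 1\<^sub>m n"
    using mat_inverse(2)[OF assms(1) B] by (auto simp: minv_def)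
qed

text \<open>With y = X^{-1} x the form x . X^{-1} x equals y . X y; symmetry and positivity pass to
  the inverse through this substitution.\<close>

lemma pos_def_minv:
  assumes "pos_def X" "X \<in> carrier_mat n n"
  shows "minv X \<in> carrier_mat n n" "X * minv X = 1\<^sub>m n" "minv X * X = 1\<^sub>m n" "pos_def (minv X)"
proof -
  note inv = minv_inverse[OF assms(2) pos_def_det[OF assms]]
  note S = pos_def_sym[OF assms]
  show C: "minv X \<in> carrier_mat n n" "X * minv X = 1\<^sub>m n" "minv X * X = 1\<^sub>m n" by (fact inv)+
  have XM: "X *\<^sub>v (minv X *\<^sub>v x) = x" if "x \<in> carrier_vec n" for x
    using assoc_mult_mat_vec[OF assms(2) C(1) that] C(2) that by simp
  show "pos_def (minv X)"
  proof (rule pos_defI[where n = n])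
    show "sym_mat n (minv X)"
    proof (rule sym_mat_by_scalar_prod[OF C(1)])
      fix x y :: "real vec" assume xy: "x \<in> carrier_vec n" "y \<in> carrier_vec n"
      have "(minv X *\<^sub>v x) \<bullet> (X *\<^sub>v (minv X *\<^sub>v y)) = (X *\<^sub>v (minv X *\<^sub>v x)) \<bullet> (minv X *\<^sub>v y)"
        by (subst sym_mat_scalar_prod[OF S]) (use C xy in auto)
      then show "(minv X *\<^sub>v x) \<bullet> y = x \<bullet> (minv X *\<^sub>v y)" using XM xy by simp
    qed
    fix x :: "real vec" assume x: "x \<in> carrier_vec n" "x \<noteq> 0\<^sub>v n"
    let ?y = "minv X *\<^sub>v x"
    have y: "?y \<in> carrier_vec n" using C x by simp
    have "?y \<noteq> 0\<^sub>v n"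
    proof
      assume "?y = 0\<^sub>v n"
      then have "x = X *\<^sub>v 0\<^sub>v n" using XM[OF x(1)] by simp
      then show False using x assms(2) by auto
    qed
    then have "0 < ?y \<bullet> (X *\<^sub>v ?y)" using pos_def_pos[OF assms y] by simp
    also have "\<dots> = x \<bullet> ?y" using XM[OF x(1)] comm_scalar_prod[OF y x(1)] by simp
    finally show "0 < x \<bullet> (minv X *\<^sub>v x)" .
  qed
qed

section \<open>Eigenvectors and the positive definite square root\<close>

text \<open>A complex eigenvector z exists because the spectrum is nonempty. Its eigenvalue is real:
  conj(z)^T X z is its own conjugate by symmetry and equals the eigenvalue times |z|^2 > 0. Re z and
  Im z then satisfy the same equation, and one of them is nonzero.\<close>

lemma symmetric_eigenvector:
  assumes X: "sym_mat n X" and n: "0 < n"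
  shows "\<exists>v l. v \<in> carrier_vec n \<and> v \<noteq> 0\<^sub>v n \<and> X *\<^sub>v v = l \<cdot>\<^sub>v v"
proof -
  have XC: "X \<in> carrier_mat n n" using X by (simp add: sym_mat_def)
  have Xsym: "X $$ (i, j) = X $$ (j, i)" if "i < n" "j < n" for i j
    using sym_mat_index[OF X that] .
  let ?Z = "map_mat complex_of_real X"
  have ZC: "?Z \<in> carrier_mat n n" using XC by simp
  obtain m where "m \<in> spectrum ?Z" using spectrum_non_empty[OF ZC n] by auto
  then obtain z where z: "z \<in> carrier_vec n" "z \<noteq> 0\<^sub>v n" "?Z *\<^sub>v z = m \<cdot>\<^sub>v z"
    using ZC unfolding spectrum_def eigenvalue_def eigenvector_def by auto
  have eq: "(\<Sum>j\<in>{0..<n}. of_real (X $$ (i, j)) * z $ j) = m * z $ i" if "i < n" for i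
  proof -
    have "(\<Sum>j\<in>{0..<n}. of_real (X $$ (i, j)) * z $ j) = (?Z *\<^sub>v z) $ i"
      using that z(1) XC by (simp add: scalar_prod_def)
    also have "\<dots> = m * z $ i" unfolding z(3) using that z(1) by simp
    finally show ?thesis .
  qed
  define T where "T = (\<Sum>i\<in>{0..<n}. \<Sum>j\<in>{0..<n}. cnj (z $ i) * of_real (X $$ (i, j)) * z $ j)"
  define N where "N = (\<Sum>i\<in>{0..<n}. (cmod (z $ i))\<^sup>2)"
  have "T = (\<Sum>i\<in>{0..<n}. cnj (z $ i) * (\<Sum>j\<in>{0..<n}. of_real (X $$ (i, j)) * z $ j))"
    unfolding T_def by (simp add: sum_distrib_left mult.assoc)
  also have "\<dots> = (\<Sum>i\<in>{0..<n}. cnj (z $ i) * (m * z $ i))"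
    by (rule sum.cong) (auto simp: eq)
  also have "\<dots> = m * of_real N"
    unfolding N_def of_real_sum sum_distrib_left
    by (rule sum.cong) (simp_all only: complex_norm_square mult_ac)
  finally have TN: "T = m * of_real N" .
  have "cnj T = (\<Sum>i\<in>{0..<n}. \<Sum>j\<in>{0..<n}. z $ i * of_real (X $$ (i, j)) * cnj (z $ j))"
    unfolding T_def by simp
  also have "\<dots> = (\<Sum>j\<in>{0..<n}. \<Sum>i\<in>{0..<n}. z $ i * of_real (X $$ (i, j)) * cnj (z $ j))"
    by (rule sum.swap)
  also have "\<dots> = T"
    unfolding T_def by (intro sum.cong refl) (simp add: Xsym mult_ac)
  finally have "cnj T = T" .
  have Npos: "N > 0"
  proof -
    obtain i where "i < n" "z $ i \<noteq> 0"
      using z(1,2) by (metis carrier_vecD eq_vecI index_zero_vec)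
    then have "0 < (cmod (z $ i))\<^sup>2" by simp
    also have "\<dots> \<le> N" unfolding N_def
      by (rule member_le_sum) (use \<open>i < n\<close> in auto)
    finally show ?thesis .
  qed
  have "Im m = 0"
    using \<open>cnj T = T\<close> TN Npos by (auto simp: complex_eq_iff)
  then obtain l where l: "m = of_real l" by (metis complex_is_Real_iff Reals_cases)
  have re: "X *\<^sub>v map_vec Re z = l \<cdot>\<^sub>v map_vec Re z"
  proof (rule eq_vecI)
    fix i assume "i < dim_vec (l \<cdot>\<^sub>v map_vec Re z)"
    then have i: "i < n" using z by simp
    have "Re (\<Sum>j\<in>{0..<n}. of_real (X $$ (i, j)) * z $ j) = Re (m * z $ i)" by (simp only: eq[OF i])
    then show "(X *\<^sub>v map_vec Re z) $ i = (l \<cdot>\<^sub>v map_vec Re z) $ i"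
      using i z XC by (simp add: scalar_prod_def l)
  qed (use XC z in auto)
  have im: "X *\<^sub>v map_vec Im z = l \<cdot>\<^sub>v map_vec Im z"
  proof (rule eq_vecI)
    fix i assume "i < dim_vec (l \<cdot>\<^sub>v map_vec Im z)"
    then have i: "i < n" using z by simp
    have "Im (\<Sum>j\<in>{0..<n}. of_real (X $$ (i, j)) * z $ j) = Im (m * z $ i)" by (simp only: eq[OF i])
    then show "(X *\<^sub>v map_vec Im z) $ i = (l \<cdot>\<^sub>v map_vec Im z) $ i"
      using i z XC by (simp add: scalar_prod_def l)
  qed (use XC z in auto)
  have "map_vec Re z \<noteq> 0\<^sub>v n \<or> map_vec Im z \<noteq> 0\<^sub>v n"
  proof (rule ccontr)
    assume a: "\<not> ?thesis"
    have "z = 0\<^sub>v n"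
    proof (rule eq_vecI)
      fix i assume "i < dim_vec (0\<^sub>v n :: complex vec)"
      then have "map_vec Re z $ i = 0" "map_vec Im z $ i = 0" "i < n" using a by simp_all
      then show "z $ i = 0\<^sub>v n $ i" using z by (simp add: complex_eq_iff)
    qed (use z in simp)
    then show False using z by simp
  qed
  moreover have "map_vec Re z \<in> carrier_vec n" "map_vec Im z \<in> carrier_vec n"
    using z(1) by simp_all
  ultimately show ?thesis using re im by blast
qed

text \<open>The Householder reflection that exchanges the first unit vector with the unit vector \<open>v\<close>.\<close>

lemma reflection_exists:
  fixes v :: "real vec"
  assumes v: "v \<in> carrier_vec n" and unit: "v \<bullet> v = 1" and n: "0 < n"
  shows "\<exists>H. sym_mat n H \<and> H * H = 1\<^sub>m n \<and> H *\<^sub>v unit_vec n 0 = v"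
proof (cases "v = unit_vec n 0")
  case True
  then show ?thesis by (intro exI[of _ "1\<^sub>m n"]) (auto simp: sym_mat_def)
next
  case False
  define e where "e = (unit_vec n 0 :: real vec)"
  have e: "e \<in> carrier_vec n" by (simp add: e_def)
  define u where "u = v - e"
  have u: "u \<in> carrier_vec n" using v e by (simp add: u_def)
  have "u \<noteq> 0\<^sub>v n"
  proof
    assume "u = 0\<^sub>v n"
    have "v = e"
    proof (rule eq_vecI)
      fix i assume i: "i < dim_vec e"
      then have "u $ i = 0" using \<open>u = 0\<^sub>v n\<close> e by simp
      then show "v $ i = e $ i" using i e v by (simp add: u_def)
    qed (use v e in auto)
    then show False using False by (simp add: e_def)
  qed
  then have uu: "0 < u \<bullet> u" by (rule scalar_prod_self_pos[OF u])
  define c where "c = 2 / (u \<bullet> u)"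
  define H where "H = mat n n (\<lambda>(i, j). (if i = j then 1 else 0) - c * (u $ i * u $ j))"
  have HC: "H \<in> carrier_mat n n" by (simp add: H_def)
  have Hx: "H *\<^sub>v x = x - (c * (u \<bullet> x)) \<cdot>\<^sub>v u" if x: "x \<in> carrier_vec n" for x
  proof (rule eq_vecI)
    fix i assume "i < dim_vec (x - (c * (u \<bullet> x)) \<cdot>\<^sub>v u)"
    then have i: "i < n" using u by simp
    have "(H *\<^sub>v x) $ i = (\<Sum>j\<in>{0..<n}. ((if i = j then 1 else 0) - c * (u $ i * u $ j)) * x $ j)"
      using i x HC by (simp add: scalar_prod_def H_def)
    also have "\<dots> = (\<Sum>j\<in>{0..<n}. (if i = j then x $ j else 0)) - (\<Sum>j\<in>{0..<n}. c * u $ i * (u $ j * x $ j))"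
      unfolding sum_subtractf[symmetric] by (rule sum.cong) (auto simp: algebra_simps)
    also have "\<dots> = x $ i - c * u $ i * (u \<bullet> x)"
      using i x by (simp add: scalar_prod_def sum_distrib_left)
    finally show "(H *\<^sub>v x) $ i = (x - (c * (u \<bullet> x)) \<cdot>\<^sub>v u) $ i"
      using i u x by simp
  qed (use u HC in auto)
  have "H * H = 1\<^sub>m n"
  proof (rule eq_mat_by_mult_vec)
    fix x :: "real vec" assume x: "x \<in> carrier_vec n"
    let ?y = "x - (c * (u \<bullet> x)) \<cdot>\<^sub>v u"
    have y: "?y \<in> carrier_vec n" using x u by simp
    have "u \<bullet> ?y = u \<bullet> x - c * (u \<bullet> x) * (u \<bullet> u)"
      by (subst scalar_prod_minus_distrib[OF u x]) (use u in simp_all)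
    also have "\<dots> = - (u \<bullet> x)" using uu by (simp add: c_def)
    finally have uy: "u \<bullet> ?y = - (u \<bullet> x)" .
    have "(H * H) *\<^sub>v x = H *\<^sub>v ?y" using HC x Hx[OF x] by simp
    also have "\<dots> = ?y - (c * (- (u \<bullet> x))) \<cdot>\<^sub>v u" by (subst Hx[OF y]) (simp only: uy)
    also have "\<dots> = 1\<^sub>m n *\<^sub>v x" using x u by auto
    finally show "(H * H) *\<^sub>v x = 1\<^sub>m n *\<^sub>v x" .
  qed (use HC in auto)
  moreover have "sym_mat n H"
    by (rule sym_matI[OF HC]) (auto simp: H_def mult_ac)
  moreover have "H *\<^sub>v e = v"
  proof -
    have ee: "e \<bullet> e = 1" using n by (simp add: e_def)
    have ue: "u \<bullet> e = v \<bullet> e - 1"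
      unfolding u_def by (subst minus_scalar_prod_distrib[OF v e e]) (simp add: ee)
    have "u \<bullet> u = u \<bullet> v - u \<bullet> e"
      by (subst (2) u_def) (rule scalar_prod_minus_distrib[OF u v e])
    also have "u \<bullet> v = 1 - e \<bullet> v"
      unfolding u_def by (subst minus_scalar_prod_distrib[OF v e v]) (simp add: unit)
    finally have "u \<bullet> u = 2 - 2 * (v \<bullet> e)" using ue comm_scalar_prod[OF e v] by simp
    \<comment> \<open>Both vectors have norm one, so u . u = 2 - 2 v . e = -2 u . e, and the
      reflection moves e by exactly u.\<close>
    then have "c * (u \<bullet> e) = - 1" using uu ue by (simp add: c_def field_simps)
    then have "H *\<^sub>v e = e + u" using Hx[OF e] e u by auto
    then show ?thesis using e v by (auto simp: u_def)
  qed
  ultimately show ?thesis unfolding e_def by blast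
qed


text \<open>Deflation by induction on the dimension. A reflection H taking the first unit vector to
  a unit eigenvector turns X into H X H = diag(l, C) with C positive definite of size n; a root Y of
  C gives the root H diag(sqrt l, Y) H of X.\<close>

lemma pos_def_sqrt_exists:
  assumes "pos_def X" "X \<in> carrier_mat n n"
  shows "\<exists>Y. pos_def Y \<and> Y \<in> carrier_mat n n \<and> Y * Y = X"
  using assms
proof (induction n arbitrary: X)
  case 0
  then show ?case by (intro exI[of _ X]) auto
next
  case (Suc n)
  let ?N = "Suc n"
  note X = Suc.prems(2)
  have XS: "sym_mat ?N X" using Suc.prems by (rule pos_def_sym)
  obtain v0 l where v0: "v0 \<in> carrier_vec ?N" "v0 \<noteq> 0\<^sub>v ?N" "X *\<^sub>v v0 = l \<cdot>\<^sub>v v0"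
    using symmetric_eigenvector[OF XS] by auto
  have pos: "0 < v0 \<bullet> v0" by (rule scalar_prod_self_pos[OF v0(1,2)])
  have "0 < v0 \<bullet> (X *\<^sub>v v0)" by (rule pos_def_pos[OF Suc.prems v0(1,2)])
  then have l: "0 < l" using pos v0 by (simp add: zero_less_mult_iff)
  define v where "v = (1 / sqrt (v0 \<bullet> v0)) \<cdot>\<^sub>v v0"
  have v: "v \<in> carrier_vec ?N" using v0 by (simp add: v_def)
  have "v \<bullet> v = 1" using v0 pos by (simp add: v_def)
  moreover have Xv: "X *\<^sub>v v = l \<cdot>\<^sub>v v"
    unfolding v_def using v0 X by (subst mult_mat_vec[of _ ?N ?N]) (auto simp: mult.commute)
  ultimately obtain H where H: "sym_mat ?N H" "H * H = 1\<^sub>m ?N" "H *\<^sub>v unit_vec ?N 0 = v"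
    using reflection_exists[OF v] by auto
  have HC: "H \<in> carrier_mat ?N ?N" using H(1) by (rule sym_mat_carrier)
  have HH: "H *\<^sub>v (H *\<^sub>v x) = x" if "x \<in> carrier_vec ?N" for x
    using assoc_mult_mat_vec[OF HC HC that] H(2) that by simp
  define B where "B = H * X * H"
  have BC: "B \<in> carrier_mat ?N ?N" using HC X by (simp add: B_def)
  have Bx: "B *\<^sub>v x = H *\<^sub>v (X *\<^sub>v (H *\<^sub>v x))" if "x \<in> carrier_vec ?N" for x
    unfolding B_def using HC X that
    by (subst assoc_mult_mat_vec[of _ ?N ?N _ ?N]; simp)
  have BS: "sym_mat ?N B"
  proof (rule sym_mat_by_scalar_prod[OF BC])
    fix x y :: "real vec" assume xy: "x \<in> carrier_vec ?N" "y \<in> carrier_vec ?N"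
    show "(B *\<^sub>v x) \<bullet> y = x \<bullet> (B *\<^sub>v y)"
      unfolding Bx[OF xy(1)] Bx[OF xy(2)] using xy HC X
      by (simp add: sym_mat_scalar_prod[OF H(1)] sym_mat_scalar_prod[OF XS])
  qed
  have qB: "x \<bullet> (B *\<^sub>v x) = (H *\<^sub>v x) \<bullet> (X *\<^sub>v (H *\<^sub>v x))" if "x \<in> carrier_vec ?N" for x
    unfolding Bx[OF that] using that HC X by (simp add: sym_mat_scalar_prod[OF H(1)])
  have Be: "B *\<^sub>v unit_vec ?N 0 = l \<cdot>\<^sub>v unit_vec ?N 0"
  proof -
    have "B *\<^sub>v unit_vec ?N 0 = H *\<^sub>v (l \<cdot>\<^sub>v v)" by (simp add: Bx H(3) Xv)
    also have "\<dots> = l \<cdot>\<^sub>v (H *\<^sub>v v)" by (rule mult_mat_vec[OF HC v])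
    also have "H *\<^sub>v v = unit_vec ?N 0" using HH[of "unit_vec ?N 0"] H(3) by simp
    finally show ?thesis .
  qed
  define C where "C = mat n n (\<lambda>(i, j). B $$ (Suc i, Suc j))"
  have CC: "C \<in> carrier_mat n n" by (simp add: C_def)
  define L where "L = (\<lambda>c::real. c \<cdot>\<^sub>m 1\<^sub>m 1)"
  have LC: "L c \<in> carrier_mat 1 1" for c by (simp add: L_def)
  \<comment> \<open>The eigenvector equation gives the first column of B and symmetry the first row,
    so B splits into diagonal blocks.\<close>
  have B0: "B $$ (i, 0) = (if i = 0 then l else 0)" if "i < ?N" for i
  proof -
    have "B $$ (i, 0) = (B *\<^sub>v unit_vec ?N 0) $ i" using that BC by simp
    then show ?thesis unfolding Be using that by simp
  qed
  have B0': "B $$ (0, i) = (if i = 0 then l else 0)" if "i < ?N" for i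
    using B0[OF that] sym_mat_index[OF BS _ that, of 0] by simp
  have Bblock: "B = four_block_mat (L l) (0\<^sub>m 1 n) (0\<^sub>m n 1) C"
  proof (rule eq_matI)
    fix i j assume "i < dim_row (four_block_mat (L l) (0\<^sub>m 1 n) (0\<^sub>m n 1) C)"
      "j < dim_col (four_block_mat (L l) (0\<^sub>m 1 n) (0\<^sub>m n 1) C)"
    then have ij: "i < ?N" "j < ?N" using CC LC[of l] by auto
    show "B $$ (i, j) = four_block_mat (L l) (0\<^sub>m 1 n) (0\<^sub>m n 1) C $$ (i, j)"
      using ij B0[of i] B0'[of j] CC by (cases i; cases j) (auto simp: L_def C_def)
  qed (use BC CC LC[of l] in auto)
  have CS: "sym_mat n C"
  proof (rule sym_matI[OF CC])
    fix i j assume "i < n" "j < n"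
    then show "C $$ (i, j) = C $$ (j, i)"
      using sym_mat_index[OF BS, of "Suc i" "Suc j"] by (simp add: C_def)
  qed
  \<comment> \<open>The form of diag(c, D) separates; this serves C inside B and, at the end, the
    assembled root.\<close>
  have qF: "(a @\<^sub>v x) \<bullet> (four_block_mat (L c) (0\<^sub>m 1 n) (0\<^sub>m n 1) D *\<^sub>v (a @\<^sub>v x))
      = c * (a \<bullet> a) + x \<bullet> (D *\<^sub>v x)"
    if "a \<in> carrier_vec 1" "x \<in> carrier_vec n" "D \<in> carrier_mat n n" for a x D c
  proof -
    have "L c *\<^sub>v a = c \<cdot>\<^sub>v a"
      unfolding L_def using that by (intro eq_vecI) (auto simp: scalar_prod_def)
    then show ?thesis
      using that LC[of c] by (subst mult_mat_vec_split) (auto simp: scalar_prod_append[of _ 1 _ n])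
  qed
  have "pos_def C"
  proof (rule pos_defI[OF CS])
    fix x :: "real vec" assume x: "x \<in> carrier_vec n" "x \<noteq> 0\<^sub>v n"
    let ?z = "0\<^sub>v 1 @\<^sub>v x"
    have z: "?z \<in> carrier_vec ?N" using x append_carrier_vec[of "0\<^sub>v 1" 1 x n] by simp
    have "H *\<^sub>v ?z \<noteq> 0\<^sub>v ?N"
    proof
      assume "H *\<^sub>v ?z = 0\<^sub>v ?N"
      then have "?z = 0\<^sub>v 1 @\<^sub>v 0\<^sub>v n"
        using HH[OF z] mult_mat_zero_vec[OF HC] by (simp add: zero_vec_append)
      then show False using x(2) append_vec_eq[of "0\<^sub>v 1" 1 "0\<^sub>v 1" x "0\<^sub>v n"] by simp
    qed
    then have "0 < ?z \<bullet> (B *\<^sub>v ?z)"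
      unfolding qB[OF z] using pos_def_pos[OF Suc.prems] z HC by simp
    then show "0 < x \<bullet> (C *\<^sub>v x)"
      unfolding Bblock using qF[of "0\<^sub>v 1" x C l] x CC by simp
  qed
  then obtain Y where Y: "pos_def Y" "Y \<in> carrier_mat n n" "Y * Y = C"
    using Suc.IH CC by blast
  define D where "D = four_block_mat (L (sqrt l)) (0\<^sub>m 1 n) (0\<^sub>m n 1) Y"
  have DC: "D \<in> carrier_mat ?N ?N"
    using four_block_carrier_mat[OF LC[of "sqrt l"] Y(2)] by (simp add: D_def)
  have YS: "sym_mat n Y" using Y by (simp add: pos_def_sym)
  have DS: "sym_mat ?N D"
    unfolding sym_mat_def
  proof
    show "D\<^sup>T = D" unfolding D_def
      using YS LC by (subst transpose_four_block_mat[of _ 1 1 _ n _ n]) (auto simp: sym_mat_def L_def)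
  qed (fact DC)
  have DD: "D * D = B"
    unfolding Bblock D_def using Y LC l
    by (subst mult_four_block_mat[of _ 1 1 _ n _ n _ _ 1 _ n])
      (auto simp: L_def left_mult_zero_mat[of _ n n] right_mult_zero_mat[of _ n n])
  define Z where "Z = H * D * H"
  have ZC: "Z \<in> carrier_mat ?N ?N" using HC DC by (simp add: Z_def)
  have Zx: "Z *\<^sub>v x = H *\<^sub>v (D *\<^sub>v (H *\<^sub>v x))" if "x \<in> carrier_vec ?N" for x
    unfolding Z_def using HC DC that by (subst assoc_mult_mat_vec[of _ ?N ?N _ ?N]; simp)
  have "Z * Z = X"
  proof (rule eq_mat_by_mult_vec)
    fix x :: "real vec" assume x: "x \<in> carrier_vec ?N"
    have Hx: "H *\<^sub>v x \<in> carrier_vec ?N" using HC x by simp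
    have "(Z * Z) *\<^sub>v x = Z *\<^sub>v (Z *\<^sub>v x)" using ZC x by simp
    also have "\<dots> = H *\<^sub>v (D *\<^sub>v (H *\<^sub>v (H *\<^sub>v (D *\<^sub>v (H *\<^sub>v x)))))"
      using x HC DC ZC by (simp add: Zx)
    also have "\<dots> = H *\<^sub>v (D *\<^sub>v (D *\<^sub>v (H *\<^sub>v x)))"
      using Hx DC by (subst HH) auto
    also have "D *\<^sub>v (D *\<^sub>v (H *\<^sub>v x)) = B *\<^sub>v (H *\<^sub>v x)"
      using Hx DC DD by (metis assoc_mult_mat_vec)
    also have "\<dots> = H *\<^sub>v (X *\<^sub>v x)" unfolding Bx[OF Hx] using HH[OF x] by simp
    also have "H *\<^sub>v \<dots> = X *\<^sub>v x" using x X by (subst HH) auto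
    finally show "(Z * Z) *\<^sub>v x = X *\<^sub>v x" .
  qed (use ZC X in auto)
  moreover have "pos_def Z"
  proof (rule pos_defI[where n = ?N])
    show "sym_mat ?N Z"
    proof (rule sym_mat_by_scalar_prod[OF ZC])
      fix x y :: "real vec" assume xy: "x \<in> carrier_vec ?N" "y \<in> carrier_vec ?N"
      show "(Z *\<^sub>v x) \<bullet> y = x \<bullet> (Z *\<^sub>v y)"
        unfolding Zx[OF xy(1)] Zx[OF xy(2)] using xy HC DC
        by (simp add: sym_mat_scalar_prod[OF H(1)] sym_mat_scalar_prod[OF DS])
    qed
    fix x :: "real vec" assume x: "x \<in> carrier_vec ?N" "x \<noteq> 0\<^sub>v ?N"
    have Hx: "H *\<^sub>v x \<in> carrier_vec (1 + n)" using HC x by simp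
    obtain a b where ab: "a \<in> carrier_vec 1" "b \<in> carrier_vec n" "H *\<^sub>v x = a @\<^sub>v b"
      using vec_first_last_append[OF Hx] vec_first_carrier vec_last_carrier by metis
    have "x \<bullet> (Z *\<^sub>v x) = (H *\<^sub>v x) \<bullet> (D *\<^sub>v (H *\<^sub>v x))"
      unfolding Zx[OF x(1)] using x HC DC by (simp add: sym_mat_scalar_prod[OF H(1)])
    also have "\<dots> = sqrt l * (a \<bullet> a) + b \<bullet> (Y *\<^sub>v b)"
      unfolding ab(3) D_def by (rule qF[OF ab(1,2) Y(2)])
    finally have eq: "x \<bullet> (Z *\<^sub>v x) = sqrt l * (a \<bullet> a) + b \<bullet> (Y *\<^sub>v b)" .
    show "0 < x \<bullet> (Z *\<^sub>v x)"
    proof (cases "b = 0\<^sub>v n")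
      case True
      have "a \<noteq> 0\<^sub>v 1"
      proof
        assume "a = 0\<^sub>v 1"
        then have "H *\<^sub>v x = 0\<^sub>v ?N" using ab(3) True by (simp add: zero_vec_append)
        then show False using x(2) HH[OF x(1)] mult_mat_zero_vec[OF HC] by simp
      qed
      then show ?thesis using eq True l Y scalar_prod_self_pos[OF ab(1)] by simp
    next
      case False
      then show ?thesis using eq l pos_def_pos[OF Y(1,2) ab(2)] by (simp add: add_nonneg_pos)
    qed
  qed
  ultimately show ?case using ZC by blast
qed

text \<open>Y^2 = Z^2 gives Y D + D Z = 0 for D = Y - Z, and positivity of both roots forces D = 0
  without any commutation of Y and Z.\<close>

lemma pos_def_sqrt_unique:
  assumes Y: "pos_def Y" "Y \<in> carrier_mat n n" and Z: "pos_def Z" "Z \<in> carrier_mat n n"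
    and eq: "Y * Y = Z * Z"
  shows "Y = Z"
proof -
  define D where "D = Y - Z"
  have D: "D \<in> carrier_mat n n" using Y Z by (auto simp: D_def minus_carrier_mat)
  have YS: "sym_mat n Y" and ZS: "sym_mat n Z" using Y Z by (simp_all add: pos_def_sym)
  have Dsym: "D $$ (i, j) = D $$ (j, i)" if "i < n" "j < n" for i j
    using sym_mat_index[OF YS that] sym_mat_index[OF ZS that] that Y Z by (simp add: D_def)
  have Zsym: "Z $$ (i, j) = Z $$ (j, i)" if "i < n" "j < n" for i j
    using sym_mat_index[OF ZS that] .
  have "Y * D + D * Z = 0\<^sub>m n n"
  proof -
    have "Y * D + D * Z = (Y * Y - Y * Z) + (Y * Z - Z * Z)"
      unfolding D_def using Y(2) Z(2) by (simp add: mult_minus_distrib_mat minus_mult_distrib_mat)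
    also have "\<dots> = 0\<^sub>m n n" unfolding eq using Y Z by (auto intro!: eq_matI)
    finally show ?thesis .
  qed
  then have zero: "(\<Sum>k\<in>{0..<n}. Y $$ (i, k) * D $$ (k, j)) + (\<Sum>k\<in>{0..<n}. D $$ (i, k) * Z $$ (k, j)) = 0"
    if "i < n" "j < n" for i j
  proof -
    have "(Y * D + D * Z) $$ (i, j) = 0" using \<open>Y * D + D * Z = 0\<^sub>m n n\<close> that by simp
    then show ?thesis using that Y(2) Z(2) D by (simp add: scalar_prod_def)
  qed
  have q: "col D j \<bullet> (X *\<^sub>v col D j) = (\<Sum>i\<in>{0..<n}. \<Sum>k\<in>{0..<n}. D $$ (i, j) * (X $$ (i, k) * D $$ (k, j)))"
    if "j < n" "X \<in> carrier_mat n n" for X j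
    using that D by (simp add: scalar_prod_def sum_distrib_left)
  \<comment> \<open>The trace of \<open>D (Y D + D Z)\<close> is a sum of two nonnegative terms.\<close>
  have "0 = (\<Sum>j\<in>{0..<n}. \<Sum>i\<in>{0..<n}. D $$ (i, j) *
      ((\<Sum>k\<in>{0..<n}. Y $$ (i, k) * D $$ (k, j)) + (\<Sum>k\<in>{0..<n}. D $$ (i, k) * Z $$ (k, j))))"
    using zero by simp
  also have "\<dots> = (\<Sum>j\<in>{0..<n}. col D j \<bullet> (Y *\<^sub>v col D j))
      + (\<Sum>j\<in>{0..<n}. \<Sum>i\<in>{0..<n}. \<Sum>k\<in>{0..<n}. D $$ (i, j) * (D $$ (i, k) * Z $$ (k, j)))"
    using q[OF _ Y(2)] by (simp add: distrib_left sum.distrib sum_distrib_left)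
  \<comment> \<open>Exchanging the indices and using the symmetry of D and Z turns the second triple
    sum into the forms of Z at the columns of D.\<close>
  also have "(\<Sum>j\<in>{0..<n}. \<Sum>i\<in>{0..<n}. \<Sum>k\<in>{0..<n}. D $$ (i, j) * (D $$ (i, k) * Z $$ (k, j)))
      = (\<Sum>i\<in>{0..<n}. \<Sum>j\<in>{0..<n}. \<Sum>k\<in>{0..<n}. D $$ (i, j) * (D $$ (i, k) * Z $$ (k, j)))"
    by (rule sum.swap)
  also have "\<dots> = (\<Sum>i\<in>{0..<n}. \<Sum>j\<in>{0..<n}. \<Sum>k\<in>{0..<n}. D $$ (j, i) * (Z $$ (j, k) * D $$ (k, i)))"
    by (intro sum.cong refl) (simp add: Dsym Zsym mult_ac)
  also have "\<dots> = (\<Sum>j\<in>{0..<n}. col D j \<bullet> (Z *\<^sub>v col D j))"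
    using q[OF _ Z(2)] by simp
  finally have sum0: "(\<Sum>j\<in>{0..<n}. col D j \<bullet> (Y *\<^sub>v col D j)) + (\<Sum>j\<in>{0..<n}. col D j \<bullet> (Z *\<^sub>v col D j)) = 0"
    by simp
  have nn: "0 \<le> col D j \<bullet> (Y *\<^sub>v col D j)" "0 \<le> col D j \<bullet> (Z *\<^sub>v col D j)" if "j < n" for j
    using that D Y Z by (auto intro!: pos_def_nonneg)
  have "(\<Sum>j\<in>{0..<n}. col D j \<bullet> (Y *\<^sub>v col D j)) = 0"
    using sum0 nn by (smt (verit) atLeastLessThan_iff sum_nonneg)
  then have col0: "col D j \<bullet> (Y *\<^sub>v col D j) = 0" if "j < n" for j
    using nn that by (subst (asm) sum_nonneg_eq_0_iff) auto
  show "Y = Z"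
  proof (rule eq_matI)
    fix i j assume ij: "i < dim_row Z" "j < dim_col Z"
    then have "i < n" "j < n" using Z by auto
    then have "col D j = 0\<^sub>v n"
      using col0[of j] pos_def_pos[OF Y, of "col D j"] D by (metis col_carrier_vec less_irrefl)
    then have "D $$ (i, j) = 0" using \<open>i < n\<close> \<open>j < n\<close> D by (metis carrier_matD index_col index_zero_vec(1))
    then show "Y $$ (i, j) = Z $$ (i, j)" using ij by (simp add: D_def)
  qed (use Y Z in auto)
qed

text \<open>The description operator in \<open>msqrt\<close> is resolved by existence and
  uniqueness. Its predicate fixes no dimension, but Z Z = X fixes the number of rows of Z, and
  positive definite matrices are square.\<close>

lemma msqrt_pos_def:
  assumes X: "pos_def X" "X \<in> carrier_mat n n"
  shows "msqrt X \<in> carrier_mat n n" "pos_def (msqrt X)" "msqrt X * msqrt X = X"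
proof -
  obtain Y where Y: "pos_def Y" "Y \<in> carrier_mat n n" "Y * Y = X"
    using pos_def_sqrt_exists[OF X] by auto
  have "msqrt X = Y"
    unfolding msqrt_def
  proof (rule the_equality)
    fix Z assume Z: "pos_def Z \<and> Z * Z = X"
    have "dim_row Z = n" using Z X(2) by (metis carrier_matD(1) index_mult_mat(2))
    then have "Z \<in> carrier_mat n n" using Z pos_def_square by blast
    then show "Z = Y" using pos_def_sqrt_unique Y Z by auto
  qed (use Y in simp)
  then show "msqrt X \<in> carrier_mat n n" "pos_def (msqrt X)" "msqrt X * msqrt X = X"
    using Y by simp_all
qed

text \<open>The inverse of the root is positive definite and squares to X^{-1}, so uniqueness
  identifies it with the root of X^{-1}.\<close>

lemma msqrt_minv:
  assumes X: "pos_def X" "X \<in> carrier_mat n n"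
  shows "msqrt (minv X) = minv (msqrt X)"
proof -
  note S = msqrt_pos_def[OF X]
  note I = pos_def_minv[OF X]
  note R = msqrt_pos_def[OF I(4,1)]
  note SI = pos_def_minv[OF S(2,1)]
  let ?S = "msqrt X" and ?T = "minv (msqrt X)"
  have "?T * ?T = ?T * ?T * (X * minv X)" using SI(1) I(2) by simp
  also have "\<dots> = ?T * ?T * (?S * ?S * minv X)" by (simp only: S(3))
  also have "\<dots> = ?T * (?T * ?S) * (?S * minv X)" using SI(1) S(1) I(1)
    by (simp add: assoc_mult_mat[of _ n n _ n _ n])
  also have "\<dots> = (?T * ?S) * minv X" using SI(1) S(1) I(1) 
    by (simp add: SI(3) assoc_mult_mat[symmetric, of _ n n _ n _ n] del: assoc_mult_mat)
  also have "\<dots> = minv X" using I(1) SI(3) by simp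
  finally have "msqrt (minv X) * msqrt (minv X) = ?T * ?T" using R(3) by simp
  then show ?thesis by (rule pos_def_sqrt_unique[OF R(2,1) SI(4,1)])
qed

section \<open>Block matrices\<close>

text \<open>Cauchy-Schwarz row by row; the constant is the squared Frobenius norm.\<close>

lemma norm_mult_mat_vec_bound:
  assumes A: "A \<in> carrier_mat nr nc"
  shows "\<exists>C\<ge>0. \<forall>x\<in>carrier_vec nc. (A *\<^sub>v x) \<bullet> (A *\<^sub>v x) \<le> C * (x \<bullet> (x :: real vec))"
proof (intro exI conjI ballI)
  show "0 \<le> (\<Sum>i\<in>{0..<nr}. row A i \<bullet> row A i)" by (rule sum_nonneg) simp
  fix x :: "real vec" assume x: "x \<in> carrier_vec nc"
  have "(A *\<^sub>v x) \<bullet> (A *\<^sub>v x) = (\<Sum>i\<in>{0..<nr}. (row A i \<bullet> x)\<^sup>2)"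
    using A by (simp add: scalar_prod_def[of "A *\<^sub>v x"] power2_eq_square)
  also have "\<dots> \<le> (\<Sum>i\<in>{0..<nr}. (row A i \<bullet> row A i) * (x \<bullet> x))"
  proof (rule sum_mono)
    fix i assume i: "i \<in> {0..<nr}"
    show "(row A i \<bullet> x)\<^sup>2 \<le> (row A i \<bullet> row A i) * (x \<bullet> x)"
      using Cauchy_Schwarz_ineq_sum[of "\<lambda>j. row A i $ j" "\<lambda>j. x $ j" "{0..<nc}"] x A i
      by (simp add: scalar_prod_def power2_eq_square)
  qed
  finally show "(A *\<^sub>v x) \<bullet> (A *\<^sub>v x) \<le> (\<Sum>i\<in>{0..<nr}. row A i \<bullet> row A i) * (x \<bullet> x)"
    by (simp add: sum_distrib_right)
qed

text \<open>With S = \<open>msqrt X\<close>, |x|^2 = |S^{-1} S x|^2 <= C |S x|^2 = C x . X x, so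
  neither compactness nor a smallest eigenvalue is involved. C + 1 keeps the reciprocal meaningful
  when C = 0.\<close>

lemma pos_def_coercive:
  assumes X: "pos_def X" "X \<in> carrier_mat n n"
  shows "\<exists>c>0. \<forall>x\<in>carrier_vec n. c * (x \<bullet> x) \<le> x \<bullet> (X *\<^sub>v x)"
proof -
  define S where "S = msqrt X"
  note S = msqrt_pos_def[OF X, folded S_def]
  note SI = pos_def_minv[OF S(2,1)]
  note SS = pos_def_sym[OF S(2,1)]
  obtain C where C: "0 \<le> C" "\<And>x. x \<in> carrier_vec n \<Longrightarrow> (minv S *\<^sub>v x) \<bullet> (minv S *\<^sub>v x) \<le> C * (x \<bullet> x)"
    using norm_mult_mat_vec_bound[OF SI(1)] by auto
  show ?thesis
  proof (intro exI conjI ballI)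
    show "0 < 1 / (C + 1)" using C by simp
    fix x :: "real vec" assume x: "x \<in> carrier_vec n"
    have "x = minv S *\<^sub>v (S *\<^sub>v x)"
      using assoc_mult_mat_vec[OF SI(1) S(1) x] SI(3) x by simp
    then have "x \<bullet> x \<le> C * ((S *\<^sub>v x) \<bullet> (S *\<^sub>v x))"
      using C(2)[of "S *\<^sub>v x"] S(1) x by simp
    also have "(S *\<^sub>v x) \<bullet> (S *\<^sub>v x) = x \<bullet> (X *\<^sub>v x)"
      using sym_mat_scalar_prod[OF SS x, of "S *\<^sub>v x"] assoc_mult_mat_vec[OF S(1) S(1) x] S(1,3) x by simp
    finally have "x \<bullet> x \<le> (C + 1) * (x \<bullet> (X *\<^sub>v x))"
      using pos_def_nonneg[OF X x] by (simp add: distrib_right)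
    then show "1 / (C + 1) * (x \<bullet> x) \<le> x \<bullet> (X *\<^sub>v x)"
      using C(1) by (simp add: field_simps)
  qed
qed

text \<open>Supplies the uniform margin of the strict main inequality, from which the decay rate is
  taken.\<close>

lemma neg_def_coercive:
  assumes "neg_def X" "X \<in> carrier_mat n n"
  shows "\<exists>c>0. \<forall>x\<in>carrier_vec n. x \<bullet> (X *\<^sub>v x) \<le> - c * (x \<bullet> x)"
proof -
  have q: "x \<bullet> ((- X) *\<^sub>v x) = - (x \<bullet> (X *\<^sub>v x))" if "x \<in> carrier_vec n" for x
    using that assms(2) by simp
  have "pos_def (- X)"
  proof (rule pos_defI[where n = n])
    show "sym_mat n (- X)"
      using assms unfolding neg_def_def sym_mat_def by (auto simp: transpose_uminus)
  qed (use assms q in \<open>auto simp: neg_def_def\<close>)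
  then obtain c where c: "0 < c" "\<forall>x\<in>carrier_vec n. c * (x \<bullet> x) \<le> x \<bullet> ((- X) *\<^sub>v x)"
    using pos_def_coercive[of "- X" n] assms(2) by auto
  then have "\<forall>x\<in>carrier_vec n. x \<bullet> (X *\<^sub>v x) \<le> - c * (x \<bullet> x)"
    using q by fastforce
  then show ?thesis using c(1) by blast
qed

text \<open>Each \<open>Sy\<close>-term of the inequality becomes twice the pairing of two linear
  images, which can then be computed separately.\<close>

lemma quad_form_Sy:
  assumes "A \<in> carrier_mat n k" "B \<in> carrier_mat k n" "x \<in> carrier_vec n"
  shows "x \<bullet> (Sy (A * B) *\<^sub>v x) = 2 * ((A\<^sup>T *\<^sub>v x) \<bullet> (B *\<^sub>v x))"
proof -
  have AB: "A * B \<in> carrier_mat n n" using assms by simp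
  have "x \<bullet> (Sy (A * B) *\<^sub>v x) = x \<bullet> ((A * B) *\<^sub>v x) + x \<bullet> ((A * B)\<^sup>T *\<^sub>v x)"
    unfolding Sy_def add_mult_distrib_mat_vec[OF AB iffD2[OF transpose_carrier_mat AB] assms(3)]
    by (rule scalar_prod_add_distrib[OF assms(3) mult_mat_vec_carrier[OF AB assms(3)]
          mult_mat_vec_carrier[OF iffD2[OF transpose_carrier_mat AB] assms(3)]])
  also have "x \<bullet> ((A * B)\<^sup>T *\<^sub>v x) = ((A * B)\<^sup>T *\<^sub>v x) \<bullet> x"
    by (rule comm_scalar_prod[OF assms(3)]) (rule mult_mat_vec_carrier[OF iffD2[OF transpose_carrier_mat AB] assms(3)])
  also have "\<dots> = x \<bullet> ((A * B) *\<^sub>v x)"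
    by (rule transpose_vec_mult_scalar[OF AB assms(3,3)])
  also have "x \<bullet> ((A * B) *\<^sub>v x) = (A\<^sup>T *\<^sub>v x) \<bullet> (B *\<^sub>v x)"
    using transpose_vec_mult_scalar[OF assms(1) _ assms(3), of "B *\<^sub>v x"] assms by simp
  finally show ?thesis by simp
qed

section \<open>Stacked vectors and concatenated matrices\<close>

lemma append_vec_assoc: "(a @\<^sub>v b) @\<^sub>v c = a @\<^sub>v (b @\<^sub>v (c :: 'a vec))"
  by (intro eq_vecI) auto

lemma append_vec_vNil_right: "v @\<^sub>v vNil = (v :: 'a vec)"
  by (intro eq_vecI) auto

lemma stack_vec_simps [simp]:
  "stack_vec [] = vNil" "stack_vec (v # vs) = v @\<^sub>v stack_vec vs"
  by (simp_all add: stack_vec_def)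

lemma stack_vec_append: "stack_vec (us @ vs) = stack_vec us @\<^sub>v stack_vec vs"
  by (induction us) (simp_all add: append_vec_assoc)

lemma dim_stack_vec [simp]: "dim_vec (stack_vec vs) = sum_list (map dim_vec vs)"
  by (induction vs) simp_all

lemma stack_vec_carrier:
  assumes "\<And>i. i \<in> set is \<Longrightarrow> v i \<in> carrier_vec (n i)"
  shows "stack_vec (map v is) \<in> carrier_vec (\<Sum>i\<leftarrow>is. n i)"
  using assms by (induction "is") auto

lemma scalar_prod_append': 
  "dim_vec a = dim_vec c \<Longrightarrow> dim_vec b = dim_vec d \<Longrightarrow> (a @\<^sub>v b) \<bullet> (c @\<^sub>v d) = a \<bullet> c + b \<bullet> (d :: real vec)"
  by (rule scalar_prod_append[of _ "dim_vec a" _ "dim_vec b"]) (auto intro: carrier_vecI)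

lemma scalar_prod_stack_vec:
  assumes "\<And>i. i \<in> set is \<Longrightarrow> dim_vec (u i) = dim_vec (v i)"
  shows "stack_vec (map u is) \<bullet> stack_vec (map v is) = (\<Sum>i\<leftarrow>is. u i \<bullet> v i)"
  using assms
proof (induction "is")
  case (Cons a "is")
  have "map (dim_vec \<circ> u) is = map (dim_vec \<circ> v) is" using Cons.prems by simp
  then have "dim_vec (stack_vec (map u is)) = dim_vec (stack_vec (map v is))"
    by (simp del: map_eq_conv)
  then show ?case using Cons by (simp add: scalar_prod_append' del: dim_stack_vec)
qed simp

lemma hcat_simps [simp]:
  "hcat nr [] = 0\<^sub>m nr 0"
  "hcat nr (A # As) = four_block_mat A (hcat nr As) (0\<^sub>m 0 (dim_col A)) (0\<^sub>m 0 (dim_col (hcat nr As)))"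
  by (simp_all add: hcat_def)

lemma hcat_carrier:
  assumes "\<And>A. A \<in> set As \<Longrightarrow> dim_row A = nr"
  shows "hcat nr As \<in> carrier_mat nr (\<Sum>A\<leftarrow>As. dim_col A)"
  using assms by (induction As) (auto intro!: carrier_matI)

lemma dim_col_hcat [simp]: "dim_col (hcat nr As) = (\<Sum>A\<leftarrow>As. dim_col A)"
  by (induction As) auto

lemma hcat_mult_vec:
  assumes "A \<in> carrier_mat nr n" "hcat nr As \<in> carrier_mat nr k" "v \<in> carrier_vec n" "u \<in> carrier_vec k"
  shows "hcat nr (A # As) *\<^sub>v (v @\<^sub>v u) = A *\<^sub>v v + hcat nr As *\<^sub>v u"
proof -
  have "hcat nr (A # As) *\<^sub>v (v @\<^sub>v u)
      = (A *\<^sub>v v + hcat nr As *\<^sub>v u) @\<^sub>v (0\<^sub>m 0 n *\<^sub>v v + 0\<^sub>m 0 k *\<^sub>v u)"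
    unfolding hcat_simps using assms by (subst four_block_mat_mult_vec[of _ nr n _ k _ 0]) auto
  also have "0\<^sub>m 0 n *\<^sub>v v + 0\<^sub>m 0 k *\<^sub>v u = (vNil :: real vec)" by auto
  finally show ?thesis by (simp only: append_vec_vNil_right)
qed

lemma hcat_Nil_mult_vec [simp]: "hcat nr [] *\<^sub>v vNil = 0\<^sub>v nr"
  by (intro eq_vecI) (auto simp: scalar_prod_def)

lemma mult_hcat:
  assumes "B \<in> carrier_mat m nr" "\<And>A. A \<in> set As \<Longrightarrow> dim_row A = nr"
  shows "B * hcat nr As = hcat m (map ((*) B) As)"
  using assms(2)
proof (induction As)
  case Nil
  then show ?case using assms(1) by auto
next
  case (Cons A As)
  have A: "A \<in> carrier_mat nr (dim_col A)" using Cons.prems by (auto intro: carrier_matI)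
  have H: "hcat nr As \<in> carrier_mat nr (dim_col (hcat nr As))"
    using hcat_carrier[of As nr] Cons.prems by simp
  \<comment> \<open>B is padded with empty blocks so that the product rule for four-block matrices
    fits the recursion of \<open>hcat\<close>.\<close>
  have B: "B = four_block_mat B (0\<^sub>m m 0) (0\<^sub>m 0 nr) (0\<^sub>m 0 0)"
    using assms(1) by (intro eq_matI) auto
  have "B * hcat nr (A # As) = four_block_mat B (0\<^sub>m m 0) (0\<^sub>m 0 nr) (0\<^sub>m 0 0) * hcat nr (A # As)"
    by (rule arg_cong[OF B, where f = "\<lambda>X. X * hcat nr (A # As)"])
  also have "\<dots> = hcat m (map ((*) B) (A # As))"
  proof -
    let ?H = "hcat nr As" and ?c = "dim_col A"
    have BA: "B * A \<in> carrier_mat m ?c" and BH: "B * ?H \<in> carrier_mat m (dim_col ?H)"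
      using mult_carrier_mat[OF assms(1) A] mult_carrier_mat[OF assms(1) H] by blast+
    have IH: "B * ?H = hcat m (map ((*) B) As)" using Cons by simp
    have "four_block_mat B (0\<^sub>m m 0) (0\<^sub>m 0 nr) (0\<^sub>m 0 0) * hcat nr (A # As)
      = four_block_mat (B * A + 0\<^sub>m m 0 * 0\<^sub>m 0 ?c) (B * ?H + 0\<^sub>m m 0 * 0\<^sub>m 0 (dim_col ?H))
        (0\<^sub>m 0 nr * A + 0\<^sub>m 0 0 * 0\<^sub>m 0 ?c) (0\<^sub>m 0 nr * ?H + 0\<^sub>m 0 0 * 0\<^sub>m 0 (dim_col ?H))"
      unfolding hcat_simps
      by (rule mult_four_block_mat[OF assms(1) zero_carrier_mat zero_carrier_mat zero_carrier_mat A H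
            zero_carrier_mat zero_carrier_mat])
    also have "B * A + 0\<^sub>m m 0 * 0\<^sub>m 0 ?c = B * A" using BA by simp
    also have "B * ?H + 0\<^sub>m m 0 * 0\<^sub>m 0 (dim_col ?H) = B * ?H"
      using BH by (simp del: dim_col_hcat)
    also have "0\<^sub>m 0 nr * A + 0\<^sub>m 0 0 * 0\<^sub>m 0 ?c = 0\<^sub>m 0 (dim_col (B * A))" by (intro eq_matI) auto
    also have "0\<^sub>m 0 nr * ?H + 0\<^sub>m 0 0 * 0\<^sub>m 0 (dim_col ?H) = 0\<^sub>m 0 (dim_col (B * ?H))"
      by (intro eq_matI) auto
    finally show ?thesis unfolding list.map hcat_simps IH .
  qed
  finally show ?case .
qed

lemma vcat_simps [simp]: "vcat nc [] = 0\<^sub>m 0 nc" "vcat nc (A # As) = A @\<^sub>r vcat nc As"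
  by (simp_all add: vcat_def)

lemma vcat_carrier:
  assumes "\<And>A. A \<in> set As \<Longrightarrow> dim_col A = nc"
  shows "vcat nc As \<in> carrier_mat (\<Sum>A\<leftarrow>As. dim_row A) nc"
  using assms by (induction As) auto

lemma dim_row_append_rows [simp]: "dim_row (A @\<^sub>r B) = dim_row A + dim_row B"
  by (simp add: append_rows_def)

lemma dim_col_append_rows [simp]: "dim_col (A @\<^sub>r B) = dim_col A"
  by (simp add: append_rows_def)

lemma transpose_append_rows_mult_vec:
  assumes "A \<in> carrier_mat n nc" "B \<in> carrier_mat k nc" "u \<in> carrier_vec n" "v \<in> carrier_vec k"
  shows "(A @\<^sub>r B)\<^sup>T *\<^sub>v (u @\<^sub>v v) = A\<^sup>T *\<^sub>v u + B\<^sup>T *\<^sub>v (v :: real vec)"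
proof -
  have "(A @\<^sub>r B)\<^sup>T *\<^sub>v (u @\<^sub>v v) = (A\<^sup>T *\<^sub>v u + B\<^sup>T *\<^sub>v v) @\<^sub>v (0\<^sub>m 0 n *\<^sub>v u + 0\<^sub>m 0 k *\<^sub>v v)"
    unfolding append_rows_def using assms
    by (subst transpose_four_block_mat[of _ n nc _ 0 _ k], simp_all)
      (subst four_block_mat_mult_vec[of _ nc n _ k _ 0], auto)
  also have "0\<^sub>m 0 n *\<^sub>v u + 0\<^sub>m 0 k *\<^sub>v v = (vNil :: real vec)" by auto
  finally show ?thesis by (simp only: append_vec_vNil_right)
qed

lemma transpose_vcat_Nil_mult_vec [simp]: "(vcat nc [])\<^sup>T *\<^sub>v vNil = 0\<^sub>v nc"
  by (intro eq_vecI) (auto simp: scalar_prod_def)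

lemma dim_row_diag_block_mat: "dim_row (diag_block_mat As) = (\<Sum>A\<leftarrow>As. dim_row A)"
  by (induction As) (auto simp: Let_def)

lemma dim_col_diag_block_mat: "dim_col (diag_block_mat As) = (\<Sum>A\<leftarrow>As. dim_col A)"
  by (induction As) (auto simp: Let_def)

lemma diag_block_mat_Cons_mult_vec:
  assumes "u \<in> carrier_vec (dim_col A)" "v \<in> carrier_vec (dim_col (diag_block_mat As))"
  shows "diag_block_mat (A # As) *\<^sub>v (u @\<^sub>v v) = A *\<^sub>v u @\<^sub>v diag_block_mat As *\<^sub>v (v :: real vec)"
  unfolding diag_block_mat.simps Let_def using assms
  by (subst four_block_mat_mult_vec[of _ "dim_row A" "dim_col A" _ "dim_col (diag_block_mat As)" _ "dim_row (diag_block_mat As)"])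
    auto

lemma diag_block_mat_mult_stack:
  assumes "\<And>i. i \<in> set is \<Longrightarrow> v i \<in> carrier_vec (dim_col (A i))"
  shows "diag_block_mat (map A is) *\<^sub>v stack_vec (map v is) = stack_vec (map (\<lambda>i. A i *\<^sub>v v i) is)"
  using assms
proof (induction "is")
  case (Cons a "is")
  have "map (dim_vec \<circ> v) is = map (dim_col \<circ> A) is" using Cons.prems by simp
  then have "stack_vec (map v is) \<in> carrier_vec (dim_col (diag_block_mat (map A is)))"
    by (intro carrier_vecI) (simp add: dim_col_diag_block_mat del: map_eq_conv)
  then show ?case using Cons
    unfolding list.map stack_vec_simps by (subst diag_block_mat_Cons_mult_vec) auto
qed (auto intro!: eq_vecI)

section \<open>Kronecker products\<close>

lemma dim_kron [simp]:
  "dim_row (A \<otimes>\<^sub>k B) = dim_row A * dim_row B" "dim_col (A \<otimes>\<^sub>k B) = dim_col A * dim_col B"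
  by (simp_all add: kron_def)

lemma kron_carrier [intro]:
  "A \<in> carrier_mat a b \<Longrightarrow> B \<in> carrier_mat c d \<Longrightarrow> A \<otimes>\<^sub>k B \<in> carrier_mat (a * c) (b * d)"
  by (auto simp: kron_def)

lemma kron_index:
  "i < dim_row A * dim_row B \<Longrightarrow> j < dim_col A * dim_col B \<Longrightarrow>
    (A \<otimes>\<^sub>k B) $$ (i, j) = A $$ (i div dim_row B, j div dim_col B) * B $$ (i mod dim_row B, j mod dim_col B)"
  by (simp add: kron_def)

lemma kron_zero: "0\<^sub>m a b \<otimes>\<^sub>k 1\<^sub>m n = 0\<^sub>m (a * n) (b * n)"
  by (rule eq_matI) (auto simp: kron_index less_mult_imp_div_less)

lemma kron_minus:
  assumes "dim_row A = dim_row B" "dim_col A = dim_col B"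
  shows "(A - B) \<otimes>\<^sub>k C = (A \<otimes>\<^sub>k C) - (B \<otimes>\<^sub>k C)"
  by (rule eq_matI) (use assms in \<open>auto simp: kron_index less_mult_imp_div_less left_diff_distrib\<close>)

lemma sub_mult_div_mod:
  assumes "a * n \<le> i" "0 < (n::nat)"
  shows "(i - a * n) div n = i div n - a" "(i - a * n) mod n = i mod n"
proof -
  obtain k where "i = a * n + k" using le_Suc_ex[OF assms(1)] by auto
  then show "(i - a * n) div n = i div n - a" "(i - a * n) mod n = i mod n" using assms(2) by simp_all
qed

text \<open>Block boundaries of the product are multiples of n, so passing to quotient and remainder
  by n commutes with the choice of the block.\<close>

lemma kron_four_block:
  assumes "A \<in> carrier_mat a c" "B \<in> carrier_mat a d" "C \<in> carrier_mat b c" "D \<in> carrier_mat b d" and n: "0 < n"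
  shows "four_block_mat A B C D \<otimes>\<^sub>k 1\<^sub>m n
    = four_block_mat (A \<otimes>\<^sub>k 1\<^sub>m n) (B \<otimes>\<^sub>k 1\<^sub>m n) (C \<otimes>\<^sub>k 1\<^sub>m n) (D \<otimes>\<^sub>k (1\<^sub>m n :: real mat))"
proof (rule eq_matI)
  fix i j
  assume "i < dim_row (four_block_mat (A \<otimes>\<^sub>k 1\<^sub>m n) (B \<otimes>\<^sub>k 1\<^sub>m n) (C \<otimes>\<^sub>k 1\<^sub>m n) (D \<otimes>\<^sub>k 1\<^sub>m n))"
    "j < dim_col (four_block_mat (A \<otimes>\<^sub>k 1\<^sub>m n) (B \<otimes>\<^sub>k 1\<^sub>m n) (C \<otimes>\<^sub>k 1\<^sub>m n) (D \<otimes>\<^sub>k 1\<^sub>m n))"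
  then have ij: "i < (a + b) * n" "j < (c + d) * n" using assms by (auto simp: distrib_right)
  then have ij': "i div n < a + b" "j div n < c + d" by (auto simp: less_mult_imp_div_less)
  have cond: "i < a * n \<longleftrightarrow> i div n < a" "j < c * n \<longleftrightarrow> j div n < c"
    using n by (auto simp: div_less_iff_less_mult)
  have i2: "i - a * n < b * n" "(i - a * n) div n = i div n - a" "(i - a * n) mod n = i mod n" if "\<not> i < a * n"
    using that ij(1) sub_mult_div_mod[of a n i] n by (simp_all add: distrib_right less_diff_conv2)
  have j2: "j - c * n < d * n" "(j - c * n) div n = j div n - c" "(j - c * n) mod n = j mod n" if "\<not> j < c * n"
    using that ij(2) sub_mult_div_mod[of c n j] n by (simp_all add: distrib_right less_diff_conv2)
  define \<delta> where "\<delta> = (1\<^sub>m n :: real mat) $$ (i mod n, j mod n)"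
  have L: "(four_block_mat A B C D \<otimes>\<^sub>k 1\<^sub>m n) $$ (i, j) = four_block_mat A B C D $$ (i div n, j div n) * \<delta>"
    using assms ij by (subst kron_index) (auto simp: \<delta>_def)
  have K: "(X \<otimes>\<^sub>k 1\<^sub>m n) $$ (k, l) = X $$ (k div n, l div n) * (1\<^sub>m n :: real mat) $$ (k mod n, l mod n)"
    if "X \<in> carrier_mat r s" "k < r * n" "l < s * n" for X r s k l
    using that by (subst kron_index) auto
  have dims: "dim_row (A \<otimes>\<^sub>k 1\<^sub>m n) = a * n" "dim_col (A \<otimes>\<^sub>k 1\<^sub>m n) = c * n"
    "dim_row (D \<otimes>\<^sub>k 1\<^sub>m n) = b * n" "dim_col (D \<otimes>\<^sub>k 1\<^sub>m n) = d * n"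
    "dim_row A = a" "dim_col A = c" "dim_row D = b" "dim_col D = d"
    using assms by auto
  have R: "four_block_mat (A \<otimes>\<^sub>k 1\<^sub>m n) (B \<otimes>\<^sub>k 1\<^sub>m n) (C \<otimes>\<^sub>k 1\<^sub>m n) (D \<otimes>\<^sub>k 1\<^sub>m n) $$ (i, j)
    = (if i < a * n then if j < c * n then (A \<otimes>\<^sub>k 1\<^sub>m n) $$ (i, j) else (B \<otimes>\<^sub>k 1\<^sub>m n) $$ (i, j - c * n)
       else if j < c * n then (C \<otimes>\<^sub>k 1\<^sub>m n) $$ (i - a * n, j) else (D \<otimes>\<^sub>k 1\<^sub>m n) $$ (i - a * n, j - c * n))"
    using ij by (subst index_mat_four_block) (simp_all only: dims distrib_right)
  have S: "four_block_mat A B C D $$ (i div n, j div n)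
    = (if i < a * n then if j < c * n then A $$ (i div n, j div n) else B $$ (i div n, j div n - c)
       else if j < c * n then C $$ (i div n - a, j div n) else D $$ (i div n - a, j div n - c))"
    using ij' by (subst index_mat_four_block) (simp_all only: dims cond)
  show "(four_block_mat A B C D \<otimes>\<^sub>k 1\<^sub>m n) $$ (i, j)
    = four_block_mat (A \<otimes>\<^sub>k 1\<^sub>m n) (B \<otimes>\<^sub>k 1\<^sub>m n) (C \<otimes>\<^sub>k 1\<^sub>m n) (D \<otimes>\<^sub>k 1\<^sub>m n) $$ (i, j)"
    unfolding L R S \<delta>_def
    using K[OF assms(1), of i j] K[OF assms(2), of i "j - c * n"] K[OF assms(3), of "i - a * n" j]
      K[OF assms(4), of "i - a * n" "j - c * n"] i2 j2
    by presburger
qed (use assms in \<open>auto simp: distrib_right\<close>)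

lemma kron_hcat:
  assumes "\<And>A. A \<in> set As \<Longrightarrow> dim_row A = nr" and n: "0 < n"
  shows "hcat nr As \<otimes>\<^sub>k 1\<^sub>m n = hcat (nr * n) (map (\<lambda>A. A \<otimes>\<^sub>k 1\<^sub>m n) As)"
  using assms(1)
proof (induction As)
  case Nil
  then show ?case by (auto intro!: eq_matI)
next
  case (Cons A As)
  have A: "A \<in> carrier_mat nr (dim_col A)" using Cons.prems by (auto intro: carrier_matI)
  have H: "hcat nr As \<in> carrier_mat nr (dim_col (hcat nr As))"
    using hcat_carrier[of As nr] Cons.prems by simp
  have IH: "hcat nr As \<otimes>\<^sub>k 1\<^sub>m n = hcat (nr * n) (map (\<lambda>A. A \<otimes>\<^sub>k 1\<^sub>m n) As)" using Cons by simp
  have dc: "dim_col (hcat (nr * n) (map (\<lambda>A. A \<otimes>\<^sub>k 1\<^sub>m n) As)) = dim_col (hcat nr As) * n"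
    unfolding IH[symmetric] by simp
  show ?case unfolding list.map hcat_simps
    by (subst kron_four_block[where b = 0, OF A H _ _ n]) (simp_all add: kron_zero IH dc del: dim_col_hcat)
qed

lemma kron_diag_block:
  assumes n: "0 < n"
  shows "diag_block_mat As \<otimes>\<^sub>k 1\<^sub>m n = diag_block_mat (map (\<lambda>A. A \<otimes>\<^sub>k 1\<^sub>m n) As)"
proof (induction As)
  case Nil
  then show ?case by (auto intro!: eq_matI)
next
  case (Cons A As)
  show ?case unfolding list.map diag_block_mat.simps Let_def Cons.IH[symmetric]
    by (subst kron_four_block[OF _ _ _ _ n, of _ "dim_row A" "dim_col A" _ "dim_col (diag_block_mat As)" _ "dim_row (diag_block_mat As)"])
      (simp_all add: kron_zero)
qed

text \<open>Elements of \<open>\<real>\<^sup>k \<otimes> \<real>\<^sup>n\<close> in the index order of the Kronecker product.\<close>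

definition bvec :: "nat \<Rightarrow> nat \<Rightarrow> (nat \<Rightarrow> nat \<Rightarrow> real) \<Rightarrow> real vec" where
  "bvec k n u = vec (k * n) (\<lambda>p. u (p div n) (p mod n))"

lemma bvec_carrier [simp]: "bvec k n u \<in> carrier_vec (k * n)"
  by (simp add: bvec_def)

lemma dim_bvec [simp]: "dim_vec (bvec k n u) = k * n"
  by (simp add: bvec_def)

lemma bvec_cong:
  "(\<And>a j. a < k \<Longrightarrow> j < n \<Longrightarrow> u a j = v a j) \<Longrightarrow> bvec k n u = bvec k n v"
  unfolding bvec_def
proof (rule eq_vecI)
  assume eq: "\<And>a j. a < k \<Longrightarrow> j < n \<Longrightarrow> u a j = v a j"
  fix p assume "p < dim_vec (vec (k * n) (\<lambda>p. v (p div n) (p mod n)))"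
  then have p: "p < k * n" by simp
  then have "0 < n" by (cases n) auto
  then show "vec (k * n) (\<lambda>p. u (p div n) (p mod n)) $ p = vec (k * n) (\<lambda>p. v (p div n) (p mod n)) $ p"
    using p eq[of "p div n" "p mod n"] by (simp add: less_mult_imp_div_less)
qed simp

lemma sum_div_mod:
  fixes k n :: nat
  shows "(\<Sum>p\<in>{0..<k * n}. f (p div n) (p mod n)) = (\<Sum>a\<in>{0..<k}. \<Sum>j\<in>{0..<n}. (f a j :: 'a :: comm_monoid_add))"
proof (cases "n = 0")
  case False
  have "(\<Sum>p\<in>{0..<k * n}. f (p div n) (p mod n))
      = (\<Sum>a\<in>{0..<k}. \<Sum>p\<in>{a * n..<a * n + n}. f (p div n) (p mod n))"
    using sum.nat_group[of "\<lambda>p. f (p div n) (p mod n)" n k] by (simp add: atLeast0LessThan)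
  also have "\<dots> = (\<Sum>a\<in>{0..<k}. \<Sum>j\<in>{0..<n}. f a j)"
  proof (rule sum.cong[OF refl])
    fix a
    have "(\<Sum>p\<in>{a * n..<a * n + n}. f (p div n) (p mod n))
        = (\<Sum>j\<in>{0..<n}. f ((j + a * n) div n) ((j + a * n) mod n))"
      using sum.shift_bounds_nat_ivl[of "\<lambda>p. f (p div n) (p mod n)" 0 "a * n" n] by (simp add: add.commute)
    also have "\<dots> = (\<Sum>j\<in>{0..<n}. f a j)" by (rule sum.cong) auto
    finally show "(\<Sum>p\<in>{a * n..<a * n + n}. f (p div n) (p mod n)) = (\<Sum>j\<in>{0..<n}. f a j)" .
  qed
  finally show ?thesis .
qed simp

lemma scalar_prod_bvec:
  "bvec k n u \<bullet> bvec k n v = (\<Sum>a\<in>{0..<k}. \<Sum>j\<in>{0..<n}. u a j * v a j)"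
  unfolding sum_div_mod[symmetric] by (simp add: scalar_prod_def bvec_def)

text \<open>Splitting the summation index into quotient and remainder separates the two factors;
  this is the purpose of \<open>bvec\<close>.\<close>

lemma kron_mult_bvec:
  assumes "A \<in> carrier_mat r c" "B \<in> carrier_mat n' n"
  shows "(A \<otimes>\<^sub>k B) *\<^sub>v bvec c n u
    = bvec r n' (\<lambda>a j. \<Sum>b\<in>{0..<c}. \<Sum>l\<in>{0..<n}. A $$ (a, b) * B $$ (j, l) * u b l)"
proof (rule eq_vecI)
  fix p assume "p < dim_vec (bvec r n' (\<lambda>a j. \<Sum>b\<in>{0..<c}. \<Sum>l\<in>{0..<n}. A $$ (a, b) * B $$ (j, l) * u b l))"
  then have p: "p < r * n'" by simp
  have "((A \<otimes>\<^sub>k B) *\<^sub>v bvec c n u) $ p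
      = (\<Sum>t\<in>{0..<c * n}. A $$ (p div n', t div n) * B $$ (p mod n', t mod n) * u (t div n) (t mod n))"
    using assms p by (simp add: scalar_prod_def kron_index bvec_def)
  then show "((A \<otimes>\<^sub>k B) *\<^sub>v bvec c n u) $ p
    = bvec r n' (\<lambda>a j. \<Sum>b\<in>{0..<c}. \<Sum>l\<in>{0..<n}. A $$ (a, b) * B $$ (j, l) * u b l) $ p"
    using p by (simp add: bvec_def sum_div_mod[where f = "\<lambda>b l. A $$ (p div n', b) * B $$ (p mod n', l) * u b l"])
qed (use assms in simp)

lemma kron_one_mult_bvec:
  assumes "A \<in> carrier_mat r c"
  shows "(A \<otimes>\<^sub>k 1\<^sub>m n) *\<^sub>v bvec c n u = bvec r n (\<lambda>a j. \<Sum>b\<in>{0..<c}. A $$ (a, b) * u b j)"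
  unfolding kron_mult_bvec[OF assms one_carrier_mat]
proof (rule bvec_cong)
  fix a j assume "a < r" "j < n"
  then have "A $$ (a, b) * 1\<^sub>m n $$ (j, l) * u b l = (if j = l then A $$ (a, b) * u b j else 0)"
    if "l \<in> {0..<n}" for b l
    using that by auto
  then show "(\<Sum>b\<in>{0..<c}. \<Sum>l\<in>{0..<n}. A $$ (a, b) * 1\<^sub>m n $$ (j, l) * u b l) = (\<Sum>b\<in>{0..<c}. A $$ (a, b) * u b j)"
    using \<open>j < n\<close> by simp
qed

lemma one_kron_mult_bvec:
  assumes "R \<in> carrier_mat n n"
  shows "(1\<^sub>m k \<otimes>\<^sub>k R) *\<^sub>v bvec k n u = bvec k n (\<lambda>a j. \<Sum>l\<in>{0..<n}. R $$ (j, l) * u a l)"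
  unfolding kron_mult_bvec[OF one_carrier_mat assms]
proof (rule bvec_cong)
  fix a j assume a: "a < k" "j < n"
  have "(\<Sum>l\<in>{0..<n}. 1\<^sub>m k $$ (a, b) * R $$ (j, l) * u b l) = (if a = b then \<Sum>l\<in>{0..<n}. R $$ (j, l) * u a l else 0)"
    if "b \<in> {0..<k}" for b
    using that a by auto
  then show "(\<Sum>b\<in>{0..<k}. \<Sum>l\<in>{0..<n}. 1\<^sub>m k $$ (a, b) * R $$ (j, l) * u b l) = (\<Sum>l\<in>{0..<n}. R $$ (j, l) * u a l)"
    using a by simp
qed

text \<open>The left side is what the matrix inequality contains, the right side what Bessel's
  inequality bounds: one R-form per kernel function.\<close>

lemma quad_form_one_kron:
  assumes "R \<in> carrier_mat n n"
  shows "bvec k n u \<bullet> ((1\<^sub>m k \<otimes>\<^sub>k R) *\<^sub>v bvec k n u)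
    = (\<Sum>a\<in>{0..<k}. vec n (u a) \<bullet> (R *\<^sub>v vec n (u a)))"
  unfolding one_kron_mult_bvec[OF assms] scalar_prod_bvec using assms
  by (simp add: scalar_prod_def)

lemma col_mat_carrier [simp]: "col_mat v \<in> carrier_mat (dim_vec v) 1"
  using mat_of_cols_carrier(1)[of "dim_vec v" "[v]"] by (simp add: col_mat_def)

lemma col_mat_index: "a < dim_vec v \<Longrightarrow> col_mat v $$ (a, 0) = v $ a"
  by (simp add: col_mat_def mat_of_cols_index)

text \<open>Puts the integrands of \<open>xi_vec\<close> and \<open>a_vec\<close> and the boundary
  columns of \<open>bM\<close> into coordinates.\<close>

lemma col_mat_kron_mult_vec:
  assumes "x \<in> carrier_vec n"
  shows "(col_mat v \<otimes>\<^sub>k 1\<^sub>m n) *\<^sub>v x = bvec (dim_vec v) n (\<lambda>a j. v $ a * x $ j)"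
proof -
  have "x = bvec 1 n (\<lambda>_ j. x $ j)" using assms by (intro eq_vecI) (auto simp: bvec_def)
  then have "(col_mat v \<otimes>\<^sub>k 1\<^sub>m n) *\<^sub>v x = (col_mat v \<otimes>\<^sub>k 1\<^sub>m n) *\<^sub>v bvec 1 n (\<lambda>_ j. x $ j)"
    by (rule arg_cong[where f = "\<lambda>y. (col_mat v \<otimes>\<^sub>k 1\<^sub>m n) *\<^sub>v y"])
  also have "\<dots> = bvec (dim_vec v) n (\<lambda>a j. v $ a * x $ j)"
    using kron_one_mult_bvec[OF col_mat_carrier[of v], of n "\<lambda>_ j. x $ j"]
    by (auto simp: col_mat_index intro!: bvec_cong)
  finally show ?thesis .
qed

declare hcat_simps [simp del]

lemma hcat_Nil_carrier: "hcat nr [] \<in> carrier_mat nr 0"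
  by (simp add: hcat_simps)

lemma hcat_Cons_carrier:
  assumes "A \<in> carrier_mat nr a" "hcat nr As \<in> carrier_mat nr b"
  shows "hcat nr (A # As) \<in> carrier_mat nr (a + b)"
  unfolding hcat_simps using assms by (auto simp del: dim_col_hcat)

lemma hcat_single_carrier: "A \<in> carrier_mat nr a \<Longrightarrow> hcat nr [A] \<in> carrier_mat nr a"
  using hcat_Cons_carrier[OF _ hcat_Nil_carrier] by fastforce

lemma hcat_single_mult_vec:
  assumes "A \<in> carrier_mat nr c" "v \<in> carrier_vec c"
  shows "hcat nr [A] *\<^sub>v v = A *\<^sub>v v"
  using hcat_mult_vec[OF assms(1) hcat_Nil_carrier assms(2), of vNil] mult_mat_vec_carrier[OF assms]
  by (simp add: append_vec_vNil_right del: zero_vec_zero)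

lemma zero_mat_mult_vec: "x \<in> carrier_vec b \<Longrightarrow> 0\<^sub>m a b *\<^sub>v x = (0\<^sub>v a :: real vec)"
  by (intro eq_vecI) auto

lemma vcat_Nil_carrier: "vcat nc [] \<in> carrier_mat 0 nc"
  by simp

lemma vcat_Cons_carrier:
  "A \<in> carrier_mat a nc \<Longrightarrow> vcat nc As \<in> carrier_mat b nc \<Longrightarrow> vcat nc (A # As) \<in> carrier_mat (a + b) nc"
  unfolding vcat_simps by (rule carrier_append_rows)

lemma vcat_single_carrier: "A \<in> carrier_mat a nc \<Longrightarrow> vcat nc [A] \<in> carrier_mat a nc"
  using vcat_Cons_carrier[OF _ vcat_Nil_carrier] by fastforce

lemma transpose_vcat_mult_vec:
  assumes "A \<in> carrier_mat a nc" "vcat nc As \<in> carrier_mat b nc" "u \<in> carrier_vec a" "v \<in> carrier_vec b"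
  shows "(vcat nc (A # As))\<^sup>T *\<^sub>v (u @\<^sub>v v) = A\<^sup>T *\<^sub>v u + (vcat nc As)\<^sup>T *\<^sub>v (v :: real vec)"
  unfolding vcat_simps by (rule transpose_append_rows_mult_vec[OF assms])

lemma transpose_vcat_single_mult_vec:
  assumes "A \<in> carrier_mat a nc" "u \<in> carrier_vec a"
  shows "(vcat nc [A])\<^sup>T *\<^sub>v u = A\<^sup>T *\<^sub>v u"
  using transpose_vcat_mult_vec[OF assms(1) vcat_Nil_carrier assms(2), of vNil]
    mult_mat_vec_carrier[of "A\<^sup>T" nc a u] assms transpose_vcat_Nil_mult_vec[of nc]
  by (simp add: append_vec_vNil_right del: zero_vec_zero vcat_simps)

lemma diag_block_pair_carrier:
  assumes "A \<in> carrier_mat a c" "diag_block_mat Bs \<in> carrier_mat b d"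
  shows "diag_block_mat (A # Bs) \<in> carrier_mat (a + b) (c + d)"
  using assms by (auto simp: Let_def)

lemma quad_form_add:
  assumes "X \<in> carrier_mat n n" "Y \<in> carrier_mat n n" "x \<in> carrier_vec n"
  shows "x \<bullet> ((X + Y) *\<^sub>v x) = x \<bullet> (X *\<^sub>v x) + x \<bullet> (Y *\<^sub>v (x :: real vec))"
  unfolding add_mult_distrib_mat_vec[OF assms]
  by (rule scalar_prod_add_distrib[OF assms(3) mult_mat_vec_carrier[OF assms(1,3)] mult_mat_vec_carrier[OF assms(2,3)]])

lemma quad_form_minus:
  assumes "X \<in> carrier_mat n n" "Y \<in> carrier_mat n n" "x \<in> carrier_vec n"
  shows "x \<bullet> ((X - Y) *\<^sub>v x) = x \<bullet> (X *\<^sub>v x) - x \<bullet> (Y *\<^sub>v (x :: real vec))"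
  unfolding minus_mult_distrib_mat_vec[OF assms]
  by (rule scalar_prod_minus_distrib[OF assms(3) mult_mat_vec_carrier[OF assms(1,3)] mult_mat_vec_carrier[OF assms(2,3)]])

lemma quad_form_four_block:
  assumes A: "A \<in> carrier_mat n n" and B: "B \<in> carrier_mat n k" and D: "D \<in> carrier_mat k k"
    and u: "u \<in> carrier_vec n" and v: "v \<in> carrier_vec k"
  shows "(u @\<^sub>v v) \<bullet> (four_block_mat A B (B\<^sup>T) D *\<^sub>v (u @\<^sub>v v))
    = u \<bullet> (A *\<^sub>v u) + 2 * (u \<bullet> (B *\<^sub>v v)) + v \<bullet> (D *\<^sub>v (v :: real vec))"
proof -
  have BT: "B\<^sup>T \<in> carrier_mat k n" using B by simp
  have c: "A *\<^sub>v u \<in> carrier_vec n" "B *\<^sub>v v \<in> carrier_vec n" "B\<^sup>T *\<^sub>v u \<in> carrier_vec k" "D *\<^sub>v v \<in> carrier_vec k"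
    using A B BT D u v by (auto intro: mult_mat_vec_carrier)
  have "v \<bullet> (B\<^sup>T *\<^sub>v u) = u \<bullet> (B *\<^sub>v v)"
    using transpose_vec_mult_scalar[OF B v u] comm_scalar_prod[OF v c(3)] by simp
  then show ?thesis
    unfolding four_block_mat_mult_vec[OF A B BT D u v]
    using c u v by (simp add: scalar_prod_append[of _ n _ k] scalar_prod_add_distrib[of _ n] scalar_prod_add_distrib[of _ k])
qed

lemma append_vec_minus:
  assumes "dim_vec a = dim_vec c" "dim_vec b = dim_vec d"
  shows "(a @\<^sub>v b) - (c @\<^sub>v d) = (a - c) @\<^sub>v (b - (d :: real vec))"
  using assms by (intro eq_vecI) auto

lemma append_vec_plus:
  assumes "dim_vec a = dim_vec c" "dim_vec b = dim_vec d"
  shows "(a @\<^sub>v b) + (c @\<^sub>v d) = (a + c) @\<^sub>v (b + (d :: real vec))"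
  using assms by (intro eq_vecI) auto

lemma dim_stack_vec_cong:
  assumes "\<And>i. i \<in> set is \<Longrightarrow> dim_vec (f i) = dim_vec (g i)"
  shows "dim_vec (stack_vec (map f is)) = dim_vec (stack_vec (map g is))"
  using assms by (induction "is") auto

lemma stack_vec_minus:
  assumes "\<And>i. i \<in> set is \<Longrightarrow> dim_vec (f i) = dim_vec (g i)"
  shows "stack_vec (map f is) - stack_vec (map g is) = stack_vec (map (\<lambda>i. f i - (g i :: real vec)) is)"
  using assms
proof (induction "is")
  case (Cons a "is")
  then have "dim_vec (stack_vec (map f is)) = dim_vec (stack_vec (map g is))"
    by (intro dim_stack_vec_cong) simp
  then show ?case using Cons by (simp add: append_vec_minus del: dim_stack_vec)
qed auto

lemma stack_vec_plus:
  assumes "\<And>i. i \<in> set is \<Longrightarrow> dim_vec (f i) = dim_vec (g i)"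
  shows "stack_vec (map f is) + stack_vec (map g is) = stack_vec (map (\<lambda>i. f i + (g i :: real vec)) is)"
  using assms
proof (induction "is")
  case (Cons a "is")
  then have "dim_vec (stack_vec (map f is)) = dim_vec (stack_vec (map g is))"
    by (intro dim_stack_vec_cong) simp
  then show ?case using Cons by (simp add: append_vec_plus del: dim_stack_vec)
qed auto

lemma sum_list_idx: "sum_list (map f (idx p)) = (\<Sum>i = 1..ndelays p. f i)"
  unfolding idx_def by (simp add: interv_sum_list_conv_sum_set_nat atLeastLessThanSuc_atLeastAtMost del: upt_Suc)

lemma set_idx: "set (idx p) = {1..ndelays p}"
  by (auto simp: idx_def)

lemma gram_carrier [simp]: "gram S a b u v \<in> carrier_mat a b"
  by (simp add: gram_def)

section \<open>Absolutely continuous functions\<close>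

lemma absolutely_continuous_betweenD:
  assumes "absolutely_continuous_between a b f" "0 < \<epsilon>"
  obtains \<delta> where "0 < \<delta>" and
    "\<And>(M::nat) x y. (\<And>k. k < M \<Longrightarrow> a \<le> x k \<and> x k \<le> y k \<and> y k \<le> b) \<Longrightarrow>
      disjoint_family_on (\<lambda>k. {x k<..<y k}) {..<M} \<Longrightarrow> (\<Sum>k<M. y k - x k) < \<delta> \<Longrightarrow>
      (\<Sum>k<M. \<bar>f (y k) - f (x k)\<bar>) < \<epsilon>"
proof -
  obtain \<delta> where \<delta>: "0 < \<delta>" "\<forall>(M::nat) x y. (\<forall>k<M. a \<le> x k \<and> x k \<le> y k \<and> y k \<le> b) \<and>
        disjoint_family_on (\<lambda>k. {x k<..<y k}) {..<M} \<and> (\<Sum>k<M. y k - x k) < \<delta>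
        \<longrightarrow> (\<Sum>k<M. \<bar>f (y k) - f (x k)\<bar>) < \<epsilon>"
    using assms unfolding absolutely_continuous_between_def by blast
  show thesis
    by (rule that[OF \<delta>(1)]) (use \<delta>(2) in blast)
qed

lemma absolutely_continuous_lipschitz:
  assumes "\<And>x y. a \<le> x \<Longrightarrow> x \<le> y \<Longrightarrow> y \<le> b \<Longrightarrow> \<bar>f y - f x\<bar> \<le> C * (y - x)"
  shows "absolutely_continuous_between a b f"
  unfolding absolutely_continuous_between_def
proof (intro allI impI)
  fix \<epsilon> :: real assume e: "0 < \<epsilon>"
  let ?d = "\<epsilon> / (\<bar>C\<bar> + 1)"
  have "(\<Sum>k<M. \<bar>f (y k) - f (x k)\<bar>) < \<epsilon>"
    if ord: "\<forall>k<M. a \<le> x k \<and> x k \<le> y k \<and> y k \<le> b" and len: "(\<Sum>k<M. y k - x k) < ?d" for M :: nat and x y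
  proof -
    have nn: "0 \<le> (\<Sum>k<M. y k - x k)" using ord by (intro sum_nonneg) auto
    have "(\<Sum>k<M. \<bar>f (y k) - f (x k)\<bar>) \<le> (\<Sum>k<M. C * (y k - x k))"
      using ord assms by (intro sum_mono) auto
    also have "\<dots> = C * (\<Sum>k<M. y k - x k)" by (simp add: sum_distrib_left)
    also have "\<dots> \<le> (\<bar>C\<bar> + 1) * (\<Sum>k<M. y k - x k)" using nn by (intro mult_right_mono) auto
    also have "\<dots> < \<epsilon>" using len by (simp add: field_simps add_pos_nonneg)
    finally show ?thesis .
  qed
  moreover have "0 < ?d" using e by (simp add: add_nonneg_pos)
  ultimately show "\<exists>\<delta>>0. \<forall>(M::nat) x y.
        (\<forall>k<M. a \<le> x k \<and> x k \<le> y k \<and> y k \<le> b) \<and> disjoint_family_on (\<lambda>k. {x k<..<y k}) {..<M} \<and>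
        (\<Sum>k<M. y k - x k) < \<delta> \<longrightarrow> (\<Sum>k<M. \<bar>f (y k) - f (x k)\<bar>) < \<epsilon>"
    by blast
qed

lemma absolutely_continuous_const: "absolutely_continuous_between a b (\<lambda>_. c)"
  by (rule absolutely_continuous_lipschitz[where C = 0]) simp

lemma absolutely_continuous_add:
  assumes f: "absolutely_continuous_between a b f" and g: "absolutely_continuous_between a b g"
  shows "absolutely_continuous_between a b (\<lambda>x. f x + g x)"
  unfolding absolutely_continuous_between_def
proof (intro allI impI)
  fix \<epsilon> :: real assume "0 < \<epsilon>"
  then have e: "0 < \<epsilon> / 2" by simp
  obtain d1 where d1: "0 < d1" "\<And>(M::nat) x y. (\<And>k. k < M \<Longrightarrow> a \<le> x k \<and> x k \<le> y k \<and> y k \<le> b) \<Longrightarrow>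
      disjoint_family_on (\<lambda>k. {x k<..<y k}) {..<M} \<Longrightarrow> (\<Sum>k<M. y k - x k) < d1 \<Longrightarrow>
      (\<Sum>k<M. \<bar>f (y k) - f (x k)\<bar>) < \<epsilon> / 2"
    using absolutely_continuous_betweenD[OF f e] by blast
  obtain d2 where d2: "0 < d2" "\<And>(M::nat) x y. (\<And>k. k < M \<Longrightarrow> a \<le> x k \<and> x k \<le> y k \<and> y k \<le> b) \<Longrightarrow>
      disjoint_family_on (\<lambda>k. {x k<..<y k}) {..<M} \<Longrightarrow> (\<Sum>k<M. y k - x k) < d2 \<Longrightarrow>
      (\<Sum>k<M. \<bar>g (y k) - g (x k)\<bar>) < \<epsilon> / 2"
    using absolutely_continuous_betweenD[OF g e] by blast
  have "(\<Sum>k<M. \<bar>(f (y k) + g (y k)) - (f (x k) + g (x k))\<bar>) < \<epsilon>"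
    if "\<forall>k<M. a \<le> x k \<and> x k \<le> y k \<and> y k \<le> b" "disjoint_family_on (\<lambda>k. {x k<..<y k}) {..<M}"
      "(\<Sum>k<M. y k - x k) < min d1 d2" for M :: nat and x y
  proof -
    have "(\<Sum>k<M. \<bar>(f (y k) + g (y k)) - (f (x k) + g (x k))\<bar>)
      \<le> (\<Sum>k<M. \<bar>f (y k) - f (x k)\<bar>) + (\<Sum>k<M. \<bar>g (y k) - g (x k)\<bar>)"
      unfolding sum.distrib[symmetric] by (rule sum_mono) linarith
    also have "\<dots> < \<epsilon>" using d1(2)[of M x y] d2(2)[of M x y] that by simp
    finally show ?thesis .
  qed
  moreover have "0 < min d1 d2" using d1 d2 by simp
  ultimately show "\<exists>\<delta>>0. \<forall>(M::nat) x y.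
        (\<forall>k<M. a \<le> x k \<and> x k \<le> y k \<and> y k \<le> b) \<and> disjoint_family_on (\<lambda>k. {x k<..<y k}) {..<M} \<and>
        (\<Sum>k<M. y k - x k) < \<delta> \<longrightarrow> (\<Sum>k<M. \<bar>(f (y k) + g (y k)) - (f (x k) + g (x k))\<bar>) < \<epsilon>"
    by blast
qed

lemma absolutely_continuous_sum:
  assumes "\<And>i. i \<in> I \<Longrightarrow> absolutely_continuous_between a b (f i)"
  shows "absolutely_continuous_between a b (\<lambda>x. \<Sum>i\<in>I. f i x)"
  using assms
  by (induction I rule: infinite_finite_induct) (auto intro: absolutely_continuous_const absolutely_continuous_add)

lemma absolutely_continuous_imp_continuous:
  assumes f: "absolutely_continuous_between a b f"
  shows "continuous_on {a..b} f"
  unfolding continuous_on_iff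
proof (intro ballI allI impI)
  fix x :: real and \<epsilon> :: real assume x: "x \<in> {a..b}" and e: "0 < \<epsilon>"
  obtain d where d: "0 < d" "\<And>(M::nat) x y. (\<And>k. k < M \<Longrightarrow> a \<le> x k \<and> x k \<le> y k \<and> y k \<le> b) \<Longrightarrow>
      disjoint_family_on (\<lambda>k. {x k<..<y k}) {..<M} \<Longrightarrow> (\<Sum>k<M. y k - x k) < d \<Longrightarrow>
      (\<Sum>k<M. \<bar>f (y k) - f (x k)\<bar>) < \<epsilon>"
    using absolutely_continuous_betweenD[OF f e] by blast
  have "dist (f y) (f x) < \<epsilon>" if y: "y \<in> {a..b}" "dist y x < d" for y
  proof (cases "x \<le> y")
    case True
    then show ?thesis using d(2)[of 1 "\<lambda>_. x" "\<lambda>_. y"] x y by (auto simp: dist_real_def disjoint_family_on_def)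
  next
    case False
    then show ?thesis using d(2)[of 1 "\<lambda>_. y" "\<lambda>_. x"] x y
      by (auto simp: dist_real_def disjoint_family_on_def abs_minus_commute)
  qed
  then show "\<exists>d>0. \<forall>y\<in>{a..b}. dist y x < d \<longrightarrow> dist (f y) (f x) < \<epsilon>" using d(1) by blast
qed

lemma absolutely_continuous_mult:
  assumes f: "absolutely_continuous_between a b f" and g: "absolutely_continuous_between a b g"
  shows "absolutely_continuous_between a b (\<lambda>x. f x * g x)"
  unfolding absolutely_continuous_between_def
proof (intro allI impI)
  fix \<epsilon> :: real assume e0: "0 < \<epsilon>"
  have bdd: "\<exists>B>0. \<forall>x\<in>{a..b}. \<bar>h x\<bar> \<le> B" if "continuous_on {a..b} h" for h :: "real \<Rightarrow> real"
  proof -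
    have "bounded (h ` {a..b})" by (rule compact_imp_bounded[OF compact_continuous_image[OF that compact_Icc]])
    then show ?thesis unfolding bounded_pos by auto
  qed
  obtain B where B: "0 < B" "\<forall>x\<in>{a..b}. \<bar>f x\<bar> \<le> B" using bdd[OF absolutely_continuous_imp_continuous[OF f]] by blast
  obtain C where C: "0 < C" "\<forall>x\<in>{a..b}. \<bar>g x\<bar> \<le> C" using bdd[OF absolutely_continuous_imp_continuous[OF g]] by blast
  \<comment> \<open>B bounds f and C bounds g; each of the two parts of the product increment then
    costs less than half of \<epsilon>.\<close>
  have e1: "0 < \<epsilon> / (2 * C)" and e2: "0 < \<epsilon> / (2 * B)" using B C e0 by simp_all
  obtain d1 where d1: "0 < d1" "\<And>(M::nat) x y. (\<And>k. k < M \<Longrightarrow> a \<le> x k \<and> x k \<le> y k \<and> y k \<le> b) \<Longrightarrow>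
      disjoint_family_on (\<lambda>k. {x k<..<y k}) {..<M} \<Longrightarrow> (\<Sum>k<M. y k - x k) < d1 \<Longrightarrow>
      (\<Sum>k<M. \<bar>f (y k) - f (x k)\<bar>) < \<epsilon> / (2 * C)"
    using absolutely_continuous_betweenD[OF f e1] by blast
  obtain d2 where d2: "0 < d2" "\<And>(M::nat) x y. (\<And>k. k < M \<Longrightarrow> a \<le> x k \<and> x k \<le> y k \<and> y k \<le> b) \<Longrightarrow>
      disjoint_family_on (\<lambda>k. {x k<..<y k}) {..<M} \<Longrightarrow> (\<Sum>k<M. y k - x k) < d2 \<Longrightarrow>
      (\<Sum>k<M. \<bar>g (y k) - g (x k)\<bar>) < \<epsilon> / (2 * B)"
    using absolutely_continuous_betweenD[OF g e2] by blast
  have "(\<Sum>k<M. \<bar>f (y k) * g (y k) - f (x k) * g (x k)\<bar>) < \<epsilon>"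
    if ord: "\<forall>k<M. a \<le> x k \<and> x k \<le> y k \<and> y k \<le> b" and dj: "disjoint_family_on (\<lambda>k. {x k<..<y k}) {..<M}"
      and len: "(\<Sum>k<M. y k - x k) < min d1 d2" for M :: nat and x y
  proof -
    have "\<bar>f (y k) * g (y k) - f (x k) * g (x k)\<bar> \<le> C * \<bar>f (y k) - f (x k)\<bar> + B * \<bar>g (y k) - g (x k)\<bar>"
      if k: "k < M" for k
    proof -
      have xy: "x k \<in> {a..b}" "y k \<in> {a..b}" using ord k by (auto intro: order_trans)
      have "f (y k) * g (y k) - f (x k) * g (x k) = g (y k) * (f (y k) - f (x k)) + f (x k) * (g (y k) - g (x k))"
        by (simp add: algebra_simps)
      also have "\<bar>\<dots>\<bar> \<le> \<bar>g (y k)\<bar> * \<bar>f (y k) - f (x k)\<bar> + \<bar>f (x k)\<bar> * \<bar>g (y k) - g (x k)\<bar>"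
        by (metis abs_mult abs_triangle_ineq)
      also have "\<dots> \<le> C * \<bar>f (y k) - f (x k)\<bar> + B * \<bar>g (y k) - g (x k)\<bar>"
        using xy B(2) C(2) by (intro add_mono mult_right_mono) auto
      finally show ?thesis .
    qed
    then have "(\<Sum>k<M. \<bar>f (y k) * g (y k) - f (x k) * g (x k)\<bar>)
      \<le> (\<Sum>k<M. C * \<bar>f (y k) - f (x k)\<bar> + B * \<bar>g (y k) - g (x k)\<bar>)"
      by (intro sum_mono) simp
    also have "\<dots> = C * (\<Sum>k<M. \<bar>f (y k) - f (x k)\<bar>) + B * (\<Sum>k<M. \<bar>g (y k) - g (x k)\<bar>)"
      by (simp add: sum.distrib sum_distrib_left)
    also have "\<dots> < C * (\<epsilon> / (2 * C)) + B * (\<epsilon> / (2 * B))"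
      using d1(2)[of M x y] d2(2)[of M x y] ord dj len B(1) C(1)
      by (intro add_strict_mono mult_strict_left_mono) auto
    also have "\<dots> = \<epsilon>" using B C by simp
    finally show ?thesis .
  qed
  moreover have "0 < min d1 d2" using d1 d2 by simp
  ultimately show "\<exists>\<delta>>0. \<forall>(M::nat) x y.
        (\<forall>k<M. a \<le> x k \<and> x k \<le> y k \<and> y k \<le> b) \<and> disjoint_family_on (\<lambda>k. {x k<..<y k}) {..<M} \<and>
        (\<Sum>k<M. y k - x k) < \<delta> \<longrightarrow> (\<Sum>k<M. \<bar>f (y k) * g (y k) - f (x k) * g (x k)\<bar>) < \<epsilon>"
    by blast
qed

text \<open>The tags of a fine division are good points, where the derivative controls the increment, or
  lie in an open set of small measure, where absolute continuity does.\<close>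

lemma absolutely_continuous_nonincreasing:
  assumes ac: "absolutely_continuous_between a b f" and ab: "a \<le> b"
    and AE: "AE t in lebesgue. a < t \<and> t < b \<longrightarrow> (\<exists>D\<le>0. (f has_real_derivative D) (at t))"
  shows "f b \<le> f a"
proof (rule field_le_epsilon)
  fix \<epsilon>' :: real assume e': "0 < \<epsilon>'"
  \<comment> \<open>Pieces with good tags will contribute at most \<epsilon> (b - a), those with bad
    tags at most \<epsilon>.\<close>
  define \<epsilon> where "\<epsilon> = \<epsilon>' / (b - a + 1)"
  have e: "0 < \<epsilon>" using e' ab by (simp add: \<epsilon>_def)
  define good where "good = (\<lambda>t. \<exists>D\<le>0. (f has_real_derivative D) (at t))"
  have "\<exists>Z\<in>null_sets lebesgue. {t\<in>space lebesgue. \<not> (a < t \<and> t < b \<longrightarrow> good t)} \<subseteq> Z"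
    using AE unfolding good_def eventually_ae_filter .
  then obtain Z where Z: "Z \<in> null_sets lebesgue" "{t. \<not> (a < t \<and> t < b \<longrightarrow> good t)} \<subseteq> Z"
    by (simp add: space_completion) blast
  \<comment> \<open>The hypothesis speaks of the open interval, so the endpoints join the
    exceptional null set.\<close>
  define S where "S = Z \<union> {a, b}"
  have S: "S \<in> null_sets lebesgue"
    unfolding S_def by (rule null_sets.Un[OF Z(1)]) (simp add: null_sets_completionI finite_imp_null_set_lborel)
  have goodS: "good t" if "t \<in> {a..b}" "t \<notin> S" for t
    using that Z(2) unfolding S_def by force
  obtain d where d: "0 < d" "\<And>(M::nat) x y. (\<And>k. k < M \<Longrightarrow> a \<le> x k \<and> x k \<le> y k \<and> y k \<le> b) \<Longrightarrow>
      disjoint_family_on (\<lambda>k. {x k<..<y k}) {..<M} \<Longrightarrow> (\<Sum>k<M. y k - x k) < d \<Longrightarrow>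
      (\<Sum>k<M. \<bar>f (y k) - f (x k)\<bar>) < \<epsilon>"
    using absolutely_continuous_betweenD[OF ac e] by blast
  \<comment> \<open>Outer regularity: the bad set has an open neighbourhood T whose measure is below
    the threshold d of absolute continuity.\<close>
  obtain T where T: "open T" "S \<subseteq> T" "(T - S) \<in> lmeasurable" "emeasure lebesgue (T - S) < ennreal d"
    using sets_lebesgue_outer_open[OF _ d(1), of S] S by (auto simp: null_sets_def)
  have Tm: "emeasure lebesgue T < ennreal d"
  proof -
    have "emeasure lebesgue T \<le> emeasure lebesgue ((T - S) \<union> S)"
      by (rule emeasure_mono) (use T S in \<open>auto simp: null_sets_def fmeasurableD\<close>)
    also have "\<dots> = emeasure lebesgue (T - S)"
      by (rule emeasure_Un_null_set) (use T S in \<open>auto simp: fmeasurableD\<close>)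
    finally show ?thesis using T(4) by simp
  qed
  \<comment> \<open>Radii of the gauge. At a bad point the ball stays in T; at a good one D <= 0
    limits the increment over any interval around the tag to \<epsilon> times its length.\<close>
  have "\<exists>r>0. (x \<in> S \<longrightarrow> ball x r \<subseteq> T) \<and>
      (x \<in> {a..b} \<and> x \<notin> S \<longrightarrow> (\<forall>u v. u \<in> ball x r \<and> v \<in> ball x r \<and> u \<le> x \<and> x \<le> v \<longrightarrow> f v - f u \<le> \<epsilon> * (v - u)))" for x
  proof (cases "x \<in> S")
    case True
    then obtain r where "0 < r" "ball x r \<subseteq> T" using T(1,2) openE by blast
    then show ?thesis using True by blast
  next
    case False
    show ?thesis
    proof (cases "x \<in> {a..b}")
      case True
      then obtain D where D: "D \<le> 0" "(f has_real_derivative D) (at x)" using goodS False unfolding good_def by blast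
      have "(f has_derivative (\<lambda>h. D * h)) (at x)" using D(2) by (simp add: has_field_derivative_def)
      then obtain r where r: "0 < r" "\<And>y. norm (y - x) < r \<Longrightarrow> norm (f y - f x - D * (y - x)) \<le> \<epsilon> * norm (y - x)"
        unfolding has_derivative_at_alt using e by blast
      have "f v - f u \<le> \<epsilon> * (v - u)" if "u \<in> ball x r" "v \<in> ball x r" "u \<le> x" "x \<le> v" for u v
      proof -
        have "\<bar>f v - f x - D * (v - x)\<bar> \<le> \<epsilon> * (v - x)" "\<bar>f u - f x - D * (u - x)\<bar> \<le> \<epsilon> * (x - u)"
          using r(2)[of v] r(2)[of u] that by (auto simp: dist_real_def)
        then have "f v - f u \<le> \<epsilon> * (v - x) + \<epsilon> * (x - u) + D * (v - x) - D * (u - x)" by linarith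
        also have "\<dots> = \<epsilon> * (v - u) + D * (v - u)" by (simp add: algebra_simps)
        also have "D * (v - u) \<le> 0" using D(1) that by (simp add: mult_nonpos_nonneg)
        finally show ?thesis by simp
      qed
      then show ?thesis using r(1) False by blast
    qed (use False in \<open>auto intro: exI[of _ 1]\<close>)
  qed
  then obtain r where r: "\<And>x. 0 < r x" "\<And>x. x \<in> S \<Longrightarrow> ball x (r x) \<subseteq> T"
    "\<And>x u v. x \<in> {a..b} \<Longrightarrow> x \<notin> S \<Longrightarrow> u \<in> ball x (r x) \<Longrightarrow> v \<in> ball x (r x) \<Longrightarrow> u \<le> x \<Longrightarrow> x \<le> v \<Longrightarrow> f v - f u \<le> \<epsilon> * (v - u)"
    by metis
  have "gauge (\<lambda>x. ball x (r x))" using r(1) by (simp add: gauge_def)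
  then obtain P where P: "P tagged_division_of {a..b}" "(\<lambda>x. ball x (r x)) fine P"
    using fine_division_exists_real by blast
  have finP: "finite P" using P(1) by blast
  have Pk: "\<exists>u v. k = {u..v} \<and> u \<le> x \<and> x \<le> v \<and> a \<le> u \<and> v \<le> b \<and> k \<subseteq> ball x (r x)" if xk: "(x, k) \<in> P" for x k
  proof -
    obtain u v where "k = cbox u v" using tagged_division_ofD(4)[OF P(1) xk] by blast
    moreover have "x \<in> k" "k \<subseteq> {a..b}" using tagged_division_ofD(2,3)[OF P(1) xk] by auto
    moreover have "k \<subseteq> ball x (r x)" using fineD[OF P(2) xk] by simp
    ultimately show ?thesis by (intro exI[of _ u] exI[of _ v]) auto
  qed
  define A where "A = {(x, k) \<in> P. x \<in> S}"
  define B where "B = {(x, k) \<in> P. x \<notin> S}"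
  have AB: "P = A \<union> B" "A \<inter> B = {}" "finite A" "finite B"
    using finP by (auto simp: A_def B_def intro: finite_subset[OF _ finP])
  let ?d = "\<lambda>(x::real, k). f (Sup k) - f (Inf k)"
  have "f b - f a = sum ?d P"
    using additive_tagged_division_1[OF ab P(1), of f] by simp
  also have "\<dots> = sum ?d A + sum ?d B" using AB by (simp add: sum.union_disjoint)
  also have "sum ?d B \<le> \<epsilon> * (b - a)"
  proof -
    have "sum ?d B \<le> (\<Sum>(x, k)\<in>B. \<epsilon> * measure lborel k)"
    proof (rule sum_mono, clarify)
      fix x k assume "(x, k) \<in> B"
      then have xk: "(x, k) \<in> P" "x \<notin> S" by (auto simp: B_def)
      then obtain u v where uv: "k = {u..v}" "u \<le> x" "x \<le> v" "a \<le> u" "v \<le> b" "k \<subseteq> ball x (r x)" using Pk by blast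
      moreover have "x \<in> {a..b}" using uv by auto
      moreover have "u \<in> ball x (r x)" "v \<in> ball x (r x)"
      proof -
        have "u \<in> k" "v \<in> k" unfolding uv(1) using uv(2,3) by simp_all
        then show "u \<in> ball x (r x)" "v \<in> ball x (r x)" using uv(6) by blast+
      qed
      ultimately have "f v - f u \<le> \<epsilon> * (v - u)"
        using r(3)[of x u v] xk by blast
      then show "f (Sup k) - f (Inf k) \<le> \<epsilon> * measure lborel k" using uv by simp
    qed
    also have "\<dots> \<le> (\<Sum>(x, k)\<in>P. \<epsilon> * measure lborel k)"
      by (rule sum_mono2[OF finP]) (use e AB in \<open>auto\<close>)
    also have "\<dots> = \<epsilon> * (\<Sum>(x, k)\<in>P. measure lborel k)" by (simp add: sum_distrib_left case_prod_unfold)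
    also have "(\<Sum>(x, k)\<in>P. measure lborel k) = b - a"
      using additive_content_tagged_division[of P a b] P(1) ab by simp
    finally show ?thesis .
  qed
  also have "sum ?d A \<le> \<epsilon>"
  proof -
    \<comment> \<open>The pieces with bad tags are enumerated because absolute continuity is stated
      for indexed families of intervals.\<close>
    obtain h where h: "bij_betw h {0..<card A} A" using ex_bij_betw_nat_finite[OF AB(3)] by blast
    then have h': "bij_betw h {..<card A} A" by (simp add: lessThan_atLeast0)
    define x where "x = (\<lambda>i. Inf (snd (h i)))"
    define y where "y = (\<lambda>i. Sup (snd (h i)))"
    have hA: "(fst (h i), snd (h i)) \<in> P \<and> fst (h i) \<in> S" if "i < card A" for i
    proof -
      have "h i \<in> A" using bij_betwE[OF h'] that by simp
      then show ?thesis by (simp add: A_def case_prod_unfold)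
    qed
    have xy: "snd (h i) = {x i..y i} \<and> a \<le> x i \<and> x i \<le> y i \<and> y i \<le> b \<and> {x i..y i} \<subseteq> T" if i: "i < card A" for i
    proof -
      obtain u v where uv: "snd (h i) = {u..v}" "u \<le> fst (h i)" "fst (h i) \<le> v" "a \<le> u" "v \<le> b"
        "snd (h i) \<subseteq> ball (fst (h i)) (r (fst (h i)))"
        using Pk hA[OF i] by blast
      moreover have "ball (fst (h i)) (r (fst (h i))) \<subseteq> T" using r(2) hA[OF i] by blast
      ultimately show ?thesis by (auto simp: x_def y_def)
    qed
    have dj: "disjoint_family_on (\<lambda>k. {x k<..<y k}) {..<card A}"
      unfolding disjoint_family_on_def
    proof (intro ballI impI)
      fix i j assume ij: "i \<in> {..<card A}" "j \<in> {..<card A}" "i \<noteq> j"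
      then have "h i \<noteq> h j" using h' by (auto simp: bij_betw_def inj_on_def)
      then have "interior (snd (h i)) \<inter> interior (snd (h j)) = {}"
        using tagged_division_ofD(5)[OF P(1), of "fst (h i)" "snd (h i)" "fst (h j)" "snd (h j)"] hA ij
        by (auto simp: prod_eq_iff)
      then show "{x i<..<y i} \<inter> {x j<..<y j} = {}" using xy ij by simp
    qed
    have "(\<Sum>k<card A. y k - x k) < d"
    proof -
      \<comment> \<open>The open pieces are disjoint and lie in T, so their total length is below
        d.\<close>
      have "ennreal (\<Sum>k<card A. y k - x k) = (\<Sum>k<card A. emeasure lborel {x k<..<y k})"
        using xy by (subst sum_ennreal[symmetric]) (auto intro!: sum.cong)
      also have "\<dots> = emeasure lborel (\<Union>k<card A. {x k<..<y k})"
        by (rule sum_emeasure) (use dj in auto)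
      also have "\<dots> = emeasure lebesgue (\<Union>k<card A. {x k<..<y k})"
        by simp
      also have "\<dots> \<le> emeasure lebesgue T"
        by (rule emeasure_mono) (use xy T(1) in \<open>force simp: subset_eq\<close>)+
      also have "\<dots> < ennreal d" by (rule Tm)
      finally have "ennreal (\<Sum>k<card A. y k - x k) < ennreal d" .
      moreover have "0 \<le> (\<Sum>k<card A. y k - x k)" by (intro sum_nonneg) (use xy in auto)
      ultimately show ?thesis by (simp add: ennreal_less_iff)
    qed
    then have "(\<Sum>k<card A. \<bar>f (y k) - f (x k)\<bar>) < \<epsilon>" using d(2)[of "card A" x y] xy dj by blast
    moreover have "sum ?d A = (\<Sum>k<card A. f (y k) - f (x k))"
      using sum.reindex_bij_betw[OF h', of ?d] by (simp add: x_def y_def case_prod_unfold)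
    moreover have "(\<Sum>k<card A. f (y k) - f (x k)) \<le> (\<Sum>k<card A. \<bar>f (y k) - f (x k)\<bar>)"
      by (rule sum_mono) simp
    ultimately show ?thesis by linarith
  qed
  finally have "f b - f a \<le> \<epsilon> * (b - a + 1)" by (simp add: algebra_simps)
  also have "\<dots> = \<epsilon>'" using ab by (simp add: \<epsilon>_def)
  finally show "f b \<le> f a + \<epsilon>'" by simp
qed

section \<open>A smooth step function\<close>

text \<open>Index k means k + 1 differentiations. Recursing into \<open>deriv f\<close> makes
  closure under products, inverses and affine substitutions an induction on k; smoothness is
  \<open>diff_upto k\<close> for every k.\<close>

fun diff_upto :: "nat \<Rightarrow> (real \<Rightarrow> real) \<Rightarrow> bool" where
  "diff_upto 0 f \<longleftrightarrow> (\<forall>x. f differentiable at x)"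
| "diff_upto (Suc k) f \<longleftrightarrow> (\<forall>x. f differentiable at x) \<and> diff_upto k (deriv f)"

lemma diff_upto_differentiable: "diff_upto k f \<Longrightarrow> f differentiable at x"
  by (cases k) auto

lemma diff_upto_Suc: "diff_upto (Suc k) f \<Longrightarrow> diff_upto k f"
  by (induction k arbitrary: f) auto

lemma diff_upto_funpow: "diff_upto k f \<Longrightarrow> (deriv ^^ k) f differentiable at x"
  by (induction k arbitrary: f) (auto simp: funpow_Suc_right simp del: funpow.simps)

lemma differentiable_deriv: "(f :: real \<Rightarrow> real) differentiable at x \<Longrightarrow> (f has_real_derivative deriv f x) (at x)"
  using DERIV_deriv_iff_real_differentiable by blast

lemma diff_upto_const: "diff_upto k (\<lambda>_. c)"
proof (induction k arbitrary: c)
  case (Suc k)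
  have "deriv (\<lambda>_::real. c) = (\<lambda>_. 0)" by (rule ext) simp
  then show ?case using Suc by simp
qed simp

lemma diff_upto_add: "diff_upto k f \<Longrightarrow> diff_upto k g \<Longrightarrow> diff_upto k (\<lambda>x. f x + g x)"
proof (induction k arbitrary: f g)
  case (Suc k)
  have "deriv (\<lambda>x. f x + g x) = (\<lambda>x. deriv f x + deriv g x)"
    by (rule ext, rule DERIV_imp_deriv, rule DERIV_add) (use Suc.prems in \<open>auto intro: differentiable_deriv\<close>)
  then show ?case using Suc by auto
qed auto

lemma diff_upto_mult: "diff_upto k f \<Longrightarrow> diff_upto k g \<Longrightarrow> diff_upto k (\<lambda>x. f x * g x)"
proof (induction k arbitrary: f g)
  case (Suc k)
  have d: "f differentiable at x" "g differentiable at x" for x using Suc.prems by auto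
  have "deriv (\<lambda>x. f x * g x) = (\<lambda>x. deriv f x * g x + deriv g x * f x)"
    by (rule ext, rule DERIV_imp_deriv, rule DERIV_mult) (use d in \<open>auto intro: differentiable_deriv\<close>)
  moreover have "diff_upto k (\<lambda>x. deriv f x * g x + deriv g x * f x)"
  proof -
    have "diff_upto k (deriv f)" "diff_upto k (deriv g)" "diff_upto k f" "diff_upto k g"
      using Suc.prems diff_upto_Suc[OF Suc.prems(1)] diff_upto_Suc[OF Suc.prems(2)] by simp_all
    then show ?thesis by (intro diff_upto_add Suc.IH)
  qed
  ultimately show ?case using d by simp
qed auto

lemma diff_upto_inverse:
  assumes "\<And>x. g x \<noteq> 0"
  shows "diff_upto k g \<Longrightarrow> diff_upto k (\<lambda>x. inverse (g x))"
proof (induction k)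
  case (Suc k)
  have d: "g differentiable at x" for x using Suc.prems by auto
  have dv: "((\<lambda>x. inverse (g x)) has_real_derivative - (deriv g x * (inverse (g x) * inverse (g x)))) (at x)" for x
    using DERIV_inverse_fun[OF differentiable_deriv[OF d[of x]] assms] by (simp add: power2_eq_square mult_ac)
  then have "deriv (\<lambda>x. inverse (g x)) = (\<lambda>x. (- 1) * (deriv g x * (inverse (g x) * inverse (g x))))"
    by (auto intro!: DERIV_imp_deriv)
  moreover have "diff_upto k (\<lambda>x. (- 1) * (deriv g x * (inverse (g x) * inverse (g x))))"
    using Suc diff_upto_Suc[OF Suc.prems] by (intro diff_upto_mult diff_upto_const Suc.IH) auto
  ultimately show ?case using dv by (auto simp: real_differentiable_def)
qed (auto simp: assms)

lemma diff_upto_affine: "diff_upto k f \<Longrightarrow> diff_upto k (\<lambda>x. f (c * x + d))"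
proof (induction k arbitrary: f)
  have dv: "((\<lambda>x. f (c * x + d)) has_real_derivative deriv f (c * x + d) * c) (at x)"
    if "\<And>x. f differentiable at x" for f x
    by (rule DERIV_chain2[OF differentiable_deriv[OF that]]) (auto intro!: derivative_eq_intros)
  {
    case 0
    then have "((\<lambda>x. f (c * x + d)) has_real_derivative deriv f (c * x + d) * c) (at x)" for x
      using dv[of f] by simp
    then show ?case by (auto simp: real_differentiable_def)
  next
    case (Suc k)
    have d: "f differentiable at x" for x using Suc.prems by auto
    have "deriv (\<lambda>x. f (c * x + d)) = (\<lambda>x. deriv f (c * x + d) * c)"
      using dv[OF d] by (auto intro!: DERIV_imp_deriv)
    moreover have "diff_upto k (\<lambda>x. deriv f (c * x + d) * c)"
      using Suc by (intro diff_upto_mult diff_upto_const Suc.IH) auto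
    ultimately show ?case using dv[OF d] by (auto simp: real_differentiable_def)
  }
qed

text \<open>The classical flat function with a polynomial factor in 1/x. This factor makes the
  family closed under differentiation, P going to t^2 (P - P').\<close>

definition flat_exp :: "real poly \<Rightarrow> real \<Rightarrow> real" where
  "flat_exp P x = (if x \<le> 0 then 0 else poly P (1 / x) * exp (- (1 / x)))"

lemma poly_exp_tendsto_0: "((\<lambda>y. poly P y * exp (- y)) \<longlongrightarrow> (0::real)) at_top"
proof -
  have "((\<lambda>y. \<Sum>i\<le>degree P. coeff P i * (y ^ i / exp y)) \<longlongrightarrow> (\<Sum>i\<le>degree P. coeff P i * 0)) at_top"
    by (intro tendsto_sum tendsto_mult tendsto_const tendsto_power_div_exp_0)
  moreover have "(\<lambda>y. \<Sum>i\<le>degree P. coeff P i * (y ^ i / exp y)) = (\<lambda>y. poly P y * exp (- y))"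
    by (simp add: poly_altdef sum_distrib_right exp_minus divide_inverse mult.assoc)
  ultimately show ?thesis by simp
qed

text \<open>Away from 0 this is the chain rule. At 0 the right difference quotient is y P(y) exp(-y)
  with y = 1/h tending to infinity, and the left one is zero.\<close>

lemma flat_exp_deriv:
  "(flat_exp P has_real_derivative flat_exp ([:0, 0, 1:] * (P - pderiv P)) x) (at x)"
proof (cases "x = 0")
  case True
  have r: "((\<lambda>h. flat_exp P h / h) \<longlongrightarrow> 0) (at_right 0)"
  proof -
    have "((\<lambda>h. poly ([:0, 1:] * P) (inverse h) * exp (- inverse h)) \<longlongrightarrow> (0::real)) (at_right 0)"
      by (rule filterlim_compose[OF poly_exp_tendsto_0 filterlim_inverse_at_top_right])
    then show ?thesis
      by (rule Lim_transform_eventually)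
        (auto simp: eventually_at_right_field flat_exp_def divide_inverse mult_ac intro!: exI[of _ 1])
  qed
  have "((\<lambda>h. flat_exp P h / h) \<longlongrightarrow> 0) (at_left 0)"
    by (rule Lim_transform_eventually[OF tendsto_const])
      (auto simp: eventually_at_left_field flat_exp_def intro!: exI[of _ "-1"])
  then have "((\<lambda>h. flat_exp P h / h) \<longlongrightarrow> 0) (at 0)"
    using r by (simp add: filterlim_split_at)
  moreover have "flat_exp S 0 = 0" for S by (simp add: flat_exp_def)
  ultimately show ?thesis unfolding True DERIV_def by simp
next
  case False
  show ?thesis
  proof (cases "0 < x")
    case True
    have "((\<lambda>x. poly P (1 / x) * exp (- (1 / x))) has_real_derivative flat_exp ([:0, 0, 1:] * (P - pderiv P)) x) (at x)"
      using True by (auto simp: flat_exp_def field_simps power2_eq_square intro!: derivative_eq_intros DERIV_chain'[where g = "poly P", OF _ poly_DERIV])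
    then show ?thesis
      by (rule has_field_derivative_transform_within_open[of _ _ _ "{0<..}"]) (use True in \<open>auto simp: flat_exp_def\<close>)
  next
    case F: False
    have "((\<lambda>x. 0) has_real_derivative flat_exp ([:0, 0, 1:] * (P - pderiv P)) x) (at x)"
      using F by (simp add: flat_exp_def)
    then show ?thesis
      by (rule has_field_derivative_transform_within_open[of _ _ _ "{..<0}"]) (use F False in \<open>auto simp: flat_exp_def\<close>)
  qed
qed

lemma diff_upto_flat_exp: "diff_upto k (flat_exp P)"
proof (induction k arbitrary: P)
  case 0
  then show ?case using flat_exp_deriv by (auto simp: real_differentiable_def)
next
  case (Suc k)
  have "deriv (flat_exp P) = flat_exp ([:0, 0, 1:] * (P - pderiv P))"
    by (rule ext) (rule DERIV_imp_deriv[OF flat_exp_deriv])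
  then show ?case using Suc flat_exp_deriv by (auto simp: real_differentiable_def simp del: mult_pCons_left)
qed

text \<open>The quotient \<phi>(x) / (\<phi>(x) + \<phi>(1 - x)) for the flat function \<phi>; the
  denominator is positive since x > 0 or 1 - x > 0. The argument 1 - x is spelled in the form that
  \<open>diff_upto_affine\<close> produces.\<close>

definition smooth_step :: "real \<Rightarrow> real" where
  "smooth_step x = flat_exp 1 x * inverse (flat_exp 1 x + flat_exp 1 ((- 1) * x + 1))"

lemma flat_exp_1_pos: "0 < x \<Longrightarrow> 0 < flat_exp 1 x" and flat_exp_1_nonneg: "0 \<le> flat_exp 1 x"
  by (simp_all add: flat_exp_def)

lemma flat_exp_1_mono: "x \<le> y \<Longrightarrow> flat_exp 1 x \<le> flat_exp 1 y"
  by (auto simp: flat_exp_def frac_le)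

lemma smooth_step_denom: "0 < flat_exp 1 x + flat_exp 1 ((- 1) * x + 1)"
  using flat_exp_1_pos[of x] flat_exp_1_pos[of "(- 1) * x + 1"] flat_exp_1_nonneg[of x] flat_exp_1_nonneg[of "(- 1) * x + 1"]
  by (cases "0 < x") (auto intro: add_pos_nonneg add_nonneg_pos)

lemma diff_upto_smooth_step: "diff_upto k smooth_step"
proof -
  have a: "diff_upto k (\<lambda>x. flat_exp 1 ((- 1) * x + 1))" by (rule diff_upto_affine[OF diff_upto_flat_exp])
  have b: "diff_upto k (\<lambda>x. flat_exp 1 x + flat_exp 1 ((- 1) * x + 1))" by (rule diff_upto_add[OF diff_upto_flat_exp a])
  have c: "diff_upto k (\<lambda>x. inverse (flat_exp 1 x + flat_exp 1 ((- 1) * x + 1)))"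
    by (rule diff_upto_inverse[OF _ b]) (use smooth_step_denom in \<open>simp add: less_imp_neq[symmetric]\<close>)
  show ?thesis unfolding smooth_step_def[abs_def] by (rule diff_upto_mult[OF diff_upto_flat_exp c])
qed

lemma smooth_step_0: "x \<le> 0 \<Longrightarrow> smooth_step x = 0"
  by (simp add: smooth_step_def flat_exp_def)

lemma smooth_step_1: "1 \<le> x \<Longrightarrow> smooth_step x = 1"
proof -
  assume "1 \<le> x"
  then have "flat_exp 1 ((- 1) * x + 1) = 0" by (simp add: flat_exp_def)
  then show ?thesis using smooth_step_denom[of x] by (simp add: smooth_step_def)
qed

lemma smooth_step_mono: "x \<le> y \<Longrightarrow> smooth_step x \<le> smooth_step y"
proof -
  assume xy: "x \<le> y"
  let ?a = "flat_exp 1 x" and ?b = "flat_exp 1 ((- 1) * x + 1)" and ?c = "flat_exp 1 y" and ?d = "flat_exp 1 ((- 1) * y + 1)"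
  have "?a \<le> ?c" "?d \<le> ?b" "0 \<le> ?a" "0 \<le> ?d" using xy by (auto intro: flat_exp_1_mono flat_exp_1_nonneg)
  \<comment> \<open>Cross-multiplied form of a / (a + b) <= c / (c + d).\<close>
  then have "?a * ?d \<le> ?c * ?b" by (intro mult_mono) auto
  then show ?thesis
    using smooth_step_denom[of x] smooth_step_denom[of y]
    by (simp add: smooth_step_def divide_inverse[symmetric] divide_le_eq pos_le_divide_eq field_simps)
qed

section \<open>Weakly differentiable functions\<close>

text \<open>Fubini is applied to the completed measure; the countable cover for
  \<open>lborel\<close> serves it as well.\<close>

lemma sigma_finite_lebesgue: "sigma_finite_measure (lebesgue :: real measure)"
proof
  obtain A :: "real set set" where A0: "countable A \<and> A \<subseteq> sets lborel \<and> \<Union> A = space lborel \<and> (\<forall>a\<in>A. emeasure lborel a \<noteq> \<infinity>)"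
    using lborel.sigma_finite_countable[where 'a = real] by (rule exE)
  then have A: "countable A" "A \<subseteq> sets lborel" "\<Union> A = space lborel" "\<And>a. a \<in> A \<Longrightarrow> emeasure lborel a \<noteq> \<infinity>"
    by simp_all
  have "A \<subseteq> sets lebesgue" using A(2) by auto
  moreover have "emeasure lebesgue a \<noteq> \<infinity>" if "a \<in> A" for a
    using A(2) A(4)[OF that] that by (auto simp: subset_eq)
  ultimately show "\<exists>A. countable A \<and> A \<subseteq> sets lebesgue \<and> \<Union> A = space (lebesgue :: real measure) \<and> (\<forall>a\<in>A. emeasure lebesgue a \<noteq> \<infinity>)"
    using A(1,3) by (intro exI[of _ A]) (auto simp: space_completion)
qed

lemma set_integrable_mult_continuous:
  assumes g: "set_integrable lebesgue {a..b} g" and f: "continuous_on {a..b} f"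
  shows "set_integrable lebesgue {a..b} (\<lambda>x. g x * f (x::real) :: real)"
proof -
  have "f \<in> borel_measurable (lebesgue_on {a..b})" by (rule continuous_imp_measurable_on_sets_lebesgue[OF f]) simp
  moreover have "bounded (f ` {a..b})" by (rule compact_imp_bounded[OF compact_continuous_image[OF f compact_Icc]])
  ultimately have "set_integrable lebesgue {a..b} (\<lambda>x. f x * g x)"
    by (intro absolutely_integrable_bounded_measurable_product_real g) auto
  then show ?thesis by (simp add: mult.commute)
qed

lemma continuous_set_integrable:
  "continuous_on {a..b} f \<Longrightarrow> set_integrable lebesgue {a..b} (f :: real \<Rightarrow> real)"
  by (rule absolutely_integrable_continuous_real)

lemma continuous_set_integral:
  "continuous_on {a..b} f \<Longrightarrow> (LINT x:{a..b}|lebesgue. f x) = integral {a..b} (f :: real \<Rightarrow> real)"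
  by (rule set_lebesgue_integral_eq_integral(2)[OF continuous_set_integrable])

lemma set_integral_derivative:
  fixes \<phi> :: "real \<Rightarrow> real"
  assumes "a \<le> b" and d: "\<And>x. (\<phi> has_real_derivative \<phi>' x) (at x)" and c: "continuous_on UNIV \<phi>'"
  shows "(LINT x:{a..b}|lebesgue. \<phi>' x) = \<phi> b - \<phi> a"
proof -
  have "(\<phi>' has_integral (\<phi> b - \<phi> a)) {a..b}"
    by (rule fundamental_theorem_of_calculus[OF assms(1)])
      (use d in \<open>auto simp: has_real_derivative_iff_has_vector_derivative[symmetric] intro: DERIV_subset\<close>)
  then show ?thesis
    using continuous_set_integral[OF continuous_on_subset[OF c subset_UNIV]] by (simp add: integral_unique)
qed

text \<open>Fubini on the triangle a <= s <= x <= b: integrating \<phi>' over x first leaves g(s)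
  (\<phi>(b) - \<phi>(s)).\<close>

lemma integration_by_parts_primitive:
  fixes g \<phi> :: "real \<Rightarrow> real"
  assumes ab: "a \<le> b" and g: "set_integrable lebesgue {a..b} g"
    and d: "\<And>x. (\<phi> has_real_derivative \<phi>' x) (at x)" and c: "continuous_on UNIV \<phi>'"
  shows "(LINT x:{a..b}|lebesgue. (LINT s:{a..x}|lebesgue. g s) * \<phi>' x)
    = (LINT s:{a..b}|lebesgue. g s) * \<phi> b - (LINT s:{a..b}|lebesgue. g s * \<phi> s)"
proof -
  interpret sf: sigma_finite_measure "lebesgue :: real measure" by (rule sigma_finite_lebesgue)
  interpret pair_sigma_finite "lebesgue :: real measure" "lebesgue :: real measure" ..
  define A where "A = (\<lambda>s. indicator {a..b} s * g s)"
  define B where "B = (\<lambda>x. indicator {a..b} x * \<phi>' x)"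
  have A: "integrable lebesgue A" using g by (simp add: A_def set_integrable_def)
  have B: "integrable lebesgue B"
    using continuous_set_integrable[OF continuous_on_subset[OF c subset_UNIV], of a b] by (simp add: B_def set_integrable_def)
  have [measurable]: "A \<in> borel_measurable lebesgue" "B \<in> borel_measurable lebesgue" using A B by auto
  \<comment> \<open>Makes the condition s <= x measurable in the product of the completed
    measures.\<close>
  have [measurable]: "(\<lambda>x. x) \<in> borel_measurable (lebesgue :: real measure)" by (rule measurable_completion) simp
  have AB: "integrable (lebesgue \<Otimes>\<^sub>M lebesgue) (\<lambda>p. A (fst p) * B (snd p))"
  proof (rule Fubini_integrable)
    show "integrable lebesgue (\<lambda>x. \<integral>y. norm (A (fst (x, y)) * B (snd (x, y))) \<partial>lebesgue)"
      using A B by (simp add: abs_mult)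
    show "AE x in lebesgue. integrable lebesgue (\<lambda>y. A (fst (x, y)) * B (snd (x, y)))"
      using B by simp
  qed simp
  define G where "G = (\<lambda>s x. if s \<le> x then A s * B x else 0)"
  have G: "integrable (lebesgue \<Otimes>\<^sub>M lebesgue) (\<lambda>(s, x). G s x)"
  proof (rule Bochner_Integration.integrable_bound[OF AB])
    show "(\<lambda>(s, x). G s x) \<in> borel_measurable (lebesgue \<Otimes>\<^sub>M lebesgue)"
      unfolding G_def by measurable
  qed (auto simp: G_def)
  have i1: "(\<integral>s. G s x \<partial>lebesgue) = indicator {a..b} x *\<^sub>R ((LINT s:{a..x}|lebesgue. g s) * \<phi>' x)" for x
  proof (cases "x \<in> {a..b}")
    case True
    have "(\<integral>s. G s x \<partial>lebesgue) = (\<integral>s. (indicator {a..x} s *\<^sub>R g s) * \<phi>' x \<partial>lebesgue)"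
      by (rule Bochner_Integration.integral_cong) (use True in \<open>auto simp: G_def A_def B_def indicator_def\<close>)
    then show ?thesis using True by (simp add: set_lebesgue_integral_def)
  next
    case False
    then have "G s x = 0" for s by (simp add: G_def B_def)
    then show ?thesis using False by simp
  qed
  have i2: "(\<integral>x. G s x \<partial>lebesgue) = indicator {a..b} s *\<^sub>R (g s * (\<phi> b - \<phi> s))" for s
  proof (cases "s \<in> {a..b}")
    case True
    have "(\<integral>x. G s x \<partial>lebesgue) = (\<integral>x. g s * (indicator {s..b} x *\<^sub>R \<phi>' x) \<partial>lebesgue)"
      by (rule Bochner_Integration.integral_cong) (use True in \<open>auto simp: G_def A_def B_def indicator_def\<close>)
    also have "\<dots> = g s * (LINT x:{s..b}|lebesgue. \<phi>' x)" by (simp add: set_lebesgue_integral_def)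
    also have "\<dots> = g s * (\<phi> b - \<phi> s)" using set_integral_derivative[OF _ d c, of s b] True by simp
    finally show ?thesis using True by simp
  next
    case False
    then have "G s x = 0" for x by (simp add: G_def A_def)
    then show ?thesis using False by simp
  qed
  have c\<phi>: "continuous_on {a..b} \<phi>" using d by (meson DERIV_continuous_on DERIV_subset subset_UNIV)
  have "(LINT x:{a..b}|lebesgue. (LINT s:{a..x}|lebesgue. g s) * \<phi>' x) = (\<integral>x. \<integral>s. G s x \<partial>lebesgue \<partial>lebesgue)"
    unfolding i1 by (simp add: set_lebesgue_integral_def)
  also have "\<dots> = (\<integral>s. \<integral>x. G s x \<partial>lebesgue \<partial>lebesgue)" by (rule Fubini_integral[OF G])
  also have "\<dots> = (LINT s:{a..b}|lebesgue. g s * \<phi> b - g s * \<phi> s)"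
    unfolding i2 set_lebesgue_integral_def by (simp add: algebra_simps)
  also have "\<dots> = (LINT s:{a..b}|lebesgue. g s * \<phi> b) - (LINT s:{a..b}|lebesgue. g s * \<phi> s)"
    by (rule set_integral_diff) (use g set_integrable_mult_continuous[OF g c\<phi>] in auto)
  finally show ?thesis by simp
qed

lemma primitive_continuous:
  assumes "set_integrable lebesgue {a..b} (g :: real \<Rightarrow> real)"
  shows "continuous_on {a..b} (\<lambda>x. LINT s:{a..x}|lebesgue. g s)"
proof -
  have "(LINT s:{a..x}|lebesgue. g s) = integral {a..x} g" if "x \<in> {a..b}" for x
    by (rule set_lebesgue_integral_eq_integral(2)[OF set_integrable_subset[OF assms]]) (use that in auto)
  moreover have "continuous_on {a..b} (\<lambda>x. integral {a..x} g)"
    by (rule indefinite_integral_continuous_1[OF set_lebesgue_integral_eq_integral(1)[OF assms]])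
  ultimately show ?thesis
    using continuous_on_cong[of "{a..b}" "{a..b}" "\<lambda>x. LINT s:{a..x}|lebesgue. g s" "\<lambda>x. integral {a..x} g"] by blast
qed

text \<open>\<chi> is the product of an upward step on [u - e, u + e] and a downward step on
  [v - e, v + e]. Where one factor is constantly 1, the other decides the sign of the
  derivative.\<close>

lemma plateau_test_function:
  fixes u v e :: real
  assumes e: "0 < e" and uv: "u + e < v - e" and a: "a < u - e" and b: "v + e < b"
  obtains \<chi> where "test_function a b \<chi>" "\<And>x. (\<chi> has_real_derivative deriv \<chi> x) (at x)" "continuous_on UNIV (deriv \<chi>)"
    "\<And>x. x < v - e \<Longrightarrow> 0 \<le> deriv \<chi> x" "\<And>x. u + e < x \<Longrightarrow> deriv \<chi> x \<le> 0"
    "\<And>x. x < u - e \<or> (u + e < x \<and> x < v - e) \<or> v + e < x \<Longrightarrow> deriv \<chi> x = 0"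
    "\<chi> (u - e) = 0" "\<chi> (u + e) = 1" "\<chi> a = 0" "\<chi> b = 0"
proof -
  define p where "p = (\<lambda>x. smooth_step ((1 / (2 * e)) * x + (e - u) / (2 * e)))"
  define r where "r = (\<lambda>x. smooth_step ((- 1 / (2 * e)) * x + (v + e) / (2 * e)))"
  define \<chi> where "\<chi> = (\<lambda>x. p x * r x)"
  have pe: "p x = smooth_step ((x - u + e) / (2 * e))" for x
    unfolding p_def by (rule arg_cong[where f = smooth_step]) (use e in \<open>simp add: field_simps\<close>)
  have re: "r x = smooth_step ((v + e - x) / (2 * e))" for x
    unfolding r_def by (rule arg_cong[where f = smooth_step]) (use e in \<open>simp add: field_simps\<close>)
  have p0: "x \<le> u - e \<Longrightarrow> p x = 0" and p1: "u + e \<le> x \<Longrightarrow> p x = 1" for x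
    unfolding pe using e by (auto intro!: smooth_step_0 smooth_step_1 simp: divide_le_0_iff le_divide_eq)
  have r0: "v + e \<le> x \<Longrightarrow> r x = 0" and r1: "x \<le> v - e \<Longrightarrow> r x = 1" for x
    unfolding re using e by (auto intro!: smooth_step_0 smooth_step_1 simp: divide_le_0_iff le_divide_eq)
  have sm: "diff_upto k \<chi>" for k
    unfolding \<chi>_def p_def r_def by (rule diff_upto_mult; rule diff_upto_affine; rule diff_upto_smooth_step)
  have d: "(\<chi> has_real_derivative deriv \<chi> x) (at x)" for x
    by (rule differentiable_deriv[OF diff_upto_differentiable[OF sm]])
  have c: "continuous_on UNIV (deriv \<chi>)"
    using sm[of 1] by (auto intro!: continuous_at_imp_continuous_on differentiable_imp_continuous_within)
  have loc: "deriv \<chi> x = deriv h x" if "open S" "x \<in> S" "\<And>y. y \<in> S \<Longrightarrow> \<chi> y = h y" for S x h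
    by (rule deriv_cong_ev) (use that in \<open>auto intro: eventually_nhds_in_open simp: eventually_nhds\<close>)
  have const: "deriv \<chi> x = 0" if "open S" "x \<in> S" "\<And>y. y \<in> S \<Longrightarrow> \<chi> y = k" for S x k
    using loc[OF that(1,2), of "\<lambda>_. k"] that(3) by simp
  have "0 \<le> deriv \<chi> x" if x: "x < v - e" for x
  proof (rule ccontr)
    assume "\<not> 0 \<le> deriv \<chi> x"
    then obtain h where h: "0 < h" "\<And>t. 0 < t \<Longrightarrow> t < h \<Longrightarrow> \<chi> (x + t) < \<chi> x"
      using DERIV_neg_dec_right[OF d[of x]] by force
    \<comment> \<open>The increment stays left of v - e, where the falling factor is still 1, so
      only the rising factor changes.\<close>
    define t where "t = min (h / 2) (v - e - x)"
    have t: "0 < t" "t < h" "x + t \<le> v - e" using h x by (auto simp: t_def min_def)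
    have "p x \<le> p (x + t)" unfolding pe using e t by (intro smooth_step_mono divide_right_mono) auto
    then show False using h(2)[OF t(1,2)] r1[of x] r1[of "x + t"] t x by (simp add: \<chi>_def)
  qed
  moreover have "deriv \<chi> x \<le> 0" if x: "u + e < x" for x
  proof (rule ccontr)
    assume "\<not> deriv \<chi> x \<le> 0"
    then obtain h where h: "0 < h" "\<And>t. 0 < t \<Longrightarrow> t < h \<Longrightarrow> \<chi> x < \<chi> (x + t)"
      using DERIV_pos_inc_right[OF d[of x]] by force
    define t where "t = h / 2"
    have t: "0 < t" "t < h" using h by (auto simp: t_def)
    have "r (x + t) \<le> r x" unfolding re using e t by (intro smooth_step_mono divide_right_mono) auto
    then show False using h(2)[OF t(1,2)] p1[of x] p1[of "x + t"] t x by (simp add: \<chi>_def)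
  qed
  moreover have "deriv \<chi> x = 0" if x: "x < u - e \<or> (u + e < x \<and> x < v - e) \<or> v + e < x" for x
  proof -
    consider "x < u - e" | "u + e < x" "x < v - e" | "v + e < x" using x by blast
    then show ?thesis
    proof cases
      case 1
      then show ?thesis by (intro const[of "{..<u - e}" x 0]) (auto simp: \<chi>_def p0)
    next
      case 2
      then show ?thesis by (intro const[of "{u + e<..<v - e}" x 1]) (auto simp: \<chi>_def p1 r1)
    next
      case 3
      then show ?thesis by (intro const[of "{v + e<..}" x 0]) (auto simp: \<chi>_def r0)
    qed
  qed
  moreover have "test_function a b \<chi>"
    unfolding test_function_def
  proof
    show "\<forall>k. (deriv ^^ k) \<chi> differentiable_on UNIV"
      using diff_upto_funpow[OF sm] by (auto simp: differentiable_on_def)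
    have "{x. \<chi> x \<noteq> 0} \<subseteq> {u - e..v + e}"
    proof
      fix x assume "x \<in> {x. \<chi> x \<noteq> 0}"
      then have "p x \<noteq> 0" "r x \<noteq> 0" by (auto simp: \<chi>_def)
      then have "\<not> x \<le> u - e" "\<not> v + e \<le> x" using p0 r0 by blast+
      then show "x \<in> {u - e..v + e}" by simp
    qed
    then have "closure {x. \<chi> x \<noteq> 0} \<subseteq> {u - e..v + e}" by (rule closure_minimal) simp
    then show "closure {x. \<chi> x \<noteq> 0} \<subseteq> {a<..<b}" using a b by auto
  qed
  moreover have "\<chi> (u - e) = 0" "\<chi> (u + e) = 1" "\<chi> a = 0" "\<chi> b = 0"
    using p0[of "u - e"] p1[of "u + e"] r1[of "u + e"] p0[of a] r0[of b] a b uv by (simp_all add: \<chi>_def)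
  ultimately show thesis using that d c by blast
qed

text \<open>Against a plateau function, a continuous \<open>h\<close> with \<open>h u < h v\<close> would give an integrand of constant sign.\<close>

lemma weak_derivative_zero_decreasing:
  fixes h :: "real \<Rightarrow> real"
  assumes c: "continuous_on {a..b} h"
    and z: "\<And>\<chi>. test_function a b \<chi> \<Longrightarrow> continuous_on UNIV (deriv \<chi>) \<Longrightarrow> (\<And>x. (\<chi> has_real_derivative deriv \<chi> x) (at x))
      \<Longrightarrow> \<chi> b = 0 \<Longrightarrow> (LINT x:{a..b}|lebesgue. h x * deriv \<chi> x) = 0"
    and uv: "a < u" "u < v" "v < b"
  shows "h v \<le> h u"
proof (rule ccontr)
  assume "\<not> h v \<le> h u"
  then have lt: "h u < h v" by simp
  \<comment> \<open>The midpoint k separates the values of h near u from those near v, with room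
    \<open>\<delta>\<close> on either side.\<close>
  define k where "k = (h u + h v) / 2"
  define \<delta> where "\<delta> = (h v - h u) / 2"
  have \<delta>: "0 < \<delta>" using lt by (simp add: \<delta>_def)
  have "u \<in> {a..b}" "v \<in> {a..b}" using uv by auto
  note uv' = this
  obtain d1 where d1: "0 < d1" "\<And>x. x \<in> {a..b} \<Longrightarrow> dist x u < d1 \<Longrightarrow> dist (h x) (h u) < \<delta>"
    using c[unfolded continuous_on_iff, rule_format, OF uv'(1) \<delta>] by blast
  obtain d2 where d2: "0 < d2" "\<And>x. x \<in> {a..b} \<Longrightarrow> dist x v < d2 \<Longrightarrow> dist (h x) (h v) < \<delta>"
    using c[unfolded continuous_on_iff, rule_format, OF uv'(2) \<delta>] by blast
  define e where "e = min (min d1 d2) (min (u - a) (min (v - u) (b - v))) / 3"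
  have e0: "0 < e" using d1(1) d2(1) uv by (simp add: e_def)
  have "3 * e \<le> d1" "3 * e \<le> d2" "3 * e \<le> u - a" "3 * e \<le> v - u" "3 * e \<le> b - v"
    unfolding e_def by (simp_all add: min_le_iff_disj)
  then have e: "0 < e" "e < d1" "e < d2" "e < u - a" "2 * e < v - u" "e < b - v" using e0 by linarith+
  have e': "u + e < v - e" "a < u - e" "v + e < b" using e by linarith+
  obtain \<chi> where \<chi>: "test_function a b \<chi>" "\<And>x. (\<chi> has_real_derivative deriv \<chi> x) (at x)" "continuous_on UNIV (deriv \<chi>)"
    "\<And>x. x < v - e \<Longrightarrow> 0 \<le> deriv \<chi> x" "\<And>x. u + e < x \<Longrightarrow> deriv \<chi> x \<le> 0"
    "\<And>x. x < u - e \<or> (u + e < x \<and> x < v - e) \<or> v + e < x \<Longrightarrow> deriv \<chi> x = 0"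
    "\<chi> (u - e) = 0" "\<chi> (u + e) = 1" "\<chi> a = 0" "\<chi> b = 0"
    by (rule plateau_test_function[OF e0 e'], rule that)
  have hu: "h x < k" if "u - e \<le> x" "x \<le> u + e" for x
  proof -
    have "x \<in> {a..b}" "dist x u < d1" using that e uv unfolding dist_real_def by (simp_all add: abs_less_iff)
    then have "\<bar>h x - h u\<bar> < \<delta>" using d1(2) by (simp add: dist_real_def)
    moreover have "h u + \<delta> = k" by (simp add: \<delta>_def k_def field_simps)
    ultimately show ?thesis by linarith
  qed
  have hv: "k < h x" if "v - e \<le> x" "x \<le> v + e" for x
  proof -
    have "x \<in> {a..b}" "dist x v < d2" using that e uv unfolding dist_real_def by (simp_all add: abs_less_iff)
    then have "\<bar>h x - h v\<bar> < \<delta>" using d2(2) by (simp add: dist_real_def)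
    moreover have "h v - \<delta> = k" by (simp add: \<delta>_def k_def field_simps)
    ultimately show ?thesis by linarith
  qed
  have cd: "continuous_on {a..b} (deriv \<chi>)" by (rule continuous_on_subset[OF \<chi>(3)]) simp
  \<comment> \<open>Near u one has k - h > 0 and \<chi>' >= 0, near v both signs are reversed, and
    elsewhere \<chi>' = 0; so F >= 0. Subtracting from the constant k costs nothing because \<chi>'
    has integral zero.\<close>
  define F where "F = (\<lambda>x. (k - h x) * deriv \<chi> x)"
  have cF: "continuous_on {a..b} F" unfolding F_def by (intro continuous_intros c cd)
  have Fpos: "0 \<le> F x" for x
  proof -
    consider "deriv \<chi> x = 0" | "u - e \<le> x" "x \<le> u + e" | "v - e \<le> x" "x \<le> v + e"
      using \<chi>(6)[of x] by linarith
    then show ?thesis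
    proof cases
      case 2
      then show ?thesis using hu[of x] \<chi>(4)[of x] e by (simp add: F_def)
    next
      case 3
      then show ?thesis using hv[of x] \<chi>(5)[of x] e by (simp add: F_def mult_nonpos_nonpos)
    qed (simp add: F_def)
  qed
  have "(LINT x:{a..b}|lebesgue. F x) = k * (LINT x:{a..b}|lebesgue. deriv \<chi> x) - (LINT x:{a..b}|lebesgue. h x * deriv \<chi> x)"
  proof -
    have "(LINT x:{a..b}|lebesgue. F x) = (LINT x:{a..b}|lebesgue. k * deriv \<chi> x - h x * deriv \<chi> x)"
      by (simp add: F_def left_diff_distrib)
    also have "\<dots> = (LINT x:{a..b}|lebesgue. k * deriv \<chi> x) - (LINT x:{a..b}|lebesgue. h x * deriv \<chi> x)"
      by (rule set_integral_diff) (intro continuous_set_integrable continuous_intros c cd)+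
    finally show ?thesis by simp
  qed
  also have "\<dots> = 0"
    using set_integral_derivative[OF _ \<chi>(2,3), of a b] z[OF \<chi>(1,3,2,10)] \<chi>(9,10) uv by simp
  finally have "integral {a..b} F = 0" using continuous_set_integral[OF cF] by simp
  then have F0: "(F has_integral 0) (cbox a b)"
    using integrable_integral[OF integrable_continuous_real[OF cF]] by simp
  \<comment> \<open>A continuous nonnegative function with integral zero vanishes, so \<chi>' = 0
    around u although \<chi> rises there from 0 to 1.\<close>
  have Fz: "F x = 0" if "x \<in> {a..b}" for x
    by (rule has_integral_0_cbox_imp_0[of a b F x]) (use cF Fpos F0 that uv in \<open>auto simp: box_real\<close>)
  have "deriv \<chi> x = 0" if "x \<in> {u - e..u + e}" for x
    using Fz[of x] hu[of x] that e uv by (auto simp: F_def)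
  then have "(LINT x:{u - e..u + e}|lebesgue. deriv \<chi> x) = 0"
    unfolding set_lebesgue_integral_def by (intro integral_eq_zero_AE AE_I2) (auto simp: indicator_def)
  then show False
    using set_integral_derivative[OF _ \<chi>(2,3), of "u - e" "u + e"] \<chi>(7,8) e by simp
qed

text \<open>The du Bois-Reymond lemma: f minus the primitive of g has weak derivative zero. The
  preceding monotonicity, applied to this difference and to its negative, makes it constant on the
  open interval, and continuity reaches the endpoints.\<close>

lemma weak_derivative_primitive:
  fixes f g :: "real \<Rightarrow> real"
  assumes ab: "a < b" and f: "continuous_on {a..b} f" and g: "set_integrable lebesgue {a..b} g"
    and w: "weak_derivative_on a b f g" and x: "x \<in> {a..b}"
  shows "f x = f a + (LINT s:{a..x}|lebesgue. g s)"
proof -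
  define F where "F = (\<lambda>x. LINT s:{a..x}|lebesgue. g s)"
  have cF: "continuous_on {a..b} F" unfolding F_def by (rule primitive_continuous[OF g])
  define h where "h = (\<lambda>x. f x - F x)"
  have ch: "continuous_on {a..b} h" unfolding h_def by (intro continuous_intros f cF)
  have z: "(LINT x:{a..b}|lebesgue. h x * deriv \<chi> x) = 0"
    if t: "test_function a b \<chi>" and c: "continuous_on UNIV (deriv \<chi>)" and d: "\<And>x. (\<chi> has_real_derivative deriv \<chi> x) (at x)"
      and b: "\<chi> b = 0" for \<chi>
  proof -
    have cd: "continuous_on {a..b} (deriv \<chi>)" by (rule continuous_on_subset[OF c]) simp
    have "(LINT x:{a..b}|lebesgue. h x * deriv \<chi> x) = (LINT x:{a..b}|lebesgue. f x * deriv \<chi> x - F x * deriv \<chi> x)"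
      by (simp add: h_def left_diff_distrib)
    also have "\<dots> = (LINT x:{a..b}|lebesgue. f x * deriv \<chi> x) - (LINT x:{a..b}|lebesgue. F x * deriv \<chi> x)"
      by (rule set_integral_diff) (intro continuous_set_integrable continuous_intros f cF cd)+
    also have "(LINT x:{a..b}|lebesgue. f x * deriv \<chi> x) = - (LINT x:{a..b}|lebesgue. g x * \<chi> x)"
      using w t by (simp add: weak_derivative_on_def)
    also have "(LINT x:{a..b}|lebesgue. F x * deriv \<chi> x) = - (LINT x:{a..b}|lebesgue. g x * \<chi> x)"
      unfolding F_def using integration_by_parts_primitive[OF less_imp_le[OF ab] g d c] b by simp
    finally show ?thesis by simp
  qed
  have z': "(LINT x:{a..b}|lebesgue. - h x * deriv \<chi> x) = 0"
    if "test_function a b \<chi>" "continuous_on UNIV (deriv \<chi>)" "\<And>x. (\<chi> has_real_derivative deriv \<chi> x) (at x)" "\<chi> b = 0" for \<chi>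
  proof -
    have "(LINT x:{a..b}|lebesgue. h x * deriv \<chi> x) = 0" by (rule z[OF that])
    then show ?thesis by (simp add: set_lebesgue_integral_def)
  qed
  have eq: "h u = h v" if uv: "a < u" "u < v" "v < b" for u v
  proof (rule antisym)
    show "h v \<le> h u"
      by (rule weak_derivative_zero_decreasing[of a b h, OF ch _ uv]) (rule z)
    have "- h v \<le> - h u"
      by (rule weak_derivative_zero_decreasing[of a b "\<lambda>x. - h x", OF continuous_on_minus[OF ch] _ uv]) (rule z')
    then show "h u \<le> h v" by simp
  qed
  define k where "k = h ((a + b) / 2)"
  have hk: "h y = k" if y: "y \<in> {a<..<b}" for y
  proof -
    consider "y < (a + b) / 2" | "y = (a + b) / 2" | "(a + b) / 2 < y" by linarith
    then show ?thesis
    proof cases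
      case 1
      then show ?thesis unfolding k_def by (rule eq[rotated]) (use y ab in simp_all)
    next
      case 3
      then show ?thesis unfolding k_def by (rule eq[symmetric, rotated]) (use y ab in simp_all)
    next
      case 2
      then show ?thesis by (simp only: k_def)
    qed
  qed
  have cl: "closure {a<..<b} = {a..b}" using ab by simp
  have k: "h y = k" if "y \<in> {a..b}" for y
    by (rule continuous_constant_on_closure[of "{a<..<b}" h k y]) (use cl ch hk that in simp_all)
  have "h x = h a" using k[OF x] k[of a] ab by simp
  moreover have "F a = 0"
    unfolding F_def using ab by (subst set_lebesgue_integral_eq_integral(2)[OF set_integrable_subset[OF g]]) auto
  ultimately show ?thesis by (simp add: h_def F_def)
qed

section \<open>Square integrable functions\<close>

lemma square_integrable_mult:
  assumes "square_integrable_on S f" "square_integrable_on S g"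
  shows "set_integrable lebesgue S (\<lambda>x. f x * g x)"
  unfolding set_integrable_def
proof (rule Bochner_Integration.integrable_bound)
  have F: "(\<lambda>x. indicator S x *\<^sub>R f x) \<in> borel_measurable lebesgue" "(\<lambda>x. indicator S x *\<^sub>R g x) \<in> borel_measurable lebesgue"
    using assms by (auto simp: square_integrable_on_def set_borel_measurable_def)
  have "(\<lambda>x. indicator S x *\<^sub>R (f x * g x)) = (\<lambda>x. (indicator S x *\<^sub>R f x) * (indicator S x *\<^sub>R g x))"
    by (auto simp: indicator_def)
  then show "(\<lambda>x. indicator S x *\<^sub>R (f x * g x)) \<in> borel_measurable lebesgue"
    using borel_measurable_times[OF F] by simp
  show "integrable lebesgue (\<lambda>x. indicator S x *\<^sub>R (f x)\<^sup>2 + indicator S x *\<^sub>R (g x)\<^sup>2)"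
    using assms by (auto simp: square_integrable_on_def set_integrable_def)
  have "\<bar>f x * g x\<bar> \<le> (f x)\<^sup>2 + (g x)\<^sup>2" for x
  proof -
    have "2 * \<bar>f x\<bar> * \<bar>g x\<bar> \<le> (f x)\<^sup>2 + (g x)\<^sup>2" using sum_squares_bound[of "\<bar>f x\<bar>" "\<bar>g x\<bar>"] by simp
    moreover have "0 \<le> \<bar>f x\<bar> * \<bar>g x\<bar>" by simp
    ultimately show ?thesis unfolding abs_mult by linarith
  qed
  then show "AE x in lebesgue. norm (indicator S x *\<^sub>R (f x * g x)) \<le> norm (indicator S x *\<^sub>R (f x)\<^sup>2 + indicator S x *\<^sub>R (g x)\<^sup>2)"
    by (auto simp: indicator_def)
qed

lemma square_integrable_scale: 
  assumes "square_integrable_on S f"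
  shows "square_integrable_on S (\<lambda>x. c * f x)"
proof -
  have "(\<lambda>x. indicator S x *\<^sub>R (c * f x)) = (\<lambda>x. c * (indicator S x *\<^sub>R f x))" by auto
  then show ?thesis
    using assms by (auto simp: square_integrable_on_def set_borel_measurable_def power_mult_distrib)
qed

lemma square_integrable_add:
  assumes f: "square_integrable_on S f" and g: "square_integrable_on S g"
  shows "square_integrable_on S (\<lambda>x. f x + g x)"
  unfolding square_integrable_on_def
proof
  have "(\<lambda>x. indicator S x *\<^sub>R (f x + g x)) = (\<lambda>x. indicator S x *\<^sub>R f x + indicator S x *\<^sub>R g x)"
    by (auto simp: distrib_left)
  then show "set_borel_measurable lebesgue S (\<lambda>x. f x + g x)"
    using f g by (auto simp: square_integrable_on_def set_borel_measurable_def)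
  have "(\<lambda>x. (f x + g x)\<^sup>2) = (\<lambda>x. (f x * f x + g x * g x) + 2 * (f x * g x))"
    by (auto simp: power2_eq_square algebra_simps)
  moreover have "set_integrable lebesgue S (\<lambda>x. (f x * f x + g x * g x) + 2 * (f x * g x))"
    by (intro set_integral_add set_integrable_mult_right square_integrable_mult f g)
  ultimately show "set_integrable lebesgue S (\<lambda>x. (f x + g x)\<^sup>2)" by simp
qed

lemma square_integrable_zero: "square_integrable_on S (\<lambda>x. 0)"
  by (simp add: square_integrable_on_def set_borel_measurable_def set_integrable_def)

lemma square_integrable_sum:
  assumes "\<And>i. i \<in> I \<Longrightarrow> square_integrable_on S (f i)"
  shows "square_integrable_on S (\<lambda>x. \<Sum>i\<in>I. f i x)"
  using assms
  by (induction I rule: infinite_finite_induct) (auto intro: square_integrable_zero square_integrable_add)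

lemma square_integrable_cong:
  assumes "\<And>x. x \<in> S \<Longrightarrow> f x = g x"
  shows "square_integrable_on S f \<longleftrightarrow> square_integrable_on S g"
proof -
  have "(\<lambda>x. indicator S x *\<^sub>R f x) = (\<lambda>x. indicator S x *\<^sub>R g x)"
    "(\<lambda>x. indicator S x *\<^sub>R (f x)\<^sup>2) = (\<lambda>x. indicator S x *\<^sub>R (g x)\<^sup>2)"
    using assms by (auto simp: indicator_def)
  then show ?thesis by (simp add: square_integrable_on_def set_borel_measurable_def set_integrable_def)
qed

lemma square_integrable_continuous:
  assumes "continuous_on {a..b} (f :: real \<Rightarrow> real)"
  shows "square_integrable_on {a..b} f"
  unfolding square_integrable_on_def
proof
  have "integrable lebesgue (\<lambda>x. indicator {a..b} x *\<^sub>R f x)"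
    using continuous_set_integrable[OF assms] by (simp add: set_integrable_def)
  then show "set_borel_measurable lebesgue {a..b} f" unfolding set_borel_measurable_def by (rule borel_measurable_integrable)
  show "set_integrable lebesgue {a..b} (\<lambda>x. (f x)\<^sup>2)"
    by (rule continuous_set_integrable) (intro continuous_intros assms)
qed

lemma square_integrable_integrable:
  assumes "square_integrable_on {a..b} f"
  shows "set_integrable lebesgue {a..b} f"
  using square_integrable_mult[OF assms square_integrable_continuous[OF continuous_on_const, of _ _ 1]] by simp

lemma set_integral_mult_sum_left:
  assumes "\<And>i. i \<in> I \<Longrightarrow> square_integrable_on S (f i)" "square_integrable_on S g"
  shows "(LINT x:S|lebesgue. (\<Sum>i\<in>I. c i * f i x) * g x) = (\<Sum>i\<in>I. c i * (LINT x:S|lebesgue. f i x * g x))"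
proof -
  have i: "integrable lebesgue (\<lambda>x. c i * (indicator S x *\<^sub>R (f i x * g x)))" if "i \<in> I" for i
    using square_integrable_mult[OF assms(1)[OF that] assms(2)] by (simp add: set_integrable_def)
  have "(LINT x:S|lebesgue. (\<Sum>i\<in>I. c i * f i x) * g x) = (\<integral>x. (\<Sum>i\<in>I. c i * (indicator S x *\<^sub>R (f i x * g x))) \<partial>lebesgue)"
    unfolding set_lebesgue_integral_def
    by (rule Bochner_Integration.integral_cong) (auto simp: sum_distrib_right sum_distrib_left mult_ac)
  also have "\<dots> = (\<Sum>i\<in>I. \<integral>x. c i * (indicator S x *\<^sub>R (f i x * g x)) \<partial>lebesgue)"
    by (rule Bochner_Integration.integral_sum[OF i])
  finally show ?thesis by (simp add: set_lebesgue_integral_def)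
qed

section \<open>Gram matrices\<close>

lemma L2_on_mult_mat:
  assumes A: "A \<in> carrier_mat k' k" and u: "L2_on S k u"
  shows "L2_on S k' (\<lambda>t. A *\<^sub>v u t)"
  unfolding L2_on_def
proof (intro conjI ballI allI impI)
  show "A *\<^sub>v u t \<in> carrier_vec k'" if "t \<in> S" for t
    using mult_mat_vec_carrier[OF A] u that by (auto simp: L2_on_def)
  fix j assume j: "j < k'"
  have "square_integrable_on S (\<lambda>t. \<Sum>i\<in>{0..<k}. A $$ (j, i) * u t $ i)"
    by (rule square_integrable_sum, rule square_integrable_scale) (use u in \<open>auto simp: L2_on_def\<close>)
  moreover have "(A *\<^sub>v u t) $ j = (\<Sum>i\<in>{0..<k}. A $$ (j, i) * u t $ i)" if "t \<in> S" for t
    using A j u that by (auto simp: L2_on_def scalar_prod_def)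
  ultimately show "square_integrable_on S (\<lambda>t. (A *\<^sub>v u t) $ j)"
    using square_integrable_cong[of S "\<lambda>t. (A *\<^sub>v u t) $ j"] by simp
qed

lemma L2_on_minus:
  assumes u: "L2_on S k u" and v: "L2_on S k v"
  shows "L2_on S k (\<lambda>t. u t - v t)"
  unfolding L2_on_def
proof (intro conjI ballI allI impI)
  show "u t - v t \<in> carrier_vec k" if "t \<in> S" for t using u v that by (auto simp: L2_on_def)
  fix j assume j: "j < k"
  have "square_integrable_on S (\<lambda>t. u t $ j + (- 1) * v t $ j)"
    by (rule square_integrable_add, use u j in \<open>simp add: L2_on_def\<close>, rule square_integrable_scale)
      (use v j in \<open>simp add: L2_on_def\<close>)
  moreover have "(u t - v t) $ j = u t $ j + (- 1) * v t $ j" if "t \<in> S" for t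
    using u v j that by (auto simp: L2_on_def)
  ultimately show "square_integrable_on S (\<lambda>t. (u t - v t) $ j)"
    using square_integrable_cong[of S "\<lambda>t. (u t - v t) $ j"] by simp
qed

lemma L2_on_append:
  assumes u: "L2_on S k u" and v: "L2_on S l v"
  shows "L2_on S (k + l) (\<lambda>t. u t @\<^sub>v v t)"
  unfolding L2_on_def
proof (intro conjI ballI allI impI)
  show "u t @\<^sub>v v t \<in> carrier_vec (k + l)" if "t \<in> S" for t using u v that by (auto simp: L2_on_def)
  fix j assume j: "j < k + l"
  have "(u t @\<^sub>v v t) $ j = (if j < k then u t $ j else v t $ (j - k))" if "t \<in> S" for t
  proof -
    have "dim_vec (u t) = k" "dim_vec (v t) = l" using u v that by (auto simp: L2_on_def)
    then show ?thesis using j by simp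
  qed
  moreover have "square_integrable_on S (\<lambda>t. if j < k then u t $ j else v t $ (j - k))"
    using u v j by (cases "j < k") (auto simp: L2_on_def)
  ultimately show "square_integrable_on S (\<lambda>t. (u t @\<^sub>v v t) $ j)"
    using square_integrable_cong[of S "\<lambda>t. (u t @\<^sub>v v t) $ j"] by simp
qed

lemma set_integral_cong:
  assumes "\<And>x. x \<in> S \<Longrightarrow> f x = g x"
  shows "(LINT x:S|M. f x) = (LINT x:S|M. (g x :: real))"
  unfolding set_lebesgue_integral_def
  by (rule Bochner_Integration.integral_cong) (use assms in \<open>auto simp: indicator_def\<close>)

lemma gram_mult_left:
  assumes A: "A \<in> carrier_mat k' k" and u: "L2_on S k u" and v: "L2_on S l v"
  shows "gram S k' l (\<lambda>t. A *\<^sub>v u t) v = A * gram S k l u v"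
proof (rule eq_matI)
  fix i j assume "i < dim_row (A * gram S k l u v)" "j < dim_col (A * gram S k l u v)"
  then have ij: "i < k'" "j < l" using A by (auto simp: gram_def)
  have "gram S k' l (\<lambda>t. A *\<^sub>v u t) v $$ (i, j) = (LINT t:S|lebesgue. (A *\<^sub>v u t) $ i * v t $ j)"
    using ij by (simp add: gram_def)
  also have "\<dots> = (LINT t:S|lebesgue. (\<Sum>b\<in>{0..<k}. A $$ (i, b) * u t $ b) * v t $ j)"
  proof (rule set_integral_cong)
    fix t assume "t \<in> S"
    then have "dim_vec (u t) = k" using u by (auto simp: L2_on_def)
    then show "(A *\<^sub>v u t) $ i * v t $ j = (\<Sum>b\<in>{0..<k}. A $$ (i, b) * u t $ b) * v t $ j"
      using A ij by (simp add: scalar_prod_def)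
  qed
  also have "\<dots> = (\<Sum>b\<in>{0..<k}. A $$ (i, b) * (LINT t:S|lebesgue. u t $ b * v t $ j))"
    by (rule set_integral_mult_sum_left) (use u v ij in \<open>auto simp: L2_on_def\<close>)
  also have "\<dots> = (A * gram S k l u v) $$ (i, j)"
    using A ij by (simp add: gram_def scalar_prod_def)
  finally show "gram S k' l (\<lambda>t. A *\<^sub>v u t) v $$ (i, j) = (A * gram S k l u v) $$ (i, j)" .
qed (use A in \<open>auto simp: gram_def\<close>)

lemma gram_transpose: "(gram S k l u v)\<^sup>T = gram S l k v u"
  by (rule eq_matI) (auto simp: gram_def mult.commute)

lemma gram_carrier_mat: "gram S a b u v \<in> carrier_mat a b"
  by (simp add: gram_def)

lemma gram_mult_right:
  assumes B: "B \<in> carrier_mat l' l" and u: "L2_on S k u" and v: "L2_on S l v"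
  shows "gram S k l' u (\<lambda>t. B *\<^sub>v v t) = gram S k l u v * B\<^sup>T"
proof -
  have "gram S k l' u (\<lambda>t. B *\<^sub>v v t) = (gram S l' k (\<lambda>t. B *\<^sub>v v t) u)\<^sup>T" by (rule gram_transpose[symmetric])
  also have "\<dots> = (B * gram S l k v u)\<^sup>T" by (simp only: gram_mult_left[OF B v u])
  also have "\<dots> = (gram S l k v u)\<^sup>T * B\<^sup>T" by (rule transpose_mult[OF B gram_carrier_mat])
  finally show ?thesis by (simp only: gram_transpose)
qed

lemma gram_minus_left:
  assumes u: "L2_on S k u" and u': "L2_on S k u'" and v: "L2_on S l v"
  shows "gram S k l (\<lambda>t. u t - u' t) v = gram S k l u v - gram S k l u' v"
proof (rule eq_matI)
  fix i j assume "i < dim_row (gram S k l u v - gram S k l u' v)" "j < dim_col (gram S k l u v - gram S k l u' v)"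
  then have ij: "i < k" "j < l" by (auto simp: gram_def)
  have "(LINT t:S|lebesgue. (u t - u' t) $ i * v t $ j) = (LINT t:S|lebesgue. u t $ i * v t $ j - u' t $ i * v t $ j)"
    by (rule set_integral_cong) (use u u' ij in \<open>auto simp: L2_on_def left_diff_distrib\<close>)
  also have "\<dots> = (LINT t:S|lebesgue. u t $ i * v t $ j) - (LINT t:S|lebesgue. u' t $ i * v t $ j)"
    by (rule set_integral_diff; rule square_integrable_mult) (use u u' v ij in \<open>auto simp: L2_on_def\<close>)
  finally show "gram S k l (\<lambda>t. u t - u' t) v $$ (i, j) = (gram S k l u v - gram S k l u' v) $$ (i, j)"
    using ij by (simp add: gram_def)
qed (auto simp: gram_def)

lemma gram_cong:
  assumes "\<And>t. t \<in> S \<Longrightarrow> u t = u' t" "\<And>t. t \<in> S \<Longrightarrow> v t = v' t"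
  shows "gram S k l u v = gram S k l u' v'"
proof (rule eq_matI)
  fix i j assume "i < dim_row (gram S k l u' v')" "j < dim_col (gram S k l u' v')"
  moreover have "(LINT t:S|lebesgue. u t $ i * v t $ j) = (LINT t:S|lebesgue. u' t $ i * v' t $ j)"
    by (rule set_integral_cong) (simp add: assms)
  ultimately show "gram S k l u v $$ (i, j) = gram S k l u' v' $$ (i, j)" by (simp add: gram_def)
qed (auto simp: gram_def)

text \<open>The Gram matrix of B g is B G B^T; surjectivity of B makes B^T injective, which keeps
  the form positive.\<close>

lemma pos_def_gram_image:
  assumes G: "pos_def (gram S k k g g)" and g: "L2_on S k g" and B: "B \<in> carrier_mat k' k"
    and surj: "\<And>x. x \<in> carrier_vec k' \<Longrightarrow> \<exists>y\<in>carrier_vec k. B *\<^sub>v y = x"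
    and u: "\<And>t. t \<in> S \<Longrightarrow> u t = B *\<^sub>v g t"
  shows "pos_def (gram S k' k' u u)"
proof (rule pos_defI[where n = k'])
  let ?G = "gram S k k g g"
  have BT: "B\<^sup>T \<in> carrier_mat k k'" using B by simp
  have "gram S k' k' u u = gram S k' k' (\<lambda>t. B *\<^sub>v g t) (\<lambda>t. B *\<^sub>v g t)" by (rule gram_cong) (simp_all add: u)
  also have "\<dots> = B * gram S k k' g (\<lambda>t. B *\<^sub>v g t)" by (rule gram_mult_left[OF B g L2_on_mult_mat[OF B g]])
  also have "\<dots> = B * (?G * B\<^sup>T)" by (simp only: gram_mult_right[OF B g g])
  finally have eq: "gram S k' k' u u = B * (?G * B\<^sup>T)" .
  show "sym_mat k' (gram S k' k' u u)" unfolding sym_mat_def by (simp only: gram_transpose gram_carrier_mat)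
  fix x :: "real vec" assume x: "x \<in> carrier_vec k'" "x \<noteq> 0\<^sub>v k'"
  have Bx: "B\<^sup>T *\<^sub>v x \<in> carrier_vec k" by (rule mult_mat_vec_carrier[OF BT x(1)])
  have GB: "?G * B\<^sup>T \<in> carrier_mat k k'" by (rule mult_carrier_mat[OF gram_carrier_mat BT])
  have "gram S k' k' u u *\<^sub>v x = B *\<^sub>v (?G *\<^sub>v (B\<^sup>T *\<^sub>v x))"
    unfolding eq assoc_mult_mat_vec[OF B GB x(1)] assoc_mult_mat_vec[OF gram_carrier_mat BT x(1)] by (rule refl)
  then have "x \<bullet> (gram S k' k' u u *\<^sub>v x) = (B\<^sup>T *\<^sub>v x) \<bullet> (?G *\<^sub>v (B\<^sup>T *\<^sub>v x))"
    using transpose_vec_mult_scalar[OF B mult_mat_vec_carrier[OF gram_carrier_mat Bx] x(1)] by simp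
  moreover have "B\<^sup>T *\<^sub>v x \<noteq> 0\<^sub>v k"
  proof
    assume z: "B\<^sup>T *\<^sub>v x = 0\<^sub>v k"
    obtain y where y: "y \<in> carrier_vec k" "B *\<^sub>v y = x" using surj[OF x(1)] by auto
    have "x \<bullet> x = (B\<^sup>T *\<^sub>v x) \<bullet> y" using transpose_vec_mult_scalar[OF B y(1) x(1)] y(2) by simp
    then have "x \<bullet> x = 0" using z y(1) by simp
    then show False using scalar_prod_self_eq_0_iff[OF x(1)] x(2) by simp
  qed
  ultimately show "0 < x \<bullet> (gram S k' k' u u *\<^sub>v x)"
    using pos_def_pos[OF G gram_carrier_mat Bx] by simp
qed

text \<open>The integral of \<open>z \<bullet> R z\<close> for the residual \<open>z\<close> of the orthogonal projection is nonnegative.\<close>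

lemma bessel_inequality:
  fixes k n :: nat and u :: "nat \<Rightarrow> real \<Rightarrow> real" and y :: "real \<Rightarrow> real vec"
  assumes u: "\<And>i. i < k \<Longrightarrow> square_integrable_on {a..b} (u i)"
    and on: "\<And>i j. i < k \<Longrightarrow> j < k \<Longrightarrow> (LINT t:{a..b}|lebesgue. u i t * u j t) = (if i = j then 1 else 0)"
    and y: "\<And>j. j < n \<Longrightarrow> continuous_on {a..b} (\<lambda>t. y t $ j)" "\<And>t. t \<in> {a..b} \<Longrightarrow> y t \<in> carrier_vec n"
    and R: "R \<in> carrier_mat n n" "\<And>x. x \<in> carrier_vec n \<Longrightarrow> 0 \<le> x \<bullet> (R *\<^sub>v x)"
  shows "(\<Sum>i\<in>{0..<k}. vec n (\<lambda>j. LINT t:{a..b}|lebesgue. u i t * y t $ j) \<bullet> (R *\<^sub>v vec n (\<lambda>j. LINT t:{a..b}|lebesgue. u i t * y t $ j)))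
    \<le> (LINT t:{a..b}|lebesgue. y t \<bullet> (R *\<^sub>v y t))"
proof -
  let ?I = "{a..b}"
  define c where "c = (\<lambda>i j. LINT t:?I|lebesgue. u i t * y t $ j)"
  define z where "z = (\<lambda>t j. y t $ j + (\<Sum>i\<in>{0..<k}. - c i j * u i t))"
  have ys: "square_integrable_on ?I (\<lambda>t. y t $ j)" if "j < n" for j
    by (rule square_integrable_continuous[OF y(1)[OF that]])
  have ps: "square_integrable_on ?I (\<lambda>t. \<Sum>i\<in>{0..<k}. - c i j * u i t)" for j
    by (rule square_integrable_sum, rule square_integrable_scale) (use u in auto)
  have zs: "square_integrable_on ?I (\<lambda>t. z t j)" if "j < n" for j
    unfolding z_def by (rule square_integrable_add[OF ys[OF that] ps])
  have q: "x \<bullet> (R *\<^sub>v x) = (\<Sum>j\<in>{0..<n}. \<Sum>l\<in>{0..<n}. R $$ (j, l) * (x $ j * x $ l))" if "x \<in> carrier_vec n" for x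
    using that R(1) by (simp add: scalar_prod_def sum_distrib_left mult_ac)
  \<comment> \<open>Pulls the integral through the double sum; used both for the residual z and for
    y itself.\<close>
  have int_q: "(LINT t:?I|lebesgue. (\<Sum>j\<in>{0..<n}. \<Sum>l\<in>{0..<n}. R $$ (j, l) * (v t j * v t l)))
      = (\<Sum>j\<in>{0..<n}. \<Sum>l\<in>{0..<n}. R $$ (j, l) * (LINT t:?I|lebesgue. v t j * v t l))"
    if v: "\<And>j. j < n \<Longrightarrow> square_integrable_on ?I (\<lambda>t. v t j)" for v
  proof -
    have i: "integrable lebesgue (\<lambda>t. R $$ (j, l) * (indicator ?I t *\<^sub>R (v t j * v t l)))" if "j < n" "l < n" for j l
      using square_integrable_mult[OF v[OF that(1)] v[OF that(2)]] by (simp add: set_integrable_def)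
    have "(LINT t:?I|lebesgue. (\<Sum>j\<in>{0..<n}. \<Sum>l\<in>{0..<n}. R $$ (j, l) * (v t j * v t l)))
      = (\<integral>t. (\<Sum>j\<in>{0..<n}. \<Sum>l\<in>{0..<n}. R $$ (j, l) * (indicator ?I t *\<^sub>R (v t j * v t l))) \<partial>lebesgue)"
      unfolding set_lebesgue_integral_def
      by (rule Bochner_Integration.integral_cong) (auto simp: sum_distrib_left mult_ac)
    also have "\<dots> = (\<Sum>j\<in>{0..<n}. \<integral>t. (\<Sum>l\<in>{0..<n}. R $$ (j, l) * (indicator ?I t *\<^sub>R (v t j * v t l))) \<partial>lebesgue)"
      by (rule Bochner_Integration.integral_sum, rule Bochner_Integration.integrable_sum) (use i in auto)
    also have "\<dots> = (\<Sum>j\<in>{0..<n}. \<Sum>l\<in>{0..<n}. \<integral>t. R $$ (j, l) * (indicator ?I t *\<^sub>R (v t j * v t l)) \<partial>lebesgue)"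
      by (intro sum.cong refl Bochner_Integration.integral_sum) (use i in auto)
    finally show ?thesis by (simp add: set_lebesgue_integral_def)
  qed
  have cross: "(LINT t:?I|lebesgue. (\<Sum>i\<in>{0..<k}. - c i j * u i t) * y t $ l) = - (\<Sum>i\<in>{0..<k}. c i j * c i l)" if "l < n" for j l
    by (subst set_integral_mult_sum_left) (use u ys[OF that] in \<open>simp_all add: c_def sum_negf\<close>)
  have pp: "(LINT t:?I|lebesgue. (\<Sum>i\<in>{0..<k}. - c i j * u i t) * (\<Sum>i\<in>{0..<k}. - c i l * u i t)) = (\<Sum>i\<in>{0..<k}. c i j * c i l)" for j l
  proof -
    have "(LINT t:?I|lebesgue. u i t * (\<Sum>i'\<in>{0..<k}. - c i' l * u i' t)) = - c i l" if i: "i < k" for i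
    proof -
      have "(LINT t:?I|lebesgue. u i t * (\<Sum>i'\<in>{0..<k}. - c i' l * u i' t))
        = (LINT t:?I|lebesgue. (\<Sum>i'\<in>{0..<k}. - c i' l * u i' t) * u i t)" by (simp add: mult.commute)
      also have "\<dots> = (\<Sum>i'\<in>{0..<k}. - c i' l * (LINT t:?I|lebesgue. u i' t * u i t))"
        by (rule set_integral_mult_sum_left) (use u i in auto)
      also have "\<dots> = (\<Sum>i'\<in>{0..<k}. if i' = i then - c i' l else 0)"
        by (rule sum.cong) (use on i in auto)
      also have "\<dots> = - c i l" using i by (subst sum.delta) auto
      finally show ?thesis .
    qed
    then show ?thesis
      by (subst set_integral_mult_sum_left) (use u ps in \<open>auto simp: sum_negf intro!: sum.cong\<close>)
  qed
  \<comment> \<open>By orthonormality each of the two cross terms contributes -\<Sum> c c and the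
    projection with itself +\<Sum> c c, so one negative sum is left.\<close>
  have zz: "(LINT t:?I|lebesgue. z t j * z t l) = (LINT t:?I|lebesgue. y t $ j * y t $ l) - (\<Sum>i\<in>{0..<k}. c i j * c i l)"
    if jl: "j < n" "l < n" for j l
  proof -
    let ?p = "\<lambda>j t. \<Sum>i\<in>{0..<k}. - c i j * u i t"
    have I1: "set_integrable lebesgue ?I (\<lambda>t. y t $ j * y t $ l)" and I2: "set_integrable lebesgue ?I (\<lambda>t. ?p l t * y t $ j)"
      and I3: "set_integrable lebesgue ?I (\<lambda>t. ?p j t * y t $ l)" and I4: "set_integrable lebesgue ?I (\<lambda>t. ?p j t * ?p l t)"
      by (rule square_integrable_mult ys ps jl)+
    have "(LINT t:?I|lebesgue. z t j * z t l)
      = (LINT t:?I|lebesgue. (y t $ j * y t $ l + ?p l t * y t $ j) + (?p j t * y t $ l + ?p j t * ?p l t))"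
      unfolding z_def by (simp only: distrib_left distrib_right mult.commute add_ac)
    also have "\<dots> = ((LINT t:?I|lebesgue. y t $ j * y t $ l) + (LINT t:?I|lebesgue. ?p l t * y t $ j))
        + ((LINT t:?I|lebesgue. ?p j t * y t $ l) + (LINT t:?I|lebesgue. ?p j t * ?p l t))"
      using set_integral_add(2)[OF set_integral_add(1)[OF I1 I2] set_integral_add(1)[OF I3 I4]]
        set_integral_add(2)[OF I1 I2] set_integral_add(2)[OF I3 I4] by simp
    also have "\<dots> = (LINT t:?I|lebesgue. y t $ j * y t $ l) - (\<Sum>i\<in>{0..<k}. c i j * c i l)"
      unfolding cross[OF jl(1)] cross[OF jl(2)] pp by (simp add: mult.commute)
    finally show ?thesis .
  qed
  have "0 \<le> (LINT t:?I|lebesgue. (\<Sum>j\<in>{0..<n}. \<Sum>l\<in>{0..<n}. R $$ (j, l) * (z t j * z t l)))"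
    unfolding set_lebesgue_integral_def
  proof (rule Bochner_Integration.integral_nonneg)
    fix t
    have "0 \<le> vec n (z t) \<bullet> (R *\<^sub>v vec n (z t))" by (rule R(2)) simp
    also have "\<dots> = (\<Sum>j\<in>{0..<n}. \<Sum>l\<in>{0..<n}. R $$ (j, l) * (z t j * z t l))" by (subst q) auto
    finally show "0 \<le> indicator ?I t *\<^sub>R (\<Sum>j\<in>{0..<n}. \<Sum>l\<in>{0..<n}. R $$ (j, l) * (z t j * z t l))" by simp
  qed
  also have "\<dots> = (\<Sum>j\<in>{0..<n}. \<Sum>l\<in>{0..<n}. R $$ (j, l) * ((LINT t:?I|lebesgue. y t $ j * y t $ l) - (\<Sum>i\<in>{0..<k}. c i j * c i l)))"
    by (subst int_q[OF zs]) (auto simp: zz intro!: sum.cong)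
  also have "\<dots> = (\<Sum>j\<in>{0..<n}. \<Sum>l\<in>{0..<n}. R $$ (j, l) * (LINT t:?I|lebesgue. y t $ j * y t $ l))
      - (\<Sum>j\<in>{0..<n}. \<Sum>l\<in>{0..<n}. \<Sum>i\<in>{0..<k}. R $$ (j, l) * (c i j * c i l))"
    by (simp add: right_diff_distrib sum_subtractf sum_distrib_left)
  also have "(\<Sum>j\<in>{0..<n}. \<Sum>l\<in>{0..<n}. R $$ (j, l) * (LINT t:?I|lebesgue. y t $ j * y t $ l))
      = (LINT t:?I|lebesgue. y t \<bullet> (R *\<^sub>v y t))"
    by (subst int_q[symmetric], erule ys, rule set_integral_cong) (use y(2) q in auto)
  also have "(\<Sum>j\<in>{0..<n}. \<Sum>l\<in>{0..<n}. \<Sum>i\<in>{0..<k}. R $$ (j, l) * (c i j * c i l))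
      = (\<Sum>i\<in>{0..<k}. vec n (c i) \<bullet> (R *\<^sub>v vec n (c i)))"
  proof -
    have "(\<Sum>i\<in>{0..<k}. vec n (c i) \<bullet> (R *\<^sub>v vec n (c i))) = (\<Sum>i\<in>{0..<k}. \<Sum>j\<in>{0..<n}. \<Sum>l\<in>{0..<n}. R $$ (j, l) * (c i j * c i l))"
      by (rule sum.cong[OF refl]) (subst q, auto)
    also have "\<dots> = (\<Sum>j\<in>{0..<n}. \<Sum>i\<in>{0..<k}. \<Sum>l\<in>{0..<n}. R $$ (j, l) * (c i j * c i l))" by (rule sum.swap)
    also have "\<dots> = (\<Sum>j\<in>{0..<n}. \<Sum>l\<in>{0..<n}. \<Sum>i\<in>{0..<k}. R $$ (j, l) * (c i j * c i l))"
      by (rule sum.cong[OF refl]) (rule sum.swap)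
    finally show ?thesis by simp
  qed
  finally show ?thesis by (simp add: c_def)
qed

section \<open>Integrals over a moving window\<close>

lemma antiderivative_exists:
  fixes y :: "real \<Rightarrow> real"
  assumes y: "continuous_on UNIV y"
  obtains Y where "\<And>x. (Y has_real_derivative y x) (at x)"
proof
  fix x :: real
  \<comment> \<open>An interval around 0 with x in its interior, so that the derivative within it is
    the full derivative.\<close>
  let ?c = "\<bar>x\<bar> + 1"
  have "((\<lambda>u. LBINT t=ereal 0..ereal u. y t) has_vector_derivative y x) (at x within {- ?c..?c})"
    by (rule interval_integral_FTC2) (use continuous_on_subset[OF y] in auto)
  then have "((\<lambda>u. LBINT t=ereal 0..ereal u. y t) has_real_derivative y x) (at x within {- ?c..?c})"
    by (simp add: has_real_derivative_iff_has_vector_derivative)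
  moreover have "at x within {- ?c..?c} = at x" by (rule at_within_interior) (auto simp: abs_real_def)
  ultimately show "((\<lambda>u. LBINT t=ereal 0..ereal u. y t) has_real_derivative y x) (at x)" by simp
qed

text \<open>The mean value theorem and uniform continuity of y on a compact interval bound the error
  of the difference quotient of Y uniformly in \<tau>; integration against g multiplies it by the
  integral of |g|.\<close>

lemma window_integral_derivative_smooth:
  fixes g Y y :: "real \<Rightarrow> real"
  assumes ab: "a \<le> b" and g: "set_integrable lebesgue {a..b} g" and y: "continuous_on UNIV y"
    and Y: "\<And>x. (Y has_real_derivative y x) (at x)"
  shows "((\<lambda>t. LINT \<tau>:{a..b}|lebesgue. g \<tau> * Y (t + \<tau>)) has_real_derivative
      (LINT \<tau>:{a..b}|lebesgue. g \<tau> * y (t + \<tau>))) (at t)"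
  unfolding has_field_derivative_def has_derivative_at_alt
proof (intro conjI allI impI)
  show "bounded_linear ((*) (LINT \<tau>:{a..b}|lebesgue. g \<tau> * y (t + \<tau>)))" by (rule bounded_linear_mult_right)
  fix e :: real assume e: "0 < e"
  define C where "C = (LINT \<tau>:{a..b}|lebesgue. \<bar>g \<tau>\<bar>)"
  have C: "0 \<le> C" unfolding C_def set_lebesgue_integral_def by (rule Bochner_Integration.integral_nonneg) simp
  have gn: "set_integrable lebesgue {a..b} (\<lambda>\<tau>. \<bar>g \<tau>\<bar>)" by (rule set_integrable_abs[OF g])
  define \<epsilon> where "\<epsilon> = e / (C + 1)"
  have \<epsilon>: "0 < \<epsilon>" using e C by (simp add: \<epsilon>_def)
  \<comment> \<open>The window is enlarged by one on each side, hence the restriction to increments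
    below one at the end.\<close>
  let ?K = "{t + a - 1..t + b + 1}"
  have "uniformly_continuous_on ?K y"
    by (rule compact_uniformly_continuous[OF continuous_on_subset[OF y] compact_Icc]) simp
  then obtain d where d: "0 < d" "\<And>u v. u \<in> ?K \<Longrightarrow> v \<in> ?K \<Longrightarrow> dist v u < d \<Longrightarrow> dist (y v) (y u) < \<epsilon>"
    unfolding uniformly_continuous_on_def using \<epsilon> by metis
  have cY: "continuous_on S Y" for S using Y by (meson DERIV_continuous_on DERIV_subset subset_UNIV)
  have cYt: "continuous_on {a..b} (\<lambda>\<tau>. Y (s + \<tau>))" for s
    by (rule continuous_on_compose2[OF cY[of UNIV]]) (auto intro!: continuous_intros)
  have cyt: "continuous_on {a..b} (\<lambda>\<tau>. y (s + \<tau>))" for s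
    by (rule continuous_on_compose2[OF y]) (auto intro!: continuous_intros)
  have "\<bar>(LINT \<tau>:{a..b}|lebesgue. g \<tau> * Y (s + \<tau>)) - (LINT \<tau>:{a..b}|lebesgue. g \<tau> * Y (t + \<tau>))
      - (LINT \<tau>:{a..b}|lebesgue. g \<tau> * y (t + \<tau>)) * (s - t)\<bar> \<le> e * \<bar>s - t\<bar>"
    if s: "\<bar>s - t\<bar> < min d 1" for s
  proof -
    define q where "q = (\<lambda>\<tau>. Y (s + \<tau>) - Y (t + \<tau>) - y (t + \<tau>) * (s - t))"
    have qb: "\<bar>q \<tau>\<bar> \<le> \<epsilon> * \<bar>s - t\<bar>" if \<tau>: "\<tau> \<in> {a..b}" for \<tau>
    proof -
      have m: "\<exists>z. \<bar>z - t\<bar> \<le> \<bar>s - t\<bar> \<and> Y (s + \<tau>) - Y (t + \<tau>) = (s - t) * y (z + \<tau>)"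
      proof -
        consider "s < t" | "s = t" | "t < s" by linarith
        then show ?thesis
        proof cases
          case 1
          obtain z where "s + \<tau> < z" "z < t + \<tau>" "Y (t + \<tau>) - Y (s + \<tau>) = (t + \<tau> - (s + \<tau>)) * y z"
            using MVT2[of "s + \<tau>" "t + \<tau>" Y y] 1 Y by auto
          then show ?thesis by (intro exI[of _ "z - \<tau>"]) (auto simp: algebra_simps)
        next
          case 3
          obtain z where "t + \<tau> < z" "z < s + \<tau>" "Y (s + \<tau>) - Y (t + \<tau>) = (s + \<tau> - (t + \<tau>)) * y z"
            using MVT2[of "t + \<tau>" "s + \<tau>" Y y] 3 Y by auto
          then show ?thesis by (intro exI[of _ "z - \<tau>"]) auto
        qed auto
      qed
      then obtain z where z: "\<bar>z - t\<bar> \<le> \<bar>s - t\<bar>" "Y (s + \<tau>) - Y (t + \<tau>) = (s - t) * y (z + \<tau>)" by blast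
      have "z + \<tau> \<in> ?K" "t + \<tau> \<in> ?K" "dist (z + \<tau>) (t + \<tau>) < d"
        using z(1) s \<tau> by (auto simp: dist_real_def abs_le_iff abs_less_iff)
      then have "\<bar>y (z + \<tau>) - y (t + \<tau>)\<bar> < \<epsilon>" using d(2) by (simp add: dist_real_def)
      moreover have "q \<tau> = (y (z + \<tau>) - y (t + \<tau>)) * (s - t)" unfolding q_def z(2) by (simp add: algebra_simps)
      ultimately show ?thesis by (simp add: abs_mult mult_right_mono)
    qed
    have I: "set_integrable lebesgue {a..b} (\<lambda>\<tau>. g \<tau> * Y (s + \<tau>))" "set_integrable lebesgue {a..b} (\<lambda>\<tau>. g \<tau> * Y (t + \<tau>))"
      "set_integrable lebesgue {a..b} (\<lambda>\<tau>. g \<tau> * y (t + \<tau>) * (s - t))"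
      by (intro set_integrable_mult_continuous[OF g] set_integrable_mult_left cYt cyt)+
    have "(LINT \<tau>:{a..b}|lebesgue. g \<tau> * q \<tau>)
      = (LINT \<tau>:{a..b}|lebesgue. (g \<tau> * Y (s + \<tau>) - g \<tau> * Y (t + \<tau>)) - g \<tau> * y (t + \<tau>) * (s - t))"
      by (simp add: q_def algebra_simps)
    also have "\<dots> = (LINT \<tau>:{a..b}|lebesgue. g \<tau> * Y (s + \<tau>)) - (LINT \<tau>:{a..b}|lebesgue. g \<tau> * Y (t + \<tau>))
        - (LINT \<tau>:{a..b}|lebesgue. g \<tau> * y (t + \<tau>)) * (s - t)"
      using set_integral_diff(2)[OF set_integral_diff(1)[OF I(1,2)] I(3)] set_integral_diff(2)[OF I(1,2)] by simp
    finally have eq: "(LINT \<tau>:{a..b}|lebesgue. g \<tau> * Y (s + \<tau>)) - (LINT \<tau>:{a..b}|lebesgue. g \<tau> * Y (t + \<tau>))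
        - (LINT \<tau>:{a..b}|lebesgue. g \<tau> * y (t + \<tau>)) * (s - t) = (LINT \<tau>:{a..b}|lebesgue. g \<tau> * q \<tau>)" by simp
    have "\<bar>LINT \<tau>:{a..b}|lebesgue. g \<tau> * q \<tau>\<bar> \<le> (LINT \<tau>:{a..b}|lebesgue. \<bar>g \<tau>\<bar> * (\<epsilon> * \<bar>s - t\<bar>))"
      unfolding set_lebesgue_integral_def real_norm_def[symmetric]
    proof (rule Bochner_Integration.integral_norm_bound_integral)
      show "integrable lebesgue (\<lambda>x. indicator {a..b} x *\<^sub>R (g x * q x))"
        unfolding set_integrable_def[symmetric] q_def
        by (rule set_integrable_mult_continuous[OF g]) (intro continuous_intros cYt cyt)
      show "integrable lebesgue (\<lambda>x. indicator {a..b} x *\<^sub>R (norm (g x) * (\<epsilon> * norm (s - t))))"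
        unfolding set_integrable_def[symmetric] real_norm_def by (rule set_integrable_mult_left[OF gn])
      show "norm (indicator {a..b} x *\<^sub>R (g x * q x)) \<le> indicator {a..b} x *\<^sub>R (norm (g x) * (\<epsilon> * norm (s - t)))" for x
        using qb[of x] by (auto simp: indicator_def abs_mult intro: mult_left_mono)
    qed
    also have "\<dots> = C * (\<epsilon> * \<bar>s - t\<bar>)" unfolding C_def by simp
    also have "\<dots> \<le> (C + 1) * (\<epsilon> * \<bar>s - t\<bar>)" using \<epsilon> by (intro mult_right_mono) auto
    also have "\<dots> = e * \<bar>s - t\<bar>" using C by (simp add: \<epsilon>_def)
    finally show ?thesis unfolding eq .
  qed
  then show "\<exists>d>0. \<forall>s. norm (s - t) < d \<longrightarrow>
      norm ((LINT \<tau>:{a..b}|lebesgue. g \<tau> * Y (s + \<tau>)) - (LINT \<tau>:{a..b}|lebesgue. g \<tau> * Y (t + \<tau>))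
        - (LINT \<tau>:{a..b}|lebesgue. g \<tau> * y (t + \<tau>)) * (s - t)) \<le> e * norm (s - t)"
    using d(1) by (intro exI[of _ "min d 1"]) auto
qed

text \<open>Integration by parts moves the shift from the merely continuous \<open>y\<close> to an antiderivative of it.\<close>

lemma window_integral_derivative:
  fixes f g y :: "real \<Rightarrow> real"
  assumes ab: "a \<le> b" and g: "set_integrable lebesgue {a..b} g"
    and f: "\<And>x. x \<in> {a..b} \<Longrightarrow> f x = f a + (LINT s:{a..x}|lebesgue. g s)" and y: "continuous_on UNIV y"
  shows "((\<lambda>t. LINT \<tau>:{a..b}|lebesgue. f \<tau> * y (t + \<tau>)) has_real_derivative
      (f b * y (t + b) - f a * y (t + a) - (LINT \<tau>:{a..b}|lebesgue. g \<tau> * y (t + \<tau>)))) (at t)"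
proof -
  obtain Y where Y: "\<And>x. (Y has_real_derivative y x) (at x)" using antiderivative_exists[OF y] by blast
  have Yt: "((\<lambda>\<tau>. Y (t + \<tau>)) has_real_derivative y (t + \<tau>)) (at \<tau>)" for t \<tau>
  proof -
    have "((\<lambda>\<tau>. t + \<tau>) has_real_derivative 1) (at \<tau>)" by (auto intro!: derivative_eq_intros)
    from DERIV_chain2[OF Y this] show ?thesis by simp
  qed
  have Yt': "((\<lambda>t. Y (t + \<tau>)) has_real_derivative y (t + \<tau>)) (at t)" for t \<tau>
  proof -
    have "((\<lambda>t. t + \<tau>) has_real_derivative 1) (at t)" by (auto intro!: derivative_eq_intros)
    from DERIV_chain2[OF Y this] show ?thesis by simp
  qed
  have cy: "continuous_on S (\<lambda>\<tau>. y (t + \<tau>))" for S t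
    by (rule continuous_on_compose2[OF y]) (auto intro!: continuous_intros)
  \<comment> \<open>f is its value at a plus the primitive of g, so one integration by parts leaves
    boundary terms and an integral of g against Y, all of them differentiable in t.\<close>
  have eq: "(LINT \<tau>:{a..b}|lebesgue. f \<tau> * y (t + \<tau>))
      = f b * Y (t + b) - f a * Y (t + a) - (LINT \<tau>:{a..b}|lebesgue. g \<tau> * Y (t + \<tau>))" for t
  proof -
    let ?F = "\<lambda>x. LINT s:{a..x}|lebesgue. g s"
    have "(LINT \<tau>:{a..b}|lebesgue. f \<tau> * y (t + \<tau>)) = (LINT \<tau>:{a..b}|lebesgue. f a * y (t + \<tau>) + ?F \<tau> * y (t + \<tau>))"
      by (rule set_integral_cong) (subst f, assumption, rule distrib_right)
    also have "\<dots> = (LINT \<tau>:{a..b}|lebesgue. f a * y (t + \<tau>)) + (LINT \<tau>:{a..b}|lebesgue. ?F \<tau> * y (t + \<tau>))"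
      by (rule set_integral_add; rule continuous_set_integrable)
        (intro continuous_intros cy primitive_continuous[OF g])+
    also have "(LINT \<tau>:{a..b}|lebesgue. f a * y (t + \<tau>)) = f a * (Y (t + b) - Y (t + a))"
      using set_integral_derivative[OF ab Yt cy] by simp
    also have "(LINT \<tau>:{a..b}|lebesgue. ?F \<tau> * y (t + \<tau>)) = ?F b * Y (t + b) - (LINT s:{a..b}|lebesgue. g s * Y (t + s))"
      by (rule integration_by_parts_primitive[OF ab g Yt cy])
    finally show ?thesis using f[of b] ab by (simp add: algebra_simps)
  qed
  show ?thesis unfolding eq
    by (rule DERIV_diff[OF DERIV_diff[OF DERIV_cmult[OF Yt'] DERIV_cmult[OF Yt']] window_integral_derivative_smooth[OF ab g y Y]])
qed

text \<open>The derivative formula is bounded on [t0, T] because y is bounded on the compact range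
  of its arguments; the mean value theorem turns the bound into a Lipschitz constant.\<close>

lemma window_integral_lipschitz:
  fixes f g y :: "real \<Rightarrow> real"
  assumes ab: "a \<le> b" and g: "set_integrable lebesgue {a..b} g"
    and f: "\<And>x. x \<in> {a..b} \<Longrightarrow> f x = f a + (LINT s:{a..x}|lebesgue. g s)" and y: "continuous_on UNIV y"
  shows "absolutely_continuous_between t0 T (\<lambda>t. LINT \<tau>:{a..b}|lebesgue. f \<tau> * y (t + \<tau>))"
proof -
  let ?K = "{t0 + a..T + b}"
  have "bounded (y ` ?K)" by (rule compact_imp_bounded[OF compact_continuous_image[OF continuous_on_subset[OF y] compact_Icc]]) simp
  then obtain B where B: "0 < B" "\<And>x. x \<in> ?K \<Longrightarrow> \<bar>y x\<bar> \<le> B" unfolding bounded_pos by auto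
  define C where "C = (LINT \<tau>:{a..b}|lebesgue. \<bar>g \<tau>\<bar>)"
  have cy: "continuous_on {a..b} (\<lambda>\<tau>. y (t + \<tau>))" for t
    by (rule continuous_on_compose2[OF y]) (auto intro!: continuous_intros)
  have D: "\<bar>f b * y (t + b) - f a * y (t + a) - (LINT \<tau>:{a..b}|lebesgue. g \<tau> * y (t + \<tau>))\<bar> \<le> \<bar>f b\<bar> * B + \<bar>f a\<bar> * B + C * B"
    if t: "t0 \<le> t" "t \<le> T" for t
  proof -
    have "\<bar>LINT \<tau>:{a..b}|lebesgue. g \<tau> * y (t + \<tau>)\<bar> \<le> (LINT \<tau>:{a..b}|lebesgue. \<bar>g \<tau>\<bar> * B)"
      unfolding set_lebesgue_integral_def real_norm_def[symmetric]
    proof (rule Bochner_Integration.integral_norm_bound_integral)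
      show "integrable lebesgue (\<lambda>x. indicator {a..b} x *\<^sub>R (g x * y (t + x)))"
        unfolding set_integrable_def[symmetric] by (rule set_integrable_mult_continuous[OF g cy])
      show "integrable lebesgue (\<lambda>x. indicator {a..b} x *\<^sub>R (norm (g x) * B))"
        unfolding set_integrable_def[symmetric] real_norm_def by (rule set_integrable_mult_left) (rule set_integrable_abs[OF g])
      show "norm (indicator {a..b} x *\<^sub>R (g x * y (t + x))) \<le> indicator {a..b} x *\<^sub>R (norm (g x) * B)" for x
        using B(2)[of "t + x"] t by (auto simp: indicator_def abs_mult intro!: mult_left_mono)
    qed
    then have "\<bar>LINT \<tau>:{a..b}|lebesgue. g \<tau> * y (t + \<tau>)\<bar> \<le> C * B" by (simp add: C_def)
    moreover have "\<bar>f b * y (t + b)\<bar> \<le> \<bar>f b\<bar> * B" "\<bar>f a * y (t + a)\<bar> \<le> \<bar>f a\<bar> * B"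
      using B(2)[of "t + b"] B(2)[of "t + a"] t ab by (simp_all add: abs_mult mult_left_mono)
    ultimately show ?thesis by linarith
  qed
  show ?thesis
  proof (rule absolutely_continuous_lipschitz[where C = "\<bar>f b\<bar> * B + \<bar>f a\<bar> * B + C * B"])
    fix u v assume uv: "t0 \<le> u" "u \<le> v" "v \<le> T"
    show "\<bar>(LINT \<tau>:{a..b}|lebesgue. f \<tau> * y (v + \<tau>)) - (LINT \<tau>:{a..b}|lebesgue. f \<tau> * y (u + \<tau>))\<bar>
      \<le> (\<bar>f b\<bar> * B + \<bar>f a\<bar> * B + C * B) * (v - u)"
    proof (cases "u = v")
      case False
      then have "u < v" using uv by simp
      then obtain z where z: "u < z" "z < v" "(LINT \<tau>:{a..b}|lebesgue. f \<tau> * y (v + \<tau>)) - (LINT \<tau>:{a..b}|lebesgue. f \<tau> * y (u + \<tau>))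
        = (v - u) * (f b * y (z + b) - f a * y (z + a) - (LINT \<tau>:{a..b}|lebesgue. g \<tau> * y (z + \<tau>)))"
        using MVT2[OF _ window_integral_derivative[OF ab g f y], of u v] by auto
      then show ?thesis unfolding z(3) abs_mult using D[of z] uv by (simp add: mult.commute mult_right_mono)
    qed simp
  qed
qed

section \<open>The kernel functions of a plant\<close>

text \<open>The Gram matrix of X^{-1/2} u is X^{-1/2} X X^{-1/2} = I, which is why the kernels are
  normalised by these roots.\<close>

lemma gram_orthonormal:
  assumes X: "pos_def (gram S k k u u)" and u: "L2_on S k u"
  shows "gram S k k (\<lambda>t. msqrt (minv (gram S k k u u)) *\<^sub>v u t) (\<lambda>t. msqrt (minv (gram S k k u u)) *\<^sub>v u t) = 1\<^sub>m k"
proof -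
  let ?X = "gram S k k u u"
  define Y where "Y = msqrt ?X"
  define T where "T = msqrt (minv ?X)"
  have Y: "Y \<in> carrier_mat k k" "pos_def Y" "Y * Y = ?X"
    unfolding Y_def by (rule msqrt_pos_def[OF X gram_carrier_mat])+
  have TY: "T = minv Y" unfolding T_def Y_def by (rule msqrt_minv[OF X gram_carrier_mat])
  have T: "T \<in> carrier_mat k k" "Y * T = 1\<^sub>m k" "T * Y = 1\<^sub>m k" "pos_def T"
    unfolding TY by (rule pos_def_minv[OF Y(2,1)])+
  have TT: "T\<^sup>T = T" using pos_def_sym[OF T(4,1)] by (simp add: sym_mat_def)
  have "gram S k k (\<lambda>t. T *\<^sub>v u t) (\<lambda>t. T *\<^sub>v u t) = T * gram S k k u (\<lambda>t. T *\<^sub>v u t)"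
    by (rule gram_mult_left[OF T(1) u L2_on_mult_mat[OF T(1) u]])
  also have "gram S k k u (\<lambda>t. T *\<^sub>v u t) = ?X * T"
    using gram_mult_right[OF T(1) u u] TT by simp
  also have "?X * T = Y * (Y * T)" unfolding Y(3)[symmetric] by (rule assoc_mult_mat[OF Y(1) Y(1) T(1)])
  also have "T * (Y * (Y * T)) = 1\<^sub>m k" unfolding T(2) using Y(1) T(3) by simp
  finally show ?thesis unfolding T_def .
qed

lemma plant_interval:
  assumes "admissible_plant p" "i \<in> {1..ndelays p}"
  shows "delay p (i - 1) < delay p i"
proof -
  have "i - 1 < ndelays p" "Suc (i - 1) = i" using assms(2) by auto
  then show ?thesis using assms(1) unfolding admissible_plant_def by metis
qed

lemma plant_L2:
  assumes p: "admissible_plant p" and i: "i \<in> {1..ndelays p}"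
  shows "L2_on (ival p i) (dim_f p i) (fn_f p i)" "L2_on (ival p i) (dim_phi p i) (fn_phi p i)"
    "L2_on (ival p i) (vk p i) (fn_h p i)" "L2_on (ival p i) (dim_phi p i + vk p i) (fn_g p i)"
proof -
  have a: "L2_on (ival p i) (dim_vphi p i) (fn_vphi p i)" "L2_on (ival p i) (dim_phi p i) (fn_phi p i)"
    "H1_with_weak_derivative (- delay p i) (- delay p (i - 1)) (dim_f p i) (fn_f p i) (\<lambda>\<tau>. Mmat p i *\<^sub>v fn_h p i \<tau>)"
    using p i by (auto simp: admissible_plant_def)
  show f: "L2_on (ival p i) (dim_f p i) (fn_f p i)" using a(3) by (simp add: H1_with_weak_derivative_def ival_def)
  show "L2_on (ival p i) (dim_phi p i) (fn_phi p i)" by fact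
  show h: "L2_on (ival p i) (vk p i) (fn_h p i)"
    using L2_on_append[OF a(1) f] by (simp add: vk_def fn_h_def[abs_def] add.commute)
  show "L2_on (ival p i) (dim_phi p i + vk p i) (fn_g p i)"
    using L2_on_append[OF a(2) h] by (simp add: fn_g_def[abs_def])
qed

lemma hcat_pair_mult_vec:
  assumes "A \<in> carrier_mat r a" "B \<in> carrier_mat r b" "u \<in> carrier_vec a" "v \<in> carrier_vec b"
  shows "hcat r [A, B] *\<^sub>v (u @\<^sub>v v) = A *\<^sub>v u + B *\<^sub>v v"
  unfolding hcat_mult_vec[OF assms(1) hcat_single_carrier[OF assms(2)] assms(3,4)] hcat_single_mult_vec[OF assms(2,4)]
  by (rule refl)

lemma hcat_pair_carrier: "A \<in> carrier_mat r a \<Longrightarrow> B \<in> carrier_mat r b \<Longrightarrow> hcat r [A, B] \<in> carrier_mat r (a + b)"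
  by (rule hcat_Cons_carrier[OF _ hcat_single_carrier])

text \<open>A block row containing an identity block is surjective, so positive definiteness survives.\<close>

lemma pos_def_gram_project:
  assumes G: "pos_def (gram S (a + b) (a + b) (\<lambda>t. u t @\<^sub>v v t) (\<lambda>t. u t @\<^sub>v v t))"
    and u: "L2_on S a u" and v: "L2_on S b v" 
  shows "pos_def (gram S b b v v)" 
proof (rule pos_def_gram_image[OF G L2_on_append[OF u v] hcat_pair_carrier[OF zero_carrier_mat one_carrier_mat]])
  fix x :: "real vec" assume x: "x \<in> carrier_vec b"
  have "hcat b [0\<^sub>m b a, 1\<^sub>m b] *\<^sub>v (0\<^sub>v a @\<^sub>v x) = x"
    unfolding hcat_pair_mult_vec[OF zero_carrier_mat one_carrier_mat zero_carrier_vec x] using x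
    by (simp add: zero_mat_mult_vec)
  then show "\<exists>y\<in>carrier_vec (a + b). hcat b [0\<^sub>m b a, 1\<^sub>m b] *\<^sub>v y = x"
    using append_carrier_vec[OF zero_carrier_vec x] by blast
next
  fix t assume "t \<in> S"
  then have c: "u t \<in> carrier_vec a" "v t \<in> carrier_vec b" using u v by (auto simp: L2_on_def)
  show "v t = hcat b [0\<^sub>m b a, 1\<^sub>m b] *\<^sub>v (u t @\<^sub>v v t)"
    unfolding hcat_pair_mult_vec[OF zero_carrier_mat one_carrier_mat c] using c by (simp add: zero_mat_mult_vec)
qed

text \<open>H and F are Gram matrices of the trailing parts of g and h. With C = \<Gamma> H^{-1} the
  function \<epsilon> is the image of g under the surjective row [I, -C], which makes E positive
  definite, and its Gram matrix with h is \<Gamma> - C H = 0.\<close>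

lemma plant_grams:
  assumes p: "admissible_plant p" and i: "i \<in> {1..ndelays p}"
  shows "pos_def (Fmat p i)" "pos_def (Hmat p i)" "pos_def (Emat p i)"
    and "L2_on (ival p i) (dim_phi p i) (fn_eps p i)"
    and "gram (ival p i) (dim_phi p i) (vk p i) (fn_eps p i) (fn_h p i) = 0\<^sub>m (dim_phi p i) (vk p i)"
proof -
  let ?S = "ival p i" and ?k = "vk p i" and ?m = "dim_phi p i"
  note L = plant_L2[OF p i]
  have v: "L2_on ?S (dim_vphi p i) (fn_vphi p i)" using p i by (auto simp: admissible_plant_def)
  have k: "kp p i = ?m + ?k" by (simp add: kp_def vk_def)
  have G: "pos_def (gram ?S (?m + ?k) (?m + ?k) (fn_g p i) (fn_g p i))"
    using p i unfolding k[symmetric] by (auto simp: admissible_plant_def)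
  show H: "pos_def (Hmat p i)"
    unfolding Hmat_def by (rule pos_def_gram_project[OF _ L(2,3)]) (use G in \<open>simp add: fn_g_def[abs_def]\<close>)
  show "pos_def (Fmat p i)"
    unfolding Fmat_def by (rule pos_def_gram_project[OF _ v L(1)])
      (use H in \<open>simp add: Hmat_def fn_h_def[abs_def] vk_def add.commute\<close>)
  have HC: "Hmat p i \<in> carrier_mat ?k ?k" and GC: "Gam p i \<in> carrier_mat ?m ?k" by (simp_all add: Hmat_def Gam_def)
  note HI = pos_def_minv[OF H HC]
  define C where "C = Gam p i * minv (Hmat p i)"
  have C: "C \<in> carrier_mat ?m ?k" unfolding C_def by (rule mult_carrier_mat[OF GC HI(1)])
  have eps: "fn_eps p i = (\<lambda>t. fn_phi p i t - C *\<^sub>v fn_h p i t)" by (simp add: fn_eps_def[abs_def] C_def)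
  note Ch = L2_on_mult_mat[OF C L(3)]
  show "L2_on ?S ?m (fn_eps p i)" unfolding eps by (rule L2_on_minus[OF L(2) Ch])
  have "gram ?S ?m ?k (fn_eps p i) (fn_h p i) = Gam p i - C * Hmat p i"
    unfolding eps gram_minus_left[OF L(2) Ch L(3)] gram_mult_left[OF C L(3) L(3)] Gam_def Hmat_def by (rule refl)
  also have "C * Hmat p i = Gam p i"
    unfolding C_def using assoc_mult_mat[OF GC HI(1) HC] HI(3) GC by simp
  finally show "gram ?S ?m ?k (fn_eps p i) (fn_h p i) = 0\<^sub>m ?m ?k" using GC by (simp add: minus_r_inv_mat)
  have mC: "- C \<in> carrier_mat ?m ?k" using C by simp
  show "pos_def (Emat p i)"
    unfolding Emat_def
  proof (rule pos_def_gram_image[OF G L(4) hcat_pair_carrier[OF one_carrier_mat mC]])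
    fix x :: "real vec" assume x: "x \<in> carrier_vec ?m"
    have "hcat ?m [1\<^sub>m ?m, - C] *\<^sub>v (x @\<^sub>v 0\<^sub>v ?k) = x"
      unfolding hcat_pair_mult_vec[OF one_carrier_mat mC x zero_carrier_vec] mult_mat_zero_vec[OF mC] using x by simp
    then show "\<exists>y\<in>carrier_vec (?m + ?k). hcat ?m [1\<^sub>m ?m, - C] *\<^sub>v y = x"
      using append_carrier_vec[OF x zero_carrier_vec] by blast
  next
    fix t assume "t \<in> ?S"
    then have c: "fn_phi p i t \<in> carrier_vec ?m" "fn_h p i t \<in> carrier_vec ?k" using L by (auto simp: L2_on_def)
    have "(- C) *\<^sub>v fn_h p i t = - (C *\<^sub>v fn_h p i t)" using c C by simp
    then show "fn_eps p i t = hcat ?m [1\<^sub>m ?m, - C] *\<^sub>v fn_g p i t"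
      unfolding fn_g_def hcat_pair_mult_vec[OF one_carrier_mat mC c] eps
      using c mult_mat_vec_carrier[OF C c(2)] by (simp add: minus_add_uminus_vec)
  qed
qed

lemma gram_index: "a < k \<Longrightarrow> b < l \<Longrightarrow> gram S k l u v $$ (a, b) = (LINT t:S|lebesgue. u t $ a * v t $ b)"
  by (simp add: gram_def)

section \<open>Quadratic functionals of continuous functions\<close>

lemma C_spaceD:
  assumes "\<phi> \<in> C_space r n"
  shows "\<And>\<tau>. \<tau> \<in> {-r..0} \<Longrightarrow> \<phi> \<tau> \<in> carrier_vec n" "\<And>j. j < n \<Longrightarrow> continuous_on {-r..0} (\<lambda>\<tau>. \<phi> \<tau> $ j)"
  using assms by (auto simp: C_space_def)

lemma C_add_closed: "\<phi> \<in> C_space r n \<Longrightarrow> \<psi> \<in> C_space r n \<Longrightarrow> C_add r \<phi> \<psi> \<in> C_space r n"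
  unfolding C_space_def
proof (intro CollectI conjI allI impI; elim CollectE conjE)
  assume *: "\<phi> \<in> {- r..0} \<rightarrow>\<^sub>E carrier_vec n" "\<psi> \<in> {- r..0} \<rightarrow>\<^sub>E carrier_vec n"
  show "C_add r \<phi> \<psi> \<in> {- r..0} \<rightarrow>\<^sub>E carrier_vec n"
    using * unfolding C_add_def by (intro restrict_PiE[THEN iffD2]) (auto simp: PiE_iff Pi_iff)
  fix j assume "j < n" "\<forall>j<n. continuous_on {- r..0} (\<lambda>\<theta>. \<phi> \<theta> $ j)" "\<forall>j<n. continuous_on {- r..0} (\<lambda>\<theta>. \<psi> \<theta> $ j)"
  then have "continuous_on {- r..0} (\<lambda>\<theta>. \<phi> \<theta> $ j + \<psi> \<theta> $ j)" by (intro continuous_intros) auto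
  moreover have "C_add r \<phi> \<psi> \<theta> $ j = \<phi> \<theta> $ j + \<psi> \<theta> $ j" if "\<theta> \<in> {- r..0}" for \<theta>
  proof -
    have "\<psi> \<theta> \<in> carrier_vec n" using *(2) that by auto
    then show ?thesis using \<open>j < n\<close> that by (simp add: C_add_def)
  qed
  ultimately show "continuous_on {- r..0} (\<lambda>\<theta>. C_add r \<phi> \<psi> \<theta> $ j)"
    using continuous_on_cong[of "{- r..0}" "{- r..0}" "\<lambda>\<theta>. C_add r \<phi> \<psi> \<theta> $ j"] by simp
qed

lemma vnorm_square: "(vnorm x)\<^sup>2 = x \<bullet> x"
  by (simp add: vnorm_def)

lemma vnorm_nonneg: "0 \<le> vnorm x"
  by (simp add: vnorm_def)

lemma index_le_vnorm:
  assumes "x \<in> carrier_vec n" "j < n"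
  shows "\<bar>x $ j\<bar> \<le> vnorm x"
proof -
  have "(x $ j)\<^sup>2 \<le> (\<Sum>i\<in>{0..<n}. (x $ i)\<^sup>2)" by (rule member_le_sum) (use assms in auto)
  also have "\<dots> = x \<bullet> x" using assms by (simp add: scalar_prod_def power2_eq_square)
  finally have "sqrt ((x $ j)\<^sup>2) \<le> vnorm x" unfolding vnorm_def by (rule real_sqrt_le_mono)
  then show ?thesis by simp
qed

text \<open>The supremum defining \<open>C_norm\<close> is over a bounded set because the norm of a
  continuous function is continuous on a compact interval.\<close>

lemma C_norm_upper:
  assumes \<phi>: "\<phi> \<in> C_space r n" and t: "\<tau> \<in> {-r..0}"
  shows "vnorm (\<phi> \<tau>) \<le> C_norm r \<phi>"
proof -
  have eq: "vnorm (\<phi> \<tau>) = sqrt (\<Sum>j\<in>{0..<n}. \<phi> \<tau> $ j * \<phi> \<tau> $ j)" if "\<tau> \<in> {-r..0}" for \<tau>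
    using C_spaceD(1)[OF \<phi> that] by (simp add: vnorm_def scalar_prod_def)
  have "continuous_on {-r..0} (\<lambda>\<tau>. sqrt (\<Sum>j\<in>{0..<n}. \<phi> \<tau> $ j * \<phi> \<tau> $ j))"
    by (intro continuous_intros) (use C_spaceD(2)[OF \<phi>] in auto)
  then have "continuous_on {-r..0} (\<lambda>\<tau>. vnorm (\<phi> \<tau>))"
    using continuous_on_cong[of "{-r..0}" "{-r..0}" "\<lambda>\<tau>. vnorm (\<phi> \<tau>)"] eq by simp
  then have "bdd_above ((\<lambda>\<tau>. vnorm (\<phi> \<tau>)) ` {-r..0})"
    by (intro bounded_imp_bdd_above compact_imp_bounded compact_continuous_image) auto
  then show ?thesis unfolding C_norm_def by (rule cSUP_upper[OF t])
qed

lemma C_norm_nonneg: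
  assumes "\<phi> \<in> C_space r n" "0 \<le> r"
  shows "0 \<le> C_norm r \<phi>"
  using C_norm_upper[OF assms(1), of 0] vnorm_nonneg[of "\<phi> 0"] assms(2) by simp

lemma C_norm_index:
  assumes "\<phi> \<in> C_space r n" "\<tau> \<in> {-r..0}" "j < n"
  shows "\<bar>\<phi> \<tau> $ j\<bar> \<le> C_norm r \<phi>"
  using index_le_vnorm[OF C_spaceD(1)[OF assms(1,2)] assms(3)] C_norm_upper[OF assms(1,2)] by linarith

text \<open>Bounded linear functionals on the extensional function space, written with
  \<open>C_add\<close> and \<open>C_scale\<close> because the space is a set and not a type.\<close>

definition linear_fnl :: "real \<Rightarrow> nat \<Rightarrow> ((real \<Rightarrow> real vec) \<Rightarrow> real) \<Rightarrow> bool" where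
  "linear_fnl r n l \<longleftrightarrow>
     (\<forall>\<phi>\<in>C_space r n. \<forall>\<psi>\<in>C_space r n. l (C_add r \<phi> \<psi>) = l \<phi> + l \<psi>) \<and>
     (\<forall>c. \<forall>\<phi>\<in>C_space r n. l (C_scale r c \<phi>) = c * l \<phi>) \<and>
     (\<exists>B\<ge>0. \<forall>\<phi>\<in>C_space r n. \<bar>l \<phi>\<bar> \<le> B * C_norm r \<phi>)"

definition bilinear_fnl :: "real \<Rightarrow> nat \<Rightarrow> ((real \<Rightarrow> real vec) \<Rightarrow> (real \<Rightarrow> real vec) \<Rightarrow> real) \<Rightarrow> bool" where
  "bilinear_fnl r n b \<longleftrightarrow>
     (\<forall>\<phi>\<in>C_space r n. \<forall>\<psi>\<in>C_space r n. \<forall>\<chi>\<in>C_space r n.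
        b (C_add r \<phi> \<psi>) \<chi> = b \<phi> \<chi> + b \<psi> \<chi> \<and> b \<chi> (C_add r \<phi> \<psi>) = b \<chi> \<phi> + b \<chi> \<psi>) \<and>
     (\<forall>c. \<forall>\<phi>\<in>C_space r n. \<forall>\<chi>\<in>C_space r n. b (C_scale r c \<phi>) \<chi> = c * b \<phi> \<chi> \<and> b \<chi> (C_scale r c \<phi>) = c * b \<chi> \<phi>) \<and>
     (\<exists>B\<ge>0. \<forall>\<phi>\<in>C_space r n. \<forall>\<chi>\<in>C_space r n. \<bar>b \<phi> \<chi>\<bar> \<le> B * C_norm r \<phi> * C_norm r \<chi>)"

lemma linear_fnl_point:
  assumes "j < n" "\<tau> \<in> {-r..0}"
  shows "linear_fnl r n (\<lambda>\<phi>. \<phi> \<tau> $ j)"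
proof -
  have "\<phi> \<tau> \<in> carrier_vec n" if "\<phi> \<in> C_space r n" for \<phi> using C_spaceD(1)[OF that assms(2)] .
  then have "dim_vec (\<phi> \<tau>) = n" if "\<phi> \<in> C_space r n" for \<phi> using that by simp
  then show ?thesis
    unfolding linear_fnl_def using assms C_norm_index[OF _ assms(2,1)]
    by (auto simp: C_add_def C_scale_def intro!: exI[of _ 1])
qed

lemma linear_fnl_integral:
  assumes u: "set_integrable lebesgue {a..b} u" and ab: "{a..b} \<subseteq> {-r..0}" and j: "j < n" and r: "0 \<le> r"
  shows "linear_fnl r n (\<lambda>\<phi>. LINT \<tau>:{a..b}|lebesgue. u \<tau> * \<phi> \<tau> $ j)"
  unfolding linear_fnl_def
proof (intro conjI ballI allI)
  have dim: "dim_vec (\<phi> \<tau>) = n" if "\<phi> \<in> C_space r n" "\<tau> \<in> {a..b}" for \<phi> \<tau> using C_spaceD(1)[OF that(1)] that(2) ab by auto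
  have I: "set_integrable lebesgue {a..b} (\<lambda>\<tau>. u \<tau> * \<phi> \<tau> $ j)" if "\<phi> \<in> C_space r n" for \<phi>
    by (rule set_integrable_mult_continuous[OF u continuous_on_subset[OF C_spaceD(2)[OF that j] ab]])
  {
    fix \<phi> \<psi> assume p: "\<phi> \<in> C_space r n" "\<psi> \<in> C_space r n"
    have "(LINT \<tau>:{a..b}|lebesgue. u \<tau> * C_add r \<phi> \<psi> \<tau> $ j) = (LINT \<tau>:{a..b}|lebesgue. u \<tau> * \<phi> \<tau> $ j + u \<tau> * \<psi> \<tau> $ j)"
      by (rule set_integral_cong) (use ab dim[OF p(2)] j in \<open>auto simp: C_add_def distrib_left subset_eq\<close>)
    then show "(LINT \<tau>:{a..b}|lebesgue. u \<tau> * C_add r \<phi> \<psi> \<tau> $ j)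
      = (LINT \<tau>:{a..b}|lebesgue. u \<tau> * \<phi> \<tau> $ j) + (LINT \<tau>:{a..b}|lebesgue. u \<tau> * \<psi> \<tau> $ j)"
      using set_integral_add(2)[OF I[OF p(1)] I[OF p(2)]] by simp
  next
    fix c \<phi> assume p: "\<phi> \<in> C_space r n"
    have "(LINT \<tau>:{a..b}|lebesgue. u \<tau> * C_scale r c \<phi> \<tau> $ j) = (LINT \<tau>:{a..b}|lebesgue. c * (u \<tau> * \<phi> \<tau> $ j))"
      by (rule set_integral_cong) (use ab dim[OF p] j in \<open>auto simp: C_scale_def subset_eq\<close>)
    then show "(LINT \<tau>:{a..b}|lebesgue. u \<tau> * C_scale r c \<phi> \<tau> $ j) = c * (LINT \<tau>:{a..b}|lebesgue. u \<tau> * \<phi> \<tau> $ j)" by simp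
  }
  show "\<exists>B\<ge>0. \<forall>\<phi>\<in>C_space r n. \<bar>LINT \<tau>:{a..b}|lebesgue. u \<tau> * \<phi> \<tau> $ j\<bar> \<le> B * C_norm r \<phi>"
  proof (intro exI conjI ballI)
    show "0 \<le> (LINT \<tau>:{a..b}|lebesgue. \<bar>u \<tau>\<bar>)" unfolding set_lebesgue_integral_def by (rule Bochner_Integration.integral_nonneg) simp
    fix \<phi> assume p: "\<phi> \<in> C_space r n"
    have "\<bar>LINT \<tau>:{a..b}|lebesgue. u \<tau> * \<phi> \<tau> $ j\<bar> \<le> (LINT \<tau>:{a..b}|lebesgue. \<bar>u \<tau>\<bar> * C_norm r \<phi>)"
      unfolding set_lebesgue_integral_def real_norm_def[symmetric]
    proof (rule Bochner_Integration.integral_norm_bound_integral)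
      show "integrable lebesgue (\<lambda>x. indicator {a..b} x *\<^sub>R (u x * \<phi> x $ j))"
        unfolding set_integrable_def[symmetric] by (rule I[OF p])
      show "integrable lebesgue (\<lambda>x. indicator {a..b} x *\<^sub>R (norm (u x) * C_norm r \<phi>))"
        unfolding set_integrable_def[symmetric] real_norm_def by (rule set_integrable_mult_left) (rule set_integrable_abs[OF u])
      show "norm (indicator {a..b} x *\<^sub>R (u x * \<phi> x $ j)) \<le> indicator {a..b} x *\<^sub>R (norm (u x) * C_norm r \<phi>)" for x
        using C_norm_index[OF p _ j, of x] ab by (auto simp: indicator_def abs_mult subset_eq intro!: mult_left_mono)
    qed
    then show "\<bar>LINT \<tau>:{a..b}|lebesgue. u \<tau> * \<phi> \<tau> $ j\<bar> \<le> (LINT \<tau>:{a..b}|lebesgue. \<bar>u \<tau>\<bar>) * C_norm r \<phi>" by simp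
  qed
qed

lemma bilinear_fnl_mult:
  assumes l: "linear_fnl r n l" and k: "linear_fnl r n k" and r: "0 \<le> r"
  shows "bilinear_fnl r n (\<lambda>\<phi> \<psi>. l \<phi> * k \<psi>)"
proof -
  obtain B where B: "0 \<le> B" "\<And>\<phi>. \<phi> \<in> C_space r n \<Longrightarrow> \<bar>l \<phi>\<bar> \<le> B * C_norm r \<phi>" using l unfolding linear_fnl_def by blast
  obtain D where D: "0 \<le> D" "\<And>\<phi>. \<phi> \<in> C_space r n \<Longrightarrow> \<bar>k \<phi>\<bar> \<le> D * C_norm r \<phi>" using k unfolding linear_fnl_def by blast
  have "\<bar>l \<phi> * k \<psi>\<bar> \<le> (B * D) * C_norm r \<phi> * C_norm r \<psi>" if p: "\<phi> \<in> C_space r n" "\<psi> \<in> C_space r n" for \<phi> \<psi>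
  proof -
    have "\<bar>l \<phi> * k \<psi>\<bar> \<le> (B * C_norm r \<phi>) * (D * C_norm r \<psi>)"
      unfolding abs_mult using B D p C_norm_nonneg[OF p(1) r] by (intro mult_mono) auto
    then show ?thesis by (simp add: mult_ac)
  qed
  then have "\<exists>C\<ge>0. \<forall>\<phi>\<in>C_space r n. \<forall>\<psi>\<in>C_space r n. \<bar>l \<phi> * k \<psi>\<bar> \<le> C * C_norm r \<phi> * C_norm r \<psi>"
    using B(1) D(1) by (intro exI[of _ "B * D"]) auto
  then show ?thesis
    using l k unfolding bilinear_fnl_def linear_fnl_def by (simp add: algebra_simps)
qed

lemma bilinear_fnl_zero: "bilinear_fnl r n (\<lambda>\<phi> \<psi>. 0)"
  by (auto simp: bilinear_fnl_def intro: exI[of _ 0])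

lemma bilinear_fnl_add:
  assumes b: "bilinear_fnl r n b" and d: "bilinear_fnl r n d" and r: "0 \<le> r"
  shows "bilinear_fnl r n (\<lambda>\<phi> \<psi>. b \<phi> \<psi> + d \<phi> \<psi>)"
proof -
  obtain B where B: "0 \<le> B" "\<And>\<phi> \<psi>. \<phi> \<in> C_space r n \<Longrightarrow> \<psi> \<in> C_space r n \<Longrightarrow> \<bar>b \<phi> \<psi>\<bar> \<le> B * C_norm r \<phi> * C_norm r \<psi>"
    using b unfolding bilinear_fnl_def by blast
  obtain D where D: "0 \<le> D" "\<And>\<phi> \<psi>. \<phi> \<in> C_space r n \<Longrightarrow> \<psi> \<in> C_space r n \<Longrightarrow> \<bar>d \<phi> \<psi>\<bar> \<le> D * C_norm r \<phi> * C_norm r \<psi>"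
    using d unfolding bilinear_fnl_def by blast
  have "\<bar>b \<phi> \<psi> + d \<phi> \<psi>\<bar> \<le> (B + D) * C_norm r \<phi> * C_norm r \<psi>" if p: "\<phi> \<in> C_space r n" "\<psi> \<in> C_space r n" for \<phi> \<psi>
    using B(2)[OF p] D(2)[OF p] abs_triangle_ineq[of "b \<phi> \<psi>" "d \<phi> \<psi>"] by (simp add: distrib_right)
  then have "\<exists>C\<ge>0. \<forall>\<phi>\<in>C_space r n. \<forall>\<psi>\<in>C_space r n. \<bar>b \<phi> \<psi> + d \<phi> \<psi>\<bar> \<le> C * C_norm r \<phi> * C_norm r \<psi>"
    using B(1) D(1) by (intro exI[of _ "B + D"]) auto
  then show ?thesis
    using b d unfolding bilinear_fnl_def by (simp add: algebra_simps)
qed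

lemma bilinear_fnl_scale:
  assumes b: "bilinear_fnl r n b" and r: "0 \<le> r"
  shows "bilinear_fnl r n (\<lambda>\<phi> \<psi>. c * b \<phi> \<psi>)"
proof -
  obtain B where B: "0 \<le> B" "\<And>\<phi> \<psi>. \<phi> \<in> C_space r n \<Longrightarrow> \<psi> \<in> C_space r n \<Longrightarrow> \<bar>b \<phi> \<psi>\<bar> \<le> B * C_norm r \<phi> * C_norm r \<psi>"
    using b unfolding bilinear_fnl_def by blast
  have "\<bar>c * b \<phi> \<psi>\<bar> \<le> (\<bar>c\<bar> * B) * C_norm r \<phi> * C_norm r \<psi>" if p: "\<phi> \<in> C_space r n" "\<psi> \<in> C_space r n" for \<phi> \<psi>
    using mult_left_mono[OF B(2)[OF p], of "\<bar>c\<bar>"] by (simp add: abs_mult mult.assoc)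
  then have "\<exists>C\<ge>0. \<forall>\<phi>\<in>C_space r n. \<forall>\<psi>\<in>C_space r n. \<bar>c * b \<phi> \<psi>\<bar> \<le> C * C_norm r \<phi> * C_norm r \<psi>"
    using B(1) by (intro exI[of _ "\<bar>c\<bar> * B"]) auto
  then show ?thesis
    using b unfolding bilinear_fnl_def by (simp add: algebra_simps)
qed

lemma bilinear_fnl_sum:
  assumes "\<And>i. i \<in> I \<Longrightarrow> bilinear_fnl r n (b i)" "0 \<le> r"
  shows "bilinear_fnl r n (\<lambda>\<phi> \<psi>. \<Sum>i\<in>I. b i \<phi> \<psi>)"
  using assms
  by (induction I rule: infinite_finite_induct) (auto intro: bilinear_fnl_zero bilinear_fnl_add)

text \<open>Linearity in each slot is \<open>linear_fnl_integral\<close> with the other function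
  absorbed into the kernel; the joint bound is estimated separately.\<close>

lemma bilinear_fnl_integral:
  assumes w: "continuous_on {a..b} w" and ab: "{a..b} \<subseteq> {-r..0}" and ij: "i < n" "j < n" and r: "0 \<le> r"
  shows "bilinear_fnl r n (\<lambda>\<phi> \<psi>. LINT \<tau>:{a..b}|lebesgue. w \<tau> * (\<phi> \<tau> $ i * \<psi> \<tau> $ j))"
proof -
  have c: "continuous_on {a..b} (\<lambda>\<tau>. \<phi> \<tau> $ k)" if "\<phi> \<in> C_space r n" "k < n" for \<phi> k
    by (rule continuous_on_subset[OF C_spaceD(2)[OF that] ab])
  have L1: "linear_fnl r n (\<lambda>\<phi>. LINT \<tau>:{a..b}|lebesgue. (w \<tau> * \<psi> \<tau> $ j) * \<phi> \<tau> $ i)" if "\<psi> \<in> C_space r n" for \<psi>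
    by (rule linear_fnl_integral[OF continuous_set_integrable ab ij(1) r]) (intro continuous_intros w c[OF that ij(2)])
  have L2: "linear_fnl r n (\<lambda>\<psi>. LINT \<tau>:{a..b}|lebesgue. (w \<tau> * \<phi> \<tau> $ i) * \<psi> \<tau> $ j)" if "\<phi> \<in> C_space r n" for \<phi>
    by (rule linear_fnl_integral[OF continuous_set_integrable ab ij(2) r]) (intro continuous_intros w c[OF that ij(1)])
  have e1: "(LINT \<tau>:{a..b}|lebesgue. (w \<tau> * \<psi> \<tau> $ j) * \<phi> \<tau> $ i) = (LINT \<tau>:{a..b}|lebesgue. w \<tau> * (\<phi> \<tau> $ i * \<psi> \<tau> $ j))" for \<phi> \<psi>
    by (simp add: mult_ac)
  have e2: "(LINT \<tau>:{a..b}|lebesgue. (w \<tau> * \<phi> \<tau> $ i) * \<psi> \<tau> $ j) = (LINT \<tau>:{a..b}|lebesgue. w \<tau> * (\<phi> \<tau> $ i * \<psi> \<tau> $ j))" for \<phi> \<psi>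
    by (simp add: mult_ac)
  define C where "C = (LINT \<tau>:{a..b}|lebesgue. \<bar>w \<tau>\<bar>)"
  have C: "0 \<le> C" unfolding C_def set_lebesgue_integral_def by (rule Bochner_Integration.integral_nonneg) simp
  have "\<bar>LINT \<tau>:{a..b}|lebesgue. w \<tau> * (\<phi> \<tau> $ i * \<psi> \<tau> $ j)\<bar> \<le> C * C_norm r \<phi> * C_norm r \<psi>"
    if p: "\<phi> \<in> C_space r n" "\<psi> \<in> C_space r n" for \<phi> \<psi>
  proof -
    have "\<bar>LINT \<tau>:{a..b}|lebesgue. w \<tau> * (\<phi> \<tau> $ i * \<psi> \<tau> $ j)\<bar> \<le> (LINT \<tau>:{a..b}|lebesgue. \<bar>w \<tau>\<bar> * (C_norm r \<phi> * C_norm r \<psi>))"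
      unfolding set_lebesgue_integral_def real_norm_def[symmetric]
    proof (rule Bochner_Integration.integral_norm_bound_integral)
      show "integrable lebesgue (\<lambda>x. indicator {a..b} x *\<^sub>R (w x * (\<phi> x $ i * \<psi> x $ j)))"
        unfolding set_integrable_def[symmetric]
        by (rule continuous_set_integrable) (intro continuous_intros w c[OF p(1) ij(1)] c[OF p(2) ij(2)])
      show "integrable lebesgue (\<lambda>x. indicator {a..b} x *\<^sub>R (norm (w x) * (C_norm r \<phi> * C_norm r \<psi>)))"
        unfolding set_integrable_def[symmetric]
        by (rule continuous_set_integrable) (intro continuous_intros w)
      show "norm (indicator {a..b} x *\<^sub>R (w x * (\<phi> x $ i * \<psi> x $ j))) \<le> indicator {a..b} x *\<^sub>R (norm (w x) * (C_norm r \<phi> * C_norm r \<psi>))" for x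
        using C_norm_index[OF p(1) _ ij(1), of x] C_norm_index[OF p(2) _ ij(2), of x] ab C_norm_nonneg[OF p(1) r]
        by (auto simp: indicator_def abs_mult subset_eq intro!: mult_left_mono mult_mono)
    qed
    then show ?thesis by (simp add: C_def mult.assoc)
  qed
  then have "\<exists>C\<ge>0. \<forall>\<phi>\<in>C_space r n. \<forall>\<psi>\<in>C_space r n.
      \<bar>LINT \<tau>:{a..b}|lebesgue. w \<tau> * (\<phi> \<tau> $ i * \<psi> \<tau> $ j)\<bar> \<le> C * C_norm r \<phi> * C_norm r \<psi>"
    using C by blast
  then show ?thesis
    using L1[unfolded e1] L2[unfolded e2] unfolding bilinear_fnl_def linear_fnl_def by simp
qed

text \<open>The derivative at \<psi> sends \<eta> to b(\<psi>, \<eta>) + b(\<eta>, \<psi>), with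
  both orders since b may be asymmetric; the remainder is exactly b(\<eta>, \<eta>).\<close>

lemma bilinear_fnl_differentiable:
  assumes b: "bilinear_fnl r n b" and r: "0 \<le> r"
  shows "differentiable_functional r n (\<lambda>\<phi>. b \<phi> \<phi>)"
  unfolding differentiable_functional_def
proof
  fix \<psi> assume \<psi>: "\<psi> \<in> C_space r n"
  obtain B where B: "0 \<le> B" "\<And>\<phi> \<psi>. \<phi> \<in> C_space r n \<Longrightarrow> \<psi> \<in> C_space r n \<Longrightarrow> \<bar>b \<phi> \<psi>\<bar> \<le> B * C_norm r \<phi> * C_norm r \<psi>"
    using b unfolding bilinear_fnl_def by blast
  have add: "b (C_add r \<phi> \<psi>) \<chi> = b \<phi> \<chi> + b \<psi> \<chi>" "b \<chi> (C_add r \<phi> \<psi>) = b \<chi> \<phi> + b \<chi> \<psi>"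
    if "\<phi> \<in> C_space r n" "\<psi> \<in> C_space r n" "\<chi> \<in> C_space r n" for \<phi> \<psi> \<chi>
    using b that unfolding bilinear_fnl_def by blast+
  have scale: "b (C_scale r c \<phi>) \<chi> = c * b \<phi> \<chi>" "b \<chi> (C_scale r c \<phi>) = c * b \<chi> \<phi>"
    if "\<phi> \<in> C_space r n" "\<chi> \<in> C_space r n" for c \<phi> \<chi>
    using b that unfolding bilinear_fnl_def by blast+
  let ?D = "\<lambda>\<eta>. b \<psi> \<eta> + b \<eta> \<psi>"
  have rem: "b (C_add r \<psi> \<eta>) (C_add r \<psi> \<eta>) - b \<psi> \<psi> - ?D \<eta> = b \<eta> \<eta>" if "\<eta> \<in> C_space r n" for \<eta>
    using add(1)[OF \<psi> that C_add_closed[OF \<psi> that]] add(2)[OF \<psi> that \<psi>] add(2)[OF \<psi> that that] by simp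
  show "\<exists>D. (\<forall>\<eta>\<in>C_space r n. \<forall>\<eta>'\<in>C_space r n. D (C_add r \<eta> \<eta>') = D \<eta> + D \<eta>') \<and>
        (\<forall>c. \<forall>\<eta>\<in>C_space r n. D (C_scale r c \<eta>) = c * D \<eta>) \<and>
        (\<exists>B. \<forall>\<eta>\<in>C_space r n. \<bar>D \<eta>\<bar> \<le> B * C_norm r \<eta>) \<and>
        (\<forall>\<epsilon>>0. \<exists>\<delta>>0. \<forall>\<eta>\<in>C_space r n. C_norm r \<eta> < \<delta> \<longrightarrow>
           \<bar>b (C_add r \<psi> \<eta>) (C_add r \<psi> \<eta>) - b \<psi> \<psi> - D \<eta>\<bar> \<le> \<epsilon> * C_norm r \<eta>)"
  proof (intro exI[of _ ?D] conjI allI ballI impI)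
    show "?D (C_add r \<eta> \<eta>') = ?D \<eta> + ?D \<eta>'" if "\<eta> \<in> C_space r n" "\<eta>' \<in> C_space r n" for \<eta> \<eta>'
      using add[OF that \<psi>] by simp
    show "?D (C_scale r c \<eta>) = c * ?D \<eta>" if "\<eta> \<in> C_space r n" for c \<eta>
      using scale[OF that \<psi>] by (simp add: distrib_left)
    show "\<exists>B. \<forall>\<eta>\<in>C_space r n. \<bar>?D \<eta>\<bar> \<le> B * C_norm r \<eta>"
    proof (intro exI ballI)
      fix \<eta> assume e: "\<eta> \<in> C_space r n"
      show "\<bar>?D \<eta>\<bar> \<le> (2 * B * C_norm r \<psi>) * C_norm r \<eta>"
        using B(2)[OF \<psi> e] B(2)[OF e \<psi>] abs_triangle_ineq[of "b \<psi> \<eta>" "b \<eta> \<psi>"] by (simp add: mult_ac)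
    qed
    fix \<epsilon> :: real assume \<epsilon>: "0 < \<epsilon>"
    show "\<exists>\<delta>>0. \<forall>\<eta>\<in>C_space r n. C_norm r \<eta> < \<delta> \<longrightarrow>
           \<bar>b (C_add r \<psi> \<eta>) (C_add r \<psi> \<eta>) - b \<psi> \<psi> - ?D \<eta>\<bar> \<le> \<epsilon> * C_norm r \<eta>"
    proof (intro exI conjI ballI impI)
      \<comment> \<open>With |b(\<eta>, \<eta>)| <= B |\<eta>|^2 this radius gives the bound
        \<epsilon> |\<eta>|; B + 1 avoids division by zero.\<close>
      show "0 < \<epsilon> / (B + 1)" using \<epsilon> B(1) by simp
      fix \<eta> assume e: "\<eta> \<in> C_space r n" "C_norm r \<eta> < \<epsilon> / (B + 1)"
      have "\<bar>b \<eta> \<eta>\<bar> \<le> (B * C_norm r \<eta>) * C_norm r \<eta>" using B(2)[OF e(1,1)] by simp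
      also have "B * C_norm r \<eta> \<le> (B + 1) * C_norm r \<eta>" using C_norm_nonneg[OF e(1) r] by (simp add: distrib_right)
      also have "(B + 1) * C_norm r \<eta> \<le> \<epsilon>" using e(2) B(1) by (simp add: field_simps)
      finally have "\<bar>b \<eta> \<eta>\<bar> \<le> \<epsilon> * C_norm r \<eta>" using C_norm_nonneg[OF e(1) r] by (simp add: mult_right_mono)
      then show "\<bar>b (C_add r \<psi> \<eta>) (C_add r \<psi> \<eta>) - b \<psi> \<psi> - ?D \<eta>\<bar> \<le> \<epsilon> * C_norm r \<eta>" unfolding rem[OF e(1)] .
    qed
  qed
qed

text \<open>The coordinate form of u . A v, a finite sum to which the closure rules for bilinear,
  absolutely continuous and differentiable functions apply.\<close>

definition bform :: "nat \<Rightarrow> nat \<Rightarrow> real mat \<Rightarrow> real vec \<Rightarrow> real vec \<Rightarrow> real" where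
  "bform k l A u v = (\<Sum>i\<in>{0..<k}. \<Sum>j\<in>{0..<l}. A $$ (i, j) * (u $ i * v $ j))"

lemma bform_eq: "A \<in> carrier_mat k l \<Longrightarrow> u \<in> carrier_vec k \<Longrightarrow> v \<in> carrier_vec l \<Longrightarrow> bform k l A u v = u \<bullet> (A *\<^sub>v v)"
  by (simp add: bform_def scalar_prod_def sum_distrib_left mult_ac)

lemma bilinear_fnl_bform:
  assumes "\<And>i. i < k \<Longrightarrow> linear_fnl r n (\<lambda>\<phi>. u \<phi> $ i)" "\<And>i. i < l \<Longrightarrow> linear_fnl r n (\<lambda>\<phi>. v \<phi> $ i)" "0 \<le> r"
  shows "bilinear_fnl r n (\<lambda>\<phi> \<psi>. bform k l A (u \<phi>) (v \<psi>))"
  unfolding bform_def by (intro bilinear_fnl_sum bilinear_fnl_scale bilinear_fnl_mult assms) (use assms in auto)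

lemma absolutely_continuous_bform:
  assumes "\<And>i. i < k \<Longrightarrow> absolutely_continuous_between a b (\<lambda>s. u s $ i)" "\<And>i. i < l \<Longrightarrow> absolutely_continuous_between a b (\<lambda>s. v s $ i)"
  shows "absolutely_continuous_between a b (\<lambda>s. bform k l A (u s) (v s))"
  unfolding bform_def
  by (intro absolutely_continuous_sum absolutely_continuous_mult absolutely_continuous_const assms) auto

definition vderiv :: "nat \<Rightarrow> (real \<Rightarrow> real vec) \<Rightarrow> real vec \<Rightarrow> real \<Rightarrow> bool" where
  "vderiv k f f' t \<longleftrightarrow> (\<forall>s. f s \<in> carrier_vec k) \<and> f' \<in> carrier_vec k \<and>
     (\<forall>i<k. ((\<lambda>s. f s $ i) has_real_derivative f' $ i) (at t))"

lemma bform_derivative: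
  assumes u: "vderiv k u u' t" and v: "vderiv l v v' t" and A: "A \<in> carrier_mat k l"
  shows "((\<lambda>s. bform k l A (u s) (v s)) has_real_derivative u' \<bullet> (A *\<^sub>v v t) + u t \<bullet> (A *\<^sub>v v')) (at t)"
proof -
  have c: "u t \<in> carrier_vec k" "v t \<in> carrier_vec l" "u' \<in> carrier_vec k" "v' \<in> carrier_vec l"
    using u v by (auto simp: vderiv_def)
  have "((\<lambda>s. bform k l A (u s) (v s)) has_real_derivative
    (\<Sum>i\<in>{0..<k}. \<Sum>j\<in>{0..<l}. A $$ (i, j) * (u' $ i * v t $ j + v' $ j * u t $ i))) (at t)"
    unfolding bform_def
    by (intro DERIV_sum DERIV_cmult DERIV_mult) (use u v in \<open>auto simp: vderiv_def\<close>)
  moreover have "(\<Sum>i\<in>{0..<k}. \<Sum>j\<in>{0..<l}. A $$ (i, j) * (u' $ i * v t $ j + v' $ j * u t $ i))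
      = bform k l A u' (v t) + bform k l A (u t) v'"
    by (simp add: bform_def distrib_left sum.distrib mult_ac)
  ultimately show ?thesis using bform_eq[OF A c(3,2)] bform_eq[OF A c(1,4)] by simp
qed

lemma vderiv_append:
  assumes f: "vderiv a f f' t" and g: "vderiv b g g' t"
  shows "vderiv (a + b) (\<lambda>s. f s @\<^sub>v g s) (f' @\<^sub>v g') t"
proof -
  have d: "dim_vec (f s) = a" "dim_vec (g s) = b" "dim_vec f' = a" "dim_vec g' = b" for s
    using f g by (auto simp: vderiv_def)
  have "((\<lambda>s. (f s @\<^sub>v g s) $ i) has_real_derivative (f' @\<^sub>v g') $ i) (at t)" if "i < a + b" for i
  proof -
    have e: "(f s @\<^sub>v g s) $ i = (if i < a then f s $ i else g s $ (i - a))"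
      "(f' @\<^sub>v g') $ i = (if i < a then f' $ i else g' $ (i - a))" for s
      using that by (simp_all add: d)
    show ?thesis unfolding e using f g that by (cases "i < a") (auto simp: vderiv_def)
  qed
  then show ?thesis using f g by (auto simp: vderiv_def)
qed

lemma vderiv_stack:
  assumes "\<And>i. i \<in> set is \<Longrightarrow> vderiv (k i) (\<lambda>s. f s i) (f' i) t"
  shows "vderiv (\<Sum>i\<leftarrow>is. k i) (\<lambda>s. stack_vec (map (f s) is)) (stack_vec (map f' is)) t"
  using assms
proof (induction "is")
  case Nil
  then show ?case by (simp add: vderiv_def)
next
  case (Cons i "is")
  then show ?case by (simp add: vderiv_append)
qed

lemma vderiv_bvec:
  assumes "\<And>a j. a < k \<Longrightarrow> j < n \<Longrightarrow> ((\<lambda>s. u s a j) has_real_derivative u' a j) (at t)"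
  shows "vderiv (k * n) (\<lambda>s. bvec k n (u s)) (bvec k n u') t"
proof -
  have "((\<lambda>s. bvec k n (u s) $ i) has_real_derivative bvec k n u' $ i) (at t)" if i: "i < k * n" for i
  proof -
    have "0 < n" using i by (cases n) auto
    then show ?thesis using assms[of "i div n" "i mod n"] i by (simp add: bvec_def less_mult_imp_div_less)
  qed
  then show ?thesis by (simp add: vderiv_def)
qed

text \<open>Transfers a property of scalar functions to the entries of a stacked vector. It is used
  for bounded linearity and for absolute continuity of the entries of \<eta>.\<close>

lemma component_stack:
  assumes "\<And>i q. i \<in> set is \<Longrightarrow> q < k i \<Longrightarrow> P (\<lambda>s. f s i $ q)" "\<And>i s. i \<in> set is \<Longrightarrow> f s i \<in> carrier_vec (k i)"
    and "q < (\<Sum>i\<leftarrow>is. k i)"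
  shows "P (\<lambda>s. stack_vec (map (f s) is) $ q)"
  using assms
proof (induction "is" arbitrary: q)
  case (Cons i "is")
  have c: "f s i \<in> carrier_vec (k i)" "stack_vec (map (f s) is) \<in> carrier_vec (\<Sum>i\<leftarrow>is. k i)" for s
    using Cons.prems(2) by (auto intro!: stack_vec_carrier)
  have eq: "(\<lambda>s. stack_vec (map (f s) (i # is)) $ q) = (\<lambda>s. if q < k i then f s i $ q else stack_vec (map (f s) is) $ (q - k i))"
  proof
    fix s
    have d: "dim_vec (f s i) = k i" "dim_vec (stack_vec (map (f s) is)) = (\<Sum>i\<leftarrow>is. k i)"
      using c[of s] by (auto simp only: carrier_vecD)
    show "stack_vec (map (f s) (i # is)) $ q = (if q < k i then f s i $ q else stack_vec (map (f s) is) $ (q - k i))"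
      using index_append_vec(1)[of q "f s i" "stack_vec (map (f s) is)"] Cons.prems(3) unfolding d by simp
  qed
  show ?case unfolding eq
    using Cons.prems Cons.IH[of "q - k i"] by (cases "q < k i") auto
qed simp

lemma component_bvec:
  assumes "\<And>a j. a < k \<Longrightarrow> j < n \<Longrightarrow> P (\<lambda>s. u s a j)" "i < k * n"
  shows "P (\<lambda>s. bvec k n (u s) $ i)"
proof -
  have "0 < n" using assms(2) by (cases n) auto
  then show ?thesis using assms(1)[of "i div n" "i mod n"] assms(2) by (simp add: bvec_def less_mult_imp_div_less)
qed

section \<open>The matrix inequality as an inequality of quadratic forms\<close>

locale admissible =
  fixes p :: plant
  assumes plant: "admissible_plant p"
begin

abbreviation "n \<equiv> dim_x p"
abbreviation "m \<equiv> dim_z p"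
abbreviation "q \<equiv> dim_w p"
abbreviation "l \<equiv> dim_y p"
abbreviation "\<nu> \<equiv> ndelays p"

lemma dims_pos: "0 < n" "0 < m" "0 < q" "0 < l" "0 < \<nu>"
  using plant by (auto simp: admissible_plant_def)

lemma pos_def_grams:
  assumes "i \<in> set (idx p)"
  shows "pos_def (Fmat p i)" "pos_def (Hmat p i)" "pos_def (Emat p i)"
  using plant_grams[OF plant] assms by (auto simp: set_idx)

lemma gram_carriers:
  "Fmat p i \<in> carrier_mat (dim_f p i) (dim_f p i)" "Hmat p i \<in> carrier_mat (vk p i) (vk p i)"
  "Emat p i \<in> carrier_mat (dim_phi p i) (dim_phi p i)" "Gam p i \<in> carrier_mat (dim_phi p i) (vk p i)"
  by (simp_all add: Fmat_def Hmat_def Emat_def Gam_def)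

lemma msqrt_carriers:
  assumes "i \<in> set (idx p)"
  shows "msqrt (minv (Fmat p i)) \<in> carrier_mat (dim_f p i) (dim_f p i)"
    "msqrt (minv (Hmat p i)) \<in> carrier_mat (vk p i) (vk p i)" "msqrt (Hmat p i) \<in> carrier_mat (vk p i) (vk p i)"
    "msqrt (minv (Emat p i)) \<in> carrier_mat (dim_phi p i) (dim_phi p i)" "msqrt (Emat p i) \<in> carrier_mat (dim_phi p i) (dim_phi p i)"
proof -
  note g = pos_def_grams[OF assms]
  note mi = pos_def_minv[OF g(1) gram_carriers(1)] pos_def_minv[OF g(2) gram_carriers(2)]
    pos_def_minv[OF g(3) gram_carriers(3)]
  show "msqrt (minv (Fmat p i)) \<in> carrier_mat (dim_f p i) (dim_f p i)" by (rule msqrt_pos_def(1)[OF mi(4,1)])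
  show "msqrt (minv (Hmat p i)) \<in> carrier_mat (vk p i) (vk p i)" by (rule msqrt_pos_def(1)[OF mi(8,5)])
  show "msqrt (minv (Emat p i)) \<in> carrier_mat (dim_phi p i) (dim_phi p i)" by (rule msqrt_pos_def(1)[OF mi(12,9)])
  show "msqrt (Hmat p i) \<in> carrier_mat (vk p i) (vk p i)" by (rule msqrt_pos_def(1)[OF g(2) gram_carriers(2)])
  show "msqrt (Emat p i) \<in> carrier_mat (dim_phi p i) (dim_phi p i)" by (rule msqrt_pos_def(1)[OF g(3) gram_carriers(3)])
qed

lemma T_carriers:
  assumes "i \<in> set (idx p)"
  shows "Tmat p i \<in> carrier_mat (kp p i) (vk p i)" "Ttil p i \<in> carrier_mat (kp p i) (dim_phi p i)"
proof -
  have k: "kp p i = dim_phi p i + vk p i" by (simp add: kp_def vk_def)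
  show "Tmat p i \<in> carrier_mat (kp p i) (vk p i)"
    unfolding k Tmat_def
    by (rule carrier_append_rows[OF mult_carrier_mat[OF gram_carriers(4) msqrt_carriers(2)[OF assms]] msqrt_carriers(3)[OF assms]])
  show "Ttil p i \<in> carrier_mat (kp p i) (dim_phi p i)"
    unfolding k Ttil_def by (rule carrier_append_rows[OF msqrt_carriers(5)[OF assms] zero_carrier_mat])
qed

lemma kp_sum_eq: "kp_sum p = vk_sum p + mu_sum p"
  by (simp add: kp_sum_def vk_sum_def mu_sum_def sum.distrib kp_def vk_def)

lemma coeff_row_carrier:
  assumes X: "\<And>i. i \<in> {0..\<nu>} \<Longrightarrow> X i \<in> carrier_mat r k"
    and Xh: "\<And>i. i \<in> {1..\<nu>} \<Longrightarrow> Xh i \<in> carrier_mat r (kp p i * k)"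
    and Y: "Y \<in> carrier_mat r q"
  shows "coeff_row p k X Xh Y \<in> carrier_mat r (beta p * k + q)"
proof -
  let ?As = "[X 0] @ map X (idx p) @ map (\<lambda>i. Xh i * (Tmat p i \<otimes>\<^sub>k 1\<^sub>m k)) (idx p) @
      map (\<lambda>i. Xh i * (Ttil p i \<otimes>\<^sub>k 1\<^sub>m k)) (idx p) @ [Y]"
  have Xd: "dim_row (X i) = r" "dim_col (X i) = k" if "i \<in> {0..\<nu>}" for i
    using carrier_matD[OF X[OF that]] by auto
  have Xhd: "dim_row (Xh i) = r" if "i \<in> {1..\<nu>}" for i
    using carrier_matD[OF Xh[OF that]] by auto
  have rows: "dim_row A = r" if "A \<in> set ?As" for A
    using that Xd Xhd carrier_matD[OF Y] by (auto simp: set_idx)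
  have "(\<Sum>A\<leftarrow>?As. dim_col A) = k + (\<Sum>i\<leftarrow>idx p. k) + (\<Sum>i\<leftarrow>idx p. vk p i * k) + (\<Sum>i\<leftarrow>idx p. dim_phi p i * k) + q"
  proof -
    have "map (dim_col \<circ> X) (idx p) = map (\<lambda>_. k) (idx p)"
      using Xd by (auto simp: set_idx)
    moreover have "map (dim_col \<circ> (\<lambda>i. Xh i * (Tmat p i \<otimes>\<^sub>k 1\<^sub>m k))) (idx p) = map (\<lambda>i. vk p i * k) (idx p)"
      using carrier_matD[OF T_carriers(1)] by auto
    moreover have "map (dim_col \<circ> (\<lambda>i. Xh i * (Ttil p i \<otimes>\<^sub>k 1\<^sub>m k))) (idx p) = map (\<lambda>i. dim_phi p i * k) (idx p)"
      using carrier_matD[OF T_carriers(2)] by auto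
    ultimately show ?thesis using Xd(2)[of 0] Y by (simp del: map_eq_conv)
  qed
  also have "\<dots> = beta p * k + q"
    unfolding sum_list_idx
    by (simp add: beta_def kp_sum_eq vk_sum_def mu_sum_def sum_distrib_right[symmetric] distrib_right)
  finally have "(\<Sum>A\<leftarrow>?As. dim_col A) = beta p * k + q" .
  then show ?thesis
    using hcat_carrier[of ?As r, OF rows] carrier_matD(1)[OF Y] unfolding coeff_row_def by metis
qed

lemma bA_carrier: "bA p \<in> carrier_mat n (beta p * n + q)"
  unfolding bA_def using plant
  by (intro coeff_row_carrier) (auto simp: admissible_plant_def)

lemma gain_row_carrier:
  assumes "\<And>i. i \<in> {0..\<nu>} \<Longrightarrow> X i \<in> carrier_mat r l"
    and "\<And>i. i \<in> {1..\<nu>} \<Longrightarrow> Xh i \<in> carrier_mat r (kp p i * l)"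
  shows "gain_row p r X Xh \<in> carrier_mat r (beta p * l + q)"
  unfolding gain_row_def using assms by (intro coeff_row_carrier) auto

text \<open>Applied with B = W^{-1}: the gains W^{-1} U_i assemble to W^{-1} times the row assembled
  from the U_i.\<close>

lemma gain_row_mult:
  assumes B: "B \<in> carrier_mat r r"
    and X: "\<And>i. i \<in> {0..\<nu>} \<Longrightarrow> X i \<in> carrier_mat r l"
    and Xh: "\<And>i. i \<in> {1..\<nu>} \<Longrightarrow> Xh i \<in> carrier_mat r (kp p i * l)"
  shows "gain_row p r (\<lambda>i. B * X i) (\<lambda>i. B * Xh i) = B * gain_row p r X Xh"
proof -
  let ?As = "[X 0] @ map X (idx p) @ map (\<lambda>i. Xh i * (Tmat p i \<otimes>\<^sub>k 1\<^sub>m l)) (idx p) @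
      map (\<lambda>i. Xh i * (Ttil p i \<otimes>\<^sub>k 1\<^sub>m l)) (idx p) @ [0\<^sub>m r q]"
  have rows: "dim_row A = r" if "A \<in> set ?As" for A
    using that carrier_matD(1)[OF X] carrier_matD(1)[OF Xh] by (auto simp: set_idx)
  have "(B * Xh i) * (Tmat p i \<otimes>\<^sub>k 1\<^sub>m l) = B * (Xh i * (Tmat p i \<otimes>\<^sub>k 1\<^sub>m l))"
    "(B * Xh i) * (Ttil p i \<otimes>\<^sub>k 1\<^sub>m l) = B * (Xh i * (Ttil p i \<otimes>\<^sub>k 1\<^sub>m l))" if "i \<in> set (idx p)" for i
    using that
    by (auto simp: set_idx intro!: assoc_mult_mat[OF B Xh kron_carrier[OF T_carriers(1) one_carrier_mat]]
        assoc_mult_mat[OF B Xh kron_carrier[OF T_carriers(2) one_carrier_mat]])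
  moreover have "B * 0\<^sub>m r q = 0\<^sub>m r q" using B by simp
  ultimately have "map ((*) B) ?As = [B * X 0] @ map (\<lambda>i. B * X i) (idx p)
      @ map (\<lambda>i. (B * Xh i) * (Tmat p i \<otimes>\<^sub>k 1\<^sub>m l)) (idx p)
      @ map (\<lambda>i. (B * Xh i) * (Ttil p i \<otimes>\<^sub>k 1\<^sub>m l)) (idx p) @ [0\<^sub>m r q]"
    by simp
  then show ?thesis
    unfolding gain_row_def coeff_row_def index_zero_mat using mult_hcat[of B r r ?As, OF B rows] by metis
qed

lemma out_block_carrier: "out_block p \<in> carrier_mat (beta p * l + q) (beta p * n + q)"
proof -
  have "Cout p \<in> carrier_mat l n" using plant by (simp add: admissible_plant_def)
  then show ?thesis unfolding out_block_def
    by (intro carrier_matI) (auto simp: dim_row_diag_block_mat dim_col_diag_block_mat)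
qed

lemma diag_idx_carrier:
  assumes "\<And>i. i \<in> set (idx p) \<Longrightarrow> X i \<in> carrier_mat (a i) (b i)"
  shows "diag_idx p X \<in> carrier_mat (\<Sum>i = 1..\<nu>. a i) (\<Sum>i = 1..\<nu>. b i)"
proof -
  have "map (dim_row \<circ> X) (idx p) = map a (idx p)" "map (dim_col \<circ> X) (idx p) = map b (idx p)"
    using assms by auto
  then show ?thesis
    unfolding diag_idx_def sum_list_idx[symmetric]
    by (intro carrier_matI) (simp_all add: dim_row_diag_block_mat dim_col_diag_block_mat del: map_eq_conv)
qed

lemma diag_idx_mult_stack:
  assumes "\<And>i. i \<in> set (idx p) \<Longrightarrow> X i \<in> carrier_mat (a i) (b i)"
    and "\<And>i. i \<in> set (idx p) \<Longrightarrow> v i \<in> carrier_vec (b i)"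
  shows "diag_idx p X *\<^sub>v stack_vec (map v (idx p)) = stack_vec (map (\<lambda>i. X i *\<^sub>v v i) (idx p))"
  unfolding diag_idx_def
  by (rule diag_block_mat_mult_stack) (use carrier_matD(2)[OF assms(1)] assms(2) in simp)

lemma diag_idx_kron: "diag_idx p X \<otimes>\<^sub>k 1\<^sub>m n = diag_idx p (\<lambda>i. X i \<otimes>\<^sub>k 1\<^sub>m n)"
  unfolding diag_idx_def kron_diag_block[OF dims_pos(1)] by (simp add: comp_def)

lemma stack_idx_carrier:
  assumes "\<And>i. i \<in> set (idx p) \<Longrightarrow> v i \<in> carrier_vec (k i)"
  shows "stack_vec (map v (idx p)) \<in> carrier_vec (\<Sum>i = 1..\<nu>. k i)"
  using stack_vec_carrier[of "idx p" v k] assms by (simp add: sum_list_idx)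

lemma quad_form_diag_idx:
  assumes X: "\<And>i. i \<in> set (idx p) \<Longrightarrow> X i \<in> carrier_mat (k i) (k i)"
    and v: "\<And>i. i \<in> set (idx p) \<Longrightarrow> v i \<in> carrier_vec (k i)"
  shows "stack_vec (map v (idx p)) \<bullet> (diag_idx p X *\<^sub>v stack_vec (map v (idx p)))
    = (\<Sum>i = 1..\<nu>. v i \<bullet> (X i *\<^sub>v v i))"
proof -
  have "stack_vec (map v (idx p)) \<bullet> (diag_idx p X *\<^sub>v stack_vec (map v (idx p)))
    = (\<Sum>i\<leftarrow>idx p. v i \<bullet> (X i *\<^sub>v v i))"
  proof -
    have "dim_vec (v i) = dim_vec (X i *\<^sub>v v i)" if "i \<in> set (idx p)" for i
      using carrier_matD(1)[OF X[OF that]] carrier_vecD[OF v[OF that]] by simp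
    then show ?thesis
      using scalar_prod_stack_vec[of "idx p" v "\<lambda>i. X i *\<^sub>v v i"] diag_idx_mult_stack[of X k k v] X v by simp
  qed
  then show ?thesis by (simp add: sum_list_idx)
qed

end

context admissible begin

section \<open>The blocks of M and I-hat acting on kernel coefficients\<close>

text \<open>Expresses F^{-1/2} f_i through the normalised H^{-1/2} h_i; \<open>mF\<close> does the
  same for F^{-1/2} M_i h_i, the derivative of the former.\<close>

definition eF :: "nat \<Rightarrow> real mat" where
  "eF i = msqrt (minv (Fmat p i)) *
       hcat (dim_f p i) [0\<^sub>m (dim_f p i) (dim_vphi p i), 1\<^sub>m (dim_f p i)] * msqrt (Hmat p i)"

definition mF :: "nat \<Rightarrow> real mat" where
  "mF i = msqrt (minv (Fmat p i)) * Mmat p i * msqrt (Hmat p i)"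

definition vF :: "nat \<Rightarrow> real \<Rightarrow> real vec" where
  "vF i t = msqrt (minv (Fmat p i)) *\<^sub>v fn_f p i t"

text \<open>Purely algebraic: x stands for arbitrary coefficients in the place of \<xi>, and in
  \<open>deta_block\<close> the value ed i stands for e(t - r_i), with ed 0 the current
  value.\<close>

definition eta_block :: "(nat \<Rightarrow> nat \<Rightarrow> nat \<Rightarrow> real) \<Rightarrow> nat \<Rightarrow> real vec" where
  "eta_block x i = bvec (dim_f p i) n (\<lambda>a j. \<Sum>b\<in>{0..<vk p i}. eF i $$ (a, b) * x i b j)"

definition deta_block :: "(nat \<Rightarrow> real vec) \<Rightarrow> (nat \<Rightarrow> nat \<Rightarrow> nat \<Rightarrow> real) \<Rightarrow> nat \<Rightarrow> real vec" where
  "deta_block ed x i = bvec (dim_f p i) n (\<lambda>a j. vF i (- delay p (i - 1)) $ a * ed (i - 1) $ j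
     - vF i (- delay p i) $ a * ed i $ j - (\<Sum>b\<in>{0..<vk p i}. mF i $$ (a, b) * x i b j))"

lemma eF_carrier:
  assumes "i \<in> set (idx p)"
  shows "eF i \<in> carrier_mat (dim_f p i) (vk p i)"
proof -
  have "hcat (dim_f p i) [0\<^sub>m (dim_f p i) (dim_vphi p i), 1\<^sub>m (dim_f p i)] \<in> carrier_mat (dim_f p i) (vk p i)"
    unfolding vk_def add.commute[of "dim_f p i"]
    by (rule hcat_Cons_carrier[OF zero_carrier_mat hcat_single_carrier[OF one_carrier_mat]])
  then show ?thesis unfolding eF_def
    by (rule mult_carrier_mat[OF mult_carrier_mat[OF msqrt_carriers(1)[OF assms]] msqrt_carriers(3)[OF assms]])
qed

lemma Mmat_carrier:
  assumes "i \<in> set (idx p)"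
  shows "Mmat p i \<in> carrier_mat (dim_f p i) (vk p i)"
  using plant assms by (simp add: admissible_plant_def set_idx)

lemma mF_carrier:
  assumes "i \<in> set (idx p)"
  shows "mF i \<in> carrier_mat (dim_f p i) (vk p i)"
  unfolding mF_def
  by (rule mult_carrier_mat[OF mult_carrier_mat[OF msqrt_carriers(1)[OF assms] Mmat_carrier[OF assms]] msqrt_carriers(3)[OF assms]])

lemma vF_dim: "i \<in> set (idx p) \<Longrightarrow> dim_vec (vF i t) = dim_f p i"
  using carrier_matD(1)[OF msqrt_carriers(1)] by (simp add: vF_def)

lemma Ihat_alt: "Ihat p = diag_idx p (\<lambda>i. eF i \<otimes>\<^sub>k 1\<^sub>m n)"
  unfolding Ihat_def eF_def[symmetric] by (rule diag_idx_kron)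

lemma d_sum_mult: "d_sum p * n = (\<Sum>i = 1..\<nu>. dim_f p i * n)"
  by (simp add: d_sum_def sum_distrib_right)

lemma vk_sum_mult: "vk_sum p * n = (\<Sum>i = 1..\<nu>. vk p i * n)"
  by (simp add: vk_sum_def sum_distrib_right)

lemma mu_sum_mult: "mu_sum p * n = (\<Sum>i = 1..\<nu>. dim_phi p i * n)"
  by (simp add: mu_sum_def sum_distrib_right)

lemma kron_1_carrier: "X \<in> carrier_mat a b \<Longrightarrow> X \<otimes>\<^sub>k 1\<^sub>m n \<in> carrier_mat (a * n) (b * n)"
  by (rule kron_carrier) simp_all

lemma Ihat_carrier: "Ihat p \<in> carrier_mat (d_sum p * n) (vk_sum p * n)"
  unfolding Ihat_alt d_sum_mult vk_sum_mult
  by (rule diag_idx_carrier) (rule kron_1_carrier[OF eF_carrier])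

lemma Ihat_mult: 
  "Ihat p *\<^sub>v stack_vec (map (\<lambda>i. bvec (vk p i) n (x i)) (idx p)) = stack_vec (map (eta_block x) (idx p))"
proof -
  have "Ihat p *\<^sub>v stack_vec (map (\<lambda>i. bvec (vk p i) n (x i)) (idx p))
    = stack_vec (map (\<lambda>i. (eF i \<otimes>\<^sub>k 1\<^sub>m n) *\<^sub>v bvec (vk p i) n (x i)) (idx p))"
    unfolding Ihat_alt by (rule diag_idx_mult_stack[OF kron_1_carrier[OF eF_carrier]]) simp_all
  also have "\<dots> = stack_vec (map (eta_block x) (idx p))"
    by (rule arg_cong[where f = stack_vec]) (simp add: eta_block_def kron_one_mult_bvec[OF eF_carrier])
  finally show ?thesis .
qed

lemma eta_carrier: "stack_vec (map (eta_block x) (idx p)) \<in> carrier_vec (d_sum p * n)"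
  unfolding d_sum_mult by (rule stack_idx_carrier) (simp add: eta_block_def)

lemma deta_carrier: "stack_vec (map (deta_block ed x) (idx p)) \<in> carrier_vec (d_sum p * n)"
  unfolding d_sum_mult by (rule stack_idx_carrier) (simp add: deta_block_def)

text \<open>The delayed values can be grouped as (0), (1..\<nu>) or as (0..\<nu>-1), (\<nu>). The
  first grouping is that of \<theta>, the second that of the leading blocks of \<open>bM\<close> and
  \<open>Xi\<close>, whose i-th block acts on the value at delay r_{i-1}.\<close>

lemma stack_shift:
  "ed 0 @\<^sub>v stack_vec (map ed (idx p)) = stack_vec (map (\<lambda>i. ed (i - 1)) (idx p)) @\<^sub>v (ed \<nu> :: real vec)"
proof -
  have "map (\<lambda>i. ed (i - 1)) (idx p) = map ed [0..<\<nu>]"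
    unfolding idx_def by (simp add: map_Suc_upt[symmetric] del: upt_Suc)
  moreover have "ed 0 # map ed (idx p) = map ed [0..<\<nu>] @ [ed \<nu>]"
  proof -
    have "0 # idx p = [0..<Suc \<nu>]" unfolding idx_def by (simp add: upt_conv_Cons del: upt_Suc)
    then have "ed 0 # map ed (idx p) = map ed [0..<Suc \<nu>]" by (metis list.map(2))
    then show ?thesis by simp
  qed
  ultimately have "stack_vec (ed 0 # map ed (idx p)) = stack_vec (map (\<lambda>i. ed (i - 1)) (idx p) @ [ed \<nu>])" by simp
  then show ?thesis by (simp only: stack_vec_append stack_vec_simps append_vec_vNil_right)
qed

lemma sum_const_n: "(\<Sum>i = 1..\<nu>. n) = \<nu> * n"
  by simp

text \<open>The product returns the boundary terms at both ends of each interval minus the M_i-term,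
  which is the derivative of \<eta> after integration by parts. The first concatenation in
  \<open>bM\<close> is evaluated in the shifted grouping, the second in the original one.\<close>

lemma bM_mult:
  assumes ed: "\<And>i. i \<le> \<nu> \<Longrightarrow> ed i \<in> carrier_vec n"
  shows "bM p \<otimes>\<^sub>k 1\<^sub>m n \<in> carrier_mat (d_sum p * n) (n + (\<nu> * n + vk_sum p * n))" (is ?C)
    and "(bM p \<otimes>\<^sub>k 1\<^sub>m n) *\<^sub>v (ed 0 @\<^sub>v (stack_vec (map ed (idx p)) @\<^sub>v stack_vec (map (\<lambda>i. bvec (vk p i) n (x i)) (idx p))))
    = stack_vec (map (deta_block ed x) (idx p))" (is "_ *\<^sub>v ?v = _")
proof -
  let ?d = "d_sum p" and ?k = "vk_sum p" and ?\<xi> = "stack_vec (map (\<lambda>i. bvec (vk p i) n (x i)) (idx p))"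
  define X where "X = diag_idx p (\<lambda>i. col_mat (vF i (- delay p (i - 1))))"
  define Y where "Y = diag_idx p (\<lambda>i. col_mat (vF i (- delay p i)))"
  define Z where "Z = diag_idx p mF"
  have cm: "col_mat (vF i t) \<in> carrier_mat (dim_f p i) 1" if "i \<in> set (idx p)" for i t
    using col_mat_carrier[of "vF i t"] vF_dim[OF that] by simp
  have X: "X \<in> carrier_mat ?d \<nu>" and Y: "Y \<in> carrier_mat ?d \<nu>" and Z: "Z \<in> carrier_mat ?d ?k"
    using diag_idx_carrier[of "\<lambda>i. col_mat (vF i (- delay p (i - 1)))" "dim_f p" "\<lambda>_. 1", OF cm]
      diag_idx_carrier[of "\<lambda>i. col_mat (vF i (- delay p i))" "dim_f p" "\<lambda>_. 1", OF cm]
      diag_idx_carrier[of mF "dim_f p" "vk p", OF mF_carrier]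
    by (simp_all add: X_def Y_def Z_def d_sum_def vk_sum_def)
  note dXYZ = carrier_matD[OF X] carrier_matD[OF Y] carrier_matD[OF Z]
  have bM: "bM p = hcat ?d [X, 0\<^sub>m ?d 1, 0\<^sub>m ?d ?k] - hcat ?d [0\<^sub>m ?d 1, Y, Z]"
    by (simp add: bM_def X_def Y_def Z_def vF_def mF_def[abs_def])
  have rows: "dim_row A = ?d" if "A \<in> set [X, 0\<^sub>m ?d 1, 0\<^sub>m ?d ?k]" for A
    using that dXYZ by auto
  have rows': "dim_row A = ?d" if "A \<in> set [0\<^sub>m ?d 1, Y, Z]" for A
    using that dXYZ by auto
  let ?X = "X \<otimes>\<^sub>k 1\<^sub>m n" and ?Y = "Y \<otimes>\<^sub>k 1\<^sub>m n" and ?Z = "Z \<otimes>\<^sub>k 1\<^sub>m n"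
  have h1: "hcat ?d [X, 0\<^sub>m ?d 1, 0\<^sub>m ?d ?k] \<in> carrier_mat ?d (\<nu> + (1 + ?k))"
    by (rule hcat_Cons_carrier[OF X hcat_Cons_carrier[OF zero_carrier_mat hcat_single_carrier[OF zero_carrier_mat]]])
  have h2: "hcat ?d [0\<^sub>m ?d 1, Y, Z] \<in> carrier_mat ?d (1 + (\<nu> + ?k))"
    by (rule hcat_Cons_carrier[OF zero_carrier_mat hcat_Cons_carrier[OF Y hcat_single_carrier[OF Z]]])
  have hr: "dim_row (hcat ?d [X, 0\<^sub>m ?d 1, 0\<^sub>m ?d ?k]) = dim_row (hcat ?d [0\<^sub>m ?d 1, Y, Z])"
    by (simp only: carrier_matD[OF h1] carrier_matD[OF h2])
  have hc: "dim_col (hcat ?d [X, 0\<^sub>m ?d 1, 0\<^sub>m ?d ?k]) = dim_col (hcat ?d [0\<^sub>m ?d 1, Y, Z])"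
    unfolding carrier_matD[OF h1] carrier_matD[OF h2] by simp
  note k1 = kron_hcat[of "[X, 0\<^sub>m ?d 1, 0\<^sub>m ?d ?k]" ?d n, OF _ dims_pos(1)]
  note k2 = kron_hcat[of "[0\<^sub>m ?d 1, Y, Z]" ?d n, OF _ dims_pos(1)]
  have eq: "bM p \<otimes>\<^sub>k 1\<^sub>m n = hcat (?d * n) [?X, 0\<^sub>m (?d * n) n, 0\<^sub>m (?d * n) (?k * n)]
      - hcat (?d * n) [0\<^sub>m (?d * n) n, ?Y, ?Z]"
    unfolding bM kron_minus[OF hr hc]
    by (subst k1, erule rows, subst k2, erule rows') (simp only: list.map kron_zero mult_1)
  have Xc: "?X \<in> carrier_mat (?d * n) (\<nu> * n)" and Yc: "?Y \<in> carrier_mat (?d * n) (\<nu> * n)"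
    and Zc: "?Z \<in> carrier_mat (?d * n) (?k * n)"
    using X Y Z by (simp_all add: kron_1_carrier)
  note dc = carrier_matD[OF Xc] carrier_matD[OF Yc] carrier_matD[OF Zc]
  have c0: "hcat (?d * n) [0\<^sub>m (?d * n) (?k * n)] \<in> carrier_mat (?d * n) (?k * n)"
    by (rule hcat_single_carrier[OF zero_carrier_mat])
  have c1: "hcat (?d * n) [0\<^sub>m (?d * n) n, 0\<^sub>m (?d * n) (?k * n)] \<in> carrier_mat (?d * n) (n + ?k * n)"
    by (rule hcat_Cons_carrier[OF zero_carrier_mat c0])
  have c2: "hcat (?d * n) [?X, 0\<^sub>m (?d * n) n, 0\<^sub>m (?d * n) (?k * n)] \<in> carrier_mat (?d * n) (\<nu> * n + (n + ?k * n))"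
    by (rule hcat_Cons_carrier[OF Xc c1])
  have c3: "hcat (?d * n) [?Z] \<in> carrier_mat (?d * n) (?k * n)"
    by (rule hcat_single_carrier[OF Zc])
  have c4: "hcat (?d * n) [?Y, ?Z] \<in> carrier_mat (?d * n) (\<nu> * n + ?k * n)"
    by (rule hcat_Cons_carrier[OF Yc c3])
  have c5: "hcat (?d * n) [0\<^sub>m (?d * n) n, ?Y, ?Z] \<in> carrier_mat (?d * n) (n + (\<nu> * n + ?k * n))"
    by (rule hcat_Cons_carrier[OF zero_carrier_mat c4])
  note single = hcat_single_mult_vec
  have c2': "hcat (?d * n) [?X, 0\<^sub>m (?d * n) n, 0\<^sub>m (?d * n) (?k * n)] \<in> carrier_mat (?d * n) (n + (\<nu> * n + ?k * n))"
    by (subst add.left_commute) (rule c2)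
  show ?C unfolding eq using minus_carrier_mat[OF c5] by simp
  have edi: "ed i \<in> carrier_vec n" "ed (i - 1) \<in> carrier_vec n" if "i \<in> set (idx p)" for i
    using ed that by (auto simp: set_idx)
  have E: "stack_vec (map ed (idx p)) \<in> carrier_vec (\<nu> * n)"
    "stack_vec (map (\<lambda>i. ed (i - 1)) (idx p)) \<in> carrier_vec (\<nu> * n)"
    unfolding sum_const_n[symmetric] by (rule stack_idx_carrier, erule edi)+
  have \<xi>: "?\<xi> \<in> carrier_vec (?k * n)"
    unfolding vk_sum_mult by (rule stack_idx_carrier) simp
  have e0: "ed 0 \<in> carrier_vec n" "ed \<nu> \<in> carrier_vec n" using ed by auto
  have v: "?v \<in> carrier_vec (n + (\<nu> * n + ?k * n))" 
    by (rule append_carrier_vec[OF e0(1) append_carrier_vec[OF E(1) \<xi>]])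
  have v': "?v = stack_vec (map (\<lambda>i. ed (i - 1)) (idx p)) @\<^sub>v (ed \<nu> @\<^sub>v ?\<xi>)"
    unfolding append_vec_assoc[symmetric] stack_shift[of ed] by (rule refl)
  have XE: "?X *\<^sub>v stack_vec (map (\<lambda>i. ed (i - 1)) (idx p))
      = stack_vec (map (\<lambda>i. bvec (dim_f p i) n (\<lambda>a j. vF i (- delay p (i - 1)) $ a * ed (i - 1) $ j)) (idx p))"
    unfolding X_def diag_idx_kron
    by (subst diag_idx_mult_stack[where a = "\<lambda>i. dim_f p i * n" and b = "\<lambda>_. n"])
      (use kron_1_carrier[OF cm] edi in \<open>simp_all add: col_mat_kron_mult_vec vF_dim cong: map_cong\<close>)
  have YE: "?Y *\<^sub>v stack_vec (map ed (idx p))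
      = stack_vec (map (\<lambda>i. bvec (dim_f p i) n (\<lambda>a j. vF i (- delay p i) $ a * ed i $ j)) (idx p))"
    unfolding Y_def diag_idx_kron
    by (subst diag_idx_mult_stack[where a = "\<lambda>i. dim_f p i * n" and b = "\<lambda>_. n"])
      (use kron_1_carrier[OF cm] edi in \<open>simp_all add: col_mat_kron_mult_vec vF_dim cong: map_cong\<close>)
  have ZX: "?Z *\<^sub>v ?\<xi>
      = stack_vec (map (\<lambda>i. bvec (dim_f p i) n (\<lambda>a j. \<Sum>b\<in>{0..<vk p i}. mF i $$ (a, b) * x i b j)) (idx p))"
    unfolding Z_def diag_idx_kron
    by (subst diag_idx_mult_stack[where a = "\<lambda>i. dim_f p i * n" and b = "\<lambda>i. vk p i * n"])
      (use kron_1_carrier[OF mF_carrier] in \<open>simp_all add: kron_one_mult_bvec[OF mF_carrier] cong: map_cong\<close>)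
  have "(bM p \<otimes>\<^sub>k 1\<^sub>m n) *\<^sub>v ?v
    = hcat (?d * n) [?X, 0\<^sub>m (?d * n) n, 0\<^sub>m (?d * n) (?k * n)] *\<^sub>v ?v
      - hcat (?d * n) [0\<^sub>m (?d * n) n, ?Y, ?Z] *\<^sub>v ?v"
    unfolding eq by (rule minus_mult_distrib_mat_vec[OF c2' c5 v])
  also have "hcat (?d * n) [?X, 0\<^sub>m (?d * n) n, 0\<^sub>m (?d * n) (?k * n)] *\<^sub>v ?v
    = ?X *\<^sub>v stack_vec (map (\<lambda>i. ed (i - 1)) (idx p))"
  proof -
    have "hcat (?d * n) [0\<^sub>m (?d * n) n, 0\<^sub>m (?d * n) (?k * n)] *\<^sub>v (ed \<nu> @\<^sub>v ?\<xi>) = 0\<^sub>v (?d * n)"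
      unfolding hcat_mult_vec[OF zero_carrier_mat c0 e0(2) \<xi>] single[OF zero_carrier_mat \<xi>]
        zero_mat_mult_vec[OF e0(2)] zero_mat_mult_vec[OF \<xi>] by simp
    then show ?thesis
      unfolding v' hcat_mult_vec[OF Xc c1 E(2) append_carrier_vec[OF e0(2) \<xi>]]
      using mult_mat_vec_carrier[OF Xc E(2)] by simp
  qed
  also have "hcat (?d * n) [0\<^sub>m (?d * n) n, ?Y, ?Z] *\<^sub>v ?v = ?Y *\<^sub>v stack_vec (map ed (idx p)) + ?Z *\<^sub>v ?\<xi>"
    unfolding hcat_mult_vec[OF zero_carrier_mat c4 e0(1) append_carrier_vec[OF E(1) \<xi>]]
      hcat_mult_vec[OF Yc c3 E(1) \<xi>] single[OF Zc \<xi>] zero_mat_mult_vec[OF e0(1)]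
    by (rule left_zero_vec[OF add_carrier_vec[OF mult_mat_vec_carrier[OF Yc E(1)] mult_mat_vec_carrier[OF Zc \<xi>]]])
  also have "?X *\<^sub>v stack_vec (map (\<lambda>i. ed (i - 1)) (idx p)) - (?Y *\<^sub>v stack_vec (map ed (idx p)) + ?Z *\<^sub>v ?\<xi>)
    = stack_vec (map (deta_block ed x) (idx p))"
    unfolding XE YE ZX
    by (subst stack_vec_plus, simp, subst stack_vec_minus, simp, rule arg_cong[where f = stack_vec])
      (auto simp: deta_block_def bvec_def less_mult_imp_div_less)
  finally show "(bM p \<otimes>\<^sub>k 1\<^sub>m n) *\<^sub>v ?v = stack_vec (map (deta_block ed x) (idx p))" .
qed

end

lemma stack_theta: "stack_vec ([a] @ map f is @ [b, c, d]) = a @\<^sub>v (stack_vec (map f is) @\<^sub>v (b @\<^sub>v (c @\<^sub>v d)))"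
  by (simp only: stack_vec_append stack_vec_simps append_vec_vNil_right append.simps)

section \<open>The hypotheses on the unknowns and the factors of the main inequality\<close>

locale lmi = admissible +
  fixes s :: supply_data and \<alpha> :: "nat \<Rightarrow> real"
    and P1 W P2 P3 :: "real mat"
    and Q R U Uh K Kh :: "nat \<Rightarrow> real mat"
  assumes adm_supply: "admissible_supply p s"
    and P1: "sym_mat n P1" and W: "sym_mat n W"
    and P2: "P2 \<in> carrier_mat n (d_sum p * n)" and P3: "sym_mat (d_sum p * n) P3"
    and Q: "\<And>i. i \<in> {1..\<nu>} \<Longrightarrow> sym_mat n (Q i)"
    and R: "\<And>i. i \<in> {1..\<nu>} \<Longrightarrow> sym_mat n (R i)"
    and U: "\<And>i. i \<in> {0..\<nu>} \<Longrightarrow> U i \<in> carrier_mat n l"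
    and Uh: "\<And>i. i \<in> {1..\<nu>} \<Longrightarrow> Uh i \<in> carrier_mat n (kp p i * l)"
    and K: "\<And>i. i \<in> {0..\<nu>} \<Longrightarrow> K i \<in> carrier_mat m l"
    and Kh: "\<And>i. i \<in> {1..\<nu>} \<Longrightarrow> Kh i \<in> carrier_mat m (kp p i * l)"
    and lmi_P: "pos_def (four_block_mat P1 P2 (P2\<^sup>T) (P3 + diag_idx p (\<lambda>i. 1\<^sub>m (dim_f p i) \<otimes>\<^sub>k Q i)))"
    and lmi_Q: "pos_def (diag_idx p Q)"
    and lmi_R: "pos_def (diag_idx p R)"
    and lmi_main:
      "neg_def (Sy (alpha_stack p \<alpha> * hcat n [- W, Pihat p W U Uh])
         + four_block_mat (0\<^sub>m n n) (bP p P1 P2) ((bP p P1 P2)\<^sup>T) (Phi p s P2 P3 Q R K Kh))"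
begin

abbreviation "N \<equiv> beta p * n + q"
abbreviation "dn \<equiv> d_sum p * n"

lemma beta_n: "beta p * n = n + (\<nu> * n + (vk_sum p * n + mu_sum p * n))"
  by (simp add: beta_def kp_sum_eq distrib_right)

lemma gU: "gain_row p n U Uh \<in> carrier_mat n (beta p * l + q)"
  by (rule gain_row_carrier[OF U Uh])

lemma gK: "gain_row p m K Kh \<in> carrier_mat m (beta p * l + q)"
  by (rule gain_row_carrier[OF K Kh])

text \<open>The first block of \<open>Pihat\<close>; it turns out to be W times the matrix of the
  error dynamics.\<close>

definition Pi1 :: "real mat" where "Pi1 = W * bA p + gain_row p n U Uh * out_block p"

lemma Pi1_carrier: "Pi1 \<in> carrier_mat n N"
  unfolding Pi1_def by (rule add_carrier_mat[OF mult_carrier_mat[OF gU out_block_carrier]])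

lemma Sig_carrier: "Sig p K Kh \<in> carrier_mat m N"
  unfolding Sig_def by (rule add_carrier_mat[OF mult_carrier_mat[OF gK out_block_carrier]])

lemma Pihat_carrier: "Pihat p W U Uh \<in> carrier_mat n (N + m)"
  unfolding Pihat_def Pi1_def[symmetric]
  by (rule hcat_Cons_carrier[OF Pi1_carrier hcat_single_carrier[OF zero_carrier_mat]])

lemma Pihat_mult:
  assumes "\<theta> \<in> carrier_vec N" "y \<in> carrier_vec m"
  shows "Pihat p W U Uh *\<^sub>v (\<theta> @\<^sub>v y) = Pi1 *\<^sub>v \<theta>"
  unfolding Pihat_def Pi1_def[symmetric]
    hcat_mult_vec[OF Pi1_carrier hcat_single_carrier[OF zero_carrier_mat] assms]
    hcat_single_mult_vec[OF zero_carrier_mat assms(2)] zero_mat_mult_vec[OF assms(2)]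
  by (rule right_zero_vec[OF mult_mat_vec_carrier[OF Pi1_carrier assms(1)]])

lemma WP_carrier: "hcat n [- W, Pihat p W U Uh] \<in> carrier_mat n (n + (N + m))"
  by (rule hcat_Cons_carrier[OF _ hcat_single_carrier[OF Pihat_carrier]]) (use sym_mat_carrier[OF W] in simp)

lemma WP_mult:
  assumes "u \<in> carrier_vec n" "\<theta> \<in> carrier_vec N" "y \<in> carrier_vec m"
  shows "hcat n [- W, Pihat p W U Uh] *\<^sub>v (u @\<^sub>v (\<theta> @\<^sub>v y)) = - (W *\<^sub>v u) + Pi1 *\<^sub>v \<theta>"
proof -
  have "- W \<in> carrier_mat n n" using sym_mat_carrier[OF W] by simp
  moreover have "(- W) *\<^sub>v u = - (W *\<^sub>v u)" using sym_mat_carrier[OF W] assms by simp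
  ultimately show ?thesis
    using hcat_mult_vec[OF _ hcat_single_carrier[OF Pihat_carrier] assms(1) append_carrier_vec[OF assms(2,3)]]
      hcat_single_mult_vec[OF Pihat_carrier append_carrier_vec[OF assms(2,3)]] Pihat_mult[OF assms(2,3)] by simp
qed

lemma alpha_stack_alt:
  "alpha_stack p \<alpha> = 1\<^sub>m n @\<^sub>r vcat n (map (\<lambda>i. \<alpha> i \<cdot>\<^sub>m 1\<^sub>m n) [1..<Suc (beta p)] @ [0\<^sub>m (q + m) n])"
  unfolding alpha_stack_def by simp

lemma alpha_rest_carrier:
  "vcat n (map (\<lambda>i. \<alpha> i \<cdot>\<^sub>m 1\<^sub>m n) [1..<Suc (beta p)] @ [0\<^sub>m (q + m) n]) \<in> carrier_mat (N + m) n"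
proof -
  let ?As = "map (\<lambda>i. \<alpha> i \<cdot>\<^sub>m 1\<^sub>m n) [1..<Suc (beta p)] @ [0\<^sub>m (q + m) n]"
  have "(\<Sum>A\<leftarrow>?As. dim_row A) = N + m"
    by (simp add: comp_def sum_list_triv del: upt_Suc)
  then show ?thesis using vcat_carrier[of ?As n] by fastforce
qed

lemma alpha_stack_carrier: "alpha_stack p \<alpha> \<in> carrier_mat (n + (N + m)) n"
  unfolding alpha_stack_alt by (rule carrier_append_rows[OF one_carrier_mat alpha_rest_carrier])

lemma bP_carrier: "bP p P1 P2 \<in> carrier_mat n (N + m)"
proof -
  have eq: "N + m = n + (\<nu> * n + (vk_sum p * n + (mu_sum p * n + q + m)))" by (simp add: beta_n)
  show ?thesis unfolding eq bP_def Let_def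
    by (rule hcat_Cons_carrier[OF sym_mat_carrier[OF P1] hcat_Cons_carrier[OF zero_carrier_mat
          hcat_Cons_carrier[OF mult_carrier_mat[OF P2 Ihat_carrier] hcat_single_carrier[OF zero_carrier_mat]]]])
qed

lemma bP_mult:
  assumes e: "e \<in> carrier_vec n" and E: "E \<in> carrier_vec (\<nu> * n)" and x: "x \<in> carrier_vec (vk_sum p * n)"
    and r: "r \<in> carrier_vec (mu_sum p * n + q + m)"
  shows "bP p P1 P2 *\<^sub>v (e @\<^sub>v (E @\<^sub>v (x @\<^sub>v r))) = P1 *\<^sub>v e + P2 *\<^sub>v (Ihat p *\<^sub>v x)"
proof -
  note c1 = hcat_single_carrier[OF zero_carrier_mat, of n "mu_sum p * n + q + m"]
  note c2 = hcat_Cons_carrier[OF mult_carrier_mat[OF P2 Ihat_carrier] c1]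
  note c3 = hcat_Cons_carrier[OF zero_carrier_mat c2, of "\<nu> * n"]
  note v2 = append_carrier_vec[OF x r]
  note v3 = append_carrier_vec[OF E v2]
  have "P2 *\<^sub>v (Ihat p *\<^sub>v x) \<in> carrier_vec n"
    by (rule mult_mat_vec_carrier[OF P2 mult_mat_vec_carrier[OF Ihat_carrier x]])
  then show ?thesis
    unfolding bP_def Let_def hcat_mult_vec[OF sym_mat_carrier[OF P1] c3 e v3]
      hcat_mult_vec[OF zero_carrier_mat c2 E v2] hcat_mult_vec[OF mult_carrier_mat[OF P2 Ihat_carrier] c1 x r]
      hcat_single_mult_vec[OF zero_carrier_mat r] zero_mat_mult_vec[OF E] zero_mat_mult_vec[OF r]
      assoc_mult_mat_vec[OF P2 Ihat_carrier x]
    by simp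
qed

text \<open>\<open>V1 * H1\<close> and \<open>V2 * H2\<close> are the two products under
  \<open>Sy\<close> in \<open>Phi\<close>. The first pairs P2^T e + P3 \<eta> with the derivative of
  \<eta>, the second pairs -J2 w + Jt^T y with \<zeta>.\<close>

definition V1 :: "real mat" where
  "V1 = vcat dn [P2, 0\<^sub>m (\<nu> * n) dn, (Ihat p)\<^sup>T * P3, 0\<^sub>m (mu_sum p * n + q + m) dn]"
definition H1 :: "real mat" where
  "H1 = hcat dn [bM p \<otimes>\<^sub>k 1\<^sub>m n, 0\<^sub>m dn (mu_sum p * n + q + m)]"
definition V2 :: "real mat" where
  "V2 = vcat m [0\<^sub>m (beta p * n) m, - ((J2 s)\<^sup>T), Jt s]"
definition H2 :: "real mat" where
  "H2 = hcat m [Sig p K Kh, 0\<^sub>m m m]"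

lemma dims_N: "n + (\<nu> * n + (vk_sum p * n + (mu_sum p * n + q + m))) = N + m"
  "n + (\<nu> * n + vk_sum p * n) + (mu_sum p * n + q + m) = N + m"
  "beta p * n + (q + m) = N + m"
  by (simp_all add: beta_n)

lemma IP_carrier: "(Ihat p)\<^sup>T * P3 \<in> carrier_mat (vk_sum p * n) dn"
  by (rule mult_carrier_mat[OF iffD2[OF transpose_carrier_mat Ihat_carrier] sym_mat_carrier[OF P3]])

lemma V1_carrier: "V1 \<in> carrier_mat (N + m) dn"
  unfolding V1_def dims_N(1)[symmetric]
  by (rule vcat_Cons_carrier[OF P2 vcat_Cons_carrier[OF zero_carrier_mat
      vcat_Cons_carrier[OF IP_carrier vcat_single_carrier[OF zero_carrier_mat]]]])

lemma V1_mult: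
  assumes e: "e \<in> carrier_vec n" and E: "E \<in> carrier_vec (\<nu> * n)" and x: "x \<in> carrier_vec (vk_sum p * n)"
    and r: "r \<in> carrier_vec (mu_sum p * n + q + m)"
  shows "V1\<^sup>T *\<^sub>v (e @\<^sub>v (E @\<^sub>v (x @\<^sub>v r))) = P2\<^sup>T *\<^sub>v e + P3 *\<^sub>v (Ihat p *\<^sub>v x)"
proof -
  note c1 = vcat_single_carrier[OF zero_carrier_mat, of dn "mu_sum p * n + q + m"]
  note c2 = vcat_Cons_carrier[OF IP_carrier c1]
  note c3 = vcat_Cons_carrier[OF zero_carrier_mat c2, of "\<nu> * n"]
  note v2 = append_carrier_vec[OF x r]
  note v3 = append_carrier_vec[OF E v2]
  have "((Ihat p)\<^sup>T * P3)\<^sup>T = P3 * Ihat p"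
    using transpose_mult[OF iffD2[OF transpose_carrier_mat Ihat_carrier] sym_mat_carrier[OF P3]] P3
    by (simp add: sym_mat_def)
  then have IP: "((Ihat p)\<^sup>T * P3)\<^sup>T *\<^sub>v x = P3 *\<^sub>v (Ihat p *\<^sub>v x)"
    using assoc_mult_mat_vec[OF sym_mat_carrier[OF P3] Ihat_carrier x] by simp
  have c: "P3 *\<^sub>v (Ihat p *\<^sub>v x) \<in> carrier_vec dn"
    by (rule mult_mat_vec_carrier[OF sym_mat_carrier[OF P3] mult_mat_vec_carrier[OF Ihat_carrier x]])
  show ?thesis
    unfolding V1_def transpose_vcat_mult_vec[OF P2 c3 e v3] transpose_vcat_mult_vec[OF zero_carrier_mat c2 E v2]
      transpose_vcat_mult_vec[OF IP_carrier c1 x r] transpose_vcat_single_mult_vec[OF zero_carrier_mat r]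
      IP zero_transpose_mat zero_mat_mult_vec[OF E] zero_mat_mult_vec[OF r]
      right_zero_vec[OF c] left_zero_vec[OF c] by (rule refl)
qed

lemma H1_carrier: "H1 \<in> carrier_mat dn (N + m)"
  unfolding H1_def dims_N(2)[symmetric]
  by (rule hcat_Cons_carrier[OF bM_mult(1)[of "\<lambda>_. 0\<^sub>v n"] hcat_single_carrier[OF zero_carrier_mat]]) simp

lemma H1_mult:
  assumes ed: "\<And>i. i \<le> \<nu> \<Longrightarrow> ed i \<in> carrier_vec n"
    and x: "\<xi> = stack_vec (map (\<lambda>i. bvec (vk p i) n (x i)) (idx p))"
    and r: "r \<in> carrier_vec (mu_sum p * n + q + m)"
  shows "H1 *\<^sub>v (ed 0 @\<^sub>v (stack_vec (map ed (idx p)) @\<^sub>v (\<xi> @\<^sub>v r))) = stack_vec (map (deta_block ed x) (idx p))"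
proof -
  have "stack_vec (map ed (idx p)) \<in> carrier_vec (\<nu> * n)"
    unfolding sum_const_n[symmetric] by (rule stack_idx_carrier) (use ed in \<open>simp add: set_idx\<close>)
  moreover have "\<xi> \<in> carrier_vec (vk_sum p * n)"
    unfolding vk_sum_mult x by (rule stack_idx_carrier) simp
  moreover have "ed 0 \<in> carrier_vec n" using ed by simp
  ultimately have v: "ed 0 @\<^sub>v (stack_vec (map ed (idx p)) @\<^sub>v \<xi>) \<in> carrier_vec (n + (\<nu> * n + vk_sum p * n))"
    by (intro append_carrier_vec)
  have eq: "ed 0 @\<^sub>v (stack_vec (map ed (idx p)) @\<^sub>v (\<xi> @\<^sub>v r)) = (ed 0 @\<^sub>v (stack_vec (map ed (idx p)) @\<^sub>v \<xi>)) @\<^sub>v r"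
    by (simp only: append_vec_assoc)
  have b1: "bM p \<otimes>\<^sub>k 1\<^sub>m n \<in> carrier_mat dn (n + (\<nu> * n + vk_sum p * n))"
    by (rule bM_mult(1)[OF ed])
  have b2: "(bM p \<otimes>\<^sub>k 1\<^sub>m n) *\<^sub>v (ed 0 @\<^sub>v (stack_vec (map ed (idx p)) @\<^sub>v \<xi>)) = stack_vec (map (deta_block ed x) (idx p))"
    unfolding x by (rule bM_mult(2)[OF ed])
  show ?thesis
    unfolding eq H1_def hcat_mult_vec[OF b1 hcat_single_carrier[OF zero_carrier_mat] v r]
      hcat_single_mult_vec[OF zero_carrier_mat r] zero_mat_mult_vec[OF r] b2
    by (rule right_zero_vec[OF deta_carrier])
qed

lemma supply_carriers:
  "J1 s \<in> carrier_mat m m" "Jt s \<in> carrier_mat m m" "J2 s \<in> carrier_mat m q" "J3 s \<in> carrier_mat q q"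
  "sym_mat m (J1 s)" "sym_mat q (J3 s)"
  using adm_supply by (simp_all add: admissible_supply_def sym_mat_def)

lemma J2T_carrier: "- ((J2 s)\<^sup>T) \<in> carrier_mat q m"
  using supply_carriers(3) by simp

lemma V2_carrier: "V2 \<in> carrier_mat (N + m) m"
  unfolding V2_def dims_N(3)[symmetric]
  by (rule vcat_Cons_carrier[OF zero_carrier_mat vcat_Cons_carrier[OF J2T_carrier
      vcat_single_carrier[OF supply_carriers(2)]]])

lemma V2_mult:
  assumes x: "x \<in> carrier_vec (beta p * n)" and w: "w \<in> carrier_vec q" and y: "y \<in> carrier_vec m"
  shows "V2\<^sup>T *\<^sub>v (x @\<^sub>v (w @\<^sub>v y)) = - (J2 s *\<^sub>v w) + (Jt s)\<^sup>T *\<^sub>v y"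
proof -
  note c1 = vcat_single_carrier[OF supply_carriers(2)]
  note c2 = vcat_Cons_carrier[OF J2T_carrier c1]
  have J: "(- ((J2 s)\<^sup>T))\<^sup>T *\<^sub>v w = - (J2 s *\<^sub>v w)"
    using supply_carriers(3) w by (simp add: transpose_uminus)
  have c: "- (J2 s *\<^sub>v w) + (Jt s)\<^sup>T *\<^sub>v y \<in> carrier_vec m"
    using mult_mat_vec_carrier[OF supply_carriers(3) w]
      mult_mat_vec_carrier[OF iffD2[OF transpose_carrier_mat supply_carriers(2)] y]
    by (intro add_carrier_vec) auto
  show ?thesis
    unfolding V2_def transpose_vcat_mult_vec[OF zero_carrier_mat c2 x append_carrier_vec[OF w y]]
      transpose_vcat_mult_vec[OF J2T_carrier c1 w y] transpose_vcat_single_mult_vec[OF supply_carriers(2) y]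
      zero_transpose_mat zero_mat_mult_vec[OF x] J by (rule left_zero_vec[OF c])
qed

lemma H2_carrier: "H2 \<in> carrier_mat m (N + m)"
  unfolding H2_def by (rule hcat_Cons_carrier[OF Sig_carrier hcat_single_carrier[OF zero_carrier_mat]])

lemma H2_mult:
  assumes "\<theta> \<in> carrier_vec N" "y \<in> carrier_vec m"
  shows "H2 *\<^sub>v (\<theta> @\<^sub>v y) = Sig p K Kh *\<^sub>v \<theta>"
  unfolding H2_def hcat_mult_vec[OF Sig_carrier hcat_single_carrier[OF zero_carrier_mat] assms]
    hcat_single_mult_vec[OF zero_carrier_mat assms(2)] zero_mat_mult_vec[OF assms(2)]
  by (rule right_zero_vec[OF mult_mat_vec_carrier[OF Sig_carrier assms(1)]])

end

lemma quad_form_diag_block: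
  assumes "A \<in> carrier_mat a a" "diag_block_mat Bs \<in> carrier_mat b b" "u \<in> carrier_vec a" "v \<in> carrier_vec b"
  shows "(u @\<^sub>v v) \<bullet> (diag_block_mat (A # Bs) *\<^sub>v (u @\<^sub>v v))
    = u \<bullet> (A *\<^sub>v u) + v \<bullet> (diag_block_mat Bs *\<^sub>v (v :: real vec))"
proof -
  have "diag_block_mat (A # Bs) *\<^sub>v (u @\<^sub>v v) = A *\<^sub>v u @\<^sub>v diag_block_mat Bs *\<^sub>v v"
    by (rule diag_block_mat_Cons_mult_vec) (use assms in auto)
  then show ?thesis
    using scalar_prod_append[OF assms(3,4) mult_mat_vec_carrier[OF assms(1,3)] mult_mat_vec_carrier[OF assms(2,4)]]
    by (simp del: diag_block_mat.simps)
qed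

lemma quad_form_zero: "u \<in> carrier_vec a \<Longrightarrow> u \<bullet> (0\<^sub>m a a *\<^sub>v u) = (0 :: real)"
  by (simp add: zero_mat_mult_vec)

lemma invertible_mat_det:
  assumes "invertible_mat (A :: real mat)" "A \<in> carrier_mat n n"
  shows "det A \<noteq> 0"
proof -
  obtain B where B: "A * B = 1\<^sub>m n" "B * A = 1\<^sub>m (dim_row B)"
    using assms unfolding invertible_mat_def inverts_mat_def by auto
  have "dim_col B = n" using arg_cong[OF B(1), of dim_col] by simp
  moreover have "dim_row B = n" using arg_cong[OF B(2), of dim_col] assms(2) by simp
  ultimately have "B \<in> carrier_mat n n" by auto
  then have "det A * det B = 1" using det_mult[OF assms(2)] B(1) by (metis det_one)
  then show ?thesis by auto
qed

context lmi begin

lemma QR_carrier: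
  assumes "i \<in> set (idx p)"
  shows "Q i \<in> carrier_mat n n" "R i \<in> carrier_mat n n"
  using Q[of i] R[of i] assms by (auto simp: set_idx sym_mat_def)

text \<open>The positive block diagonal is aligned with the values at r_0, ..., r_{\<nu>-1}, the
  negative one with those at r_1, ..., r_\<nu>; \<theta> is therefore read in two groupings.\<close>

lemma quad_form_Xi:
  assumes ed: "\<And>i. i \<le> \<nu> \<Longrightarrow> ed i \<in> carrier_vec n" and w: "w \<in> carrier_vec q"
    and xi: "\<xi> = stack_vec (map (\<lambda>i. bvec (vk p i) n (x i)) (idx p))"
    and as: "a = stack_vec (map (\<lambda>i. bvec (dim_phi p i) n (y i)) (idx p))"
    and th: "\<theta> = ed 0 @\<^sub>v (stack_vec (map ed (idx p)) @\<^sub>v (\<xi> @\<^sub>v (a @\<^sub>v w)))"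
  shows "Xi p s Q R \<in> carrier_mat N N"
    and "\<theta> \<bullet> (Xi p s Q R *\<^sub>v \<theta>) =
      (\<Sum>i = 1..\<nu>. ed (i - 1) \<bullet> (Q i *\<^sub>v ed (i - 1)) + (delay p i - delay p (i - 1)) * (ed (i - 1) \<bullet> (R i *\<^sub>v ed (i - 1))))
      - (\<Sum>i = 1..\<nu>. ed i \<bullet> (Q i *\<^sub>v ed i))
      - (\<Sum>i = 1..\<nu>. bvec (vk p i) n (x i) \<bullet> ((1\<^sub>m (vk p i) \<otimes>\<^sub>k R i) *\<^sub>v bvec (vk p i) n (x i)))
      - (\<Sum>i = 1..\<nu>. bvec (dim_phi p i) n (y i) \<bullet> ((1\<^sub>m (dim_phi p i) \<otimes>\<^sub>k R i) *\<^sub>v bvec (dim_phi p i) n (y i)))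
      - w \<bullet> (J3 s *\<^sub>v w)"
proof -
  let ?E = "stack_vec (map ed (idx p))" and ?E' = "stack_vec (map (\<lambda>i. ed (i - 1)) (idx p))"
  have edi: "ed i \<in> carrier_vec n" "ed (i - 1) \<in> carrier_vec n" if "i \<in> set (idx p)" for i
    using ed that by (auto simp: set_idx)
  have E: "?E \<in> carrier_vec (\<nu> * n)" "?E' \<in> carrier_vec (\<nu> * n)"
    unfolding sum_const_n[symmetric] by (rule stack_idx_carrier, erule edi)+
  have xc: "\<xi> \<in> carrier_vec (vk_sum p * n)" unfolding vk_sum_mult xi by (rule stack_idx_carrier) simp
  have ac: "a \<in> carrier_vec (mu_sum p * n)" unfolding mu_sum_mult as by (rule stack_idx_carrier) simp
  have e0: "ed 0 \<in> carrier_vec n" "ed \<nu> \<in> carrier_vec n" using ed by auto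
  define QD where "QD = diag_idx p Q"
  define RD where "RD = diag_idx p R"
  define R1 where "R1 = diag_idx p (\<lambda>i. 1\<^sub>m (vk p i) \<otimes>\<^sub>k R i)"
  define R2 where "R2 = diag_idx p (\<lambda>i. 1\<^sub>m (dim_phi p i) \<otimes>\<^sub>k R i)"
  have Lc: "(delay p i - delay p (i - 1)) \<cdot>\<^sub>m 1\<^sub>m n \<in> carrier_mat n n" for i by simp
  have QD: "QD \<in> carrier_mat (\<nu> * n) (\<nu> * n)" and RD: "RD \<in> carrier_mat (\<nu> * n) (\<nu> * n)"
    and Lam: "Lam p \<in> carrier_mat (\<nu> * n) (\<nu> * n)"
    unfolding sum_const_n[symmetric] QD_def RD_def Lam_def
    by (rule diag_idx_carrier, (erule QR_carrier | rule Lc))+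
  have R1: "R1 \<in> carrier_mat (vk_sum p * n) (vk_sum p * n)"
    unfolding R1_def vk_sum_mult by (rule diag_idx_carrier) (rule kron_carrier[OF one_carrier_mat QR_carrier(2)])
  have R2: "R2 \<in> carrier_mat (mu_sum p * n) (mu_sum p * n)"
    unfolding R2_def mu_sum_mult by (rule diag_idx_carrier) (rule kron_carrier[OF one_carrier_mat QR_carrier(2)])
  have RL: "RD * Lam p \<in> carrier_mat (\<nu> * n) (\<nu> * n)" by (rule mult_carrier_mat[OF RD Lam])
  have A1: "QD + RD * Lam p \<in> carrier_mat (\<nu> * n) (\<nu> * n)" using RL by (rule add_carrier_mat)
  let ?D1 = "[QD + RD * Lam p, 0\<^sub>m n n, 0\<^sub>m (kp_sum p * n) (kp_sum p * n), 0\<^sub>m q q]"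
  let ?D2 = "[0\<^sub>m n n, QD, R1, R2, J3 s]"
  have Xi: "Xi p s Q R = diag_block_mat ?D1 - diag_block_mat ?D2"
    by (simp add: Xi_def Let_def QD_def RD_def R1_def R2_def del: diag_block_mat.simps)
  have d14: "diag_block_mat [0\<^sub>m q q :: real mat] \<in> carrier_mat q q" 
    unfolding diag_block_mat_singleton by (rule zero_carrier_mat)
  have d13: "diag_block_mat [0\<^sub>m (kp_sum p * n) (kp_sum p * n), 0\<^sub>m q q :: real mat] \<in> carrier_mat (kp_sum p * n + q) (kp_sum p * n + q)"
    by (rule diag_block_pair_carrier[OF zero_carrier_mat d14])
  have d12: "diag_block_mat [0\<^sub>m n n, 0\<^sub>m (kp_sum p * n) (kp_sum p * n), 0\<^sub>m q q :: real mat]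
      \<in> carrier_mat (n + (kp_sum p * n + q)) (n + (kp_sum p * n + q))"
    by (rule diag_block_pair_carrier[OF zero_carrier_mat d13])
  have d11: "diag_block_mat ?D1 \<in> carrier_mat (\<nu> * n + (n + (kp_sum p * n + q))) (\<nu> * n + (n + (kp_sum p * n + q)))"
    by (rule diag_block_pair_carrier[OF A1 d12])
  have d25: "diag_block_mat [J3 s] \<in> carrier_mat q q"
    unfolding diag_block_mat_singleton by (rule supply_carriers(4))
  note d24 = diag_block_pair_carrier[OF R2 d25]
  note d23 = diag_block_pair_carrier[OF R1 d24]
  note d22 = diag_block_pair_carrier[OF QD d23]
  note d21 = diag_block_pair_carrier[OF zero_carrier_mat d22, of n n]
  have N1: "\<nu> * n + (n + (kp_sum p * n + q)) = N" and N2: "n + (\<nu> * n + (vk_sum p * n + (mu_sum p * n + q))) = N"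
    by (simp_all add: beta_def kp_sum_eq distrib_right)
  note d11' = d11[unfolded N1] and d21' = d21[unfolded N2]
  show "Xi p s Q R \<in> carrier_mat N N" unfolding Xi by (rule minus_carrier_mat[OF d21'])
  note v4 = append_carrier_vec[OF ac w]
  note v3 = append_carrier_vec[OF xc v4]
  note v2 = append_carrier_vec[OF E(1) v3]
  note v1 = append_carrier_vec[OF e0(1) v2]
  have th': "\<theta> = ?E' @\<^sub>v (ed \<nu> @\<^sub>v ((\<xi> @\<^sub>v a) @\<^sub>v w))"
    unfolding th append_vec_assoc[symmetric] stack_shift[of ed] by (rule refl)
  have thc: "\<theta> \<in> carrier_vec N" unfolding th N2[symmetric] by (rule v1)
  \<comment> \<open>The positive part has a single zero block of size \<kappa> n, so \<xi> and a are
    merged there.\<close>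
  have xa: "\<xi> @\<^sub>v a \<in> carrier_vec (kp_sum p * n)"
    using append_carrier_vec[OF xc ac] by (simp add: kp_sum_eq distrib_right)
  have "\<theta> \<bullet> (diag_block_mat ?D1 *\<^sub>v \<theta>) = ?E' \<bullet> ((QD + RD * Lam p) *\<^sub>v ?E')"
    unfolding th' quad_form_diag_block[OF A1 d12 E(2) append_carrier_vec[OF e0(2) append_carrier_vec[OF xa w]]]
      quad_form_diag_block[OF zero_carrier_mat d13 e0(2) append_carrier_vec[OF xa w]]
      quad_form_diag_block[OF zero_carrier_mat d14 xa w] diag_block_mat_singleton
      quad_form_zero[OF e0(2)] quad_form_zero[OF xa] quad_form_zero[OF w]
    by simp
  also have "\<dots> = ?E' \<bullet> (QD *\<^sub>v ?E') + ?E' \<bullet> (RD *\<^sub>v (Lam p *\<^sub>v ?E'))"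
    unfolding quad_form_add[OF QD RL E(2)] assoc_mult_mat_vec[OF RD Lam E(2)] by (rule refl)
  also have "?E' \<bullet> (QD *\<^sub>v ?E') = (\<Sum>i = 1..\<nu>. ed (i - 1) \<bullet> (Q i *\<^sub>v ed (i - 1)))"
    unfolding QD_def by (rule quad_form_diag_idx[OF QR_carrier(1) edi(2)])
  also have "?E' \<bullet> (RD *\<^sub>v (Lam p *\<^sub>v ?E'))
    = (\<Sum>i = 1..\<nu>. (delay p i - delay p (i - 1)) * (ed (i - 1) \<bullet> (R i *\<^sub>v ed (i - 1))))"
  proof -
    have "Lam p *\<^sub>v ?E' = stack_vec (map (\<lambda>i. (delay p i - delay p (i - 1)) \<cdot>\<^sub>m 1\<^sub>m n *\<^sub>v ed (i - 1)) (idx p))"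
      unfolding Lam_def by (rule diag_idx_mult_stack[OF Lc edi(2)])
    also have "\<dots> = stack_vec (map (\<lambda>i. (delay p i - delay p (i - 1)) \<cdot>\<^sub>v ed (i - 1)) (idx p))"
    proof (rule arg_cong[where f = stack_vec], rule map_cong[OF refl])
      fix i assume "i \<in> set (idx p)"
      then show "(delay p i - delay p (i - 1)) \<cdot>\<^sub>m 1\<^sub>m n *\<^sub>v ed (i - 1) = (delay p i - delay p (i - 1)) \<cdot>\<^sub>v ed (i - 1)"
        using edi(2)[of i] by (intro eq_vecI) auto
    qed
    finally have "RD *\<^sub>v (Lam p *\<^sub>v ?E')
      = stack_vec (map (\<lambda>i. R i *\<^sub>v ((delay p i - delay p (i - 1)) \<cdot>\<^sub>v ed (i - 1))) (idx p))"
      unfolding RD_def using edi(2) by (simp only:) (rule diag_idx_mult_stack[OF QR_carrier(2)], simp_all)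
    moreover have "dim_vec (ed (i - 1)) = dim_vec (R i *\<^sub>v ((delay p i - delay p (i - 1)) \<cdot>\<^sub>v ed (i - 1)))"
      if "i \<in> set (idx p)" for i
      using carrier_matD(1)[OF QR_carrier(2)[OF that]] carrier_vecD[OF edi(2)[OF that]] by simp
    ultimately have "?E' \<bullet> (RD *\<^sub>v (Lam p *\<^sub>v ?E'))
      = (\<Sum>i\<leftarrow>idx p. ed (i - 1) \<bullet> (R i *\<^sub>v ((delay p i - delay p (i - 1)) \<cdot>\<^sub>v ed (i - 1))))"
      by (simp only: scalar_prod_stack_vec)
    also have "\<dots> = (\<Sum>i\<leftarrow>idx p. (delay p i - delay p (i - 1)) * (ed (i - 1) \<bullet> (R i *\<^sub>v ed (i - 1))))"
    proof (rule arg_cong[where f = sum_list], rule map_cong[OF refl])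
      fix i assume i: "i \<in> set (idx p)"
      show "ed (i - 1) \<bullet> (R i *\<^sub>v ((delay p i - delay p (i - 1)) \<cdot>\<^sub>v ed (i - 1)))
        = (delay p i - delay p (i - 1)) * (ed (i - 1) \<bullet> (R i *\<^sub>v ed (i - 1)))"
        unfolding mult_mat_vec[OF QR_carrier(2)[OF i] edi(2)[OF i]]
        by (rule scalar_prod_smult_right) (use carrier_matD(1)[OF QR_carrier(2)[OF i]] carrier_vecD[OF edi(2)[OF i]] in simp)
    qed
    finally show ?thesis by (simp only: sum_list_idx)
  qed
  finally have f1: "\<theta> \<bullet> (diag_block_mat ?D1 *\<^sub>v \<theta>) =
      (\<Sum>i = 1..\<nu>. ed (i - 1) \<bullet> (Q i *\<^sub>v ed (i - 1)) + (delay p i - delay p (i - 1)) * (ed (i - 1) \<bullet> (R i *\<^sub>v ed (i - 1))))"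
    by (simp only: sum.distrib)
  have f2: "\<theta> \<bullet> (diag_block_mat ?D2 *\<^sub>v \<theta>) = ?E \<bullet> (QD *\<^sub>v ?E) + \<xi> \<bullet> (R1 *\<^sub>v \<xi>) + a \<bullet> (R2 *\<^sub>v a) + w \<bullet> (J3 s *\<^sub>v w)"
    unfolding th quad_form_diag_block[OF zero_carrier_mat d22 e0(1) v2] quad_form_diag_block[OF QD d23 E(1) v3]
      quad_form_diag_block[OF R1 d24 xc v4] quad_form_diag_block[OF R2 d25 ac w] diag_block_mat_singleton
      quad_form_zero[OF e0(1)]
    by simp
  have g1: "?E \<bullet> (QD *\<^sub>v ?E) = (\<Sum>i = 1..\<nu>. ed i \<bullet> (Q i *\<^sub>v ed i))"
    unfolding QD_def by (rule quad_form_diag_idx[OF QR_carrier(1) edi(1)])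
  have g2: "\<xi> \<bullet> (R1 *\<^sub>v \<xi>) = (\<Sum>i = 1..\<nu>. bvec (vk p i) n (x i) \<bullet> ((1\<^sub>m (vk p i) \<otimes>\<^sub>k R i) *\<^sub>v bvec (vk p i) n (x i)))"
    unfolding R1_def xi
    by (rule quad_form_diag_idx[where k = "\<lambda>i. vk p i * n"]) (simp_all add: kron_carrier[OF one_carrier_mat QR_carrier(2)])
  have g3: "a \<bullet> (R2 *\<^sub>v a) = (\<Sum>i = 1..\<nu>. bvec (dim_phi p i) n (y i) \<bullet> ((1\<^sub>m (dim_phi p i) \<otimes>\<^sub>k R i) *\<^sub>v bvec (dim_phi p i) n (y i)))"
    unfolding R2_def as
    by (rule quad_form_diag_idx[where k = "\<lambda>i. dim_phi p i * n"]) (simp_all add: kron_carrier[OF one_carrier_mat QR_carrier(2)])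
  show "\<theta> \<bullet> (Xi p s Q R *\<^sub>v \<theta>) =
      (\<Sum>i = 1..\<nu>. ed (i - 1) \<bullet> (Q i *\<^sub>v ed (i - 1)) + (delay p i - delay p (i - 1)) * (ed (i - 1) \<bullet> (R i *\<^sub>v ed (i - 1))))
      - (\<Sum>i = 1..\<nu>. ed i \<bullet> (Q i *\<^sub>v ed i))
      - (\<Sum>i = 1..\<nu>. bvec (vk p i) n (x i) \<bullet> ((1\<^sub>m (vk p i) \<otimes>\<^sub>k R i) *\<^sub>v bvec (vk p i) n (x i)))
      - (\<Sum>i = 1..\<nu>. bvec (dim_phi p i) n (y i) \<bullet> ((1\<^sub>m (dim_phi p i) \<otimes>\<^sub>k R i) *\<^sub>v bvec (dim_phi p i) n (y i)))
      - w \<bullet> (J3 s *\<^sub>v w)"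
    unfolding Xi quad_form_minus[OF d11' d21' thc] f1 f2 g1 g2 g3 by simp
qed

end

lemma scalar_prod_uminus:
  fixes x y :: "real vec"
  assumes "x \<in> carrier_vec k" "y \<in> carrier_vec k"
  shows "x \<bullet> (- y) = - (x \<bullet> y)" "(- x) \<bullet> y = - (x \<bullet> y)" "(- x) \<bullet> (- y) = x \<bullet> y"
  using assms by (simp_all add: scalar_prod_def sum_negf)

context lmi begin

section \<open>Evaluating the main inequality along the dynamics\<close>

definition LM :: "real mat" where
  "LM = Sy (alpha_stack p \<alpha> * hcat n [- W, Pihat p W U Uh])
         + four_block_mat (0\<^sub>m n n) (bP p P1 P2) ((bP p P1 P2)\<^sup>T) (Phi p s P2 P3 Q R K Kh)"

lemma Phi_alt: "Phi p s P2 P3 Q R K Kh = Sy (V1 * H1 + V2 * H2) + diag_block_mat [Xi p s Q R, J1 s]"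
  by (simp add: Phi_def Let_def V1_def H1_def V2_def H2_def del: diag_block_mat.simps)

lemma VH_carrier: "V1 * H1 \<in> carrier_mat (N + m) (N + m)" "V2 * H2 \<in> carrier_mat (N + m) (N + m)"
  by (rule mult_carrier_mat[OF V1_carrier H1_carrier], rule mult_carrier_mat[OF V2_carrier H2_carrier])

lemma Sy_carrier: "X \<in> carrier_mat k k \<Longrightarrow> Sy X \<in> carrier_mat k k"
  unfolding Sy_def by (rule add_carrier_mat) simp

lemma Sy_add:
  assumes "X \<in> carrier_mat k k" "Y \<in> carrier_mat k k"
  shows "Sy (X + Y) = Sy X + Sy Y"
  unfolding Sy_def using assms by (intro eq_matI) auto

lemma Xi_carrier: "Xi p s Q R \<in> carrier_mat N N"
  using quad_form_Xi(1)[of "\<lambda>_. 0\<^sub>v n" "0\<^sub>v q"] by simp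

lemma XJ_carrier: "diag_block_mat [Xi p s Q R, J1 s] \<in> carrier_mat (N + m) (N + m)"
  by (rule diag_block_pair_carrier[OF Xi_carrier]) (unfold diag_block_mat_singleton, rule supply_carriers(1))

lemma Phi_carrier: "Phi p s P2 P3 Q R K Kh \<in> carrier_mat (N + m) (N + m)"
  unfolding Phi_alt by (rule add_carrier_mat[OF XJ_carrier])

lemma quad_form_Phi:
  assumes x: "x \<in> carrier_vec (N + m)" and th: "\<theta> \<in> carrier_vec N" and y: "y \<in> carrier_vec m" and xe: "x = \<theta> @\<^sub>v y"
  shows "x \<bullet> (Phi p s P2 P3 Q R K Kh *\<^sub>v x) = 2 * ((V1\<^sup>T *\<^sub>v x) \<bullet> (H1 *\<^sub>v x)) + 2 * ((V2\<^sup>T *\<^sub>v x) \<bullet> (H2 *\<^sub>v x))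
    + \<theta> \<bullet> (Xi p s Q R *\<^sub>v \<theta>) + y \<bullet> (J1 s *\<^sub>v y)"
proof -
  have J: "diag_block_mat [J1 s] \<in> carrier_mat m m" unfolding diag_block_mat_singleton by (rule supply_carriers(1))
  have S: "Sy (V1 * H1) \<in> carrier_mat (N + m) (N + m)" "Sy (V2 * H2) \<in> carrier_mat (N + m) (N + m)"
    by (rule Sy_carrier[OF VH_carrier(1)], rule Sy_carrier[OF VH_carrier(2)])
  have "x \<bullet> (diag_block_mat [Xi p s Q R, J1 s] *\<^sub>v x) = \<theta> \<bullet> (Xi p s Q R *\<^sub>v \<theta>) + y \<bullet> (J1 s *\<^sub>v y)"
    unfolding xe quad_form_diag_block[OF Xi_carrier J th y] diag_block_mat_singleton by (rule refl)
  then show ?thesis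
    unfolding Phi_alt Sy_add[OF VH_carrier] quad_form_add[OF add_carrier_mat[OF S(2)] XJ_carrier x]
      quad_form_add[OF S x] quad_form_Sy[OF V1_carrier H1_carrier x] quad_form_Sy[OF V2_carrier H2_carrier x]
    by simp
qed

lemma AH_carrier: "alpha_stack p \<alpha> * hcat n [- W, Pihat p W U Uh] \<in> carrier_mat (n + (N + m)) (n + (N + m))"
  by (rule mult_carrier_mat[OF alpha_stack_carrier WP_carrier])

lemma BP_carrier: "four_block_mat (0\<^sub>m n n) (bP p P1 P2) ((bP p P1 P2)\<^sup>T) (Phi p s P2 P3 Q R K Kh) \<in> carrier_mat (n + (N + m)) (n + (N + m))"
  by (rule four_block_carrier_mat[OF zero_carrier_mat Phi_carrier])

lemma LM_carrier: "LM \<in> carrier_mat (n + (N + m)) (n + (N + m))"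
  unfolding LM_def by (rule add_carrier_mat[OF BP_carrier])

lemma quad_form_LM:
  assumes u: "u \<in> carrier_vec n" and v: "v \<in> carrier_vec (N + m)"
  shows "(u @\<^sub>v v) \<bullet> (LM *\<^sub>v (u @\<^sub>v v)) =
    2 * (((alpha_stack p \<alpha>)\<^sup>T *\<^sub>v (u @\<^sub>v v)) \<bullet> (hcat n [- W, Pihat p W U Uh] *\<^sub>v (u @\<^sub>v v)))
    + 2 * (u \<bullet> (bP p P1 P2 *\<^sub>v v)) + v \<bullet> (Phi p s P2 P3 Q R K Kh *\<^sub>v v)"
  unfolding LM_def quad_form_add[OF Sy_carrier[OF AH_carrier] BP_carrier append_carrier_vec[OF u v]]
    quad_form_Sy[OF alpha_stack_carrier WP_carrier append_carrier_vec[OF u v]]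
    quad_form_four_block[OF zero_carrier_mat bP_carrier Phi_carrier u v] quad_form_zero[OF u]
  by simp

text \<open>On (v, 0) the form of the inequality is -2 v . W v: the transposed \<alpha>-stack reads
  its identity block, and the terms with \<open>bP\<close> and \<open>Phi\<close> vanish. This makes
  W^{-1} in the gains meaningful.\<close>

lemma W_pos_def: "pos_def W"
proof (rule pos_defI[OF W])
  fix v :: "real vec" assume v: "v \<in> carrier_vec n" "v \<noteq> 0\<^sub>v n"
  let ?z = "0\<^sub>v N @\<^sub>v 0\<^sub>v m :: real vec"
  have z0: "?z = 0\<^sub>v (N + m)" by (rule zero_vec_append)
  have z: "?z \<in> carrier_vec (N + m)" unfolding z0 by simp
  have x: "v @\<^sub>v ?z \<in> carrier_vec (n + (N + m))" by (rule append_carrier_vec[OF v(1) z])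
  have "v @\<^sub>v ?z \<noteq> 0\<^sub>v n @\<^sub>v 0\<^sub>v (N + m)"
    using append_vec_eq[OF v(1) zero_carrier_vec] v(2) by simp
  then have "(v @\<^sub>v ?z) \<bullet> (LM *\<^sub>v (v @\<^sub>v ?z)) < 0"
    using lmi_main[folded LM_def] x LM_carrier unfolding neg_def_def zero_vec_append by auto
  also have "(v @\<^sub>v ?z) \<bullet> (LM *\<^sub>v (v @\<^sub>v ?z)) = - 2 * (v \<bullet> (W *\<^sub>v v))"
  proof -
    have Wv: "W *\<^sub>v v \<in> carrier_vec n" by (rule mult_mat_vec_carrier[OF sym_mat_carrier[OF W] v(1)])
    have a: "(alpha_stack p \<alpha>)\<^sup>T *\<^sub>v (v @\<^sub>v ?z) = v"
      unfolding alpha_stack_alt transpose_append_rows_mult_vec[OF one_carrier_mat alpha_rest_carrier v(1) z]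
      unfolding z0 mult_mat_zero_vec[OF iffD2[OF transpose_carrier_mat alpha_rest_carrier]]
      using v(1) by simp
    have h: "hcat n [- W, Pihat p W U Uh] *\<^sub>v (v @\<^sub>v ?z) = - (W *\<^sub>v v)"
      unfolding WP_mult[OF v(1) zero_carrier_vec zero_carrier_vec] mult_mat_zero_vec[OF Pi1_carrier]
      using Wv by simp
    have b: "bP p P1 P2 *\<^sub>v ?z = 0\<^sub>v n" unfolding z0 by (rule mult_mat_zero_vec[OF bP_carrier])
    have f: "?z \<bullet> (Phi p s P2 P3 Q R K Kh *\<^sub>v ?z) = 0"
      unfolding z0 mult_mat_zero_vec[OF Phi_carrier] by simp
    show ?thesis
      unfolding quad_form_LM[OF v(1) z] a h b f scalar_prod_uminus(1)[OF v(1) Wv] using v(1) by simp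
  qed
  finally show "0 < v \<bullet> (W *\<^sub>v v)" by simp
qed

lemma W_inverse: "minv W \<in> carrier_mat n n" "W * minv W = 1\<^sub>m n"
  using pos_def_minv[OF W_pos_def sym_mat_carrier[OF W]] by auto

abbreviation "L \<equiv> \<lambda>i. minv W * U i"
abbreviation "Lh \<equiv> \<lambda>i. minv W * Uh i"

definition rhs_mat :: "real mat" where
  "rhs_mat = bA p + gain_row p n L Lh * out_block p"

lemma gL: "gain_row p n L Lh = minv W * gain_row p n U Uh"
  by (rule gain_row_mult[OF W_inverse(1) U Uh])

lemma gLo_carrier: "minv W * gain_row p n U Uh * out_block p \<in> carrier_mat n N"
  by (rule mult_carrier_mat[OF mult_carrier_mat[OF W_inverse(1) gU] out_block_carrier])

lemma rhs_mat_carrier: "rhs_mat \<in> carrier_mat n N"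
  unfolding rhs_mat_def gL by (rule add_carrier_mat[OF gLo_carrier])

text \<open>The change of variables U = W L undone; by this identity W x cancels the \<theta>-part
  of the row next to -W when x is the derivative of e.\<close>

lemma W_rhs: "W * rhs_mat = Pi1"
proof -
  note WC = sym_mat_carrier[OF W]
  have "W * rhs_mat = W * bA p + W * (minv W * gain_row p n U Uh * out_block p)"
    unfolding rhs_mat_def gL by (rule mult_add_distrib_mat[OF WC bA_carrier gLo_carrier])
  also have "W * (minv W * gain_row p n U Uh * out_block p) = (W * minv W) * (gain_row p n U Uh * out_block p)"
    using assoc_mult_mat[OF W_inverse(1) gU out_block_carrier]
      assoc_mult_mat[OF WC W_inverse(1) mult_carrier_mat[OF gU out_block_carrier]] by simp
  also have "\<dots> = gain_row p n U Uh * out_block p"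
    unfolding W_inverse(2) by (rule left_mult_one_mat[OF mult_carrier_mat[OF gU out_block_carrier]])
  finally show ?thesis unfolding Pi1_def .
qed

lemma J1_inverse: "minv (J1 s) \<in> carrier_mat m m" "J1 s * minv (J1 s) = 1\<^sub>m m" "sym_mat m (minv (J1 s))"
proof -
  have i: "invertible_mat (J1 s)" and nd: "neg_def (minv (J1 s))"
    using adm_supply by (simp_all add: admissible_supply_def)
  note mi = minv_inverse[OF supply_carriers(1) invertible_mat_det[OF i supply_carriers(1)]]
  show "minv (J1 s) \<in> carrier_mat m m" "J1 s * minv (J1 s) = 1\<^sub>m m" by (fact mi)+
  show "sym_mat m (minv (J1 s))" using nd mi(1) by (simp add: neg_def_def)
qed

lemma supply_rate_eq:
  assumes z: "z \<in> carrier_vec m" and w: "w \<in> carrier_vec q"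
  shows "supply_rate s z w = (Jt s *\<^sub>v z) \<bullet> (minv (J1 s) *\<^sub>v (Jt s *\<^sub>v z)) + 2 * (z \<bullet> (J2 s *\<^sub>v w)) + w \<bullet> (J3 s *\<^sub>v w)"
proof -
  note c = supply_carriers J1_inverse(1)
  have JT: "(Jt s)\<^sup>T \<in> carrier_mat m m" using c(2) by simp
  have A: "(Jt s)\<^sup>T * minv (J1 s) * Jt s \<in> carrier_mat m m"
    by (rule mult_carrier_mat[OF mult_carrier_mat[OF JT c(7)] c(2)])
  have "((Jt s)\<^sup>T * minv (J1 s) * Jt s) *\<^sub>v z = (Jt s)\<^sup>T *\<^sub>v (minv (J1 s) *\<^sub>v (Jt s *\<^sub>v z))"
    using assoc_mult_mat_vec[OF mult_carrier_mat[OF JT c(7)] c(2) z]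
      assoc_mult_mat_vec[OF JT c(7) mult_mat_vec_carrier[OF c(2) z]] by simp
  then have "z \<bullet> (((Jt s)\<^sup>T * minv (J1 s) * Jt s) *\<^sub>v z) = (Jt s *\<^sub>v z) \<bullet> (minv (J1 s) *\<^sub>v (Jt s *\<^sub>v z))"
    using transpose_vec_mult_scalar[OF JT mult_mat_vec_carrier[OF c(7) mult_mat_vec_carrier[OF c(2) z]] z]
    by simp
  then show ?thesis
    unfolding supply_rate_def quad_form_four_block[OF A c(3) c(4) z w] by simp
qed

text \<open>With w = 0 only the negative semidefinite \<zeta>-block remains, so the dissipation
  inequality becomes a decrease of the functional.\<close>

lemma supply_rate_zero:
  assumes z: "z \<in> carrier_vec m"
  shows "supply_rate s z (0\<^sub>v q) \<le> 0"
proof -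
  have "neg_semidef ((Jt s)\<^sup>T * minv (J1 s) * Jt s)" using adm_supply by (simp add: admissible_supply_def)
  moreover have "dim_row ((Jt s)\<^sup>T * minv (J1 s) * Jt s) = m" using carrier_matD(2)[OF supply_carriers(2)] by simp
  ultimately have le: "z \<bullet> (((Jt s)\<^sup>T * minv (J1 s) * Jt s) *\<^sub>v z) \<le> 0" using z unfolding neg_semidef_def by simp
  note c = supply_carriers J1_inverse(1)
  have JT: "(Jt s)\<^sup>T \<in> carrier_mat m m" using c(2) by simp
  have A: "(Jt s)\<^sup>T * minv (J1 s) * Jt s \<in> carrier_mat m m"
    by (rule mult_carrier_mat[OF mult_carrier_mat[OF JT c(7)] c(2)])
  show ?thesis
    unfolding supply_rate_def quad_form_four_block[OF A c(3) c(4) z zero_carrier_vec]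
      mult_mat_zero_vec[OF c(3)] mult_mat_zero_vec[OF c(4)]
    using le z by simp
qed

text \<open>The arguments \<open>ed\<close>, \<open>x\<close>, \<open>y\<close> and \<open>w\<close>
  are arbitrary, so this is pure linear algebra; integrals and solutions enter when it is applied.
  Of the margin c |X|^2 the part c |ed 0|^2 is kept.\<close>

lemma lmi_inequality:
  assumes c: "0 \<le> c" "\<And>X. X \<in> carrier_vec (n + (N + m)) \<Longrightarrow> X \<bullet> (LM *\<^sub>v X) \<le> - c * (X \<bullet> X)"
    and ed: "\<And>i. i \<le> \<nu> \<Longrightarrow> ed i \<in> carrier_vec n" and w: "w \<in> carrier_vec q"
    and xi: "\<xi> = stack_vec (map (\<lambda>i. bvec (vk p i) n (x i)) (idx p))"
    and as: "a = stack_vec (map (\<lambda>i. bvec (dim_phi p i) n (y i)) (idx p))"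
    and th: "\<theta> = ed 0 @\<^sub>v (stack_vec (map ed (idx p)) @\<^sub>v (\<xi> @\<^sub>v (a @\<^sub>v w)))"
    and eta: "\<eta> = stack_vec (map (eta_block x) (idx p))" and deta: "\<eta>' = stack_vec (map (deta_block ed x) (idx p))"
  shows "2 * ((rhs_mat *\<^sub>v \<theta>) \<bullet> (P1 *\<^sub>v ed 0 + P2 *\<^sub>v \<eta>)) + 2 * ((P2\<^sup>T *\<^sub>v ed 0 + P3 *\<^sub>v \<eta>) \<bullet> \<eta>')
      + (\<Sum>i = 1..\<nu>. ed (i - 1) \<bullet> (Q i *\<^sub>v ed (i - 1)) + (delay p i - delay p (i - 1)) * (ed (i - 1) \<bullet> (R i *\<^sub>v ed (i - 1))))
      - (\<Sum>i = 1..\<nu>. ed i \<bullet> (Q i *\<^sub>v ed i))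
      - (\<Sum>i = 1..\<nu>. bvec (vk p i) n (x i) \<bullet> ((1\<^sub>m (vk p i) \<otimes>\<^sub>k R i) *\<^sub>v bvec (vk p i) n (x i)))
      - (\<Sum>i = 1..\<nu>. bvec (dim_phi p i) n (y i) \<bullet> ((1\<^sub>m (dim_phi p i) \<otimes>\<^sub>k R i) *\<^sub>v bvec (dim_phi p i) n (y i)))
      - supply_rate s (Sig p K Kh *\<^sub>v \<theta>) w
    \<le> - c * (ed 0 \<bullet> ed 0)"
proof -
  define u where "u = rhs_mat *\<^sub>v \<theta>"
  define z where "z = Sig p K Kh *\<^sub>v \<theta>"
  define k where "k = (Jt s *\<^sub>v z) \<bullet> (minv (J1 s) *\<^sub>v (Jt s *\<^sub>v z))"
  let ?E = "stack_vec (map ed (idx p))"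
  have E: "?E \<in> carrier_vec (\<nu> * n)"
    unfolding sum_const_n[symmetric] by (rule stack_idx_carrier) (use ed in \<open>simp add: set_idx\<close>)
  have xc: "\<xi> \<in> carrier_vec (vk_sum p * n)" unfolding vk_sum_mult xi by (rule stack_idx_carrier) simp
  have ac: "a \<in> carrier_vec (mu_sum p * n)" unfolding mu_sum_mult as by (rule stack_idx_carrier) simp
  have e0: "ed 0 \<in> carrier_vec n" using ed by auto
  have N2: "n + (\<nu> * n + (vk_sum p * n + (mu_sum p * n + q))) = N"
    by (simp add: beta_def kp_sum_eq distrib_right)
  have thc: "\<theta> \<in> carrier_vec N"
    unfolding th N2[symmetric]
    by (rule append_carrier_vec[OF e0 append_carrier_vec[OF E append_carrier_vec[OF xc append_carrier_vec[OF ac w]]]])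
  have uc: "u \<in> carrier_vec n" unfolding u_def by (rule mult_mat_vec_carrier[OF rhs_mat_carrier thc])
  have zc: "z \<in> carrier_vec m" unfolding z_def by (rule mult_mat_vec_carrier[OF Sig_carrier thc])
  have Jz: "Jt s *\<^sub>v z \<in> carrier_vec m" by (rule mult_mat_vec_carrier[OF supply_carriers(2) zc])
  have Mz: "minv (J1 s) *\<^sub>v (Jt s *\<^sub>v z) \<in> carrier_vec m" by (rule mult_mat_vec_carrier[OF J1_inverse(1) Jz])
  \<comment> \<open>The critical point of 2 (Jt z) . Y + Y . J1 Y in Y. There the expression equals
    -(Jt z) . J1^{-1} (Jt z): the block J1 acts through its Schur complement and yields the
    quadratic term of the supply rate.\<close>
  define Y where "Y = - (minv (J1 s) *\<^sub>v (Jt s *\<^sub>v z))"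
  have Y: "Y \<in> carrier_vec m" using Mz by (simp add: Y_def)
  let ?v = "\<theta> @\<^sub>v Y" and ?X = "u @\<^sub>v (\<theta> @\<^sub>v Y)"
  have v: "?v \<in> carrier_vec (N + m)" by (rule append_carrier_vec[OF thc Y])
  have X: "?X \<in> carrier_vec (n + (N + m))" by (rule append_carrier_vec[OF uc v])
  have rc: "a @\<^sub>v (w @\<^sub>v Y) \<in> carrier_vec (mu_sum p * n + q + m)"
    using append_carrier_vec[OF ac append_carrier_vec[OF w Y]] by (simp add: add.assoc)
  \<comment> \<open>One vector in two groupings: here that of \<open>bP\<close>, \<open>V1\<close>
    and \<open>H1\<close>, in the next equation that of \<open>V2\<close>.\<close>
  have v1: "?v = ed 0 @\<^sub>v (?E @\<^sub>v (\<xi> @\<^sub>v (a @\<^sub>v (w @\<^sub>v Y))))"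
    unfolding th by (simp only: append_vec_assoc)
  have v2: "?v = (ed 0 @\<^sub>v (?E @\<^sub>v (\<xi> @\<^sub>v a))) @\<^sub>v (w @\<^sub>v Y)"
    unfolding th by (simp only: append_vec_assoc)
  have v2c: "ed 0 @\<^sub>v (?E @\<^sub>v (\<xi> @\<^sub>v a)) \<in> carrier_vec (beta p * n)"
    unfolding beta_n by (rule append_carrier_vec[OF e0 append_carrier_vec[OF E append_carrier_vec[OF xc ac]]])
  have I\<xi>: "Ihat p *\<^sub>v \<xi> = \<eta>" unfolding xi eta by (rule Ihat_mult)
  have etac: "\<eta> \<in> carrier_vec dn" unfolding eta by (rule eta_carrier)
  have bPv: "bP p P1 P2 *\<^sub>v ?v = P1 *\<^sub>v ed 0 + P2 *\<^sub>v \<eta>"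
    unfolding v1 bP_mult[OF e0 E xc rc] I\<xi> by (rule refl)
  have V1v: "V1\<^sup>T *\<^sub>v ?v = P2\<^sup>T *\<^sub>v ed 0 + P3 *\<^sub>v \<eta>"
    unfolding v1 V1_mult[OF e0 E xc rc] I\<xi> by (rule refl)
  have H1v: "H1 *\<^sub>v ?v = \<eta>'"
    unfolding v1 deta by (rule H1_mult[OF ed xi rc])
  have V2v: "V2\<^sup>T *\<^sub>v ?v = - (J2 s *\<^sub>v w) + (Jt s)\<^sup>T *\<^sub>v Y"
    unfolding v2 by (rule V2_mult[OF v2c w Y])
  have H2v: "H2 *\<^sub>v ?v = z" unfolding z_def by (rule H2_mult[OF thc Y])
  have "W *\<^sub>v u = Pi1 *\<^sub>v \<theta>"
    unfolding u_def W_rhs[symmetric] using assoc_mult_mat_vec[OF sym_mat_carrier[OF W] rhs_mat_carrier thc] by simp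
  moreover have "Pi1 *\<^sub>v \<theta> \<in> carrier_vec n" by (rule mult_mat_vec_carrier[OF Pi1_carrier thc])
  ultimately have hX: "hcat n [- W, Pihat p W U Uh] *\<^sub>v ?X = 0\<^sub>v n"
    unfolding WP_mult[OF uc thc Y] by simp
  have aX: "(alpha_stack p \<alpha>)\<^sup>T *\<^sub>v ?X \<in> carrier_vec n"
    by (rule mult_mat_vec_carrier[OF iffD2[OF transpose_carrier_mat alpha_stack_carrier] X])
  have JY: "J1 s *\<^sub>v Y = - (Jt s *\<^sub>v z)"
  proof -
    have "J1 s *\<^sub>v Y = - (J1 s *\<^sub>v (minv (J1 s) *\<^sub>v (Jt s *\<^sub>v z)))"
      unfolding Y_def using carrier_matD[OF supply_carriers(1)] carrier_vecD[OF Mz]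
      by (intro eq_vecI) auto
    also have "J1 s *\<^sub>v (minv (J1 s) *\<^sub>v (Jt s *\<^sub>v z)) = Jt s *\<^sub>v z"
      using assoc_mult_mat_vec[OF supply_carriers(1) J1_inverse(1) Jz] J1_inverse(2) Jz by simp
    finally show ?thesis .
  qed
  have YJY: "Y \<bullet> (J1 s *\<^sub>v Y) = k"
    unfolding JY unfolding k_def Y_def scalar_prod_uminus(3)[OF Mz Jz] by (rule comm_scalar_prod[OF Mz Jz])
  have JtY: "((Jt s)\<^sup>T *\<^sub>v Y) \<bullet> z = - k"
    unfolding transpose_vec_mult_scalar[OF supply_carriers(2) zc Y]
    unfolding k_def Y_def scalar_prod_uminus(2)[OF Mz Jz] comm_scalar_prod[OF Mz Jz] by (rule refl)
  have J2w: "J2 s *\<^sub>v w \<in> carrier_vec m" by (rule mult_mat_vec_carrier[OF supply_carriers(3) w])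
  have JTY: "(Jt s)\<^sup>T *\<^sub>v Y \<in> carrier_vec m"
    by (rule mult_mat_vec_carrier[OF iffD2[OF transpose_carrier_mat supply_carriers(2)] Y])
  have V2H2: "(V2\<^sup>T *\<^sub>v ?v) \<bullet> (H2 *\<^sub>v ?v) = - (z \<bullet> (J2 s *\<^sub>v w)) - k"
    unfolding V2v H2v using add_scalar_prod_distrib[of "- (J2 s *\<^sub>v w)" m "(Jt s)\<^sup>T *\<^sub>v Y" z]
      J2w JTY zc JtY comm_scalar_prod[OF zc J2w] scalar_prod_uminus(2)[OF J2w zc] by simp
  have "?X \<bullet> (LM *\<^sub>v ?X) \<le> - c * (?X \<bullet> ?X)" by (rule c(2)[OF X])
  also have "\<dots> \<le> - c * (ed 0 \<bullet> ed 0)"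
  proof -
    have "?X \<bullet> ?X = u \<bullet> u + (\<theta> \<bullet> \<theta> + Y \<bullet> Y)"
      unfolding scalar_prod_append[OF uc v uc v] scalar_prod_append[OF thc Y thc Y] by (rule refl)
    moreover have "\<theta> \<bullet> \<theta> = ed 0 \<bullet> ed 0 + (?E @\<^sub>v (\<xi> @\<^sub>v (a @\<^sub>v w))) \<bullet> (?E @\<^sub>v (\<xi> @\<^sub>v (a @\<^sub>v w)))"
      unfolding th by (rule scalar_prod_append') simp_all
    ultimately have "ed 0 \<bullet> ed 0 \<le> ?X \<bullet> ?X"
      using scalar_prod_self_nonneg[of u] scalar_prod_self_nonneg[of Y]
        scalar_prod_self_nonneg[of "?E @\<^sub>v (\<xi> @\<^sub>v (a @\<^sub>v w))"] by linarith
    then show ?thesis using c(1) by (simp add: mult_left_mono)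
  qed
  finally have "?X \<bullet> (LM *\<^sub>v ?X) \<le> - c * (ed 0 \<bullet> ed 0)" .
  moreover have "?X \<bullet> (LM *\<^sub>v ?X) = 2 * (u \<bullet> (P1 *\<^sub>v ed 0 + P2 *\<^sub>v \<eta>)) + 2 * ((P2\<^sup>T *\<^sub>v ed 0 + P3 *\<^sub>v \<eta>) \<bullet> \<eta>')
      + 2 * (- (z \<bullet> (J2 s *\<^sub>v w)) - k) + \<theta> \<bullet> (Xi p s Q R *\<^sub>v \<theta>) + k"
    unfolding quad_form_LM[OF uc v] quad_form_Phi[OF v thc Y refl] bPv V2H2 YJY
    unfolding V1v H1v hX using aX by simp
  moreover have "\<theta> \<bullet> (Xi p s Q R *\<^sub>v \<theta>) =
      (\<Sum>i = 1..\<nu>. ed (i - 1) \<bullet> (Q i *\<^sub>v ed (i - 1)) + (delay p i - delay p (i - 1)) * (ed (i - 1) \<bullet> (R i *\<^sub>v ed (i - 1))))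
      - (\<Sum>i = 1..\<nu>. ed i \<bullet> (Q i *\<^sub>v ed i))
      - (\<Sum>i = 1..\<nu>. bvec (vk p i) n (x i) \<bullet> ((1\<^sub>m (vk p i) \<otimes>\<^sub>k R i) *\<^sub>v bvec (vk p i) n (x i)))
      - (\<Sum>i = 1..\<nu>. bvec (dim_phi p i) n (y i) \<bullet> ((1\<^sub>m (dim_phi p i) \<otimes>\<^sub>k R i) *\<^sub>v bvec (dim_phi p i) n (y i)))
      - w \<bullet> (J3 s *\<^sub>v w)"
    by (rule quad_form_Xi(2)[OF ed w xi as th])
  moreover have "supply_rate s z w = k + 2 * (z \<bullet> (J2 s *\<^sub>v w)) + w \<bullet> (J3 s *\<^sub>v w)"
    unfolding supply_rate_eq[OF zc w] k_def by (rule refl)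
  ultimately show ?thesis
    unfolding u_def[symmetric] z_def[symmetric] by argo
qed

end

section \<open>Projections of the history\<close>

lemma primitive_linear_combination:
  fixes f g :: "'i \<Rightarrow> real \<Rightarrow> real"
  assumes g: "\<And>k. k \<in> I \<Longrightarrow> set_integrable lebesgue {a..b} (g k)"
    and f: "\<And>k. k \<in> I \<Longrightarrow> f k x = f k a + (LINT s:{a..x}|lebesgue. g k s)" and x: "x \<in> {a..b}"
  shows "(\<Sum>k\<in>I. c k * f k x) = (\<Sum>k\<in>I. c k * f k a) + (LINT s:{a..x}|lebesgue. \<Sum>k\<in>I. c k * g k s)"
proof -
  have i: "integrable lebesgue (\<lambda>s. c k * (indicator {a..x} s *\<^sub>R g k s))" if "k \<in> I" for k
    using set_integrable_subset[OF g[OF that], of "{a..x}"] x by (auto simp: set_integrable_def)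
  have "(LINT s:{a..x}|lebesgue. \<Sum>k\<in>I. c k * g k s) = (\<integral>s. (\<Sum>k\<in>I. c k * (indicator {a..x} s *\<^sub>R g k s)) \<partial>lebesgue)"
    unfolding set_lebesgue_integral_def
    by (rule Bochner_Integration.integral_cong) (auto simp: sum_distrib_left mult_ac)
  also have "\<dots> = (\<Sum>k\<in>I. \<integral>s. c k * (indicator {a..x} s *\<^sub>R g k s) \<partial>lebesgue)"
    by (rule Bochner_Integration.integral_sum[OF i])
  also have "\<dots> = (\<Sum>k\<in>I. c k * (LINT s:{a..x}|lebesgue. g k s))"
    by (simp add: set_lebesgue_integral_def)
  also have "\<dots> = (\<Sum>k\<in>I. c k * (f k x - f k a))" by (rule sum.cong) (simp_all add: f)
  finally show ?thesis by (simp add: right_diff_distrib sum_subtractf)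
qed

context admissible
begin

text \<open>\<open>hn\<close> and \<open>en\<close> together form the orthonormal system for
  Bessel's inequality with R_i, \<open>vF\<close> alone the one for Q_i.\<close>

definition hn :: "nat \<Rightarrow> real \<Rightarrow> real vec" where
  "hn i \<tau> = msqrt (minv (Hmat p i)) *\<^sub>v fn_h p i \<tau>"

definition en :: "nat \<Rightarrow> real \<Rightarrow> real vec" where
  "en i \<tau> = msqrt (minv (Emat p i)) *\<^sub>v fn_eps p i \<tau>"

text \<open>Coefficients of the history \<tau> |-> y(t + \<tau>) against \<open>hn\<close>, and in
  the next two definitions against \<open>en\<close> and \<open>vF\<close>, separately in each
  coordinate j.\<close>

definition cx :: "(real \<Rightarrow> real vec) \<Rightarrow> real \<Rightarrow> nat \<Rightarrow> nat \<Rightarrow> nat \<Rightarrow> real" where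
  "cx y t i b j = (LINT \<tau>:ival p i|lebesgue. hn i \<tau> $ b * y (t + \<tau>) $ j)"

definition ca :: "(real \<Rightarrow> real vec) \<Rightarrow> real \<Rightarrow> nat \<Rightarrow> nat \<Rightarrow> nat \<Rightarrow> real" where
  "ca y t i b j = (LINT \<tau>:ival p i|lebesgue. en i \<tau> $ b * y (t + \<tau>) $ j)"

definition ceta :: "(real \<Rightarrow> real vec) \<Rightarrow> real \<Rightarrow> nat \<Rightarrow> nat \<Rightarrow> nat \<Rightarrow> real" where
  "ceta y t i a j = (LINT \<tau>:ival p i|lebesgue. vF i \<tau> $ a * y (t + \<tau>) $ j)"

lemma idx_iff: "i \<in> set (idx p) \<longleftrightarrow> i \<in> {1..\<nu>}"
  by (simp add: set_idx)

lemmas interval = plant_interval[OF plant, folded idx_iff]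
lemmas L2s = plant_L2[OF plant, folded idx_iff]
lemmas grams = plant_grams[OF plant, folded idx_iff]

lemma L2_hn: "i \<in> set (idx p) \<Longrightarrow> L2_on (ival p i) (vk p i) (hn i)"
  unfolding hn_def[abs_def] by (rule L2_on_mult_mat[OF msqrt_carriers(2) L2s(3)])

lemma L2_en: "i \<in> set (idx p) \<Longrightarrow> L2_on (ival p i) (dim_phi p i) (en i)"
  unfolding en_def[abs_def] by (rule L2_on_mult_mat[OF msqrt_carriers(4) grams(4)])

lemma L2_vF: "i \<in> set (idx p) \<Longrightarrow> L2_on (ival p i) (dim_f p i) (vF i)"
  unfolding vF_def[abs_def] by (rule L2_on_mult_mat[OF msqrt_carriers(1) L2s(1)])

lemma orthonormal:
  assumes i: "i \<in> set (idx p)"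
  shows "gram (ival p i) (vk p i) (vk p i) (hn i) (hn i) = 1\<^sub>m (vk p i)"
    "gram (ival p i) (dim_phi p i) (dim_phi p i) (en i) (en i) = 1\<^sub>m (dim_phi p i)"
    "gram (ival p i) (dim_f p i) (dim_f p i) (vF i) (vF i) = 1\<^sub>m (dim_f p i)"
    "gram (ival p i) (dim_phi p i) (vk p i) (en i) (hn i) = 0\<^sub>m (dim_phi p i) (vk p i)"
proof -
  show "gram (ival p i) (vk p i) (vk p i) (hn i) (hn i) = 1\<^sub>m (vk p i)"
    using gram_orthonormal[OF grams(2)[OF i, unfolded Hmat_def] L2s(3)[OF i]] by (simp add: hn_def[abs_def] Hmat_def)
  show "gram (ival p i) (dim_phi p i) (dim_phi p i) (en i) (en i) = 1\<^sub>m (dim_phi p i)"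
    using gram_orthonormal[OF grams(3)[OF i, unfolded Emat_def] grams(4)[OF i]] by (simp add: en_def[abs_def] Emat_def)
  show "gram (ival p i) (dim_f p i) (dim_f p i) (vF i) (vF i) = 1\<^sub>m (dim_f p i)"
    using gram_orthonormal[OF grams(1)[OF i, unfolded Fmat_def] L2s(1)[OF i]] by (simp add: vF_def[abs_def] Fmat_def)
  note c = msqrt_carriers[OF i]
  have "gram (ival p i) (dim_phi p i) (vk p i) (en i) (hn i)
    = msqrt (minv (Emat p i)) * (gram (ival p i) (dim_phi p i) (vk p i) (fn_eps p i) (fn_h p i) * (msqrt (minv (Hmat p i)))\<^sup>T)"
    unfolding en_def[abs_def] hn_def[abs_def]
      gram_mult_left[OF c(4) grams(4)[OF i] L2_on_mult_mat[OF c(2) L2s(3)[OF i]]]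
      gram_mult_right[OF c(2) grams(4)[OF i] L2s(3)[OF i]] by (rule refl)
  also have "\<dots> = 0\<^sub>m (dim_phi p i) (vk p i)" unfolding grams(5)[OF i]
    using carrier_matD[OF c(2)] carrier_matD[OF c(4)] by simp
  finally show "gram (ival p i) (dim_phi p i) (vk p i) (en i) (hn i) = 0\<^sub>m (dim_phi p i) (vk p i)" .
qed

text \<open>Continuous functions on the whole line stand in for the solution and its history.\<close>

definition cont :: "(real \<Rightarrow> real vec) \<Rightarrow> bool" where
  "cont y \<longleftrightarrow> (\<forall>s. y s \<in> carrier_vec n) \<and> (\<forall>j<n. continuous_on UNIV (\<lambda>s. y s $ j))"

lemma cont_window: "cont y \<Longrightarrow> j < n \<Longrightarrow> continuous_on S (\<lambda>\<tau>. y (t + \<tau>) $ j)"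
  unfolding cont_def by (rule continuous_on_compose2[of UNIV "\<lambda>s. y s $ j"]) (auto intro!: continuous_intros)

text \<open>Since \<epsilon>_i is orthogonal to h_i, \<open>hn\<close> followed by \<open>en\<close>
  is one orthonormal family, so the two forms are bounded together by a single integral.\<close>

lemma bessel_R:
  assumes y: "cont y" and i: "i \<in> set (idx p)" and R: "R \<in> carrier_mat n n" "\<And>x. x \<in> carrier_vec n \<Longrightarrow> 0 \<le> x \<bullet> (R *\<^sub>v x)"
  shows "bvec (vk p i) n (cx y t i) \<bullet> ((1\<^sub>m (vk p i) \<otimes>\<^sub>k R) *\<^sub>v bvec (vk p i) n (cx y t i))
     + bvec (dim_phi p i) n (ca y t i) \<bullet> ((1\<^sub>m (dim_phi p i) \<otimes>\<^sub>k R) *\<^sub>v bvec (dim_phi p i) n (ca y t i))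
    \<le> (LINT \<tau>:ival p i|lebesgue. y (t + \<tau>) \<bullet> (R *\<^sub>v y (t + \<tau>)))"
proof -
  let ?k = "vk p i" and ?m = "dim_phi p i"
  define u where "u = (\<lambda>b \<tau>. if b < ?k then hn i \<tau> $ b else en i \<tau> $ (b - ?k))"
  define q where "q = (\<lambda>v. vec n v \<bullet> (R *\<^sub>v vec n v))"
  define c where "c = (\<lambda>b j. LINT \<tau>:ival p i|lebesgue. u b \<tau> * y (t + \<tau>) $ j)"
  have u: "square_integrable_on (ival p i) (u b)" if "b < ?k + ?m" for b
    using that L2_hn[OF i] L2_en[OF i] by (cases "b < ?k") (auto simp: u_def L2_on_def)
  have on: "(LINT t:ival p i|lebesgue. u a t * u b t) = (if a = b then 1 else 0)" if ab: "a < ?k + ?m" "b < ?k + ?m" for a b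
  proof -
    have hh: "(LINT t:ival p i|lebesgue. hn i t $ a * hn i t $ b) = (if a = b then 1 else 0)" if "a < ?k" "b < ?k" for a b
      using gram_index[OF that, of "ival p i" "hn i" "hn i"] that orthonormal(1)[OF i] by simp
    have ee: "(LINT t:ival p i|lebesgue. en i t $ a * en i t $ b) = (if a = b then 1 else 0)" if "a < ?m" "b < ?m" for a b
      using gram_index[OF that, of "ival p i" "en i" "en i"] that orthonormal(2)[OF i] by simp
    have eh: "(LINT t:ival p i|lebesgue. en i t $ a * hn i t $ b) = 0" if "a < ?m" "b < ?k" for a b
      using gram_index[OF that, of "ival p i" "en i" "hn i"] that orthonormal(4)[OF i] by simp
    have he: "(LINT t:ival p i|lebesgue. hn i t $ b * en i t $ a) = 0" if "a < ?m" "b < ?k" for a b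
      using eh[OF that] by (simp add: mult.commute)
    consider "a < ?k" "b < ?k" | "a < ?k" "\<not> b < ?k" | "\<not> a < ?k" "b < ?k" | "\<not> a < ?k" "\<not> b < ?k" by blast
    then show ?thesis
    proof cases
      case 1
      then show ?thesis using hh[of a b] by (simp add: u_def)
    next
      case 2
      then have "b - ?k < ?m" using ab by simp
      then show ?thesis using he[of "b - ?k" a] 2 by (auto simp: u_def)
    next
      case 3
      then have "a - ?k < ?m" using ab by simp
      then show ?thesis using eh[of "a - ?k" b] 3 by (auto simp: u_def)
    next
      case 4
      then have "a - ?k < ?m" "b - ?k < ?m" using ab by simp_all
      then show ?thesis using ee[of "a - ?k" "b - ?k"] 4 by (auto simp: u_def)
    qed
  qed
  have "(\<Sum>b\<in>{0..<?k + ?m}. q (c b)) \<le> (LINT \<tau>:ival p i|lebesgue. y (t + \<tau>) \<bullet> (R *\<^sub>v y (t + \<tau>)))"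
    unfolding q_def c_def
    by (rule bessel_inequality[of "?k + ?m" "- delay p i" "- delay p (i - 1)" u n "\<lambda>\<tau>. y (t + \<tau>)" R, folded ival_def])
      (use u on cont_window[OF y] y R in \<open>auto simp: cont_def\<close>)
  moreover have "(\<Sum>b\<in>{0..<?k + ?m}. q (c b)) = (\<Sum>b\<in>{0..<?k}. q (c b)) + (\<Sum>b\<in>{0..<?m}. q (c (b + ?k)))"
    using sum.atLeastLessThan_concat[of 0 ?k "?k + ?m" "\<lambda>b. q (c b)"]
      sum.shift_bounds_nat_ivl[of "\<lambda>b. q (c b)" 0 ?k ?m] by (simp add: add.commute)
  moreover have "(\<Sum>b\<in>{0..<?k}. q (c b)) = bvec ?k n (cx y t i) \<bullet> ((1\<^sub>m ?k \<otimes>\<^sub>k R) *\<^sub>v bvec ?k n (cx y t i))"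
    unfolding quad_form_one_kron[OF R(1)] by (rule sum.cong) (auto simp: q_def c_def cx_def[abs_def] u_def)
  moreover have "(\<Sum>b\<in>{0..<?m}. q (c (b + ?k))) = bvec ?m n (ca y t i) \<bullet> ((1\<^sub>m ?m \<otimes>\<^sub>k R) *\<^sub>v bvec ?m n (ca y t i))"
    unfolding quad_form_one_kron[OF R(1)] by (rule sum.cong) (auto simp: q_def c_def ca_def[abs_def] u_def)
  ultimately show ?thesis by simp
qed

text \<open>The companion estimate for the lower and upper bounds of the functional.\<close>

lemma bessel_F:
  assumes y: "cont y" and i: "i \<in> set (idx p)" and R: "R \<in> carrier_mat n n" "\<And>x. x \<in> carrier_vec n \<Longrightarrow> 0 \<le> x \<bullet> (R *\<^sub>v x)"
  shows "bvec (dim_f p i) n (ceta y t i) \<bullet> ((1\<^sub>m (dim_f p i) \<otimes>\<^sub>k R) *\<^sub>v bvec (dim_f p i) n (ceta y t i))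
    \<le> (LINT \<tau>:ival p i|lebesgue. y (t + \<tau>) \<bullet> (R *\<^sub>v y (t + \<tau>)))"
proof -
  let ?k = "dim_f p i"
  have u: "square_integrable_on (ival p i) (\<lambda>\<tau>. vF i \<tau> $ b)" if "b < ?k" for b
    using that L2_vF[OF i] by (auto simp: L2_on_def)
  have on: "(LINT t:ival p i|lebesgue. vF i t $ a * vF i t $ b) = (if a = b then 1 else 0)" if "a < ?k" "b < ?k" for a b
    using gram_index[OF that, of "ival p i" "vF i" "vF i"] that orthonormal(3)[OF i] by simp
  show ?thesis
    unfolding quad_form_one_kron[OF R(1)] unfolding ceta_def
    by (rule bessel_inequality[of ?k "- delay p i" "- delay p (i - 1)" "\<lambda>b \<tau>. vF i \<tau> $ b" n "\<lambda>\<tau>. y (t + \<tau>)" R, folded ival_def])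
      (use u on cont_window[OF y] y R in \<open>auto simp: cont_def\<close>)
qed

lemma sqrt_H_cancel:
  assumes i: "i \<in> set (idx p)" and v: "v \<in> carrier_vec (vk p i)"
  shows "msqrt (Hmat p i) *\<^sub>v (msqrt (minv (Hmat p i)) *\<^sub>v v) = v"
proof -
  note c = msqrt_carriers[OF i]
  have "msqrt (Hmat p i) * msqrt (minv (Hmat p i)) = 1\<^sub>m (vk p i)"
    unfolding msqrt_minv[OF grams(2)[OF i] gram_carriers(2)]
    by (rule pos_def_minv(2)[OF msqrt_pos_def(2)[OF grams(2)[OF i] gram_carriers(2)] c(3)])
  then show ?thesis using assoc_mult_mat_vec[OF c(3) c(2) v] v by simp
qed

text \<open>f_i is the lower part of h_i, and h_i is recovered from the normalised kernel because
  H^{1/2} H^{-1/2} = I.\<close>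

lemma vF_hn:
  assumes i: "i \<in> set (idx p)" and t: "\<tau> \<in> ival p i"
  shows "vF i \<tau> = eF i *\<^sub>v hn i \<tau>"
    and "msqrt (minv (Fmat p i)) *\<^sub>v (Mmat p i *\<^sub>v fn_h p i \<tau>) = mF i *\<^sub>v hn i \<tau>"
proof -
  note c = msqrt_carriers[OF i]
  let ?E = "hcat (dim_f p i) [0\<^sub>m (dim_f p i) (dim_vphi p i), 1\<^sub>m (dim_f p i)]"
  have v: "fn_vphi p i \<tau> \<in> carrier_vec (dim_vphi p i)"
    using plant i t by (auto simp: admissible_plant_def L2_on_def idx_iff)
  have f: "fn_f p i \<tau> \<in> carrier_vec (dim_f p i)" and h: "fn_h p i \<tau> \<in> carrier_vec (vk p i)"
    using L2s(1,3)[OF i] t by (auto simp: L2_on_def)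
  have E: "?E \<in> carrier_mat (dim_f p i) (vk p i)"
    unfolding vk_def add.commute[of "dim_f p i"] by (rule hcat_pair_carrier[OF zero_carrier_mat one_carrier_mat])
  have hn: "hn i \<tau> \<in> carrier_vec (vk p i)" unfolding hn_def by (rule mult_mat_vec_carrier[OF c(2) h])
  have H: "msqrt (Hmat p i) *\<^sub>v hn i \<tau> = fn_h p i \<tau>" unfolding hn_def by (rule sqrt_H_cancel[OF i h])
  have "?E *\<^sub>v fn_h p i \<tau> = fn_f p i \<tau>"
    unfolding fn_h_def hcat_pair_mult_vec[OF zero_carrier_mat one_carrier_mat v f] using v f by (simp add: zero_mat_mult_vec)
  then show "vF i \<tau> = eF i *\<^sub>v hn i \<tau>"
    unfolding eF_def vF_def assoc_mult_mat_vec[OF mult_carrier_mat[OF c(1) E] c(3) hn] H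
      assoc_mult_mat_vec[OF c(1) E h] by simp
  show "msqrt (minv (Fmat p i)) *\<^sub>v (Mmat p i *\<^sub>v fn_h p i \<tau>) = mF i *\<^sub>v hn i \<tau>"
    unfolding mF_def assoc_mult_mat_vec[OF mult_carrier_mat[OF c(1) Mmat_carrier[OF i]] c(3) hn] H
      assoc_mult_mat_vec[OF c(1) Mmat_carrier[OF i] h] by (rule refl)
qed

lemma window_combination:
  assumes y: "cont y" and i: "i \<in> set (idx p)" and j: "j < n" and A: "A \<in> carrier_mat r (vk p i)" and a: "a < r"
  shows "(LINT \<tau>:ival p i|lebesgue. (A *\<^sub>v hn i \<tau>) $ a * y (t + \<tau>) $ j) = (\<Sum>b\<in>{0..<vk p i}. A $$ (a, b) * cx y t i b j)"
proof -
  have "(LINT \<tau>:ival p i|lebesgue. (A *\<^sub>v hn i \<tau>) $ a * y (t + \<tau>) $ j)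
    = (LINT \<tau>:ival p i|lebesgue. (\<Sum>b\<in>{0..<vk p i}. A $$ (a, b) * hn i \<tau> $ b) * y (t + \<tau>) $ j)"
  proof (rule set_integral_cong)
    fix \<tau> assume "\<tau> \<in> ival p i"
    then have "hn i \<tau> \<in> carrier_vec (vk p i)" using L2_hn[OF i] by (auto simp: L2_on_def)
    then show "(A *\<^sub>v hn i \<tau>) $ a * y (t + \<tau>) $ j = (\<Sum>b\<in>{0..<vk p i}. A $$ (a, b) * hn i \<tau> $ b) * y (t + \<tau>) $ j"
      using A a by (simp add: scalar_prod_def)
  qed
  also have "\<dots> = (\<Sum>b\<in>{0..<vk p i}. A $$ (a, b) * cx y t i b j)"
    unfolding cx_def
    by (rule set_integral_mult_sum_left)
      (use L2_hn[OF i] square_integrable_continuous[OF cont_window[OF y j]] in \<open>auto simp: L2_on_def ival_def\<close>)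
  finally show ?thesis .
qed

lemma eta_block_eq:
  assumes y: "cont y" and i: "i \<in> set (idx p)"
  shows "eta_block (cx y t) i = bvec (dim_f p i) n (ceta y t i)"
  unfolding eta_block_def
proof (rule bvec_cong)
  fix a j assume aj: "a < dim_f p i" "j < n"
  have "ceta y t i a j = (LINT \<tau>:ival p i|lebesgue. (eF i *\<^sub>v hn i \<tau>) $ a * y (t + \<tau>) $ j)"
    unfolding ceta_def by (rule set_integral_cong) (simp add: vF_hn(1)[OF i])
  then show "(\<Sum>b = 0..<vk p i. eF i $$ (a, b) * cx y t i b j) = ceta y t i a j"
    using window_combination[OF y i aj(2) eF_carrier[OF i] aj(1)] by simp
qed

text \<open>\<open>weak_derivative_primitive\<close> for the components of f_i, combined by a row of
  F^{-1/2}; this is the form in which the window lemmas take a kernel.\<close>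

lemma vF_primitive:
  assumes i: "i \<in> set (idx p)" and a: "a < dim_f p i" 
  shows "set_integrable lebesgue {- delay p i..- delay p (i - 1)} (\<lambda>\<tau>. (msqrt (minv (Fmat p i)) *\<^sub>v (Mmat p i *\<^sub>v fn_h p i \<tau>)) $ a)" (is "set_integrable _ ?I ?g")
    and "\<And>x. x \<in> {- delay p i..- delay p (i - 1)} \<Longrightarrow> vF i x $ a = vF i (- delay p i) $ a
      + (LINT s:{- delay p i..x}|lebesgue. (msqrt (minv (Fmat p i)) *\<^sub>v (Mmat p i *\<^sub>v fn_h p i s)) $ a)"
proof -
  note c = msqrt_carriers[OF i]
  let ?S = "msqrt (minv (Fmat p i))" and ?d = "dim_f p i"
  have lt: "- delay p i < - delay p (i - 1)" using interval[OF i] by simp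
  have Mh: "L2_on ?I ?d (\<lambda>\<tau>. Mmat p i *\<^sub>v fn_h p i \<tau>)"
    using L2_on_mult_mat[OF Mmat_carrier[OF i] L2s(3)[OF i]] by (simp add: ival_def)
  show "set_integrable lebesgue ?I ?g"
    by (rule square_integrable_integrable) (use L2_on_mult_mat[OF c(1) Mh] a in \<open>auto simp: L2_on_def\<close>)
  have gi: "set_integrable lebesgue ?I (\<lambda>\<tau>. (Mmat p i *\<^sub>v fn_h p i \<tau>) $ k)" if "k < ?d" for k
    by (rule square_integrable_integrable) (use Mh that in \<open>auto simp: L2_on_def\<close>)
  have H1: "H1_with_weak_derivative (- delay p i) (- delay p (i - 1)) ?d (fn_f p i) (\<lambda>\<tau>. Mmat p i *\<^sub>v fn_h p i \<tau>)"
    using plant i by (auto simp: admissible_plant_def idx_iff)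
  fix x assume x: "x \<in> ?I"
  have fk: "fn_f p i x $ k = fn_f p i (- delay p i) $ k + (LINT s:{- delay p i..x}|lebesgue. (Mmat p i *\<^sub>v fn_h p i s) $ k)"
    if "k < ?d" for k
    by (rule weak_derivative_primitive[OF lt _ gi[OF that] _ x]) (use H1 that in \<open>auto simp: H1_with_weak_derivative_def\<close>)
  have S: "(?S *\<^sub>v v) $ a = (\<Sum>k\<in>{0..<?d}. ?S $$ (a, k) * v $ k)" if "v \<in> carrier_vec ?d" for v
    using c(1) a that by (simp add: scalar_prod_def)
  have fc: "fn_f p i \<tau> \<in> carrier_vec ?d" if "\<tau> \<in> ?I" for \<tau>
    using L2s(1)[OF i] that by (auto simp: L2_on_def ival_def)
  have Mc: "Mmat p i *\<^sub>v fn_h p i \<tau> \<in> carrier_vec ?d" if "\<tau> \<in> ?I" for \<tau>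
    using Mh that by (auto simp: L2_on_def)
  have "vF i x $ a = (\<Sum>k\<in>{0..<?d}. ?S $$ (a, k) * fn_f p i x $ k)" unfolding vF_def by (rule S[OF fc[OF x]])
  also have "\<dots> = (\<Sum>k\<in>{0..<?d}. ?S $$ (a, k) * fn_f p i (- delay p i) $ k)
      + (LINT s:{- delay p i..x}|lebesgue. \<Sum>k\<in>{0..<?d}. ?S $$ (a, k) * (Mmat p i *\<^sub>v fn_h p i s) $ k)"
    by (rule primitive_linear_combination[OF gi fk x]) auto
  also have "(\<Sum>k\<in>{0..<?d}. ?S $$ (a, k) * fn_f p i (- delay p i) $ k) = vF i (- delay p i) $ a"
    unfolding vF_def by (rule S[OF fc, symmetric]) (use lt in auto)
  also have "(LINT s:{- delay p i..x}|lebesgue. \<Sum>k\<in>{0..<?d}. ?S $$ (a, k) * (Mmat p i *\<^sub>v fn_h p i s) $ k)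
      = (LINT s:{- delay p i..x}|lebesgue. ?g s)"
    by (rule set_integral_cong) (rule S[OF Mc, symmetric], use x in auto)
  finally show "vF i x $ a = vF i (- delay p i) $ a + (LINT s:{- delay p i..x}|lebesgue. ?g s)" .
qed

text \<open>The relation f_i' = M_i h_i pays off here: the integral left after integration by parts
  is again a combination of the coefficients \<open>cx\<close>, so the derivative of \<eta> involves
  nothing outside \<theta>.\<close>

lemma ceta_derivative:
  assumes y: "cont y" and i: "i \<in> set (idx p)" and a: "a < dim_f p i" and j: "j < n"
  shows "((\<lambda>t. ceta y t i a j) has_real_derivative
      (vF i (- delay p (i - 1)) $ a * y (t - delay p (i - 1)) $ j - vF i (- delay p i) $ a * y (t - delay p i) $ j
       - (\<Sum>b\<in>{0..<vk p i}. mF i $$ (a, b) * cx y t i b j))) (at t)"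
proof -
  have "(LINT \<tau>:ival p i|lebesgue. (msqrt (minv (Fmat p i)) *\<^sub>v (Mmat p i *\<^sub>v fn_h p i \<tau>)) $ a * y (t + \<tau>) $ j)
     = (LINT \<tau>:ival p i|lebesgue. (mF i *\<^sub>v hn i \<tau>) $ a * y (t + \<tau>) $ j)"
    by (rule set_integral_cong) (simp add: vF_hn(2)[OF i])
  also have "\<dots> = (\<Sum>b\<in>{0..<vk p i}. mF i $$ (a, b) * cx y t i b j)"
    by (rule window_combination[OF y i j mF_carrier[OF i] a])
  finally have eq: "(LINT \<tau>:ival p i|lebesgue. (msqrt (minv (Fmat p i)) *\<^sub>v (Mmat p i *\<^sub>v fn_h p i \<tau>)) $ a * y (t + \<tau>) $ j)
     = (\<Sum>b\<in>{0..<vk p i}. mF i $$ (a, b) * cx y t i b j)" .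
  have cy: "continuous_on UNIV (\<lambda>s. y s $ j)" using y j by (simp add: cont_def)
  have lt: "- delay p i \<le> - delay p (i - 1)" using interval[OF i] by simp
  show ?thesis
    using window_integral_derivative[OF lt vF_primitive(1)[OF i a] vF_primitive(2)[OF i a] cy, of t]
    unfolding eq[unfolded ival_def] ceta_def ival_def by simp
qed

lemma ceta_absolutely_continuous:
  assumes y: "cont y" and i: "i \<in> set (idx p)" and a: "a < dim_f p i" and j: "j < n"
  shows "absolutely_continuous_between t0 T (\<lambda>t. ceta y t i a j)"
proof -
  have cy: "continuous_on UNIV (\<lambda>s. y s $ j)" using y j by (simp add: cont_def)
  have lt: "- delay p i \<le> - delay p (i - 1)" using interval[OF i] by simp
  show ?thesis unfolding ceta_def ival_def
    by (rule window_integral_lipschitz[OF lt vF_primitive(1)[OF i a] vF_primitive(2)[OF i a] cy])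
qed

text \<open>The solution e and the continuous function y in its place have to agree only on the
  delay intervals seen from t.\<close>

lemma xi_vec_eq:
  assumes y: "\<And>i \<tau>. i \<in> set (idx p) \<Longrightarrow> \<tau> \<in> ival p i \<Longrightarrow> e (t + \<tau>) = y (t + \<tau>)" and c: "cont y"
  shows "xi_vec p e t = stack_vec (map (\<lambda>i. bvec (vk p i) n (cx y t i)) (idx p))"
    and "a_vec p e t = stack_vec (map (\<lambda>i. bvec (dim_phi p i) n (ca y t i)) (idx p))"
proof -
  have gen: "vec (k * n) (\<lambda>a. LINT \<tau>:ival p i|lebesgue. ((col_mat (u \<tau>) \<otimes>\<^sub>k 1\<^sub>m n) *\<^sub>v e (t + \<tau>)) $ a)
      = bvec k n (\<lambda>b j. LINT \<tau>:ival p i|lebesgue. u \<tau> $ b * y (t + \<tau>) $ j)"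
    if i: "i \<in> set (idx p)" and u: "\<And>\<tau>. \<tau> \<in> ival p i \<Longrightarrow> u \<tau> \<in> carrier_vec k" for i k u
  proof (rule eq_vecI)
    fix a assume "a < dim_vec (bvec k n (\<lambda>b j. LINT \<tau>:ival p i|lebesgue. u \<tau> $ b * y (t + \<tau>) $ j))"
    then have a: "a < k * n" by simp
    have "(LINT \<tau>:ival p i|lebesgue. ((col_mat (u \<tau>) \<otimes>\<^sub>k 1\<^sub>m n) *\<^sub>v e (t + \<tau>)) $ a)
      = (LINT \<tau>:ival p i|lebesgue. u \<tau> $ (a div n) * y (t + \<tau>) $ (a mod n))"
    proof (rule set_integral_cong)
      fix \<tau> assume t: "\<tau> \<in> ival p i"
      have yc: "y (t + \<tau>) \<in> carrier_vec n" using c by (simp add: cont_def)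
      show "((col_mat (u \<tau>) \<otimes>\<^sub>k 1\<^sub>m n) *\<^sub>v e (t + \<tau>)) $ a = u \<tau> $ (a div n) * y (t + \<tau>) $ (a mod n)"
        unfolding y[OF i t] col_mat_kron_mult_vec[OF yc] using a u[OF t] by (simp add: bvec_def)
    qed
    then show "vec (k * n) (\<lambda>a. LINT \<tau>:ival p i|lebesgue. ((col_mat (u \<tau>) \<otimes>\<^sub>k 1\<^sub>m n) *\<^sub>v e (t + \<tau>)) $ a) $ a
      = bvec k n (\<lambda>b j. LINT \<tau>:ival p i|lebesgue. u \<tau> $ b * y (t + \<tau>) $ j) $ a"
      using a by (simp add: bvec_def)
  qed simp
  show "xi_vec p e t = stack_vec (map (\<lambda>i. bvec (vk p i) n (cx y t i)) (idx p))"
    unfolding xi_vec_def hn_def[symmetric] cx_def[abs_def]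
    by (rule arg_cong[where f = stack_vec], rule map_cong[OF refl], rule gen)
      (use L2_hn in \<open>auto simp: L2_on_def\<close>)
  show "a_vec p e t = stack_vec (map (\<lambda>i. bvec (dim_phi p i) n (ca y t i)) (idx p))"
    unfolding a_vec_def en_def[symmetric] ca_def[abs_def]
    by (rule arg_cong[where f = stack_vec], rule map_cong[OF refl], rule gen)
      (use L2_en in \<open>auto simp: L2_on_def\<close>)
qed

end

section \<open>The Lyapunov-Krasovskii functional\<close>

context lmi begin

definition etaf :: "(real \<Rightarrow> real vec) \<Rightarrow> real vec" where
  "etaf \<phi> = stack_vec (map (\<lambda>i. bvec (dim_f p i) n (ceta \<phi> 0 i)) (idx p))"

text \<open>The bilinear form behind the integral of w(\<tau>) times an A-form, expanded in
  coordinates so that each summand is a scalar window integral.\<close>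

definition qint :: "nat \<Rightarrow> real mat \<Rightarrow> (real \<Rightarrow> real) \<Rightarrow> (real \<Rightarrow> real vec) \<Rightarrow> (real \<Rightarrow> real vec) \<Rightarrow> real" where
  "qint i A w \<phi> \<psi> = (\<Sum>j\<in>{0..<n}. \<Sum>l\<in>{0..<n}. A $$ (j, l) * (LINT \<tau>:ival p i|lebesgue. w \<tau> * (\<phi> \<tau> $ j * \<psi> \<tau> $ l)))"

text \<open>The derivative of the term weighted by \<open>\<epsilon>\<close> supplies the integral of \<open>\<bar>e\<bar>\<^sup>2\<close> that turns
  negativity of the derivative into exponential decay.\<close>
definition lyap :: "real \<Rightarrow> (real \<Rightarrow> real vec) \<Rightarrow> (real \<Rightarrow> real vec) \<Rightarrow> real" where
  "lyap \<epsilon> \<phi> \<psi> = bform n n P1 (\<phi> 0) (\<psi> 0) + 2 * bform n dn P2 (\<phi> 0) (etaf \<psi>) + bform dn dn P3 (etaf \<phi>) (etaf \<psi>)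
    + (\<Sum>i = 1..\<nu>. qint i (Q i) (\<lambda>_. 1) \<phi> \<psi> + qint i (R i) (\<lambda>\<tau>. \<tau> + delay p i) \<phi> \<psi>
        + \<epsilon> * qint i (1\<^sub>m n) (\<lambda>\<tau>. \<tau> + (rmax p + 1)) \<phi> \<psi>)"

lemma delay_mono:
  assumes "i \<le> j" "j \<le> \<nu>"
  shows "delay p i \<le> delay p j"
  using assms
proof (induction j rule: dec_induct)
  case (step k)
  then show ?case using interval[of "Suc k"] by (simp add: idx_iff)
qed simp

lemma delay_0: "delay p 0 = 0"
  using plant by (simp add: admissible_plant_def)

lemma rmax_nonneg: "0 \<le> rmax p"
  using delay_mono[of 0 \<nu>] by (simp add: rmax_def delay_0)

lemma delay_bounds: "i \<le> \<nu> \<Longrightarrow> 0 \<le> delay p i \<and> delay p i \<le> rmax p"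
  using delay_mono[of 0 i] delay_mono[of i \<nu>] by (simp add: rmax_def delay_0)

lemma ival_subset: "i \<in> set (idx p) \<Longrightarrow> ival p i \<subseteq> {- rmax p..0}"
  using delay_bounds[of i] delay_bounds[of "i - 1"] by (auto simp: ival_def idx_iff)

lemma d_sum_list: "(\<Sum>i\<leftarrow>idx p. dim_f p i * n) = dn"
  by (simp add: sum_list_idx d_sum_mult)

lemma etaf_carrier: "etaf \<phi> \<in> carrier_vec dn"
  unfolding etaf_def d_sum_mult by (rule stack_idx_carrier) simp

lemma etaf_linear:
  assumes "k < dn"
  shows "linear_fnl (rmax p) n (\<lambda>\<phi>. etaf \<phi> $ k)"
  unfolding etaf_def
proof (rule component_stack[where k = "\<lambda>i. dim_f p i * n" and f = "\<lambda>\<phi> i. bvec (dim_f p i) n (ceta \<phi> 0 i)"])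
  fix i k assume i: "i \<in> set (idx p)" and k: "k < dim_f p i * n"
  show "linear_fnl (rmax p) n (\<lambda>\<phi>. bvec (dim_f p i) n (ceta \<phi> 0 i) $ k)"
  proof (rule component_bvec[where u = "\<lambda>\<phi>. ceta \<phi> 0 i", OF _ k])
    fix a j assume aj: "a < dim_f p i" "j < n"
    have "set_integrable lebesgue {- delay p i..- delay p (i - 1)} (\<lambda>\<tau>. vF i \<tau> $ a)"
      by (rule square_integrable_integrable) (use L2_vF[OF i] aj in \<open>auto simp: L2_on_def ival_def\<close>)
    from linear_fnl_integral[OF this _ aj(2) rmax_nonneg] ival_subset[OF i]
    show "linear_fnl (rmax p) n (\<lambda>\<phi>. ceta \<phi> 0 i a j)" by (simp add: ceta_def ival_def)
  qed
qed (use assms d_sum_list in simp_all)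

lemma qint_bilinear:
  assumes "i \<in> set (idx p)" "continuous_on UNIV w"
  shows "bilinear_fnl (rmax p) n (qint i A w)"
  unfolding qint_def[abs_def] ival_def
  by (intro bilinear_fnl_sum bilinear_fnl_scale bilinear_fnl_integral rmax_nonneg continuous_on_subset[OF assms(2)])
    (use ival_subset[OF assms(1)] in \<open>auto simp: ival_def\<close>)

lemma lyap_bilinear: "bilinear_fnl (rmax p) n (lyap \<epsilon>)"
  unfolding lyap_def[abs_def]
proof (intro bilinear_fnl_add rmax_nonneg bilinear_fnl_sum)
  have pt: "linear_fnl (rmax p) n (\<lambda>\<phi>. \<phi> 0 $ j)" if "j < n" for j
    by (rule linear_fnl_point[OF that]) (use rmax_nonneg in simp)
  show "bilinear_fnl (rmax p) n (\<lambda>\<phi> \<psi>. bform n n P1 (\<phi> 0) (\<psi> 0))"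
    by (rule bilinear_fnl_bform[OF pt pt rmax_nonneg])
  show "bilinear_fnl (rmax p) n (\<lambda>\<phi> \<psi>. 2 * bform n dn P2 (\<phi> 0) (etaf \<psi>))"
    by (rule bilinear_fnl_scale[OF bilinear_fnl_bform[OF pt etaf_linear rmax_nonneg] rmax_nonneg])
  show "bilinear_fnl (rmax p) n (\<lambda>\<phi> \<psi>. bform dn dn P3 (etaf \<phi>) (etaf \<psi>))"
    by (rule bilinear_fnl_bform[OF etaf_linear etaf_linear rmax_nonneg])
  fix i assume "i \<in> {1..\<nu>}"
  then have i: "i \<in> set (idx p)" by (simp add: idx_iff)
  show "bilinear_fnl (rmax p) n (\<lambda>\<phi> \<psi>. qint i (Q i) (\<lambda>_. 1) \<phi> \<psi>)" by (rule qint_bilinear[OF i continuous_on_const])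
  show "bilinear_fnl (rmax p) n (\<lambda>\<phi> \<psi>. qint i (R i) (\<lambda>\<tau>. \<tau> + delay p i) \<phi> \<psi>)"
    by (rule qint_bilinear[OF i]) (intro continuous_intros)
  show "bilinear_fnl (rmax p) n (\<lambda>\<phi> \<psi>. \<epsilon> * qint i (1\<^sub>m n) (\<lambda>\<tau>. \<tau> + (rmax p + 1)) \<phi> \<psi>)"
    by (rule bilinear_fnl_scale[OF qint_bilinear[OF i] rmax_nonneg]) (intro continuous_intros)
qed

text \<open>Segments are restricted to [-r, 0] whereas \<open>shifted\<close> is total; the
  functional does not see the difference.\<close>

lemma lyap_cong:
  assumes eq: "\<And>\<tau>. \<tau> \<in> {- rmax p..0} \<Longrightarrow> \<phi> \<tau> = \<psi> \<tau>"
  shows "lyap \<epsilon> \<phi> \<phi> = lyap \<epsilon> \<psi> \<psi>"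
proof -
  have eqi: "\<phi> \<tau> = \<psi> \<tau>" if "i \<in> set (idx p)" "\<tau> \<in> ival p i" for i \<tau>
    using eq ival_subset[OF that(1)] that(2) by auto
  have 0: "\<phi> 0 = \<psi> 0" using eq[of 0] rmax_nonneg by simp
  have e: "etaf \<phi> = etaf \<psi>"
    unfolding etaf_def
  proof (rule arg_cong[where f = stack_vec], rule map_cong[OF refl])
    fix i assume i: "i \<in> set (idx p)"
    have "ceta \<phi> 0 i a j = ceta \<psi> 0 i a j" for a j
      unfolding ceta_def by (rule set_integral_cong) (simp add: eqi[OF i])
    then show "bvec (dim_f p i) n (ceta \<phi> 0 i) = bvec (dim_f p i) n (ceta \<psi> 0 i)" by (intro bvec_cong)
  qed
  have q: "qint i A w \<phi> \<phi> = qint i A w \<psi> \<psi>" if "i \<in> {1..\<nu>}" for i A w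
  proof -
    have "(LINT \<tau>:ival p i|lebesgue. w \<tau> * (\<phi> \<tau> $ j * \<phi> \<tau> $ l)) = (LINT \<tau>:ival p i|lebesgue. w \<tau> * (\<psi> \<tau> $ j * \<psi> \<tau> $ l))" for j l
      by (rule set_integral_cong) (use eqi[of i] that in \<open>simp add: idx_iff\<close>)
    then show ?thesis unfolding qint_def by simp
  qed
  show ?thesis unfolding lyap_def 0 e using q by simp
qed

abbreviation shifted :: "(real \<Rightarrow> real vec) \<Rightarrow> real \<Rightarrow> real \<Rightarrow> real vec" where
  "shifted y t \<equiv> \<lambda>\<tau>. y (t + \<tau>)"

lemma ceta_shift: "ceta (shifted y t) 0 i = ceta y t i"
  by (rule ext)+ (simp add: ceta_def)

lemma qint_eq:
  assumes y: "cont y" and A: "A \<in> carrier_mat n n" and w: "continuous_on UNIV w"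
  shows "qint i A w (shifted y t) (shifted y t) = (LINT \<tau>:ival p i|lebesgue. w \<tau> * (y (t + \<tau>) \<bullet> (A *\<^sub>v y (t + \<tau>))))"
proof -
  have I: "integrable lebesgue (\<lambda>\<tau>. A $$ (j, l) * (indicator (ival p i) \<tau> *\<^sub>R (w \<tau> * (y (t + \<tau>) $ j * y (t + \<tau>) $ l))))"
    if "j < n" "l < n" for j l
  proof -
    have "set_integrable lebesgue (ival p i) (\<lambda>\<tau>. w \<tau> * (y (t + \<tau>) $ j * y (t + \<tau>) $ l))"
      unfolding ival_def
      by (rule continuous_set_integrable)
        (intro continuous_intros cont_window[OF y that(1)] cont_window[OF y that(2)] continuous_on_subset[OF w subset_UNIV])
    then show ?thesis by (simp add: set_integrable_def)
  qed
  have "(LINT \<tau>:ival p i|lebesgue. w \<tau> * (y (t + \<tau>) \<bullet> (A *\<^sub>v y (t + \<tau>))))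
    = (\<integral>\<tau>. (\<Sum>j\<in>{0..<n}. \<Sum>l\<in>{0..<n}. A $$ (j, l) * (indicator (ival p i) \<tau> *\<^sub>R (w \<tau> * (y (t + \<tau>) $ j * y (t + \<tau>) $ l)))) \<partial>lebesgue)"
    unfolding set_lebesgue_integral_def
  proof (rule Bochner_Integration.integral_cong[OF refl])
    fix \<tau>
    have "y (t + \<tau>) \<bullet> (A *\<^sub>v y (t + \<tau>)) = bform n n A (y (t + \<tau>)) (y (t + \<tau>))"
      using y by (intro bform_eq[OF A, symmetric]) (auto simp: cont_def)
    then show "indicator (ival p i) \<tau> *\<^sub>R (w \<tau> * (y (t + \<tau>) \<bullet> (A *\<^sub>v y (t + \<tau>))))
      = (\<Sum>j\<in>{0..<n}. \<Sum>l\<in>{0..<n}. A $$ (j, l) * (indicator (ival p i) \<tau> *\<^sub>R (w \<tau> * (y (t + \<tau>) $ j * y (t + \<tau>) $ l))))"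
      by (simp add: bform_def sum_distrib_left mult_ac)
  qed
  also have "\<dots> = (\<Sum>j\<in>{0..<n}. \<integral>\<tau>. (\<Sum>l\<in>{0..<n}. A $$ (j, l) * (indicator (ival p i) \<tau> *\<^sub>R (w \<tau> * (y (t + \<tau>) $ j * y (t + \<tau>) $ l)))) \<partial>lebesgue)"
    by (rule Bochner_Integration.integral_sum, rule Bochner_Integration.integrable_sum) (use I in auto)
  also have "\<dots> = (\<Sum>j\<in>{0..<n}. \<Sum>l\<in>{0..<n}. \<integral>\<tau>. A $$ (j, l) * (indicator (ival p i) \<tau> *\<^sub>R (w \<tau> * (y (t + \<tau>) $ j * y (t + \<tau>) $ l))) \<partial>lebesgue)"
    by (intro sum.cong refl Bochner_Integration.integral_sum) (use I in auto)
  finally show ?thesis by (simp add: qint_def set_lebesgue_integral_def)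
qed

lemma affine_primitive: "x \<in> {a..b} \<Longrightarrow> c0 + c1 * x = (c0 + c1 * a) + (LINT s:{a..x}|lebesgue. c1)" for a b x c0 c1 :: real
  using continuous_set_integral[OF continuous_on_const[of "{a..x}" c1]] by (simp add: algebra_simps)

text \<open>The scalar window rule for the continuous products y_j y_l and an affine weight, whose
  slope c1 produces the integral term. The weight \<tau> + r_i vanishes at -r_i and equals r_i -
  r_{i-1} at the right end, which is the origin of R \<Lambda> in \<open>Xi\<close>.\<close>

lemma qint_derivative:
  assumes y: "cont y" and A: "A \<in> carrier_mat n n" and i: "i \<in> set (idx p)" and w: "w = (\<lambda>\<tau>. c1 * \<tau> + c0)"
  shows "((\<lambda>t. qint i A w (shifted y t) (shifted y t)) has_real_derivative
      (w (- delay p (i - 1)) * (y (t - delay p (i - 1)) \<bullet> (A *\<^sub>v y (t - delay p (i - 1))))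
       - w (- delay p i) * (y (t - delay p i) \<bullet> (A *\<^sub>v y (t - delay p i)))
       - c1 * (LINT \<tau>:ival p i|lebesgue. y (t + \<tau>) \<bullet> (A *\<^sub>v y (t + \<tau>))))) (at t)"
    and "absolutely_continuous_between t0 T (\<lambda>t. qint i A w (shifted y t) (shifted y t))"
proof -
  let ?a = "- delay p i" and ?b = "- delay p (i - 1)"
  have lt: "?a \<le> ?b" using interval[OF i] by simp
  have cy: "continuous_on UNIV (\<lambda>s. y s $ j * y s $ l)" if "j < n" "l < n" for j l
    using y that by (auto simp: cont_def intro!: continuous_intros)
  have g: "set_integrable lebesgue {?a..?b} (\<lambda>_. c1)" by (rule continuous_set_integrable) (rule continuous_on_const)
  have f: "w x = w ?a + (LINT s:{?a..x}|lebesgue. c1)" if "x \<in> {?a..?b}" for x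
    unfolding w using affine_primitive[OF that, of c0 c1] by (simp add: add.commute)
  have yc: "y s \<in> carrier_vec n" for s using y by (simp add: cont_def)
  have "((\<lambda>t. qint i A w (shifted y t) (shifted y t)) has_real_derivative
     (\<Sum>j\<in>{0..<n}. \<Sum>l\<in>{0..<n}. A $$ (j, l) * (w ?b * (y (t + ?b) $ j * y (t + ?b) $ l) - w ?a * (y (t + ?a) $ j * y (t + ?a) $ l)
        - (LINT \<tau>:{?a..?b}|lebesgue. c1 * (y (t + \<tau>) $ j * y (t + \<tau>) $ l))))) (at t)"
    unfolding qint_def ival_def
    by (intro DERIV_sum DERIV_cmult window_integral_derivative[OF lt g f cy]) auto
  also have "(\<Sum>j\<in>{0..<n}. \<Sum>l\<in>{0..<n}. A $$ (j, l) * (w ?b * (y (t + ?b) $ j * y (t + ?b) $ l) - w ?a * (y (t + ?a) $ j * y (t + ?a) $ l)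
        - (LINT \<tau>:{?a..?b}|lebesgue. c1 * (y (t + \<tau>) $ j * y (t + \<tau>) $ l))))
    = w ?b * bform n n A (y (t + ?b)) (y (t + ?b)) - w ?a * bform n n A (y (t + ?a)) (y (t + ?a))
      - qint i A (\<lambda>_. c1) (shifted y t) (shifted y t)"
    by (simp add: bform_def qint_def ival_def right_diff_distrib sum_subtractf sum_distrib_left mult_ac)
  also have "qint i A (\<lambda>_. c1) (shifted y t) (shifted y t) = c1 * (LINT \<tau>:ival p i|lebesgue. y (t + \<tau>) \<bullet> (A *\<^sub>v y (t + \<tau>)))"
    unfolding qint_eq[OF y A continuous_on_const] by simp
  finally show "((\<lambda>t. qint i A w (shifted y t) (shifted y t)) has_real_derivative
      (w ?b * (y (t - delay p (i - 1)) \<bullet> (A *\<^sub>v y (t - delay p (i - 1))))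
       - w ?a * (y (t - delay p i) \<bullet> (A *\<^sub>v y (t - delay p i)))
       - c1 * (LINT \<tau>:ival p i|lebesgue. y (t + \<tau>) \<bullet> (A *\<^sub>v y (t + \<tau>))))) (at t)"
    unfolding bform_eq[OF A yc yc] by simp
  show "absolutely_continuous_between t0 T (\<lambda>t. qint i A w (shifted y t) (shifted y t))"
    unfolding qint_def ival_def
    by (intro absolutely_continuous_sum absolutely_continuous_mult absolutely_continuous_const window_integral_lipschitz[OF lt g f cy]) auto
qed

definition eta_at :: "(real \<Rightarrow> real vec) \<Rightarrow> real \<Rightarrow> real vec" where
  "eta_at y t = stack_vec (map (\<lambda>i. bvec (dim_f p i) n (ceta y t i)) (idx p))"

lemma etaf_shift: "etaf (shifted y t) = eta_at y t"
  by (simp add: etaf_def eta_at_def ceta_shift)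

lemma eta_at_carrier: "eta_at y t \<in> carrier_vec dn"
  unfolding etaf_shift[symmetric] by (rule etaf_carrier)

lemma eta_at_block: "cont y \<Longrightarrow> eta_at y t = stack_vec (map (eta_block (cx y t)) (idx p))"
  unfolding eta_at_def by (rule arg_cong[where f = stack_vec]) (simp add: eta_block_eq)

lemma eta_at_derivative:
  assumes y: "cont y"
  shows "vderiv dn (eta_at y) (stack_vec (map (deta_block (\<lambda>i. y (t - delay p i)) (cx y t)) (idx p))) t"
  unfolding eta_at_def[abs_def] d_sum_list[symmetric]
proof (rule vderiv_stack)
  fix i assume i: "i \<in> set (idx p)"
  show "vderiv (dim_f p i * n) (\<lambda>s. bvec (dim_f p i) n (ceta y s i)) (deta_block (\<lambda>i. y (t - delay p i)) (cx y t) i) t"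
    unfolding deta_block_def by (rule vderiv_bvec) (rule ceta_derivative[OF y i])
qed

lemma eta_at_absolutely_continuous:
  assumes y: "cont y" and k: "k < dn"
  shows "absolutely_continuous_between t0 T (\<lambda>t. eta_at y t $ k)"
  unfolding eta_at_def
proof (rule component_stack[where k = "\<lambda>i. dim_f p i * n" and f = "\<lambda>t i. bvec (dim_f p i) n (ceta y t i)"])
  fix i k assume i: "i \<in> set (idx p)" and k: "k < dim_f p i * n"
  show "absolutely_continuous_between t0 T (\<lambda>t. bvec (dim_f p i) n (ceta y t i) $ k)"
    by (rule component_bvec[where u = "\<lambda>t. ceta y t i", OF _ k]) (rule ceta_absolutely_continuous[OF y i])
qed (use k d_sum_list in simp_all)

end

section \<open>Derivative of the functional and its two-sided bounds\<close>

lemma scalar_prod_young: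
  fixes u v :: "real vec"
  assumes "u \<in> carrier_vec k" "v \<in> carrier_vec k"
  shows "2 * (u \<bullet> v) \<le> u \<bullet> u + v \<bullet> v"
proof -
  have "0 \<le> (\<Sum>i\<in>{0..<k}. (u $ i - v $ i)\<^sup>2)" by (simp add: sum_nonneg)
  also have "\<dots> = u \<bullet> u + v \<bullet> v - 2 * (u \<bullet> v)"
    using assms by (simp add: scalar_prod_def power2_eq_square algebra_simps sum.distrib sum_subtractf sum_distrib_left)
  finally show ?thesis by simp
qed

lemma bilinear_form_bound:
  assumes A: "A \<in> carrier_mat k l"
  shows "\<exists>C\<ge>0. \<forall>u\<in>carrier_vec k. \<forall>v\<in>carrier_vec l. u \<bullet> (A *\<^sub>v v) \<le> C * (u \<bullet> u + v \<bullet> (v :: real vec))"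
proof -
  obtain C where C: "0 \<le> C" "\<And>v. v \<in> carrier_vec l \<Longrightarrow> (A *\<^sub>v v) \<bullet> (A *\<^sub>v v) \<le> C * (v \<bullet> v)"
    using norm_mult_mat_vec_bound[OF A] by blast
  have "u \<bullet> (A *\<^sub>v v) \<le> (C + 1) * (u \<bullet> u + v \<bullet> v)" if uv: "u \<in> carrier_vec k" "v \<in> carrier_vec l" for u v
  proof -
    have "2 * (u \<bullet> (A *\<^sub>v v)) \<le> u \<bullet> u + C * (v \<bullet> v)"
      using scalar_prod_young[OF uv(1) mult_mat_vec_carrier[OF A uv(2)]] C(2)[OF uv(2)] by linarith
    moreover have "0 \<le> C * (u \<bullet> u)" "0 \<le> C * (v \<bullet> v)" "0 \<le> u \<bullet> u" "0 \<le> v \<bullet> v"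
      using C(1) by simp_all
    ultimately show ?thesis unfolding distrib_left distrib_right by linarith
  qed
  then show ?thesis using C(1) by (intro exI[of _ "C + 1"]) simp
qed

lemma sum_telescope_pred: "(\<Sum>i = 1..k. g (i - 1) - g i) = g 0 - (g k :: real)" for k :: nat
  by (induction k) simp_all

lemma one_kron_one_mult_bvec: "(1\<^sub>m k \<otimes>\<^sub>k 1\<^sub>m n) *\<^sub>v bvec k n u = bvec k n u"
  unfolding kron_one_mult_bvec[OF one_carrier_mat]
proof (rule bvec_cong)
  fix a j assume a: "a < k"
  have "(\<Sum>b = 0..<k. 1\<^sub>m k $$ (a, b) * u b j) = (\<Sum>b = 0..<k. if b = a then u b j else 0)"
    by (rule sum.cong) (use a in auto)
  then show "(\<Sum>b = 0..<k. 1\<^sub>m k $$ (a, b) * u b j) = u a j" using a by simp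
qed

context lmi begin

text \<open>The block diagonal form is tested on a stack supported in the i-th block.\<close>

lemma diag_idx_nonneg:
  assumes X: "pos_def (diag_idx p X)" "\<And>i. i \<in> set (idx p) \<Longrightarrow> X i \<in> carrier_mat n n" and i: "i \<in> set (idx p)" and x: "x \<in> carrier_vec n"
  shows "0 \<le> x \<bullet> (X i *\<^sub>v x)"
proof -
  define v where "v = (\<lambda>j. if j = i then x else 0\<^sub>v n)"
  have v: "v j \<in> carrier_vec n" for j using x by (simp add: v_def)
  have "0 \<le> stack_vec (map v (idx p)) \<bullet> (diag_idx p X *\<^sub>v stack_vec (map v (idx p)))"
    by (rule pos_def_nonneg[OF X(1) diag_idx_carrier[OF X(2)] stack_idx_carrier[OF v]])
  also have "\<dots> = (\<Sum>j = 1..\<nu>. v j \<bullet> (X j *\<^sub>v v j))" by (rule quad_form_diag_idx[OF X(2) v])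
  also have "\<dots> = (\<Sum>j = 1..\<nu>. if j = i then x \<bullet> (X i *\<^sub>v x) else 0)"
    by (rule sum.cong) (use X(2) in \<open>auto simp: v_def set_idx intro!: scalar_prod_left_zero mult_mat_vec_carrier\<close>)
  also have "\<dots> = x \<bullet> (X i *\<^sub>v x)" using i by (simp add: set_idx)
  finally show ?thesis .
qed

lemmas Q_nonneg = diag_idx_nonneg[OF lmi_Q QR_carrier(1)]
lemmas R_nonneg = diag_idx_nonneg[OF lmi_R QR_carrier(2)]

definition energy :: "(real \<Rightarrow> real vec) \<Rightarrow> real \<Rightarrow> nat \<Rightarrow> real" where
  "energy y t i = (LINT \<tau>:ival p i|lebesgue. y (t + \<tau>) \<bullet> y (t + \<tau>))"

lemma cont_carrier: "cont y \<Longrightarrow> y a \<in> carrier_vec n"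
  by (simp add: cont_def)

lemma one_quad: "cont y \<Longrightarrow> y a \<bullet> (1\<^sub>m n *\<^sub>v y a) = y a \<bullet> y a"
  using cont_carrier[of y a] by simp

lemma energy_one: "cont y \<Longrightarrow> (LINT \<tau>:ival p i|lebesgue. y (t + \<tau>) \<bullet> (1\<^sub>m n *\<^sub>v y (t + \<tau>))) = energy y t i"
  by (simp only: energy_def one_quad)

lemma set_integral_nonneg: "(\<And>x. x \<in> S \<Longrightarrow> 0 \<le> f x) \<Longrightarrow> 0 \<le> (LINT x:S|lebesgue. (f x :: real))"
  unfolding set_lebesgue_integral_def
  by (rule Bochner_Integration.integral_nonneg) (simp add: indicator_def)

lemma energy_nonneg: "0 \<le> energy y t i"
  unfolding energy_def by (rule set_integral_nonneg) (rule scalar_prod_self_nonneg)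

lemma cont_quad: 
  assumes y: "cont y" and A: "A \<in> carrier_mat n n"
  shows "continuous_on S (\<lambda>\<tau>. y (t + \<tau>) \<bullet> (A *\<^sub>v y (t + \<tau>)))"
  unfolding bform_eq[OF A cont_carrier[OF y] cont_carrier[OF y], symmetric] bform_def
  by (intro continuous_intros cont_window[OF y]) auto

lemma qint_nonneg:
  assumes y: "cont y" and A: "A \<in> carrier_mat n n" "\<And>x. x \<in> carrier_vec n \<Longrightarrow> 0 \<le> x \<bullet> (A *\<^sub>v x)"
    and w: "continuous_on UNIV w" "\<And>\<tau>. \<tau> \<in> ival p i \<Longrightarrow> 0 \<le> w \<tau>"
  shows "0 \<le> qint i A w (shifted y t) (shifted y t)"
  unfolding qint_eq[OF y A(1) w(1)]
  by (rule set_integral_nonneg) (intro mult_nonneg_nonneg w A(2) cont_carrier[OF y])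

lemma qint_upper:
  assumes A: "A \<in> carrier_mat n n"
    and w: "continuous_on UNIV w" "\<And>\<tau>. \<tau> \<in> ival p i \<Longrightarrow> 0 \<le> w \<tau> \<and> w \<tau> \<le> B" and B: "0 \<le> B"
  shows "\<exists>C\<ge>0. \<forall>y t. cont y \<longrightarrow> qint i A w (shifted y t) (shifted y t) \<le> C * energy y t i"
proof -
  obtain C where C: "0 \<le> C" "\<And>u v. u \<in> carrier_vec n \<Longrightarrow> v \<in> carrier_vec n \<Longrightarrow> u \<bullet> (A *\<^sub>v v) \<le> C * (u \<bullet> u + v \<bullet> v)"
    using bilinear_form_bound[OF A] by blast
  have "qint i A w (shifted y t) (shifted y t) \<le> (B * (2 * C)) * energy y t i" if y: "cont y" for y t
  proof -
    have "(LINT \<tau>:ival p i|lebesgue. w \<tau> * (y (t + \<tau>) \<bullet> (A *\<^sub>v y (t + \<tau>))))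
        \<le> (LINT \<tau>:ival p i|lebesgue. (B * (2 * C)) * (y (t + \<tau>) \<bullet> (1\<^sub>m n *\<^sub>v y (t + \<tau>))))"
    proof (rule set_integral_mono)
      show "set_integrable lebesgue (ival p i) (\<lambda>\<tau>. w \<tau> * (y (t + \<tau>) \<bullet> (A *\<^sub>v y (t + \<tau>))))"
        unfolding ival_def
        by (intro continuous_set_integrable continuous_intros cont_quad[OF y A] continuous_on_subset[OF w(1) subset_UNIV])
      show "set_integrable lebesgue (ival p i) (\<lambda>\<tau>. (B * (2 * C)) * (y (t + \<tau>) \<bullet> (1\<^sub>m n *\<^sub>v y (t + \<tau>))))"
        unfolding ival_def
        by (intro continuous_set_integrable continuous_intros cont_quad[OF y one_carrier_mat])
      fix \<tau> assume \<tau>: "\<tau> \<in> ival p i"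
      let ?z = "y (t + \<tau>)"
      have z: "?z \<in> carrier_vec n" by (rule cont_carrier[OF y])
      have "w \<tau> * (?z \<bullet> (A *\<^sub>v ?z)) \<le> w \<tau> * (2 * C * (?z \<bullet> ?z))"
        by (rule mult_left_mono) (use C(2)[OF z z] w(2)[OF \<tau>] in auto)
      also have "\<dots> \<le> B * (2 * C * (?z \<bullet> ?z))"
        by (rule mult_right_mono) (use w(2)[OF \<tau>] C(1) in \<open>auto\<close>)
      finally show "w \<tau> * (?z \<bullet> (A *\<^sub>v ?z)) \<le> (B * (2 * C)) * (?z \<bullet> (1\<^sub>m n *\<^sub>v ?z))"
        unfolding one_quad[OF y] by (simp add: mult.assoc)
    qed
    also have "\<dots> = (B * (2 * C)) * energy y t i"
      unfolding set_integral_mult_right energy_one[OF y] ..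
    finally show ?thesis unfolding qint_eq[OF y A w(1)] .
  qed
  then show ?thesis using B C(1) by (intro exI[of _ "B * (2 * C)"]) simp
qed

lemma weight_bounds:
  assumes "i \<in> set (idx p)" "\<tau> \<in> ival p i"
  shows "0 \<le> \<tau> + delay p i" "\<tau> + delay p i \<le> rmax p + 1" "0 \<le> \<tau> + (rmax p + 1)" "\<tau> + (rmax p + 1) \<le> rmax p + 1"
proof -
  have "0 \<le> delay p (i - 1)" "delay p i \<le> rmax p" "- delay p i \<le> \<tau>" "\<tau> \<le> - delay p (i - 1)"
    using assms delay_bounds[of i] delay_bounds[of "i - 1"] unfolding idx_iff ival_def by auto
  then show "0 \<le> \<tau> + delay p i" "\<tau> + delay p i \<le> rmax p + 1" "0 \<le> \<tau> + (rmax p + 1)" "\<tau> + (rmax p + 1) \<le> rmax p + 1"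
    by linarith+
qed

lemma lyap_shifted: "lyap \<epsilon> (shifted y t) (shifted y t) = bform n n P1 (y t) (y t) + 2 * bform n dn P2 (y t) (eta_at y t) + bform dn dn P3 (eta_at y t) (eta_at y t)
    + (\<Sum>i = 1..\<nu>. qint i (Q i) (\<lambda>_. 1) (shifted y t) (shifted y t) + qint i (R i) (\<lambda>\<tau>. \<tau> + delay p i) (shifted y t) (shifted y t)
        + \<epsilon> * qint i (1\<^sub>m n) (\<lambda>\<tau>. \<tau> + (rmax p + 1)) (shifted y t) (shifted y t))"
  unfolding lyap_def etaf_shift by simp

lemma lyap_absolutely_continuous:
  assumes y: "cont y" and ac: "\<And>j. j < n \<Longrightarrow> absolutely_continuous_between t0 T (\<lambda>t. y t $ j)"
  shows "absolutely_continuous_between t0 T (\<lambda>t. lyap \<epsilon> (shifted y t) (shifted y t))"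
  unfolding lyap_shifted
proof (intro absolutely_continuous_add absolutely_continuous_sum absolutely_continuous_mult absolutely_continuous_const absolutely_continuous_bform)
  fix i assume "i \<in> {1..\<nu>}"
  then have i: "i \<in> set (idx p)" by (simp add: idx_iff)
  show "absolutely_continuous_between t0 T (\<lambda>t. qint i (Q i) (\<lambda>_. 1) (shifted y t) (shifted y t))"
    by (rule qint_derivative(2)[OF y QR_carrier(1)[OF i] i, of _ 0 1]) simp
  show "absolutely_continuous_between t0 T (\<lambda>t. qint i (R i) (\<lambda>\<tau>. \<tau> + delay p i) (shifted y t) (shifted y t))"
    by (rule qint_derivative(2)[OF y QR_carrier(2)[OF i] i, of _ 1 "delay p i"]) simp
  show "absolutely_continuous_between t0 T (\<lambda>t. qint i (1\<^sub>m n) (\<lambda>\<tau>. \<tau> + (rmax p + 1)) (shifted y t) (shifted y t))"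
    by (rule qint_derivative(2)[OF y one_carrier_mat i, of _ 1 "rmax p + 1"]) simp
qed (use ac eta_at_absolutely_continuous[OF y] in auto)

text \<open>Symmetry of P1 and P3 merges the two halves of their product rules into factors of two;
  for P2 that factor is already present in \<open>lyap\<close>.\<close>

lemma lyap_derivative:
  assumes y: "cont y" and d: "vderiv n y d t"
    and \<eta>: "\<eta> = eta_at y t" and \<eta>': "\<eta>' = stack_vec (map (deta_block (\<lambda>i. y (t - delay p i)) (cx y t)) (idx p))"
  shows "((\<lambda>t. lyap \<epsilon> (shifted y t) (shifted y t)) has_real_derivative
     2 * (d \<bullet> (P1 *\<^sub>v y t + P2 *\<^sub>v \<eta>)) + 2 * ((P2\<^sup>T *\<^sub>v y t + P3 *\<^sub>v \<eta>) \<bullet> \<eta>')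
     + (\<Sum>i = 1..\<nu>. y (t - delay p (i - 1)) \<bullet> (Q i *\<^sub>v y (t - delay p (i - 1))) - y (t - delay p i) \<bullet> (Q i *\<^sub>v y (t - delay p i))
        + ((delay p i - delay p (i - 1)) * (y (t - delay p (i - 1)) \<bullet> (R i *\<^sub>v y (t - delay p (i - 1))))
           - (LINT \<tau>:ival p i|lebesgue. y (t + \<tau>) \<bullet> (R i *\<^sub>v y (t + \<tau>))))
        + \<epsilon> * ((rmax p + 1 - delay p (i - 1)) * (y (t - delay p (i - 1)) \<bullet> y (t - delay p (i - 1)))
           - (rmax p + 1 - delay p i) * (y (t - delay p i) \<bullet> y (t - delay p i)) - energy y t i))) (at t)"
  (is "(_ has_real_derivative 2 * ?A + 2 * ?B + (\<Sum>i = 1..\<nu>. ?q i + ?r i + \<epsilon> * ?e i)) _")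
proof -
  note e = eta_at_derivative[OF y, of t, folded \<eta>']
  have c: "d \<in> carrier_vec n" "y t \<in> carrier_vec n" "\<eta> \<in> carrier_vec dn" "\<eta>' \<in> carrier_vec dn"
    using d e cont_carrier[OF y] eta_at_carrier by (auto simp: vderiv_def \<eta>)
  note PC = sym_mat_carrier[OF P1] sym_mat_carrier[OF P3]
  have q: "((\<lambda>t. qint i (Q i) (\<lambda>_. 1) (shifted y t) (shifted y t)) has_real_derivative ?q i) (at t)"
    "((\<lambda>t. qint i (R i) (\<lambda>\<tau>. \<tau> + delay p i) (shifted y t) (shifted y t)) has_real_derivative ?r i) (at t)"
    "((\<lambda>t. qint i (1\<^sub>m n) (\<lambda>\<tau>. \<tau> + (rmax p + 1)) (shifted y t) (shifted y t)) has_real_derivative ?e i) (at t)"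
    if "i \<in> {1..\<nu>}" for i
  proof -
    have i: "i \<in> set (idx p)" using that by (simp add: idx_iff)
    show "((\<lambda>t. qint i (Q i) (\<lambda>_. 1) (shifted y t) (shifted y t)) has_real_derivative ?q i) (at t)"
      using qint_derivative(1)[OF y QR_carrier(1)[OF i] i, of "\<lambda>_. 1" 0 1 t] by simp
    show "((\<lambda>t. qint i (R i) (\<lambda>\<tau>. \<tau> + delay p i) (shifted y t) (shifted y t)) has_real_derivative ?r i) (at t)"
      using qint_derivative(1)[OF y QR_carrier(2)[OF i] i, of "\<lambda>\<tau>. \<tau> + delay p i" 1 "delay p i" t] by simp
    show "((\<lambda>t. qint i (1\<^sub>m n) (\<lambda>\<tau>. \<tau> + (rmax p + 1)) (shifted y t) (shifted y t)) has_real_derivative ?e i) (at t)"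
      using qint_derivative(1)[OF y one_carrier_mat i, of "\<lambda>\<tau>. \<tau> + (rmax p + 1)" 1 "rmax p + 1" t]
      unfolding one_quad[OF y] energy_def[symmetric] by (simp add: algebra_simps)
  qed
  have "((\<lambda>t. lyap \<epsilon> (shifted y t) (shifted y t)) has_real_derivative
     (d \<bullet> (P1 *\<^sub>v y t) + y t \<bullet> (P1 *\<^sub>v d)) + 2 * (d \<bullet> (P2 *\<^sub>v eta_at y t) + y t \<bullet> (P2 *\<^sub>v \<eta>'))
     + (\<eta>' \<bullet> (P3 *\<^sub>v eta_at y t) + eta_at y t \<bullet> (P3 *\<^sub>v \<eta>')) + (\<Sum>i = 1..\<nu>. ?q i + ?r i + \<epsilon> * ?e i)) (at t)"
    unfolding lyap_shifted
    by (intro DERIV_add DERIV_sum DERIV_cmult bform_derivative d e PC P2 q)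
  moreover have "y t \<bullet> (P1 *\<^sub>v d) = d \<bullet> (P1 *\<^sub>v y t)"
    using sym_mat_scalar_prod[OF P1 c(2,1)] comm_scalar_prod[OF mult_mat_vec_carrier[OF PC(1) c(2)] c(1)] by simp
  moreover have "\<eta>' \<bullet> (P3 *\<^sub>v \<eta>) = (P3 *\<^sub>v \<eta>) \<bullet> \<eta>'" 
    by (rule comm_scalar_prod[OF c(4) mult_mat_vec_carrier[OF PC(2) c(3)]])
  moreover have "\<eta> \<bullet> (P3 *\<^sub>v \<eta>') = (P3 *\<^sub>v \<eta>) \<bullet> \<eta>'" by (rule sym_mat_scalar_prod[OF P3 c(3,4), symmetric])
  moreover have "y t \<bullet> (P2 *\<^sub>v \<eta>') = (P2\<^sup>T *\<^sub>v y t) \<bullet> \<eta>'"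
    by (rule transpose_vec_mult_scalar[OF P2 c(4,2), symmetric])
  moreover have "?A = d \<bullet> (P1 *\<^sub>v y t) + d \<bullet> (P2 *\<^sub>v \<eta>)"
    by (rule scalar_prod_add_distrib[OF c(1) mult_mat_vec_carrier[OF PC(1) c(2)] mult_mat_vec_carrier[OF P2 c(3)]])
  moreover have "?B = (P2\<^sup>T *\<^sub>v y t) \<bullet> \<eta>' + (P3 *\<^sub>v \<eta>) \<bullet> \<eta>'"
    by (rule add_scalar_prod_distrib[OF mult_mat_vec_carrier[OF _ c(2)] mult_mat_vec_carrier[OF PC(2) c(3)] c(4)]) (use P2 in simp)
  ultimately show ?thesis unfolding \<eta>[symmetric] by (simp add: algebra_simps)
qed

definition theta_at :: "(real \<Rightarrow> real vec) \<Rightarrow> real vec \<Rightarrow> real \<Rightarrow> real vec" where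
  "theta_at y w t = y t @\<^sub>v (stack_vec (map (\<lambda>i. y (t - delay p i)) (idx p))
     @\<^sub>v (stack_vec (map (\<lambda>i. bvec (vk p i) n (cx y t i)) (idx p))
     @\<^sub>v (stack_vec (map (\<lambda>i. bvec (dim_phi p i) n (ca y t i)) (idx p)) @\<^sub>v w)))"

text \<open>c is fixed before \<epsilon>, so that \<epsilon> can later be chosen small against it.
  The \<epsilon>-term contributes -\<epsilon> times the energies and boundary terms costing at most
  \<epsilon> (r + 1) |y(t)|^2.\<close>

lemma lyap_decay:
  "\<exists>c>0. \<forall>\<epsilon>\<ge>0. \<forall>y w t. cont y \<longrightarrow> w \<in> carrier_vec q \<longrightarrow> vderiv n y (rhs_mat *\<^sub>v theta_at y w t) t \<longrightarrow>
     (\<exists>D. ((\<lambda>t. lyap \<epsilon> (shifted y t) (shifted y t)) has_real_derivative D) (at t) \<and>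
       D - supply_rate s (Sig p K Kh *\<^sub>v theta_at y w t) w \<le> - (c - \<epsilon> * (rmax p + 1)) * (y t \<bullet> y t) - \<epsilon> * (\<Sum>i = 1..\<nu>. energy y t i))"
proof -
  obtain c where c: "c > 0" "\<And>X. X \<in> carrier_vec (n + (N + m)) \<Longrightarrow> X \<bullet> (LM *\<^sub>v X) \<le> - c * (X \<bullet> X)"
    using neg_def_coercive[OF lmi_main[folded LM_def] LM_carrier] by blast
  have "\<exists>D. ((\<lambda>t. lyap \<epsilon> (shifted y t) (shifted y t)) has_real_derivative D) (at t) \<and>
       D - supply_rate s (Sig p K Kh *\<^sub>v theta_at y w t) w \<le> - (c - \<epsilon> * (rmax p + 1)) * (y t \<bullet> y t) - \<epsilon> * (\<Sum>i = 1..\<nu>. energy y t i)"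
    if \<epsilon>: "0 \<le> \<epsilon>" and y: "cont y" and w: "w \<in> carrier_vec q" and d: "vderiv n y (rhs_mat *\<^sub>v theta_at y w t) t" for \<epsilon> y w t
  proof -
    define ed where "ed = (\<lambda>i. y (t - delay p i))"
    have ed0: "ed 0 = y t" by (simp add: ed_def delay_0)
    define \<theta> where "\<theta> = theta_at y w t"
    define \<eta>' where "\<eta>' = stack_vec (map (deta_block ed (cx y t)) (idx p))"
    define \<eta> where "\<eta> = eta_at y t"
    define rI where "rI = (\<lambda>i. LINT \<tau>:ival p i|lebesgue. y (t + \<tau>) \<bullet> (R i *\<^sub>v y (t + \<tau>)))"
    define g where "g = (\<lambda>i. (rmax p + 1 - delay p i) * (ed i \<bullet> ed i))"
    define qq where "qq = (\<lambda>i. ed (i - 1) \<bullet> (Q i *\<^sub>v ed (i - 1)))"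
    define rr where "rr = (\<lambda>i. (delay p i - delay p (i - 1)) * (ed (i - 1) \<bullet> (R i *\<^sub>v ed (i - 1))))"
    define q0 where "q0 = (\<lambda>i. ed i \<bullet> (Q i *\<^sub>v ed i))"
    define bx where "bx = (\<lambda>i. bvec (vk p i) n (cx y t i) \<bullet> ((1\<^sub>m (vk p i) \<otimes>\<^sub>k R i) *\<^sub>v bvec (vk p i) n (cx y t i)))"
    define ba where "ba = (\<lambda>i. bvec (dim_phi p i) n (ca y t i) \<bullet> ((1\<^sub>m (dim_phi p i) \<otimes>\<^sub>k R i) *\<^sub>v bvec (dim_phi p i) n (ca y t i)))"
    define Z where "Z = 2 * ((rhs_mat *\<^sub>v \<theta>) \<bullet> (P1 *\<^sub>v ed 0 + P2 *\<^sub>v \<eta>)) + 2 * ((P2\<^sup>T *\<^sub>v ed 0 + P3 *\<^sub>v \<eta>) \<bullet> \<eta>')"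
    have D: "((\<lambda>t. lyap \<epsilon> (shifted y t) (shifted y t)) has_real_derivative
        Z + (\<Sum>i = 1..\<nu>. qq i - q0 i + (rr i - rI i) + \<epsilon> * (g (i - 1) - g i - energy y t i))) (at t)"
      using lyap_derivative[OF y d refl refl, of \<epsilon>]
      unfolding Z_def ed0 \<eta>_def \<eta>'_def \<theta>_def qq_def q0_def rr_def rI_def g_def unfolding ed_def .
    have L: "Z + (\<Sum>i = 1..\<nu>. qq i + rr i) - (\<Sum>i = 1..\<nu>. q0 i) - (\<Sum>i = 1..\<nu>. bx i) - (\<Sum>i = 1..\<nu>. ba i)
        - supply_rate s (Sig p K Kh *\<^sub>v \<theta>) w \<le> - c * (ed 0 \<bullet> ed 0)"
      unfolding Z_def qq_def rr_def q0_def bx_def ba_def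
    proof (rule lmi_inequality[OF _ c(2) _ w refl refl _ _ \<eta>'_def])
      show "\<theta> = ed 0 @\<^sub>v (stack_vec (map ed (idx p)) @\<^sub>v (stack_vec (map (\<lambda>i. bvec (vk p i) n (cx y t i)) (idx p))
          @\<^sub>v (stack_vec (map (\<lambda>i. bvec (dim_phi p i) n (ca y t i)) (idx p)) @\<^sub>v w)))"
        unfolding \<theta>_def theta_at_def ed0 unfolding ed_def ..
      show "\<eta> = stack_vec (map (eta_block (cx y t)) (idx p))" unfolding \<eta>_def by (rule eta_at_block[OF y])
    qed (use c(1) cont_carrier[OF y] in \<open>auto simp: ed_def\<close>)
    \<comment> \<open>The derivative contains the R_i-integrals with a minus sign, the matrix
      inequality only the forms of their coefficients; this comparison passes from one to the
      other.\<close>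
    have bes: "(\<Sum>i = 1..\<nu>. bx i + ba i) \<le> (\<Sum>i = 1..\<nu>. rI i)"
    proof (rule sum_mono)
      fix i assume "i \<in> {1..\<nu>}"
      then have i: "i \<in> set (idx p)" by (simp add: idx_iff)
      show "bx i + ba i \<le> rI i" unfolding bx_def ba_def rI_def by (rule bessel_R[OF y i QR_carrier(2)[OF i] R_nonneg[OF _ i]])
    qed
    \<comment> \<open>The weight at -r_i is r + 1 - r_i, so the sum telescopes to (r + 1) |y(t)|^2
      minus a nonnegative term at the largest delay.\<close>
    have tel: "(\<Sum>i = 1..\<nu>. g (i - 1) - g i) \<le> (rmax p + 1) * (y t \<bullet> y t)"
    proof -
      have "0 \<le> g \<nu>" unfolding g_def using delay_bounds[of \<nu>] by simp
      then show ?thesis unfolding sum_telescope_pred by (simp add: g_def ed0 delay_0)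
    qed
    have "Z + (\<Sum>i = 1..\<nu>. qq i - q0 i + (rr i - rI i) + \<epsilon> * (g (i - 1) - g i - energy y t i))
      = Z + (\<Sum>i = 1..\<nu>. qq i + rr i) - (\<Sum>i = 1..\<nu>. q0 i) - (\<Sum>i = 1..\<nu>. rI i)
        + \<epsilon> * (\<Sum>i = 1..\<nu>. g (i - 1) - g i) - \<epsilon> * (\<Sum>i = 1..\<nu>. energy y t i)"
      by (simp add: sum.distrib sum_subtractf sum_distrib_left[symmetric] right_diff_distrib)
    moreover have "\<epsilon> * (\<Sum>i = 1..\<nu>. g (i - 1) - g i) \<le> \<epsilon> * ((rmax p + 1) * (y t \<bullet> y t))"
      by (rule mult_left_mono[OF tel \<epsilon>])
    moreover have "(\<Sum>i = 1..\<nu>. bx i + ba i) = (\<Sum>i = 1..\<nu>. bx i) + (\<Sum>i = 1..\<nu>. ba i)" by (rule sum.distrib)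
    moreover have "- (c - \<epsilon> * (rmax p + 1)) * (y t \<bullet> y t) = - c * (ed 0 \<bullet> ed 0) + \<epsilon> * ((rmax p + 1) * (y t \<bullet> y t))"
      unfolding ed0 by (simp add: algebra_simps)
    ultimately have "Z + (\<Sum>i = 1..\<nu>. qq i - q0 i + (rr i - rI i) + \<epsilon> * (g (i - 1) - g i - energy y t i))
        - supply_rate s (Sig p K Kh *\<^sub>v \<theta>) w \<le> - (c - \<epsilon> * (rmax p + 1)) * (y t \<bullet> y t) - \<epsilon> * (\<Sum>i = 1..\<nu>. energy y t i)"
      using L bes by linarith
    then show ?thesis using D unfolding \<theta>_def by blast
  qed
  then show ?thesis using c(1) by blast
qed

text \<open>Positivity is assumed with the Q-blocks added to \<open>P3\<close>. Bessel's inequality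
  for \<open>vF\<close> bounds the form of those blocks at \<eta> by the Q-integrals of the
  functional, and the other integrals are nonnegative.\<close>

lemma lyap_lower:
  "\<exists>c>0. \<forall>\<epsilon>\<ge>0. \<forall>y t. cont y \<longrightarrow> c * (y t \<bullet> y t) \<le> lyap \<epsilon> (shifted y t) (shifted y t)"
proof -
  let ?D = "diag_idx p (\<lambda>i. 1\<^sub>m (dim_f p i) \<otimes>\<^sub>k Q i)"
  note PC = sym_mat_carrier[OF P1] sym_mat_carrier[OF P3]
  have Qk: "1\<^sub>m (dim_f p i) \<otimes>\<^sub>k Q i \<in> carrier_mat (dim_f p i * n) (dim_f p i * n)" if "i \<in> set (idx p)" for i
    by (rule kron_carrier[OF one_carrier_mat QR_carrier(1)[OF that]])
  have D: "?D \<in> carrier_mat dn dn"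
    unfolding d_sum_mult by (rule diag_idx_carrier[OF Qk])
  have F: "four_block_mat P1 P2 (P2\<^sup>T) (P3 + ?D) \<in> carrier_mat (n + dn) (n + dn)"
    by (rule four_block_carrier_mat[OF PC(1)]) (use D in simp)
  obtain c where c: "c > 0" "\<And>X. X \<in> carrier_vec (n + dn) \<Longrightarrow> c * (X \<bullet> X) \<le> X \<bullet> (four_block_mat P1 P2 (P2\<^sup>T) (P3 + ?D) *\<^sub>v X)"
    using pos_def_coercive[OF lmi_P F] by blast
  have "c * (y t \<bullet> y t) \<le> lyap \<epsilon> (shifted y t) (shifted y t)" if \<epsilon>: "0 \<le> \<epsilon>" and y: "cont y" for \<epsilon> y t
  proof -
    define \<eta> where "\<eta> = eta_at y t"
    have v: "y t \<in> carrier_vec n" "\<eta> \<in> carrier_vec dn" using cont_carrier[OF y] eta_at_carrier by (auto simp: \<eta>_def)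
    have "c * (y t \<bullet> y t) \<le> c * (y t \<bullet> y t + \<eta> \<bullet> \<eta>)" using c(1) by simp
    also have "\<dots> = c * ((y t @\<^sub>v \<eta>) \<bullet> (y t @\<^sub>v \<eta>))" by (simp add: scalar_prod_append[OF v v])
    also have "\<dots> \<le> (y t @\<^sub>v \<eta>) \<bullet> (four_block_mat P1 P2 (P2\<^sup>T) (P3 + ?D) *\<^sub>v (y t @\<^sub>v \<eta>))"
      by (rule c(2)[OF append_carrier_vec[OF v]])
    also have "\<dots> = y t \<bullet> (P1 *\<^sub>v y t) + 2 * (y t \<bullet> (P2 *\<^sub>v \<eta>)) + (\<eta> \<bullet> (P3 *\<^sub>v \<eta>) + \<eta> \<bullet> (?D *\<^sub>v \<eta>))"
      unfolding quad_form_four_block[OF PC(1) P2 add_carrier_mat[OF D] v] quad_form_add[OF PC(2) D v(2)] ..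
    also have "\<eta> \<bullet> (?D *\<^sub>v \<eta>) = (\<Sum>i = 1..\<nu>. bvec (dim_f p i) n (ceta y t i) \<bullet> ((1\<^sub>m (dim_f p i) \<otimes>\<^sub>k Q i) *\<^sub>v bvec (dim_f p i) n (ceta y t i)))"
      unfolding \<eta>_def eta_at_def by (rule quad_form_diag_idx[OF Qk]) simp_all
    finally have 1: "c * (y t \<bullet> y t) \<le> y t \<bullet> (P1 *\<^sub>v y t) + 2 * (y t \<bullet> (P2 *\<^sub>v \<eta>)) + (\<eta> \<bullet> (P3 *\<^sub>v \<eta>)
      + (\<Sum>i = 1..\<nu>. bvec (dim_f p i) n (ceta y t i) \<bullet> ((1\<^sub>m (dim_f p i) \<otimes>\<^sub>k Q i) *\<^sub>v bvec (dim_f p i) n (ceta y t i))))" .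
    have 2: "(\<Sum>i = 1..\<nu>. bvec (dim_f p i) n (ceta y t i) \<bullet> ((1\<^sub>m (dim_f p i) \<otimes>\<^sub>k Q i) *\<^sub>v bvec (dim_f p i) n (ceta y t i)))
      \<le> (\<Sum>i = 1..\<nu>. qint i (Q i) (\<lambda>_. 1) (shifted y t) (shifted y t) + qint i (R i) (\<lambda>\<tau>. \<tau> + delay p i) (shifted y t) (shifted y t)
        + \<epsilon> * qint i (1\<^sub>m n) (\<lambda>\<tau>. \<tau> + (rmax p + 1)) (shifted y t) (shifted y t))"
    proof (rule sum_mono)
      fix i assume "i \<in> {1..\<nu>}"
      then have i: "i \<in> set (idx p)" by (simp add: idx_iff)
      have "bvec (dim_f p i) n (ceta y t i) \<bullet> ((1\<^sub>m (dim_f p i) \<otimes>\<^sub>k Q i) *\<^sub>v bvec (dim_f p i) n (ceta y t i))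
         \<le> qint i (Q i) (\<lambda>_. 1) (shifted y t) (shifted y t)"
        unfolding qint_eq[OF y QR_carrier(1)[OF i] continuous_on_const] mult_1
        by (rule bessel_F[OF y i QR_carrier(1)[OF i] Q_nonneg[OF _ i]])
      moreover have "0 \<le> qint i (R i) (\<lambda>\<tau>. \<tau> + delay p i) (shifted y t) (shifted y t)"
        by (rule qint_nonneg[OF y QR_carrier(2)[OF i] R_nonneg[OF _ i]])
          (use weight_bounds[OF i] in \<open>auto intro!: continuous_intros\<close>)
      moreover have "0 \<le> qint i (1\<^sub>m n) (\<lambda>\<tau>. \<tau> + (rmax p + 1)) (shifted y t) (shifted y t)"
        by (rule qint_nonneg[OF y one_carrier_mat])
          (use weight_bounds[OF i] in \<open>auto intro!: continuous_intros\<close>)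
      ultimately show "bvec (dim_f p i) n (ceta y t i) \<bullet> ((1\<^sub>m (dim_f p i) \<otimes>\<^sub>k Q i) *\<^sub>v bvec (dim_f p i) n (ceta y t i))
        \<le> qint i (Q i) (\<lambda>_. 1) (shifted y t) (shifted y t) + qint i (R i) (\<lambda>\<tau>. \<tau> + delay p i) (shifted y t) (shifted y t)
        + \<epsilon> * qint i (1\<^sub>m n) (\<lambda>\<tau>. \<tau> + (rmax p + 1)) (shifted y t) (shifted y t)"
        using mult_nonneg_nonneg[OF \<epsilon>] by (smt (verit))
    qed
    show ?thesis
      using 1 2 unfolding lyap_shifted \<eta>_def[symmetric] bform_eq[OF PC(1) v(1,1)] bform_eq[OF P2 v] bform_eq[OF PC(2) v(2,2)] by linarith
  qed
  then show ?thesis using c(1) by blast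
qed

text \<open>Bessel's inequality for \<open>vF\<close> with the identity as weight.\<close>

lemma eta_at_square_le:
  assumes y: "cont y"
  shows "eta_at y t \<bullet> eta_at y t \<le> (\<Sum>i = 1..\<nu>. energy y t i)"
proof -
  have "eta_at y t \<bullet> eta_at y t = (\<Sum>i = 1..\<nu>. bvec (dim_f p i) n (ceta y t i) \<bullet> bvec (dim_f p i) n (ceta y t i))"
    unfolding eta_at_def by (subst scalar_prod_stack_vec) (simp_all add: sum_list_idx)
  also have "\<dots> \<le> (\<Sum>i = 1..\<nu>. energy y t i)"
  proof (rule sum_mono)
    fix i assume "i \<in> {1..\<nu>}"
    then have i: "i \<in> set (idx p)" by (simp add: idx_iff)
    have "0 \<le> x \<bullet> (1\<^sub>m n *\<^sub>v x)" if "x \<in> carrier_vec n" for x :: "real vec" using that by simp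
    then show "bvec (dim_f p i) n (ceta y t i) \<bullet> bvec (dim_f p i) n (ceta y t i) \<le> energy y t i"
      using bessel_F[OF y i one_carrier_mat, of t] unfolding energy_one[OF y] one_kron_one_mult_bvec by blast
  qed
  finally show ?thesis .
qed

text \<open>The decay estimate is in terms of |y(t)|^2 and the energies, so the functional has to be
  compared with the same two quantities; \<eta> is controlled by the energies.\<close>

lemma lyap_upper:
  assumes \<epsilon>: "0 \<le> \<epsilon>"
  shows "\<exists>C>0. \<forall>y t. cont y \<longrightarrow> lyap \<epsilon> (shifted y t) (shifted y t) \<le> C * (y t \<bullet> y t + (\<Sum>i = 1..\<nu>. energy y t i))"
proof -
  note PC = sym_mat_carrier[OF P1] sym_mat_carrier[OF P3]
  obtain A1 where A1: "0 \<le> A1" "\<And>u v. u \<in> carrier_vec n \<Longrightarrow> v \<in> carrier_vec n \<Longrightarrow> u \<bullet> (P1 *\<^sub>v v) \<le> A1 * (u \<bullet> u + v \<bullet> v)"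
    using bilinear_form_bound[OF PC(1)] by blast
  obtain A2 where A2: "0 \<le> A2" "\<And>u v. u \<in> carrier_vec n \<Longrightarrow> v \<in> carrier_vec dn \<Longrightarrow> u \<bullet> (P2 *\<^sub>v v) \<le> A2 * (u \<bullet> u + v \<bullet> v)"
    using bilinear_form_bound[OF P2] by blast
  obtain A3 where A3: "0 \<le> A3" "\<And>u v. u \<in> carrier_vec dn \<Longrightarrow> v \<in> carrier_vec dn \<Longrightarrow> u \<bullet> (P3 *\<^sub>v v) \<le> A3 * (u \<bullet> u + v \<bullet> v)"
    using bilinear_form_bound[OF PC(2)] by blast
  have "\<forall>i\<in>{1..\<nu>}. \<exists>C\<ge>0. \<forall>y t. cont y \<longrightarrow> qint i (Q i) (\<lambda>_. 1) (shifted y t) (shifted y t) + qint i (R i) (\<lambda>\<tau>. \<tau> + delay p i) (shifted y t) (shifted y t)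
        + \<epsilon> * qint i (1\<^sub>m n) (\<lambda>\<tau>. \<tau> + (rmax p + 1)) (shifted y t) (shifted y t) \<le> C * energy y t i" (is "\<forall>i\<in>_. \<exists>C\<ge>0. \<forall>y t. _ \<longrightarrow> ?V i y t \<le> _")
  proof
    fix i assume "i \<in> {1..\<nu>}"
    then have i: "i \<in> set (idx p)" by (simp add: idx_iff)
    have "\<exists>C\<ge>0. \<forall>y t. cont y \<longrightarrow> qint i (Q i) (\<lambda>_. 1) (shifted y t) (shifted y t) \<le> C * energy y t i"
      by (rule qint_upper[OF QR_carrier(1)[OF i], where B = 1]) simp_all
    then obtain C1 where C1: "0 \<le> C1" "\<And>y t. cont y \<Longrightarrow> qint i (Q i) (\<lambda>_. 1) (shifted y t) (shifted y t) \<le> C1 * energy y t i"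
      by blast
    have "\<exists>C\<ge>0. \<forall>y t. cont y \<longrightarrow> qint i (R i) (\<lambda>\<tau>. \<tau> + delay p i) (shifted y t) (shifted y t) \<le> C * energy y t i"
      by (rule qint_upper[OF QR_carrier(2)[OF i], where B = "rmax p + 1"])
        (use weight_bounds[OF i] rmax_nonneg in \<open>auto intro!: continuous_intros\<close>)
    then obtain C2 where C2: "0 \<le> C2" "\<And>y t. cont y \<Longrightarrow> qint i (R i) (\<lambda>\<tau>. \<tau> + delay p i) (shifted y t) (shifted y t) \<le> C2 * energy y t i"
      by blast
    have "\<exists>C\<ge>0. \<forall>y t. cont y \<longrightarrow> qint i (1\<^sub>m n) (\<lambda>\<tau>. \<tau> + (rmax p + 1)) (shifted y t) (shifted y t) \<le> C * energy y t i"
      by (rule qint_upper[OF one_carrier_mat, where B = "rmax p + 1"])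
        (use weight_bounds[OF i] rmax_nonneg in \<open>auto intro!: continuous_intros\<close>)
    then obtain C3 where C3: "0 \<le> C3" "\<And>y t. cont y \<Longrightarrow> qint i (1\<^sub>m n) (\<lambda>\<tau>. \<tau> + (rmax p + 1)) (shifted y t) (shifted y t) \<le> C3 * energy y t i"
      by blast
    have "?V i y t \<le> (C1 + C2 + \<epsilon> * C3) * energy y t i" if "cont y" for y t
      using C1(2)[OF that, of t] C2(2)[OF that, of t] mult_left_mono[OF C3(2)[OF that, of t] \<epsilon>] by (simp add: algebra_simps)
    then show "\<exists>C\<ge>0. \<forall>y t. cont y \<longrightarrow> ?V i y t \<le> C * energy y t i" 
      using C1(1) C2(1) C3(1) \<epsilon> by (intro exI[of _ "C1 + C2 + \<epsilon> * C3"]) simp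
  qed
  then obtain C where C: "\<And>i. i \<in> {1..\<nu>} \<Longrightarrow> 0 \<le> C i" "\<And>i y t. i \<in> {1..\<nu>} \<Longrightarrow> cont y \<Longrightarrow> ?V i y t \<le> C i * energy y t i"
    unfolding Bex_def bchoice_iff by (elim exE) blast
  define B where "B = 2 * A1 + 2 * A2 + 2 * A3 + (\<Sum>i = 1..\<nu>. C i) + 1"
  have S: "0 \<le> (\<Sum>i = 1..\<nu>. C i)" by (rule sum_nonneg) (use C(1) in auto)
  have "lyap \<epsilon> (shifted y t) (shifted y t) \<le> B * (y t \<bullet> y t + (\<Sum>i = 1..\<nu>. energy y t i))" if y: "cont y" for y t
  proof -
    let ?E = "\<Sum>i = 1..\<nu>. energy y t i" and ?h = "eta_at y t" and ?u = "y t"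
    have v: "y t \<in> carrier_vec n" "?h \<in> carrier_vec dn" using cont_carrier[OF y] eta_at_carrier by auto
    have E: "0 \<le> ?E" by (rule sum_nonneg) (rule energy_nonneg)
    have u: "0 \<le> ?u \<bullet> ?u" by (rule scalar_prod_self_nonneg)
    have h: "?h \<bullet> ?h \<le> ?E" by (rule eta_at_square_le[OF y])
    have 1: "?u \<bullet> (P1 *\<^sub>v ?u) \<le> 2 * A1 * (?u \<bullet> ?u + ?E)"
      using A1(2)[OF v(1,1)] mult_nonneg_nonneg[OF A1(1) E] by (simp add: algebra_simps)
    have 2: "2 * (?u \<bullet> (P2 *\<^sub>v ?h)) \<le> 2 * A2 * (?u \<bullet> ?u + ?E)"
      using A2(2)[OF v] mult_left_mono[OF h A2(1)] by (simp add: algebra_simps)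
    have 3: "?h \<bullet> (P3 *\<^sub>v ?h) \<le> 2 * A3 * (?u \<bullet> ?u + ?E)"
      using A3(2)[OF v(2,2)] mult_left_mono[OF h A3(1)] mult_nonneg_nonneg[OF A3(1) u] by (simp add: algebra_simps)
    have "(\<Sum>i = 1..\<nu>. ?V i y t) \<le> (\<Sum>i = 1..\<nu>. C i * ?E)"
    proof (rule sum_mono)
      fix i assume i: "i \<in> {1..\<nu>}"
      have "energy y t i \<le> ?E" by (rule member_le_sum[OF i]) (auto simp: energy_nonneg)
      then show "?V i y t \<le> C i * ?E" using C(2)[OF i y, of t] mult_left_mono[OF _ C(1)[OF i]] by fastforce
    qed
    also have "\<dots> = (\<Sum>i = 1..\<nu>. C i) * ?E" by (rule sum_distrib_right[symmetric])
    also have "\<dots> \<le> (\<Sum>i = 1..\<nu>. C i) * (?u \<bullet> ?u + ?E)" by (rule mult_left_mono) (use u S in auto)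
    finally have 4: "(\<Sum>i = 1..\<nu>. ?V i y t) \<le> (\<Sum>i = 1..\<nu>. C i) * (?u \<bullet> ?u + ?E)" .
    have "B * (?u \<bullet> ?u + ?E) = 2 * A1 * (?u \<bullet> ?u + ?E) + 2 * A2 * (?u \<bullet> ?u + ?E) + 2 * A3 * (?u \<bullet> ?u + ?E)
       + (\<Sum>i = 1..\<nu>. C i) * (?u \<bullet> ?u + ?E) + (?u \<bullet> ?u + ?E)"
      unfolding B_def distrib_right by simp
    then show ?thesis
      using 1 2 3 4 E u unfolding lyap_shifted bform_eq[OF PC(1) v(1,1)] bform_eq[OF P2 v] bform_eq[OF PC(2) v(2,2)] by linarith
  qed
  moreover have "B > 0" using A1(1) A2(1) A3(1) S unfolding B_def by linarith
  ultimately show ?thesis by blast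
qed

end

section \<open>Solutions, dissipativity and exponential stability\<close>

lemma absolutely_continuous_cong:
  assumes eq: "\<And>x. a \<le> x \<Longrightarrow> x \<le> b \<Longrightarrow> f x = g x" and f: "absolutely_continuous_between a b f"
  shows "absolutely_continuous_between a b g"
  unfolding absolutely_continuous_between_def
proof (intro allI impI)
  fix \<epsilon> :: real assume "0 < \<epsilon>"
  then obtain \<delta> where \<delta>: "0 < \<delta>"
    "\<And>(M::nat) x y. (\<And>k. k < M \<Longrightarrow> a \<le> x k \<and> x k \<le> y k \<and> y k \<le> b) \<Longrightarrow>
      disjoint_family_on (\<lambda>k. {x k<..<y k}) {..<M} \<Longrightarrow> (\<Sum>k<M. y k - x k) < \<delta> \<Longrightarrow>
      (\<Sum>k<M. \<bar>f (y k) - f (x k)\<bar>) < \<epsilon>"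
    using absolutely_continuous_betweenD[OF f] by blast
  have "(\<Sum>k<M. \<bar>g (y k) - g (x k)\<bar>) < \<epsilon>"
    if h: "\<And>k. k < M \<Longrightarrow> a \<le> x k \<and> x k \<le> y k \<and> y k \<le> b"
      "disjoint_family_on (\<lambda>k. {x k<..<y k}) {..<M}" "(\<Sum>k<M. y k - x k) < \<delta>" for M :: nat and x y
  proof -
    have "(\<Sum>k<M. \<bar>g (y k) - g (x k)\<bar>) = (\<Sum>k<M. \<bar>f (y k) - f (x k)\<bar>)"
    proof (rule sum.cong[OF refl])
      fix k assume "k \<in> {..<M}"
      then have "a \<le> x k" "x k \<le> b" "a \<le> y k" "y k \<le> b" using h(1)[of k] by auto
      then show "\<bar>g (y k) - g (x k)\<bar> = \<bar>f (y k) - f (x k)\<bar>" by (simp add: eq)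
    qed
    then show ?thesis using \<delta>(2)[OF h] by simp
  qed
  then show "\<exists>\<delta>>0. \<forall>(M::nat) x y. (\<forall>k<M. a \<le> x k \<and> x k \<le> y k \<and> y k \<le> b) \<and>
      disjoint_family_on (\<lambda>k. {x k<..<y k}) {..<M} \<and> (\<Sum>k<M. y k - x k) < \<delta> \<longrightarrow>
      (\<Sum>k<M. \<bar>g (y k) - g (x k)\<bar>) < \<epsilon>"
    using \<delta>(1) by (intro exI[of _ \<delta>]) blast
qed

text \<open>The inequality 1 - exp(-s) <= s gives the Lipschitz constant \<gamma> exp(\<gamma> (b -
  c)) on the interval.\<close>

lemma absolutely_continuous_exp:
  assumes "0 \<le> \<gamma>"
  shows "absolutely_continuous_between a b (\<lambda>t. exp (\<gamma> * (t - c)) :: real)"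
proof (rule absolutely_continuous_lipschitz)
  fix x y :: real assume xy: "a \<le> x" "x \<le> y" "y \<le> b"
  have g: "\<gamma> * (x - c) \<le> \<gamma> * (y - c)" "\<gamma> * (y - c) \<le> \<gamma> * (b - c)"
    using xy assms by (simp_all add: mult_left_mono)
  have e: "exp (\<gamma> * (x - c)) = exp (\<gamma> * (y - c)) * exp (\<gamma> * (x - y))"
    by (simp add: exp_add[symmetric] algebra_simps)
  have "exp (\<gamma> * (y - c)) - exp (\<gamma> * (x - c)) = exp (\<gamma> * (y - c)) * (1 - exp (\<gamma> * (x - y)))"
    unfolding e by (simp add: algebra_simps)
  also have "\<dots> \<le> exp (\<gamma> * (y - c)) * (\<gamma> * (y - x))"
    using exp_ge_add_one_self[of "\<gamma> * (x - y)"] by (intro mult_left_mono) (simp_all add: algebra_simps)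
  also have "\<dots> \<le> exp (\<gamma> * (b - c)) * (\<gamma> * (y - x))"
    using g xy assms by (intro mult_right_mono) simp_all
  finally show "\<bar>exp (\<gamma> * (y - c)) - exp (\<gamma> * (x - c))\<bar> \<le> (exp (\<gamma> * (b - c)) * \<gamma>) * (y - x)"
    using g by (simp add: mult.assoc)
qed

context lmi begin

text \<open>Before t0 - r a solution is unconstrained. Freezing it at its value there yields a
  function continuous on the whole line, as the window lemmas require.\<close>

definition extended :: "real \<Rightarrow> (real \<Rightarrow> real vec) \<Rightarrow> real \<Rightarrow> real vec" where
  "extended t0 e = (\<lambda>a. e (max a (t0 - rmax p)))"

lemma extended_eq: "t0 - rmax p \<le> a \<Longrightarrow> extended t0 e a = e a"
  by (simp add: extended_def max_def)

context
  fixes t0 \<psi> w e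
  assumes \<psi>: "\<psi> \<in> C_space (rmax p) n" and sol: "error_solution p L Lh t0 \<psi> w e"
begin

text \<open>Three closed pieces are glued: the constant, the initial function and the absolutely
  continuous solution. They overlap in t0 - r and in t0.\<close>

lemma solution_cont: "cont (extended t0 e)"
  unfolding cont_def
proof (intro conjI allI impI)
  fix a show "extended t0 e a \<in> carrier_vec n"
    using sol by (auto simp: error_solution_def extended_def)
next
  fix j assume j: "j < n"
  let ?y = "\<lambda>a. extended t0 e a $ j" and ?a = "t0 - rmax p"
  have 1: "continuous_on {..?a} ?y"
    by (rule continuous_on_eq[OF continuous_on_const[of _ "e ?a $ j"]]) (simp add: extended_def max_def)
  have 2: "continuous_on {?a..t0} ?y"
  proof (rule continuous_on_eq)
    show "continuous_on {?a..t0} (\<lambda>a. \<psi> (a - t0) $ j)"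
      by (rule continuous_on_compose2[OF C_spaceD(2)[OF \<psi> j]]) (auto intro!: continuous_intros)
    fix a assume a: "a \<in> {?a..t0}"
    then have "a - t0 \<in> {- rmax p..0}" by auto
    then have "e (t0 + (a - t0)) = \<psi> (a - t0)" using sol unfolding error_solution_def by blast
    then show "\<psi> (a - t0) $ j = ?y a" using a by (simp add: extended_eq)
  qed
  have 3: "continuous_on {t0..T} ?y" if "t0 < T" for T
  proof (rule continuous_on_eq)
    show "continuous_on {t0..T} (\<lambda>a. e a $ j)"
      using sol that j unfolding error_solution_def by (blast intro: absolutely_continuous_imp_continuous)
  qed (use rmax_nonneg in \<open>simp add: extended_eq\<close>)
  have "continuous_on (({..?a} \<union> {?a..t0}) \<union> {t0..T}) ?y" if "t0 < T" for T
    by (intro continuous_on_closed_Un 1 2 3 that) auto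
  \<comment> \<open>Absolute continuity is given on bounded intervals, so the line is exhausted by
    open half-lines.\<close>
  then have "continuous_on {..<T} ?y" if "t0 < T" for T
    by (rule continuous_on_subset) (use that in auto)
  then have "continuous_on (\<Union>T\<in>{t0<..}. {..<T}) ?y"
    by (intro continuous_on_open_UN) auto
  moreover have "x \<in> (\<Union>T\<in>{t0<..}. {..<T})" for x
    by (rule UN_I[of "max x t0 + 1"]) auto
  ultimately show "continuous_on UNIV ?y" by (metis UNIV_eq_I)
qed

lemma solution_absolutely_continuous:
  assumes "t0 < T" "j < n"
  shows "absolutely_continuous_between t0 T (\<lambda>t. extended t0 e t $ j)"
proof -
  have "absolutely_continuous_between t0 T (\<lambda>t. e t $ j)" using sol assms by (simp add: error_solution_def)
  then show ?thesis by (rule absolutely_continuous_cong[rotated]) (use rmax_nonneg in \<open>simp add: extended_eq\<close>)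
qed

lemma lyap_segment:
  assumes "t0 \<le> t"
  shows "lyap \<epsilon> (segment (rmax p) e t) (segment (rmax p) e t) = lyap \<epsilon> (shifted (extended t0 e) t) (shifted (extended t0 e) t)"
  by (rule lyap_cong) (use assms in \<open>simp add: segment_def extended_eq\<close>)

lemma lyap_initial: "lyap \<epsilon> (shifted (extended t0 e) t0) (shifted (extended t0 e) t0) = lyap \<epsilon> \<psi> \<psi>"
  by (rule lyap_cong) (use sol in \<open>simp add: error_solution_def extended_eq\<close>)

lemma theta_vec_eq:
  assumes t: "t0 \<le> t"
  shows "theta_vec p e w t = theta_at (extended t0 e) (w t) t"
proof -
  have e: "e (t + \<tau>) = extended t0 e (t + \<tau>)" if "- rmax p \<le> \<tau>" for \<tau> using that t by (simp add: extended_eq)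
  have d: "e (t - delay p i) = extended t0 e (t - delay p i)" if "i \<in> set (idx p)" for i
    using e[of "- delay p i"] delay_bounds[of i] that by (simp add: idx_iff)
  have "xi_vec p e t = stack_vec (map (\<lambda>i. bvec (vk p i) n (cx (extended t0 e) t i)) (idx p))"
    "a_vec p e t = stack_vec (map (\<lambda>i. bvec (dim_phi p i) n (ca (extended t0 e) t i)) (idx p))"
    by (rule xi_vec_eq[OF _ solution_cont]; use e ival_subset in force)+
  moreover have "map (\<lambda>i. e (t - delay p i)) (idx p) = map (\<lambda>i. extended t0 e (t - delay p i)) (idx p)"
    using d by simp
  moreover have "e t = extended t0 e t" using e[of 0] rmax_nonneg by simp
  ultimately show ?thesis unfolding theta_vec_def stack_theta theta_at_def by (simp only:)
qed

lemma zeta_eq: "t0 \<le> t \<Longrightarrow> zeta p K Kh e w t = Sig p K Kh *\<^sub>v theta_at (extended t0 e) (w t) t"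
  by (simp add: zeta_def Sig_def theta_vec_eq)

lemma theta_at_carrier:
  assumes y: "cont y" and w: "v \<in> carrier_vec q"
  shows "theta_at y v t \<in> carrier_vec N"
proof -
  have "stack_vec (map (\<lambda>i. y (t - delay p i)) (idx p)) \<in> carrier_vec (\<nu> * n)"
    unfolding sum_const_n[symmetric] by (rule stack_idx_carrier) (rule cont_carrier[OF y])
  moreover have "stack_vec (map (\<lambda>i. bvec (vk p i) n (cx y t i)) (idx p)) \<in> carrier_vec (vk_sum p * n)"
    unfolding vk_sum_mult by (rule stack_idx_carrier) simp
  moreover have "stack_vec (map (\<lambda>i. bvec (dim_phi p i) n (ca y t i)) (idx p)) \<in> carrier_vec (mu_sum p * n)"
    unfolding mu_sum_mult by (rule stack_idx_carrier) simp
  moreover have "N = n + (\<nu> * n + (vk_sum p * n + (mu_sum p * n + q)))" by (simp add: beta_n)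
  ultimately show ?thesis
    unfolding theta_at_def using cont_carrier[OF y] w by (simp only: append_carrier_vec)
qed

text \<open>Stated for t > t0, where e and its extension agree on an open neighbourhood.\<close>

lemma solution_derivative:
  "AE t in lebesgue. t0 < t \<and> w t \<in> carrier_vec q \<longrightarrow>
     vderiv n (extended t0 e) (rhs_mat *\<^sub>v theta_at (extended t0 e) (w t) t) t"
proof -
  have "AE t in lebesgue. t0 \<le> t \<longrightarrow>
        (\<forall>j<n. ((\<lambda>s. e s $ j) has_real_derivative error_rhs p L Lh e w t $ j) (at t))"
    using sol unfolding error_solution_def by blast
  then show ?thesis
  proof (rule AE_mp, intro AE_I2 impI)
    fix t assume d: "t0 \<le> t \<longrightarrow> (\<forall>j<n. ((\<lambda>s. e s $ j) has_real_derivative error_rhs p L Lh e w t $ j) (at t))"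
      and t: "t0 < t \<and> w t \<in> carrier_vec q"
    have r: "error_rhs p L Lh e w t = rhs_mat *\<^sub>v theta_at (extended t0 e) (w t) t"
      using t by (simp add: error_rhs_def rhs_mat_def theta_vec_eq)
    have "((\<lambda>s. extended t0 e s $ j) has_real_derivative error_rhs p L Lh e w t $ j) (at t)" if "j < n" for j
    proof (rule has_field_derivative_transform_within_open[where S = "{t0<..}"])
      show "((\<lambda>s. e s $ j) has_real_derivative error_rhs p L Lh e w t $ j) (at t)" using d t that by simp
    qed (use t rmax_nonneg in \<open>auto simp: extended_eq\<close>)
    then show "vderiv n (extended t0 e) (rhs_mat *\<^sub>v theta_at (extended t0 e) (w t) t) t"
      unfolding vderiv_def r
      using cont_carrier[OF solution_cont] mult_mat_vec_carrier[OF rhs_mat_carrier theta_at_carrier[OF solution_cont]] t by blast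
  qed
qed

end

lemma dissipative_error: "dissipative p s L Lh K Kh"
  unfolding dissipative_def
proof (intro exI conjI allI impI; (elim conjE)?)
  \<comment> \<open>Dissipativity is shown with the unperturbed functional, \<epsilon> = 0.\<close>
  show "differentiable_functional (rmax p) n (\<lambda>\<phi>. lyap 0 \<phi> \<phi>)"
    by (rule bilinear_fnl_differentiable[OF lyap_bilinear rmax_nonneg])
  fix t0 w \<psi> e
  assume w: "L2_on {t0..} q w" and \<psi>: "\<psi> \<in> C_space (rmax p) n" and sol: "error_solution p L Lh t0 \<psi> w e"
  let ?y = "extended t0 e" and ?V = "\<lambda>u. lyap 0 (segment (rmax p) e u) (segment (rmax p) e u)"
  note y = solution_cont[OF \<psi> sol]
  have wc: "w t \<in> carrier_vec q" if "t0 \<le> t" for t using w that by (simp add: L2_on_def)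
  obtain c where c: "c > 0" "\<And>y w t. cont y \<Longrightarrow> w \<in> carrier_vec q \<Longrightarrow> vderiv n y (rhs_mat *\<^sub>v theta_at y w t) t \<Longrightarrow>
     (\<exists>D. ((\<lambda>t. lyap 0 (shifted y t) (shifted y t)) has_real_derivative D) (at t) \<and>
       D - supply_rate s (Sig p K Kh *\<^sub>v theta_at y w t) w \<le> - (c - 0 * (rmax p + 1)) * (y t \<bullet> y t) - 0 * (\<Sum>i = 1..\<nu>. energy y t i))"
    using lyap_decay by (meson order_refl)
  \<comment> \<open>Dissipativity speaks of t >= t0, the derivative of the extended solution is
    available for t > t0.\<close>
  have "AE t in lebesgue. t \<noteq> t0" by (rule AE_completion[OF AE_lborel_singleton])
  with solution_derivative[OF \<psi> sol]
  show "AE t in lebesgue. t0 \<le> t \<longrightarrow>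
      (\<exists>D. (?V has_real_derivative D) (at t) \<and> D - supply_rate s (zeta p K Kh e w t) (w t) \<le> 0)"
  proof (eventually_elim, intro impI)
    fix t assume d: "t0 < t \<and> w t \<in> carrier_vec q \<longrightarrow> vderiv n ?y (rhs_mat *\<^sub>v theta_at ?y (w t) t) t"
      and t: "t \<noteq> t0" "t0 \<le> t"
    have t': "t0 < t" using t by simp
    obtain D where D: "((\<lambda>t. lyap 0 (shifted ?y t) (shifted ?y t)) has_real_derivative D) (at t)"
      "D - supply_rate s (Sig p K Kh *\<^sub>v theta_at ?y (w t) t) (w t) \<le> - c * (?y t \<bullet> ?y t)"
      using c(2)[OF y wc[OF t(2)]] d t' wc[OF t(2)] by auto
    have "(?V has_real_derivative D) (at t)"
      by (rule has_field_derivative_transform_within_open[OF D(1), where S = "{t0<..}"])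
        (use t' lyap_segment[OF \<psi> sol] in auto)
    moreover have "0 \<le> c * (?y t \<bullet> ?y t)" using c(1) by simp
    ultimately show "\<exists>D. (?V has_real_derivative D) (at t) \<and> D - supply_rate s (zeta p K Kh e w t) (w t) \<le> 0"
      using D(2) unfolding zeta_eq[OF \<psi> sol t(2)] by (intro exI[of _ D]) linarith
  qed
qed

text \<open>The functional lies above a |e(t)|^2 at every time and starts below B |\<psi>|^2. All
  constants come from the plant and the unknown matrices, so they are uniform in t0 and
  \<psi>.\<close>

lemma exponentially_stable_error: "exponentially_stable p L Lh"
proof -
  obtain c where c: "c > 0" "\<And>\<epsilon> y w t. 0 \<le> \<epsilon> \<Longrightarrow> cont y \<Longrightarrow> w \<in> carrier_vec q \<Longrightarrow> vderiv n y (rhs_mat *\<^sub>v theta_at y w t) t \<Longrightarrow>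
     (\<exists>D. ((\<lambda>t. lyap \<epsilon> (shifted y t) (shifted y t)) has_real_derivative D) (at t) \<and>
       D - supply_rate s (Sig p K Kh *\<^sub>v theta_at y w t) w \<le> - (c - \<epsilon> * (rmax p + 1)) * (y t \<bullet> y t) - \<epsilon> * (\<Sum>i = 1..\<nu>. energy y t i))"
    using lyap_decay by meson
  \<comment> \<open>Spends half of the margin c on the boundary terms of the weighted
    integral.\<close>
  define \<epsilon> where "\<epsilon> = c / (2 * (rmax p + 1))"
  have \<epsilon>: "0 < \<epsilon>" "\<epsilon> * (rmax p + 1) = c / 2" using c(1) rmax_nonneg by (simp_all add: \<epsilon>_def field_simps)
  obtain a where a: "a > 0" "\<And>y t. cont y \<Longrightarrow> a * (y t \<bullet> y t) \<le> lyap \<epsilon> (shifted y t) (shifted y t)"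
    using lyap_lower \<epsilon>(1) by (meson less_imp_le)
  obtain C where C: "C > 0" "\<And>y t. cont y \<Longrightarrow> lyap \<epsilon> (shifted y t) (shifted y t) \<le> C * (y t \<bullet> y t + (\<Sum>i = 1..\<nu>. energy y t i))"
    using lyap_upper[OF less_imp_le[OF \<epsilon>(1)]] by blast
  obtain B where B: "0 \<le> B" "\<And>\<phi>. \<phi> \<in> C_space (rmax p) n \<Longrightarrow> \<bar>lyap \<epsilon> \<phi> \<phi>\<bar> \<le> B * C_norm (rmax p) \<phi> * C_norm (rmax p) \<phi>"
    using lyap_bilinear[of \<epsilon>] unfolding bilinear_fnl_def by blast
  \<comment> \<open>The smaller of the two decay coefficients, that of |y(t)|^2 and that of the
    energies; with \<gamma> = k / C it follows that V' <= -\<gamma> V.\<close>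
  define k where "k = min (c / 2) \<epsilon>"
  have k: "0 < k" "k \<le> c / 2" "k \<le> \<epsilon>" using c(1) \<epsilon>(1) by (auto simp: k_def)
  define \<gamma> where "\<gamma> = k / C"
  have \<gamma>: "0 < \<gamma>" "\<gamma> * C = k" using k(1) C(1) by (simp_all add: \<gamma>_def)
  \<comment> \<open>The square root of B / a converts the quadratic bounds into one for the norm;
    adding 1 keeps b positive when B = 0.\<close>
  define b where "b = sqrt (B / a) + 1"
  have b: "b > 0" "B / a \<le> b\<^sup>2"
  proof -
    have "0 \<le> B / a" using B(1) a(1) by simp
    then have q: "0 \<le> sqrt (B / a)" "(sqrt (B / a))\<^sup>2 = B / a" by (rule real_sqrt_ge_zero, rule real_sqrt_pow2)
    show "b > 0" using q(1) unfolding b_def by linarith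
    show "B / a \<le> b\<^sup>2" using q(1) unfolding b_def power2_sum q(2) by simp
  qed
  have main: "vnorm (e t) \<le> b * exp (- (\<gamma> / 2) * (t - t0)) * C_norm (rmax p) \<psi>"
    if \<psi>: "\<psi> \<in> C_space (rmax p) n" and sol: "error_solution p L Lh t0 \<psi> (\<lambda>t. 0\<^sub>v q) e" and t: "t0 \<le> t" for t0 \<psi> e t
  proof -
    define y where "y = extended t0 e"
    define V where "V = (\<lambda>t. lyap \<epsilon> (shifted y t) (shifted y t))"
    \<comment> \<open>V' + \<gamma> V <= 0 almost everywhere means that G has nonpositive derivative
      there, and absolute continuity makes G nonincreasing.\<close>
    define G where "G = (\<lambda>t. exp (\<gamma> * (t - t0)) * V t)"
    note y = solution_cont[OF \<psi> sol, folded y_def]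
    have V0: "V t0 \<le> B * C_norm (rmax p) \<psi> * C_norm (rmax p) \<psi>"
      using B(2)[OF \<psi>] lyap_initial[OF \<psi> sol, of \<epsilon>] unfolding V_def y_def by linarith
    have "G t \<le> G t0"
    proof (cases "t = t0")
      case False
      then have t': "t0 < t" using t by simp
      show ?thesis
      proof (rule absolutely_continuous_nonincreasing[OF _ t])
        show "absolutely_continuous_between t0 t G"
          unfolding G_def V_def
          by (intro absolutely_continuous_mult absolutely_continuous_exp lyap_absolutely_continuous[OF y])
            (use \<gamma>(1) solution_absolutely_continuous[OF \<psi> sol t', folded y_def] in auto)
        show "AE u in lebesgue. t0 < u \<and> u < t \<longrightarrow> (\<exists>D\<le>0. (G has_real_derivative D) (at u))"
          using solution_derivative[OF \<psi> sol, folded y_def]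
        proof (eventually_elim, intro impI)
          fix u assume d: "t0 < u \<and> 0\<^sub>v q \<in> carrier_vec q \<longrightarrow> vderiv n y (rhs_mat *\<^sub>v theta_at y (0\<^sub>v q) u) u"
            and u: "t0 < u \<and> u < t"
          have d': "vderiv n y (rhs_mat *\<^sub>v theta_at y (0\<^sub>v q) u) u" using d u by simp
          let ?E = "\<Sum>i = 1..\<nu>. energy y u i"
          obtain D where D: "(V has_real_derivative D) (at u)"
            "D - supply_rate s (Sig p K Kh *\<^sub>v theta_at y (0\<^sub>v q) u) (0\<^sub>v q) \<le> - (c / 2) * (y u \<bullet> y u) - \<epsilon> * ?E"
            using c(2)[OF less_imp_le[OF \<epsilon>(1)] y zero_carrier_vec d'] unfolding V_def \<epsilon>(2) by auto
          have S: "supply_rate s (Sig p K Kh *\<^sub>v theta_at y (0\<^sub>v q) u) (0\<^sub>v q) \<le> 0"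
            by (rule supply_rate_zero[OF mult_mat_vec_carrier[OF Sig_carrier theta_at_carrier[OF \<psi> sol y zero_carrier_vec]]])
          have E: "0 \<le> ?E" by (rule sum_nonneg) (rule energy_nonneg)
          have "\<gamma> * V u \<le> \<gamma> * (C * (y u \<bullet> y u + ?E))"
            unfolding V_def by (rule mult_left_mono[OF C(2)[OF y]]) (use \<gamma>(1) in simp)
          also have "\<dots> = k * (y u \<bullet> y u) + k * ?E" unfolding \<gamma>(2)[symmetric] by (simp add: algebra_simps)
          also have "\<dots> \<le> (c / 2) * (y u \<bullet> y u) + \<epsilon> * ?E"
            by (intro add_mono mult_right_mono k E scalar_prod_self_nonneg)
          finally have VD: "\<gamma> * V u + D \<le> 0" using D(2) S by linarith
          have "(G has_real_derivative exp (\<gamma> * (u - t0)) * \<gamma> * V u + D * exp (\<gamma> * (u - t0))) (at u)"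
            unfolding G_def by (rule DERIV_mult[OF _ D(1)]) (auto intro!: derivative_eq_intros)
          moreover have "exp (\<gamma> * (u - t0)) * \<gamma> * V u + D * exp (\<gamma> * (u - t0)) = exp (\<gamma> * (u - t0)) * (\<gamma> * V u + D)"
            by (simp add: algebra_simps)
          moreover have "exp (\<gamma> * (u - t0)) * (\<gamma> * V u + D) \<le> 0" by (rule mult_nonneg_nonpos[OF _ VD]) simp
          ultimately show "\<exists>D\<le>0. (G has_real_derivative D) (at u)" by auto
        qed
      qed
    qed simp
    then have "exp (\<gamma> * (t - t0)) * V t \<le> V t0" by (simp add: G_def)
    then have "V t \<le> exp (- \<gamma> * (t - t0)) * V t0"
      using mult_left_mono[of _ _ "exp (- \<gamma> * (t - t0))"] by (fastforce simp: mult.assoc[symmetric] exp_add[symmetric])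
    also have "\<dots> \<le> exp (- \<gamma> * (t - t0)) * (B * C_norm (rmax p) \<psi> * C_norm (rmax p) \<psi>)"
      by (rule mult_left_mono[OF V0]) simp
    finally have "a * (y t \<bullet> y t) \<le> exp (- \<gamma> * (t - t0)) * (B * C_norm (rmax p) \<psi> * C_norm (rmax p) \<psi>)"
      using a(2)[OF y, of t] unfolding V_def by linarith
    then have "y t \<bullet> y t \<le> (B / a) * (exp (- \<gamma> * (t - t0)) * (C_norm (rmax p) \<psi>)\<^sup>2)"
      using a(1) by (simp add: field_simps power2_eq_square)
    also have "\<dots> \<le> b\<^sup>2 * (exp (- \<gamma> * (t - t0)) * (C_norm (rmax p) \<psi>)\<^sup>2)"
      by (rule mult_right_mono[OF b(2)]) simp
    \<comment> \<open>The rate is halved because the functional is quadratic in the norm.\<close>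
    also have "\<dots> = (b * exp (- (\<gamma> / 2) * (t - t0)) * C_norm (rmax p) \<psi>)\<^sup>2"
      by (simp add: power_mult_distrib exp_double[symmetric])
    finally have "(vnorm (e t))\<^sup>2 \<le> (b * exp (- (\<gamma> / 2) * (t - t0)) * C_norm (rmax p) \<psi>)\<^sup>2"
      using t rmax_nonneg by (simp add: vnorm_square y_def extended_eq)
    then show ?thesis
      by (rule power2_le_imp_le) (use b(1) C_norm_nonneg[OF \<psi> rmax_nonneg] in simp)
  qed
  show ?thesis
    unfolding exponentially_stable_def
  proof (intro exI conjI allI impI; (elim conjE)?)
    fix t0 \<psi> e t
    assume "\<psi> \<in> C_space (rmax p) n" "error_solution p L Lh t0 \<psi> (\<lambda>t. 0\<^sub>v q) e" "t0 \<le> t"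
    then show "vnorm (e t) \<le> b * exp (- (\<gamma> / 2) * (t - t0)) * C_norm (rmax p) \<psi>" by (rule main)
  qed (use b(1) \<gamma>(1) in simp_all)
qed

end

section \<open>Counting the unknowns\<close>

text \<open>Parametrised by the column b, which has b + 1 admissible rows.\<close>

lemma card_sym_entries: "real (card (sym_entries k)) = real k * (real k + 1) / 2"
  and finite_sym_entries: "finite (sym_entries k)"
proof -
  have eq: "sym_entries k = (\<lambda>(b, a). (a, b)) ` (SIGMA b:{..<k}. {..b})"
    by (auto simp: sym_entries_def)
  have "card (sym_entries k) = card (SIGMA b:{..<k}. {..b})"
    unfolding eq by (rule card_image) (auto simp: inj_on_def)
  also have "\<dots> = (\<Sum>b<k. Suc b)" by simp
  finally have "real (card (sym_entries k)) = (\<Sum>b<k. real b + 1)" by (simp add: add.commute)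
  also have "\<dots> = real k * (real k + 1) / 2" by (induction k) (simp_all add: field_simps)
  finally show "real (card (sym_entries k)) = real k * (real k + 1) / 2" .
  show "finite (sym_entries k)" unfolding eq by auto
qed

lemma rect_entries: "card (rect_entries r c) = r * c" "finite (rect_entries r c)"
  by (simp_all add: rect_entries_def card_cartesian_product)

lemma finite_unknown_entries: "finite (unknown_entries p X)"
  by (cases X) (simp_all add: finite_sym_entries rect_entries)

text \<open>The finitely many labels outside which there are no entries; the count itself ranges
  over an infinite type of labels.\<close>

definition unknown_labels :: "nat \<Rightarrow> unknown_matrix set" where
  "unknown_labels \<nu> = {Unk_P1, Unk_W, Unk_P2, Unk_P3} \<union> (Unk_Q ` {1..\<nu>} \<union> Unk_R ` {1..\<nu>}
     \<union> Unk_U ` {0..\<nu>} \<union> Unk_Uh ` {1..\<nu>} \<union> Unk_K ` {0..\<nu>} \<union> Unk_Kh ` {1..\<nu>})"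

lemma num_unknowns_sum: "num_unknowns p = (\<Sum>X\<in>unknown_labels (ndelays p). card (unknown_entries p X))"
proof -
  have "unknown_entries p X = {}" if "X \<notin> unknown_labels (ndelays p)" for X
    using that by (cases X) (auto simp: unknown_labels_def)
  then have "(SIGMA X:UNIV. unknown_entries p X) = (SIGMA X:unknown_labels (ndelays p). unknown_entries p X)"
    by (auto simp: Sigma_def)
  then show ?thesis
    unfolding num_unknowns_def by (subst card_SigmaI[symmetric]) (simp_all add: unknown_labels_def finite_unknown_entries)
qed

text \<open>P1, W, Q_i and R_i give (2 + 2 \<nu>) n (n + 1) / 2, P2 gives d n^2, P3 gives d n (d n +
  1) / 2, and the gains give \<beta> n l + \<beta> m l. Hence the factor of n^2 contains d, not d /
  2: all of it comes from P2, while the d / 2 in the factor of n comes from P3.\<close>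

lemma num_unknowns_formula:
  "real (num_unknowns p) =
      (0.5 * real (d_sum p) ^ 2 + real (d_sum p) + real (ndelays p) + 1) * real (dim_x p) ^ 2
      + (0.5 * real (d_sum p) + 1 + real (ndelays p) + real (beta p) * real (dim_y p)) * real (dim_x p)
      + real (beta p) * real (dim_z p) * real (dim_y p)"
proof -
  let ?\<nu> = "ndelays p" and ?c = "\<lambda>X. card (unknown_entries p X)"
  have "num_unknowns p = (\<Sum>X\<in>{Unk_P1, Unk_W, Unk_P2, Unk_P3}. ?c X)
      + (((((\<Sum>X\<in>Unk_Q ` {1..?\<nu>}. ?c X) + (\<Sum>X\<in>Unk_R ` {1..?\<nu>}. ?c X)) + (\<Sum>X\<in>Unk_U ` {0..?\<nu>}. ?c X))
      + (\<Sum>X\<in>Unk_Uh ` {1..?\<nu>}. ?c X)) + (\<Sum>X\<in>Unk_K ` {0..?\<nu>}. ?c X) + (\<Sum>X\<in>Unk_Kh ` {1..?\<nu>}. ?c X))"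
    unfolding num_unknowns_sum unknown_labels_def
    by (subst sum.union_disjoint; (auto; fail)?)+
  also have "\<dots> = ?c Unk_P1 + ?c Unk_W + ?c Unk_P2 + ?c Unk_P3
      + (((((\<Sum>i=1..?\<nu>. ?c (Unk_Q i)) + (\<Sum>i=1..?\<nu>. ?c (Unk_R i))) + (\<Sum>i=0..?\<nu>. ?c (Unk_U i)))
      + (\<Sum>i=1..?\<nu>. ?c (Unk_Uh i))) + (\<Sum>i=0..?\<nu>. ?c (Unk_K i)) + (\<Sum>i=1..?\<nu>. ?c (Unk_Kh i)))"
    by (simp add: sum.reindex inj_on_def)
  also have "\<dots> = 2 * card (sym_entries (dim_x p)) + dim_x p * (d_sum p * dim_x p) + card (sym_entries (d_sum p * dim_x p))
      + 2 * ?\<nu> * card (sym_entries (dim_x p)) + (?\<nu> + 1) * (dim_x p * dim_y p) + kp_sum p * (dim_x p * dim_y p)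
      + (?\<nu> + 1) * (dim_z p * dim_y p) + kp_sum p * (dim_z p * dim_y p)"
    by (simp add: rect_entries kp_sum_def sum_distrib_left[symmetric] sum_distrib_right[symmetric] algebra_simps)
  finally have "real (num_unknowns p) = 2 * real (card (sym_entries (dim_x p))) + dim_x p * (d_sum p * dim_x p) + real (card (sym_entries (d_sum p * dim_x p)))
      + 2 * ?\<nu> * real (card (sym_entries (dim_x p))) + (?\<nu> + 1) * (dim_x p * dim_y p) + kp_sum p * (dim_x p * dim_y p)
      + (?\<nu> + 1) * (dim_z p * dim_y p) + kp_sum p * (dim_z p * dim_y p)"
    by simp
  then show ?thesis
    unfolding card_sym_entries by (simp add: beta_def field_simps power2_eq_square)
qed

text \<open>n and all d_i vary while the other dimensions and the number of delays stay fixed; the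
  principal filter asks for one constant valid at every admissible pair. It exists because n >= 1, d
  >= 1 and \<beta> grows only linearly in d.\<close>

lemma num_unknowns_bigo:
  assumes \<nu>: "1 \<le> ndelays p"
  shows "(\<lambda>(n, d). real (num_unknowns (p\<lparr>dim_x := n, dim_f := d\<rparr>)))
      \<in> O[principal {(n, d). n \<ge> 1 \<and> (\<forall>i\<in>{1..ndelays p}. d i \<ge> 1)}](\<lambda>(n, d).
          real (d_sum (p\<lparr>dim_f := d\<rparr>)) ^ 2 * real n ^ 2)"
proof -
  \<comment> \<open>Chosen so that \<beta> = (b - 1) + d, which is at most b d for d >= 1.\<close>
  define b where "b = 2 + real (ndelays p) + real (\<Sum>i = 1..ndelays p. dim_vphi p i + dim_phi p i)"
  \<comment> \<open>The three groups bound the part with n^2, the part with n and the part without n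
    of the count; 2.5 = 0.5 + 1 + 1 and 1.5 = 0.5 + 1 collect the numerical coefficients.\<close>
  define C where "C = (2.5 + real (ndelays p)) + (1.5 + real (ndelays p) + b * real (dim_y p)) + b * real (dim_z p) * real (dim_y p)"
  show ?thesis
  proof (rule bigoI[of _ C])
    have "norm (real (num_unknowns (p\<lparr>dim_x := n, dim_f := d\<rparr>))) \<le> C * norm (real (d_sum (p\<lparr>dim_f := d\<rparr>)) ^ 2 * real n ^ 2)"
      if n: "1 \<le> n" and d: "\<forall>i\<in>{1..ndelays p}. 1 \<le> d i" for n d
    proof -
      let ?p = "p\<lparr>dim_x := n, dim_f := d\<rparr>"
      define s where "s = real (d_sum (p\<lparr>dim_f := d\<rparr>))"
      have dp: "real (d_sum ?p) = s" by (simp add: s_def d_sum_def)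
      have "d 1 \<le> (\<Sum>i = 1..ndelays p. d i)" by (rule member_le_sum) (use \<nu> in auto)
      moreover have "1 \<le> d 1" using d \<nu> by simp
      ultimately have "real 1 \<le> real (\<Sum>i = 1..ndelays p. d i)" by (intro of_nat_mono) (rule order_trans)
      then have s: "1 \<le> s" by (simp add: s_def d_sum_def)
      define N where "N = real n"
      have N: "1 \<le> N" using n by (simp add: N_def)
      have bs: "real (beta ?p) \<le> b * s"
      proof -
        have "real (beta ?p) = (1 + real (ndelays p) + real (\<Sum>i = 1..ndelays p. dim_vphi p i + dim_phi p i)) + s"
          by (simp add: beta_def kp_sum_def kp_def s_def d_sum_def sum.distrib)
        also have "\<dots> = (b - 1) * 1 + s" by (simp add: b_def)
        also have "\<dots> \<le> (b - 1) * s + s"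
          by (intro add_right_mono mult_left_mono s) (simp add: b_def sum_nonneg)
        also have "\<dots> = b * s" by (simp add: algebra_simps)
        finally show ?thesis .
      qed
      define S where "S = s\<^sup>2 * N\<^sup>2"
      have b0: "0 \<le> b" by (simp add: b_def sum_nonneg)
      have ss: "1 \<le> s\<^sup>2" "s \<le> s\<^sup>2" "1 \<le> N\<^sup>2" "N \<le> N\<^sup>2"
        using s N self_le_power[of s 2] self_le_power[of N 2] by (simp_all add: one_le_power)
      have e1: "(0.5 * s\<^sup>2 + s + real (ndelays p) + 1) * N\<^sup>2 \<le> ((2.5 + real (ndelays p)) * s\<^sup>2) * N\<^sup>2"
      proof (rule mult_right_mono)
        have "real (ndelays p) \<le> real (ndelays p) * s\<^sup>2" using mult_left_mono[OF ss(1), of "real (ndelays p)"] by simp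
        then show "0.5 * s\<^sup>2 + s + real (ndelays p) + 1 \<le> (2.5 + real (ndelays p)) * s\<^sup>2" using ss by (simp add: algebra_simps)
      qed simp
      have bk: "real (beta ?p) * k \<le> (b * k) * s\<^sup>2" if "0 \<le> k" for k
      proof -
        have "real (beta ?p) \<le> b * s\<^sup>2" using bs mult_left_mono[OF ss(2) b0] by linarith
        then have "real (beta ?p) * k \<le> (b * s\<^sup>2) * k" by (rule mult_right_mono[OF _ that])
        then show ?thesis by (simp add: mult_ac)
      qed
      have e2: "(0.5 * s + 1 + real (ndelays p) + real (beta ?p) * real (dim_y p)) * N
          \<le> ((1.5 + real (ndelays p) + b * real (dim_y p)) * s\<^sup>2) * N\<^sup>2"
      proof (rule mult_mono)
        have "real (ndelays p) \<le> real (ndelays p) * s\<^sup>2" using mult_left_mono[OF ss(1), of "real (ndelays p)"] by simp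
        then show "0.5 * s + 1 + real (ndelays p) + real (beta ?p) * real (dim_y p) \<le> (1.5 + real (ndelays p) + b * real (dim_y p)) * s\<^sup>2"
          using ss bk[of "real (dim_y p)"] by (simp add: algebra_simps)
      qed (use ss N b0 in auto)
      have e3: "real (beta ?p) * real (dim_z p) * real (dim_y p) \<le> (b * real (dim_z p) * real (dim_y p)) * s\<^sup>2 * N\<^sup>2"
      proof -
        have "real (beta ?p) * (real (dim_z p) * real (dim_y p)) \<le> (b * (real (dim_z p) * real (dim_y p))) * s\<^sup>2" by (rule bk) simp
        also have "\<dots> \<le> (b * (real (dim_z p) * real (dim_y p))) * s\<^sup>2 * N\<^sup>2"
          using mult_left_mono[OF ss(3), of "(b * (real (dim_z p) * real (dim_y p))) * s\<^sup>2"] b0 by simp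
        finally show ?thesis by (simp add: mult_ac)
      qed
      have "real (num_unknowns ?p) = (0.5 * s\<^sup>2 + s + real (ndelays p) + 1) * N\<^sup>2
          + (0.5 * s + 1 + real (ndelays p) + real (beta ?p) * real (dim_y p)) * N + real (beta ?p) * real (dim_z p) * real (dim_y p)"
        unfolding num_unknowns_formula dp by (simp add: N_def)
      also have "\<dots> \<le> C * (s\<^sup>2 * N\<^sup>2)"
        using e1 e2 e3 unfolding C_def distrib_right by (simp add: algebra_simps)
      finally show ?thesis by (simp add: s_def N_def)
    qed
    then show "\<forall>\<^sub>F x in principal {(n, d). n \<ge> 1 \<and> (\<forall>i\<in>{1..ndelays p}. d i \<ge> 1)}.
      norm (case x of (n, d) \<Rightarrow> real (num_unknowns (p\<lparr>dim_x := n, dim_f := d\<rparr>)))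
      \<le> C * norm (case x of (n, d) \<Rightarrow> real (d_sum (p\<lparr>dim_f := d\<rparr>)) ^ 2 * real n ^ 2)"
      unfolding eventually_principal by auto
  qed
qed

theorem theorem2:
  fixes p :: plant and s :: supply_data and \<alpha> :: "nat \<Rightarrow> real"
    and P1 W P2 P3 :: "real mat"
    and Q R U Uh K Kh :: "nat \<Rightarrow> real mat"
  assumes plant: "admissible_plant p"
    and supply_rate: "admissible_supply p s"
    and dims:
      "sym_mat (dim_x p) P1" "sym_mat (dim_x p) W"
      "P2 \<in> carrier_mat (dim_x p) (d_sum p * dim_x p)" "sym_mat (d_sum p * dim_x p) P3"
      "\<And>i. i \<in> {1..ndelays p} \<Longrightarrow> sym_mat (dim_x p) (Q i)"
      "\<And>i. i \<in> {1..ndelays p} \<Longrightarrow> sym_mat (dim_x p) (R i)"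
      "\<And>i. i \<in> {0..ndelays p} \<Longrightarrow> U i \<in> carrier_mat (dim_x p) (dim_y p)"
      "\<And>i. i \<in> {1..ndelays p} \<Longrightarrow> Uh i \<in> carrier_mat (dim_x p) (kp p i * dim_y p)"
      "\<And>i. i \<in> {0..ndelays p} \<Longrightarrow> K i \<in> carrier_mat (dim_z p) (dim_y p)"
      "\<And>i. i \<in> {1..ndelays p} \<Longrightarrow> Kh i \<in> carrier_mat (dim_z p) (kp p i * dim_y p)"
    and lmi_P: "pos_def (four_block_mat P1 P2 (P2\<^sup>T) (P3 + diag_idx p (\<lambda>i. 1\<^sub>m (dim_f p i) \<otimes>\<^sub>k Q i)))"
    and lmi_Q: "pos_def (diag_idx p Q)"
    and lmi_R: "pos_def (diag_idx p R)"
    and lmi_main: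
      "neg_def (Sy (alpha_stack p \<alpha> * hcat (dim_x p) [- W, Pihat p W U Uh])
         + four_block_mat (0\<^sub>m (dim_x p) (dim_x p)) (bP p P1 P2) ((bP p P1 P2)\<^sup>T) (Phi p s P2 P3 Q R K Kh))"
  shows "dissipative p s (\<lambda>i. minv W * U i) (\<lambda>i. minv W * Uh i) K Kh \<and>
    exponentially_stable p (\<lambda>i. minv W * U i) (\<lambda>i. minv W * Uh i) \<and>
    real (num_unknowns p) =
      (0.5 * real (d_sum p) ^ 2 + real (d_sum p) + real (ndelays p) + 1) * real (dim_x p) ^ 2
      + (0.5 * real (d_sum p) + 1 + real (ndelays p) + real (beta p) * real (dim_y p)) * real (dim_x p)
      + real (beta p) * real (dim_z p) * real (dim_y p) \<and>
    (\<lambda>(n, d). real (num_unknowns (p\<lparr>dim_x := n, dim_f := d\<rparr>)))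
      \<in> O[principal {(n, d). n \<ge> 1 \<and> (\<forall>i\<in>{1..ndelays p}. d i \<ge> 1)}](\<lambda>(n, d).
          real (d_sum (p\<lparr>dim_f := d\<rparr>)) ^ 2 * real n ^ 2)"
proof (intro conjI)
  interpret lmi p s \<alpha> P1 W P2 P3 Q R U Uh K Kh
    by unfold_locales (use plant supply_rate dims lmi_P lmi_Q lmi_R lmi_main in auto)
  show "dissipative p s (\<lambda>i. minv W * U i) (\<lambda>i. minv W * Uh i) K Kh" by (rule dissipative_error)
  show "exponentially_stable p (\<lambda>i. minv W * U i) (\<lambda>i. minv W * Uh i)" by (rule exponentially_stable_error)
  show "(\<lambda>(n, d). real (num_unknowns (p\<lparr>dim_x := n, dim_f := d\<rparr>)))
      \<in> O[principal {(n, d). n \<ge> 1 \<and> (\<forall>i\<in>{1..ndelays p}. d i \<ge> 1)}](\<lambda>(n, d).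
          real (d_sum (p\<lparr>dim_f := d\<rparr>)) ^ 2 * real n ^ 2)"
    using dims_pos(5) by (intro num_unknowns_bigo) simp
qed (rule num_unknowns_formula)

end
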